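(* Let $C$ be a reduced curve in the complex projective plane $\mathbb{P}^2$, let $p\in M(C)=\mathbb{P}^2\setminus C$ be a point, and let $\mathcal{A}$ be the set of lines $L$ passing through $p$ such that there is a point $q\in L\cap C$ with $(C,L)_q>1$. Let $C'$ be the curve obtained by adding to $C$ all the lines in $\mathcal{A}$, and assume that all the singularities of $C'$ are quasi homogeneous. Then $C'$ is supersolvable and free. In particular, this holds when all the singularities $s$ of $C$ have multiplicity $2$, and $p$ is not on any tangent cone $TC_s(C)$ for $(C,s)$ a singularity with Milnor number $\mu(C,s)\geq 3$.
   Context: $(C,L)_q$ denotes the intersection multiplicity at $q$. $TC_s(C)$ is the reduced projective tangent cone of $C$ at $s$, i.e. the union of the lines in $\mathbb{P}^2$ tangent at $s$ to some branch of $(C,s)$. A plane curve singularity is quasi homogeneous if in suitable local analytic coordinates it is defined by a weighted homogeneous polynomial (equivalently, its Milnor and Tjurina numbers coincide). Modular points and supersolvability: for a reduced plane curve $D$ and a point $p\in D$, $p$ is a modular point for $D$ if the central projection $\pi_p:\mathbb{P}^2\setminus\{p\}\to\mathbb{P}^1$ induces a locally trivial fibration of the complement $M(D)=\mathbb{P}^2\setminus D$. This happens if and only if for any line $L_p$ passing through $p$ and not an irreducible component of $D$ one has $(D,L_p)_p=\operatorname{mult}_p(D)$ and $(D,L_p)_q=1$ for any $q\in D\cap L_p$, $q\neq p$. The curve $D$ is supersolvable if it has at least one modular point. Freeness: let $S=\mathbb{C}[x,y,z]$. For a reduced plane curve $G=0$ with $G\in S$ homogeneous, let $D_0(G)=\{a\partial_x+b\partial_y+c\partial_z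 : a,b,c\in S,\ aG_x+bG_y+cG_z=0\}$, a graded $S$-module of rank 2. The curve $G=0$ is free if $D_0(G)$ is a free graded $S$-module. *)

theory Defs
  imports
    "HOL-Analysis.Analysis"
    "HOL-Computational_Algebra.Polynomial_Factorial"
    "HOL-Computational_Algebra.Squarefree"
    "HOL-Library.Extended_Nat"
begin

section \<open>Polynomials in three and in two variables\<close>

text \<open>
  \<open>S = \<complex>[x,y,z]\<close> is represented as \<open>\<complex>[x][y][z]\<close>: the outermost polynomial variable is \<open>z\<close> and
  the innermost one is \<open>x\<close>.  Likewise \<open>\<complex>[X,Y]\<close> is \<open>\<complex>[X][Y]\<close> with \<open>X\<close> innermost.
\<close>

type_synonym poly3 = "complex poly poly poly"
type_synonym poly2 = "complex poly poly"

definition coeff3 :: "poly3 \<Rightarrow> nat \<Rightarrow> nat \<Rightarrow> nat \<Rightarrow> complex" where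
  "coeff3 F i j k = coeff (coeff (coeff F k) j) i"

definition coeff2 :: "poly2 \<Rightarrow> nat \<Rightarrow> nat \<Rightarrow> complex" where
  "coeff2 f i j = coeff (coeff f j) i"

definition eval3 :: "poly3 \<Rightarrow> complex ^ 3 \<Rightarrow> complex" where
  "eval3 F v = poly (poly (poly F [:[:v $ 3:]:]) [:v $ 2:]) (v $ 1)"

definition eval2 :: "poly2 \<Rightarrow> complex \<times> complex \<Rightarrow> complex" where
  "eval2 f = (\<lambda>(a, b). poly (poly f [:b:]) a)"

definition dx3 :: "poly3 \<Rightarrow> poly3" where "dx3 F = map_poly (map_poly pderiv) F"
definition dy3 :: "poly3 \<Rightarrow> poly3" where "dy3 F = map_poly pderiv F"
definition dz3 :: "poly3 \<Rightarrow> poly3" where "dz3 F = pderiv F"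

definition dx2 :: "poly2 \<Rightarrow> poly2" where "dx2 f = map_poly pderiv f"
definition dy2 :: "poly2 \<Rightarrow> poly2" where "dy2 f = pderiv f"

definition subst3 :: "poly3 \<Rightarrow> poly2 \<Rightarrow> poly2 \<Rightarrow> poly2 \<Rightarrow> poly2" where
  "subst3 F P Q R =
     poly (map_poly (\<lambda>g. poly (map_poly (\<lambda>h. poly (map_poly (\<lambda>c. [:[:c:]:]) h) P) g) Q) F) R"

definition homogeneous3 :: "nat \<Rightarrow> poly3 \<Rightarrow> bool" where
  "homogeneous3 d F \<longleftrightarrow> (\<forall>i j k. coeff3 F i j k \<noteq> 0 \<longrightarrow> i + j + k = d)"

definition weighted_homogeneous2 :: "nat \<Rightarrow> nat \<Rightarrow> poly2 \<Rightarrow> bool" where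
  "weighted_homogeneous2 w\<^sub>1 w\<^sub>2 f \<longleftrightarrow> (\<exists>N. \<forall>i j. coeff2 f i j \<noteq> 0 \<longrightarrow> w\<^sub>1 * i + w\<^sub>2 * j = N)"


section \<open>Plane curves and lines\<close>

text \<open>
  A reduced plane curve is given by a square-free homogeneous equation of positive degree.  Points of
  the projective plane enter through homogeneous coordinates, i.e. non-zero vectors of \<open>\<complex>\<^sup>3\<close>; all
  notions below are independent of the choice of the representative.
\<close>

definition reduced_plane_curve :: "poly3 \<Rightarrow> bool" where
  "reduced_plane_curve F \<longleftrightarrow> squarefree F \<and> (\<exists>d\<ge>1. homogeneous3 d F)"

definition singular_point :: "poly3 \<Rightarrow> complex ^ 3 \<Rightarrow> bool" where
  "singular_point F s \<longleftrightarrow>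
     s \<noteq> 0 \<and> eval3 F s = 0 \<and> eval3 (dx3 F) s = 0 \<and> eval3 (dy3 F) s = 0 \<and> eval3 (dz3 F) s = 0"

definition linear_form :: "complex ^ 3 \<Rightarrow> poly3" where
  "linear_form a = [:[:[:0, a $ 1:], [:a $ 2:]:], [:[:a $ 3:]:]:]"

text \<open>A line of the projective plane, as the cone of the homogeneous coordinates of its points.\<close>

definition is_line :: "(complex ^ 3) set \<Rightarrow> bool" where
  "is_line L \<longleftrightarrow> (\<exists>a. a \<noteq> 0 \<and> L = {v. eval3 (linear_form a) v = 0})"

definition line_equation :: "(complex ^ 3) set \<Rightarrow> poly3" where
  "line_equation L = linear_form (SOME a. a \<noteq> 0 \<and> L = {v. eval3 (linear_form a) v = 0})"


section \<open>Local equations\<close>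

text \<open>
  If \<open>v $ k\<close> is the first non-zero coordinate of \<open>v\<close>, then \<open>(a, b) \<mapsto> [v + a e\<^sub>i + b e\<^sub>j]\<close> with
  \<open>{i, j, k} = {1, 2, 3}\<close> is an affine chart of the projective plane centred at \<open>[v]\<close>.
\<close>

definition chart_dirs :: "complex ^ 3 \<Rightarrow> (complex ^ 3) \<times> (complex ^ 3)" where
  "chart_dirs v =
     (if v $ 1 \<noteq> 0 then (axis 2 1, axis 3 1)
      else if v $ 2 \<noteq> 0 then (axis 1 1, axis 3 1)
      else (axis 1 1, axis 2 1))"

definition chart :: "complex ^ 3 \<Rightarrow> complex \<times> complex \<Rightarrow> complex ^ 3" where
  "chart v = (\<lambda>(a, b). v + a *s fst (chart_dirs v) + b *s snd (chart_dirs v))"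

definition local_equation :: "poly3 \<Rightarrow> complex ^ 3 \<Rightarrow> poly2" where
  "local_equation F v =
     (let u = fst (chart_dirs v); w = snd (chart_dirs v);
          c = (\<lambda>i. [:[:v $ i, u $ i:], [:w $ i:]:])
      in subst3 F (c 1) (c 2) (c 3))"

lemma eval2_arith:
  "eval2 0 z = 0" "eval2 (f + g) z = eval2 f z + eval2 g z" "eval2 (f * g) z = eval2 f z * eval2 g z"
  by (simp_all add: eval2_def split_beta)

lemma eval2_const: "eval2 [:[:c:]:] z = c"
  by (simp add: eval2_def split_beta)

lemma eval2_subst3:
  "eval2 (subst3 F P Q R) z = eval3 F (vector [eval2 P z, eval2 Q z, eval2 R z])"
proof -
  define A where "A = (\<lambda>h. poly (map_poly (\<lambda>c. [:[:c:]:]) h) P)"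
  define B where "B = (\<lambda>g. poly (map_poly A g) Q)"
  have A: "eval2 (A h) z = poly h (eval2 P z)" for h
    by (induction h) (simp_all add: A_def map_poly_pCons eval2_arith eval2_const)
  have A0: "A 0 = 0" by (simp add: A_def)
  have B: "eval2 (B g) z = poly (poly g [:eval2 Q z:]) (eval2 P z)" for g
    by (induction g) (simp_all add: B_def map_poly_pCons A0 eval2_arith A)
  have B0: "B 0 = 0" by (simp add: B_def)
  have "eval2 (poly (map_poly B F) R) z
          = poly (poly (poly F [:[:eval2 R z:]:]) [:eval2 Q z:]) (eval2 P z)"
    by (induction F) (simp_all add: map_poly_pCons B0 eval2_arith B)
  then show ?thesis
    by (simp add: subst3_def eval3_def A_def B_def)
qed

lemma eval2_local_equation: "eval2 (local_equation F v) z = eval3 F (chart v z)"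
proof -
  have "vector [x $ 1, x $ 2, x $ 3] = x" for x :: "complex ^ 3"
    by (simp add: vec_eq_iff forall_3)
  from this[of "chart v z"] show ?thesis
    by (simp add: local_equation_def Let_def eval2_subst3 chart_def split_beta)
       (simp add: eval2_def split_beta algebra_simps)
qed


section \<open>Local invariants\<close>

definition holomorphic2_on :: "(complex \<times> complex \<Rightarrow> complex) \<Rightarrow> (complex \<times> complex) set \<Rightarrow> bool" where
  "holomorphic2_on g U \<longleftrightarrow>
     (\<forall>z\<in>U. \<exists>\<alpha> \<beta>. (g has_derivative (\<lambda>h. \<alpha> * fst h + \<beta> * snd h)) (at z))"

text \<open>
  Representatives of the elements of the local ring of convergent power series at the origin, and
  of the ideal generated by two such elements.  Representatives of the same germ are identified
  modulo any such ideal, so that the dimension of the quotient can be computed with representatives.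
\<close>

definition germs2 :: "(complex \<times> complex \<Rightarrow> complex) set" where
  "germs2 = {g. \<exists>U. open U \<and> (0, 0) \<in> U \<and> holomorphic2_on g U}"

definition germ_ideal2 ::
  "(complex \<times> complex \<Rightarrow> complex) \<Rightarrow> (complex \<times> complex \<Rightarrow> complex) \<Rightarrow> (complex \<times> complex \<Rightarrow> complex) set"
  where "germ_ideal2 f g =
    {h \<in> germs2. \<exists>a\<in>germs2. \<exists>b\<in>germs2. \<forall>\<^sub>F z in nhds (0, 0). h z = a z * f z + b z * g z}"

text \<open>The dimension of \<open>\<O>/(f, g)\<close> as a complex vector space: the least size of a spanning set.\<close>

definition germ_codim2 ::
  "(complex \<times> complex \<Rightarrow> complex) \<Rightarrow> (complex \<times> complex \<Rightarrow> complex) \<Rightarrow> enat" where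
  "germ_codim2 f g =
     Inf {enat (card B) | B. finite B \<and> B \<subseteq> germs2 \<and>
            (\<forall>h\<in>germs2. \<exists>c. (\<lambda>z. h z - (\<Sum>b\<in>B. c b * b z)) \<in> germ_ideal2 f g)}"

definition intersection_multiplicity :: "poly3 \<Rightarrow> poly3 \<Rightarrow> complex ^ 3 \<Rightarrow> enat" where
  "intersection_multiplicity F G q =
     germ_codim2 (eval2 (local_equation F q)) (eval2 (local_equation G q))"

definition milnor_number :: "poly3 \<Rightarrow> complex ^ 3 \<Rightarrow> enat" where
  "milnor_number F s =
     germ_codim2 (eval2 (dx2 (local_equation F s))) (eval2 (dy2 (local_equation F s)))"

definition multiplicity_at :: "poly3 \<Rightarrow> complex ^ 3 \<Rightarrow> nat" where
  "multiplicity_at F s = (LEAST m. \<exists>i j. i + j = m \<and> coeff2 (local_equation F s) i j \<noteq> 0)"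

text \<open>
  A branch of the germ of \<open>f = 0\<close> at the origin is the image of an injective holomorphic
  parametrization \<open>\<gamma> = (\<gamma>\<^sub>1, \<gamma>\<^sub>2)\<close>.  Writing \<open>\<gamma>(t) = t\<^sup>k \<delta>(t)\<close> with \<open>\<delta>(0) \<noteq> 0\<close>, its tangent line has
  direction \<open>\<delta>(0)\<close>.
\<close>

definition branch_tangent_direction :: "poly2 \<Rightarrow> complex \<times> complex \<Rightarrow> bool" where
  "branch_tangent_direction f \<tau> \<longleftrightarrow>
     (\<exists>r>0. \<exists>\<gamma>\<^sub>1 \<gamma>\<^sub>2 \<delta>\<^sub>1 \<delta>\<^sub>2. \<exists>k\<ge>1.
        \<gamma>\<^sub>1 holomorphic_on ball 0 r \<and> \<gamma>\<^sub>2 holomorphic_on ball 0 r \<and>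
        inj_on (\<lambda>t. (\<gamma>\<^sub>1 t, \<gamma>\<^sub>2 t)) (ball 0 r) \<and>
        (\<forall>t\<in>ball 0 r. eval2 f (\<gamma>\<^sub>1 t, \<gamma>\<^sub>2 t) = 0) \<and>
        \<delta>\<^sub>1 holomorphic_on ball 0 r \<and> \<delta>\<^sub>2 holomorphic_on ball 0 r \<and>
        (\<forall>t\<in>ball 0 r. \<gamma>\<^sub>1 t = t ^ k * \<delta>\<^sub>1 t \<and> \<gamma>\<^sub>2 t = t ^ k * \<delta>\<^sub>2 t) \<and>
        \<tau> = (\<delta>\<^sub>1 0, \<delta>\<^sub>2 0) \<and> \<tau> \<noteq> (0, 0))"

text \<open>The union of the tangent lines to the branches, as a cone of homogeneous coordinates.\<close>

definition tangent_cone :: "poly3 \<Rightarrow> complex ^ 3 \<Rightarrow> (complex ^ 3) set" where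
  "tangent_cone F s =
     {l *s s + m *s (\<alpha> *s fst (chart_dirs s) + \<beta> *s snd (chart_dirs s)) | l m \<alpha> \<beta>.
        branch_tangent_direction (local_equation F s) (\<alpha>, \<beta>)}"

text \<open>
  \<open>\<phi>\<close> is a local analytic change of coordinates and the germ is defined in the new coordinates by \<open>h\<close>,
  i.e. the pulled back equation generates the same ideal as \<open>h\<close>.
\<close>

definition quasi_homogeneous_at :: "poly3 \<Rightarrow> complex ^ 3 \<Rightarrow> bool" where
  "quasi_homogeneous_at F s \<longleftrightarrow>
     (\<exists>U V \<phi> \<psi> e h w\<^sub>1 w\<^sub>2.
        open U \<and> (0, 0) \<in> U \<and> open V \<and> \<phi> (0, 0) = (0, 0) \<and>
        homeomorphism U V \<phi> \<psi> \<and>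
        holomorphic2_on (fst \<circ> \<phi>) U \<and> holomorphic2_on (snd \<circ> \<phi>) U \<and>
        holomorphic2_on (fst \<circ> \<psi>) V \<and> holomorphic2_on (snd \<circ> \<psi>) V \<and>
        holomorphic2_on e U \<and> (\<forall>z\<in>U. e z \<noteq> 0) \<and>
        w\<^sub>1 > 0 \<and> w\<^sub>2 > 0 \<and> weighted_homogeneous2 w\<^sub>1 w\<^sub>2 h \<and>
        (\<forall>z\<in>U. eval2 (local_equation F s) (\<phi> z) = e z * eval2 h z))"


section \<open>Projective spaces as topological spaces\<close>

definition proj :: "complex ^ 'n \<Rightarrow> (complex ^ 'n) set" where
  "proj v = range (\<lambda>c. c *s v)"

text \<open>The quotient topology; its points are the one-dimensional subspaces of \<open>\<complex>\<^sup>n\<close>.\<close>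

definition proj_space :: "(complex ^ 'n) set topology" where
  "proj_space = topology (\<lambda>W. W \<subseteq> proj ` (- {0}) \<and> open {v. v \<noteq> 0 \<and> proj v \<in> W})"

lemma openin_proj_space:
  "openin proj_space W \<longleftrightarrow> W \<subseteq> proj ` (- {0}) \<and> open {v :: complex ^ 'n. v \<noteq> 0 \<and> proj v \<in> W}"
proof -
  have 1: "{v. v \<noteq> 0 \<and> proj v \<in> A \<inter> B} = {v. v \<noteq> 0 \<and> proj v \<in> A} \<inter> {v. v \<noteq> 0 \<and> proj v \<in> B}"
    for A B :: "(complex ^ 'n) set set" by auto
  have 2: "{v. v \<noteq> 0 \<and> proj v \<in> \<Union>\<K>} = (\<Union>K\<in>\<K>. {v. v \<noteq> 0 \<and> proj v \<in> K})"
    for \<K> :: "(complex ^ 'n) set set set" by auto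
  have "istopology (\<lambda>W. W \<subseteq> proj ` (- {0}) \<and> open {v :: complex ^ 'n. v \<noteq> 0 \<and> proj v \<in> W})"
    unfolding istopology_def 1 2 by (auto intro!: open_Int open_UN)
  then show ?thesis
    by (simp add: proj_space_def topology_inverse')
qed

lemma topspace_proj_space: "topspace proj_space = proj ` (- {0 :: complex ^ 'n})"
proof -
  have "{v :: complex ^ 'n. v \<noteq> 0 \<and> proj v \<in> proj ` (- {0})} = - {0}" by auto
  then have "openin proj_space (proj ` (- {0 :: complex ^ 'n}))"
    by (simp add: openin_proj_space open_Compl)
  then have "proj ` (- {0 :: complex ^ 'n}) \<subseteq> topspace proj_space"
    by (rule openin_subset)
  moreover have "topspace proj_space \<subseteq> proj ` (- {0 :: complex ^ 'n})"
    using openin_topspace[of proj_space] unfolding openin_proj_space by (rule conjunct1)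
  ultimately show ?thesis by (rule subset_antisym[rotated])
qed

definition curve_complement :: "poly3 \<Rightarrow> (complex ^ 3) set topology" where
  "curve_complement G = subtopology proj_space {proj v | v. v \<noteq> 0 \<and> eval3 G v \<noteq> 0}"

definition locally_trivial_fibration :: "'a topology \<Rightarrow> 'b topology \<Rightarrow> ('a \<Rightarrow> 'b) \<Rightarrow> bool" where
  "locally_trivial_fibration X B \<pi> \<longleftrightarrow>
     continuous_map X B \<pi> \<and>
     (\<forall>b\<in>topspace B. \<exists>U h. openin B U \<and> b \<in> U \<and>
        homeomorphic_map
          (subtopology X {x. \<pi> x \<in> U})
          (prod_topology (subtopology B U) (subtopology X {x. \<pi> x = b})) h \<and>
        (\<forall>x\<in>topspace X. \<pi> x \<in> U \<longrightarrow> fst (h x) = \<pi> x))"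


section \<open>Supersolvable and free curves\<close>

text \<open>
  The central projection from \<open>[p]\<close> is induced by a linear map \<open>\<complex>\<^sup>3 \<rightarrow> \<complex>\<^sup>2\<close> with kernel the line spanned
  by \<open>p\<close>; two such maps differ by an automorphism of the projective line.  The base of the fibration
  is the image of the complement: the lines through \<open>[p]\<close> contained in the curve are omitted.
\<close>

definition modular_point :: "poly3 \<Rightarrow> complex ^ 3 \<Rightarrow> bool" where
  "modular_point G p \<longleftrightarrow>
     p \<noteq> 0 \<and> eval3 G p = 0 \<and>
     (\<exists>A :: complex ^ 3 ^ 2. {v. A *v v = 0} = proj p \<and>
        (let \<pi> = image (\<lambda>v. A *v v) in
          locally_trivial_fibration (curve_complement G)
            (subtopology proj_space (\<pi> ` topspace (curve_complement G))) \<pi>))"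

definition supersolvable :: "poly3 \<Rightarrow> bool" where
  "supersolvable G \<longleftrightarrow> (\<exists>p. modular_point G p)"

definition D\<^sub>0 :: "poly3 \<Rightarrow> (poly3 ^ 3) set" where
  "D\<^sub>0 G = {\<theta>. \<theta> $ 1 * dx3 G + \<theta> $ 2 * dy3 G + \<theta> $ 3 * dz3 G = 0}"

lemma module_poly3: "module ((*s) :: poly3 \<Rightarrow> poly3 ^ 3 \<Rightarrow> poly3 ^ 3)"
  by unfold_locales (simp_all add: vec_eq_iff algebra_simps)

text \<open>A free graded module is one with a basis of homogeneous elements.\<close>

definition free_curve :: "poly3 \<Rightarrow> bool" where
  "free_curve G \<longleftrightarrow>
     (\<exists>B. (\<forall>\<theta>\<in>B. \<exists>d. \<forall>i. homogeneous3 d (\<theta> $ i)) \<and>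
          \<not> module.dependent (*s) B \<and> module.span (*s) B = D\<^sub>0 G)"


section \<open>Adding the non-transversal lines through a point\<close>

definition nontransversal_lines :: "poly3 \<Rightarrow> complex ^ 3 \<Rightarrow> (complex ^ 3) set set" where
  "nontransversal_lines F p =
     {L. is_line L \<and> p \<in> L \<and>
         (\<exists>q\<in>L. q \<noteq> 0 \<and> eval3 F q = 0 \<and> intersection_multiplicity F (line_equation L) q > 1)}"

text \<open>
  For a reduced curve \<open>F\<close> not passing through \<open>[p]\<close> this set of lines is finite and none of
  them is a component of \<open>F\<close>.
\<close>

definition add_lines :: "poly3 \<Rightarrow> complex ^ 3 \<Rightarrow> poly3" where
  "add_lines F p = F * (\<Prod>L\<in>nontransversal_lines F p. line_equation L)"

end

theory Submission
  imports Defs "HOL-Complex_Analysis.Complex_Analysis" "HOL-Computational_Algebra.Fundamental_Theorem_Algebra"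
begin

text \<open>
  In coordinates with \<open>p = [0 : 0 : 1]\<close> the lines through \<open>p\<close> are the zeros of linear forms in \<open>x, y\<close>, and \<open>C'\<close> has an equation
  \<open>Q F\<close> with \<open>Q\<close> a product of such forms and \<open>F\<close> monic in \<open>z\<close> up to a constant.

  Freeness.  If \<open>Q\<^sub>x F\<^sub>y - Q\<^sub>y F\<^sub>x = \<alpha> F + \<beta> F\<^sub>z\<close>, then the derivations \<open>F \<partial>\<^sub>z\<close> and \<open>-Q\<^sub>y \<partial>\<^sub>x + Q\<^sub>x \<partial>\<^sub>y - \<beta> \<partial>\<^sub>z\<close>, corrected
  by multiples of the Euler derivation, are a basis of \<open>D\<^sub>0 (Q F)\<close>.  The ideal \<open>(F, F\<^sub>z)\<close> contains a nonzero form in \<open>x, y\<close>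
  (a discriminant), which splits into linear factors, so that membership in \<open>(F, F\<^sub>z)\<close> can be tested on power series at the points
  \<open>q\<close> where \<open>F = F\<^sub>z = 0\<close>, the points at which a line through \<open>p\<close> is not transversal to \<open>C\<close>.  If \<open>f (y, z)\<close> is the germ of
  \<open>F\<close> at \<open>q\<close> and \<open>y = 0\<close> is the line \<open>pq\<close>, the condition reads \<open>y f\<^sub>y \<in> (f, f\<^sub>z)\<close>.  When \<open>y f\<close> is quasi homogeneous, the
  weighted Euler field in the good coordinates preserves each of the branches of \<open>y f = 0\<close>, in particular the line, and gives this
  relation.  When \<open>f\<close> has order at most two the relation is elementary, except for \<open>f = (y - s (z))\<^sup>2 U + D (z)\<close> with \<open>D\<close> of
  order at least four; then the Milnor number is at least three and a branch is tangent to the line \<open>pq\<close>.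

  Supersolvability.  On a line through \<open>p\<close> that is not in \<open>C'\<close> the zeros of \<open>F\<close> are simple.  They move continuously
  with the line, and an isotopy of the affine line following them trivializes the projection from \<open>p\<close> locally.

  If \<open>C\<close> is a line, nothing is added, and every point of \<open>C\<close> is modular.
\<close>

text \<open>The main obstacle to freeness is the passage from germs back to forms. As
  \<open>F\<close> is monic in z, a relation modulo (\<open>F\<close>, \<open>F\<^sub>z\<close>) can
  be reduced until its coefficient of \<open>F\<^sub>z\<close> has degree below that of
  \<open>F\<close>; on a line, divisibility by \<open>F\<close> then concerns polynomials in one
  variable and is checked root by root. The algebra takes place in \<complex>[[Z]][[Y]]. Holomorphic
  germs enter through the definitions of quasi homogeneity, of intersection and Milnor numbers and
  of branches, and reach the formal side by the homomorphism \<open>tay\<close>.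

  The Milnor bound three has this origin: let y = s(z) solve f_y = 0, where the 2-jet of f is a
  multiple of y^2 and f(0, z) has order at least four. Then f(s(z), z) has order at least four and
  its derivative is f_z on the curve. So both partial derivatives vanish to order three along a
  smooth curve, which forces codimension at least three.

  The general argument needs at least one added line, so that p lies on \<open>C'\<close>. From
  degree two on there is one: otherwise 1 would lie in an ideal generated by two forms of positive
  degree.\<close>

no_notation fps_nth (infixl "$" 75)

section \<open>Ring homomorphisms and derivations of polynomials in three variables\<close>

text \<open>Evaluations, restrictions to lines, translations and Taylor expansions are all
  instances. A predicate on functions, rather than a type of homomorphisms, lets them be composed as
  plain functions.\<close>

definition rhom :: "('a::comm_ring_1 \<Rightarrow> 'b::comm_ring_1) \<Rightarrow> bool" where
  "rhom f \<longleftrightarrow> f 1 = 1 \<and> (\<forall>a b. f (a + b) = f a + f b) \<and> (\<forall>a b. f (a * b) = f a * f b)"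

lemma rhomD: assumes "rhom f"
  shows "f 1 = 1" "f (a + b) = f a + f b" "f (a * b) = f a * f b" "f 0 = 0"
    "f (- a) = - f a" "f (a - b) = f a - f b" "f (a ^ n) = f a ^ n" "f (of_nat n) = of_nat n"
proof -
  show 1: "f 1 = 1" and 2: "f (a * b) = f a * f b" and 3: "f (a + b) = f a + f b" for a b
    using assms by (auto simp: rhom_def)
  show 4: "f 0 = 0" using 3[of 0 0] by simp
  show 5: "f (- a) = - f a" for a using 3[of a "- a"] 4 by (simp add: eq_neg_iff_add_eq_0 add.commute)
  show "f (a - b) = f a - f b" using 3[of a "- b"] 5 by simp
  show "f (a ^ n) = f a ^ n" by (induction n) (simp_all add: 1 2)
  show "f (of_nat n) = of_nat n" by (induction n) (simp_all add: 1 3 4)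
qed

lemma map_poly_add_hom:
  assumes "f 0 = 0" "\<And>a b. f (a + b) = f a + f b"
  shows "map_poly f (p + q) = map_poly f p + map_poly f q"
  by (rule poly_eqI) (simp add: coeff_map_poly assms)

lemma map_poly_smult_hom:
  assumes "f 0 = 0" "\<And>b. f (a * b) = c * g b" "g 0 = 0"
  shows "map_poly f (smult a q) = smult c (map_poly g q)"
  by (rule poly_eqI) (simp add: coeff_map_poly assms)

lemma rhom_map_poly: assumes "rhom c" shows "rhom (map_poly c)"
proof -
  note [simp] = rhomD[OF assms]
  have a: "map_poly c (p + q) = map_poly c p + map_poly c q" for p q by (rule map_poly_add_hom) simp_all
  have "map_poly c (p * q) = map_poly c p * map_poly c q" for p q
    by (induction p) (simp_all add: map_poly_pCons a map_poly_smult_hom[where f = c and g = c])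
  then show ?thesis by (simp add: rhom_def a map_poly_1')
qed

lemma rhom_comp: "rhom f \<Longrightarrow> rhom g \<Longrightarrow> rhom (\<lambda>x. f (g x))"
  by (simp add: rhom_def)

lemma rhom_poly: "rhom (\<lambda>p. poly p x)" by (simp add: rhom_def)

lemma rhom_id: "rhom (\<lambda>c. c)" by (simp add: rhom_def)

lemma rhom_ev1: "rhom c \<Longrightarrow> rhom (\<lambda>p. poly (map_poly c p) x)"
  by (rule rhom_comp[OF rhom_poly rhom_map_poly])

text \<open>The homomorphism out of \<complex>[x,y,z] given by its universal property, with
  \<open>\<kappa>\<close> acting on the constants.\<close>

definition ev3 :: "(complex \<Rightarrow> 'r::comm_ring_1) \<Rightarrow> 'r \<Rightarrow> 'r \<Rightarrow> 'r \<Rightarrow> poly3 \<Rightarrow> 'r" where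
  "ev3 \<kappa> X Y Z F =
     poly (map_poly (\<lambda>g. poly (map_poly (\<lambda>h. poly (map_poly \<kappa> h) X) g) Y) F) Z"

definition emb :: "complex \<Rightarrow> poly3" where "emb c = [:[:[:c:]:]:]"
definition PX :: poly3 where "PX = [:[:[:0, 1:]:]:]"
definition PY :: poly3 where "PY = [:[:0, 1:]:]"
definition PZ :: poly3 where "PZ = [:0, 1:]"

lemma rhom_emb: "rhom emb"
  by (simp add: rhom_def emb_def one_pCons)

lemma rhom_ev3: "rhom \<kappa> \<Longrightarrow> rhom (ev3 \<kappa> X Y Z)"
  unfolding ev3_def by (intro rhom_ev1)

lemma ev3_gen:
  assumes "rhom \<kappa>"
  shows "ev3 \<kappa> X Y Z (emb c) = \<kappa> c" "ev3 \<kappa> X Y Z PX = X" "ev3 \<kappa> X Y Z PY = Y" "ev3 \<kappa> X Y Z PZ = Z"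
  using rhomD[OF assms] by (simp_all add: ev3_def emb_def PX_def PY_def PZ_def map_poly_pCons)

lemma poly3_induct:
  assumes "\<And>c. P (emb c)" "P PX" "P PY" "P PZ"
    "\<And>F G. P F \<Longrightarrow> P G \<Longrightarrow> P (F + G)" "\<And>F G. P F \<Longrightarrow> P G \<Longrightarrow> P (F * G)"
  shows "P F"
proof -
  have 1: "P [:[:h:]:]" for h
  proof (induction h)
    case 0 then show ?case using assms(1)[of 0] by (simp add: emb_def)
  next
    case (pCons a h)
    have "[:[:pCons a h:]:] = emb a + PX * [:[:h:]:]" by (simp add: emb_def PX_def)
    then show ?case using assms pCons by presburger
  qed
  have 2: "P [:g:]" for g
  proof (induction g)
    case 0 then show ?case using 1[of 0] by simp
  next
    case (pCons a h)
    have "[:pCons a h:] = [:[:a:]:] + PY * [:h:]" by (simp add: PY_def)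
    then show ?case using assms pCons 1[of a] by presburger
  qed
  show ?thesis
  proof (induction F)
    case 0 then show ?case using 2[of 0] by simp
  next
    case (pCons a h)
    have "pCons a h = [:a:] + PZ * h" by (simp add: PZ_def)
    then show ?case using assms pCons 2[of a] by presburger
  qed
qed

text \<open>Uniqueness in the universal property. It reduces identities between two ways of
  evaluating a polynomial to the constants and the three variables, without any computation with
  nested coefficients.\<close>

lemma rhom_poly3_unique:
  assumes "rhom \<Phi>" "rhom \<Psi>" "\<And>c. \<Phi> (emb c) = \<Psi> (emb c)" "\<Phi> PX = \<Psi> PX" "\<Phi> PY = \<Psi> PY" "\<Phi> PZ = \<Psi> PZ"
  shows "\<Phi> F = \<Psi> F"
  by (induction F rule: poly3_induct) (simp_all add: assms(3-) rhomD(2,3)[OF assms(1)] rhomD(2,3)[OF assms(2)])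

lemma rhom_eval3: "rhom (\<lambda>F. eval3 F v)"
  unfolding eval3_def by (intro rhom_comp[OF rhom_poly] rhom_poly)

lemma eval3_gen: "eval3 (emb c) v = c" "eval3 PX v = v $ 1" "eval3 PY v = v $ 2" "eval3 PZ v = v $ 3"
  by (simp_all add: eval3_def emb_def PX_def PY_def PZ_def)

lemmas eval3_hom = rhomD[OF rhom_eval3]

lemma subst3_ev3: "subst3 F P Q R = ev3 (\<lambda>c. [:[:c:]:]) P Q R F"
  by (simp add: subst3_def ev3_def)

text \<open>The image of \<open>\<iota>\<close> is infinite, while a nonzero polynomial over a
  domain has finitely many roots. With \<open>\<iota>\<close> an embedding of the constants into the
  coefficient ring, zero functions are seen to be zero polynomials, one variable at a time.\<close>

lemma poly_eq_0_if_const_roots: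
  fixes p :: "'a::idom poly" and \<iota> :: "complex \<Rightarrow> 'a"
  assumes "inj \<iota>" "\<And>t. poly p (\<iota> t) = 0" shows "p = 0"
proof (rule ccontr)
  assume "p \<noteq> 0"
  then have "finite {x. poly p x = 0}" by (rule poly_roots_finite)
  moreover have "range \<iota> \<subseteq> {x. poly p x = 0}" using assms by auto
  ultimately have "finite (range \<iota>)" by (rule finite_subset[rotated])
  then show False using assms(1) by (simp add: finite_image_iff infinite_UNIV_char_0)
qed

lemma eval2_eq_0_imp: assumes "\<And>a b. poly (poly f [:b:]) a = (0::complex)" shows "f = 0"
proof (rule poly_eq_0_if_const_roots)
  show "inj (\<lambda>b::complex. [:b:])" by (simp add: inj_def)
  show "poly f [:b:] = 0" for b
    by (rule poly_eq_0_if_const_roots[OF inj_on_id]) (simp add: assms)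
qed

lemma eval3_eq_0_imp: assumes "\<And>v. eval3 F v = 0" shows "F = 0"
proof (rule poly_eq_0_if_const_roots)
  show "inj (\<lambda>b::complex. [:[:b:]:])" by (simp add: inj_def)
  show "poly F [:[:c:]:] = 0" for c
  proof (rule eval2_eq_0_imp)
    fix a b
    show "poly (poly (poly F [:[:c:]:]) [:b:]) a = 0" using assms[of "vector [a, b, c]"] by (simp add: eval3_def)
  qed
qed

lemma eval3_ext: "(\<And>v. eval3 F v = eval3 G v) \<Longrightarrow> F = G"
  using eval3_eq_0_imp[of "F - G"] by (simp add: eval3_hom)

section \<open>Derivations and the chain rule\<close>

definition der :: "('a::comm_ring_1 \<Rightarrow> 'a) \<Rightarrow> bool" where
  "der D \<longleftrightarrow> (\<forall>a b. D (a + b) = D a + D b) \<and> (\<forall>a b. D (a * b) = a * D b + D a * b)"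

lemma derD: assumes "der D"
  shows "D (a + b) = D a + D b" "D (a * b) = a * D b + D a * b" "D 0 = 0" "D 1 = 0" "D (- a) = - D a"
    "D (a - b) = D a - D b"
proof -
  show 1: "D (a + b) = D a + D b" and 2: "D (a * b) = a * D b + D a * b" for a b
    using assms by (auto simp: der_def)
  show 3: "D 0 = 0" using 1[of 0 0] by simp
  show 4: "D 1 = 0" using 2[of 1 1] by simp
  show 5: "D (- a) = - D a" for a using 1[of a "- a"] 3 by (simp add: eq_neg_iff_add_eq_0 add.commute)
  show "D (a - b) = D a - D b" using 1[of a "- b"] 5 by simp
qed

lemma der_pderiv: "der (pderiv :: 'a::idom poly \<Rightarrow> _)"
  by (simp add: der_def pderiv_add pderiv_mult)

lemma der_map_poly: assumes "der D" shows "der (map_poly D)"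
proof -
  note [simp] = derD[OF assms]
  have a: "map_poly D (p + q) = map_poly D p + map_poly D q" for p q by (rule map_poly_add_hom) simp_all
  have s: "map_poly D (smult c q) = smult c (map_poly D q) + smult (D c) q" for c q
    by (rule poly_eqI) (simp add: coeff_map_poly)
  have "map_poly D (p * q) = p * map_poly D q + map_poly D p * q" for p q
    by (induction p) (simp_all add: map_poly_pCons a s algebra_simps)
  then show ?thesis by (simp add: der_def a)
qed

lemma der_d3: "der dx3" "der dy3" "der dz3"
proof -
  have "dx3 = map_poly (map_poly pderiv)" "dy3 = map_poly pderiv" "dz3 = pderiv"
    by (auto simp: dx3_def dy3_def dz3_def)
  then show "der dx3" "der dy3" "der dz3" using der_pderiv der_map_poly by metis+
qed

lemmas dx3_der = derD[OF der_d3(1)] and dy3_der = derD[OF der_d3(2)] and dz3_der = derD[OF der_d3(3)]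

lemma d3_gen [simp]:
  "dx3 (emb c) = 0" "dy3 (emb c) = 0" "dz3 (emb c) = 0"
  "dx3 PX = 1" "dx3 PY = 0" "dx3 PZ = 0" "dy3 PX = 0" "dy3 PY = 1" "dy3 PZ = 0"
  "dz3 PX = 0" "dz3 PY = 0" "dz3 PZ = 1"
  by (simp_all add: dx3_def dy3_def dz3_def emb_def PX_def PY_def PZ_def map_poly_pCons pderiv_pCons one_pCons)

text \<open>The chain rule for an arbitrary derivation of the target ring. It serves for the
  parameter of \<open>Phi\<close> (hence for Euler's identity), for coordinate changes, for both
  derivatives of power series and for restrictions to curves.\<close>

lemma ev3_chain:
  assumes "rhom \<kappa>" "der D" "\<And>c. D (\<kappa> c) = 0"
  shows "D (ev3 \<kappa> X Y Z F) =
    ev3 \<kappa> X Y Z (dx3 F) * D X + ev3 \<kappa> X Y Z (dy3 F) * D Y + ev3 \<kappa> X Y Z (dz3 F) * D Z"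
  by (induction F rule: poly3_induct)
    (simp_all add: ev3_gen[OF assms(1)] rhomD[OF rhom_ev3[OF assms(1)]] derD[OF assms(2)] assms(3)
       dx3_der dy3_der dz3_der algebra_simps)

section \<open>Homogeneous polynomials\<close>

text \<open>\<open>Phi F\<close> is \<open>F (t x, t y, t z)\<close> as a polynomial in \<open>t\<close>; its coefficients are the homogeneous parts of \<open>F\<close>.\<close>

definition Phi :: "poly3 \<Rightarrow> poly3 poly" where
  "Phi = ev3 (\<lambda>c. [:emb c:]) (monom PX 1) (monom PY 1) (monom PZ 1)"

text \<open>The identity F(tx, ty, tz) = t^d F in \<complex>[x,y,z][t]. In this form products are
  immediate; the equivalence with the coefficientwise definition is
  \<open>Hom_iff_homogeneous3\<close>.\<close>

definition Hom :: "nat \<Rightarrow> poly3 \<Rightarrow> bool" where "Hom d F \<longleftrightarrow> Phi F = monom F d"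

lemma rhom_cemb: "rhom (\<lambda>c. [:emb c:])" using rhom_emb by (simp add: rhom_def one_pCons)

lemma rhom_Phi: "rhom Phi" unfolding Phi_def by (rule rhom_ev3[OF rhom_cemb])

lemmas Phi_hom = rhomD[OF rhom_Phi]

lemma Phi_gen: "Phi (emb c) = [:emb c:]" "Phi PX = monom PX 1" "Phi PY = monom PY 1" "Phi PZ = monom PZ 1"
  by (simp_all add: Phi_def ev3_gen[OF rhom_cemb])

lemma poly_Phi_1: "poly (Phi F) 1 = F"
  by (rule rhom_poly3_unique[OF rhom_comp[OF rhom_poly rhom_Phi] rhom_id]) (simp_all add: Phi_gen poly_monom)

lemma Phi_dt: "pderiv (Phi F) = Phi (dx3 F) * [:PX:] + Phi (dy3 F) * [:PY:] + Phi (dz3 F) * [:PZ:]"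
proof -
  have m: "pderiv (monom c 1) = [:c:]" for c :: poly3 by (simp add: monom_altdef pderiv_mult pderiv_pCons)
  show ?thesis unfolding Phi_def
    by (subst ev3_chain[OF rhom_cemb der_pderiv]) (simp_all add: m[unfolded One_nat_def] pderiv_pCons)
qed

lemma Phi_d3:
  "map_poly dx3 (Phi F) = Phi (dx3 F) * [:0, 1:]" "map_poly dy3 (Phi F) = Phi (dy3 F) * [:0, 1:]"
  "map_poly dz3 (Phi F) = Phi (dz3 F) * [:0, 1:]"
proof -
  have m: "map_poly D (monom c 1) = monom (D c) 1" if "D 0 = 0" for D and c :: poly3
    using that by (rule map_poly_monom)
  have n: "monom 1 1 = [:0, 1::poly3:]" by (simp add: monom_altdef)
  show "map_poly dx3 (Phi F) = Phi (dx3 F) * [:0, 1:]" unfolding Phi_def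
    by (subst ev3_chain[OF rhom_cemb der_map_poly[OF der_d3(1)]])
       (simp_all only: map_poly_pCons m[of dx3, OF dx3_der(3)] d3_gen dx3_der map_poly_0 n, simp_all)
  show "map_poly dy3 (Phi F) = Phi (dy3 F) * [:0, 1:]" unfolding Phi_def
    by (subst ev3_chain[OF rhom_cemb der_map_poly[OF der_d3(2)]])
       (simp_all only: map_poly_pCons m[of dy3, OF dy3_der(3)] d3_gen dy3_der map_poly_0 n, simp_all)
  show "map_poly dz3 (Phi F) = Phi (dz3 F) * [:0, 1:]" unfolding Phi_def
    by (subst ev3_chain[OF rhom_cemb der_map_poly[OF der_d3(3)]])
       (simp_all only: map_poly_pCons m[of dz3, OF dz3_der(3)] d3_gen dz3_der map_poly_0 n, simp_all)
qed

lemma Hom_mult: "Hom d F \<Longrightarrow> Hom e G \<Longrightarrow> Hom (d + e) (F * G)"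
  by (simp add: Hom_def Phi_hom mult_monom)
lemma Hom_add: "Hom d F \<Longrightarrow> Hom d G \<Longrightarrow> Hom d (F + G)"
  by (simp add: Hom_def Phi_hom add_monom)
lemma Hom_diff: "Hom d F \<Longrightarrow> Hom d G \<Longrightarrow> Hom d (F - G)"
  by (simp add: Hom_def Phi_hom diff_monom)
lemma Hom_minus: "Hom d F \<Longrightarrow> Hom d (- F)"
  by (simp add: Hom_def Phi_hom minus_monom)
lemma Hom_0: "Hom d 0" by (simp add: Hom_def Phi_hom)
lemma Hom_emb: "Hom 0 (emb c)" by (simp add: Hom_def Phi_gen monom_0)
lemma Hom_1: "Hom 0 1" by (simp add: Hom_def Phi_hom(1) monom_altdef)
lemma Hom_PXYZ: "Hom 1 PX" "Hom 1 PY" "Hom 1 PZ" by (simp_all add: Hom_def Phi_gen)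

lemma Hom_deriv_aux:
  assumes D: "D 0 = 0" "map_poly D (Phi F) = Phi (D F) * [:0, 1:]" and "Hom d F"
  shows "Hom (d - 1) (D F)"
proof -
  have "Phi (D F) * [:0, 1:] = monom (D F) d"
    using D assms(3) by (metis Hom_def map_poly_monom)
  then have e: "pCons 0 (Phi (D F)) = monom (D F) d" by (simp add: mult.commute)
  show ?thesis
  proof (cases d)
    \<comment> \<open>The degree \<open>d - 1\<close> is truncated here, but the derivative is zero,
      and 0 is homogeneous of every degree.\<close>
    case 0
    have "coeff (pCons 0 (Phi (D F))) 0 = D F" by (simp add: e 0)
    then have "D F = 0" by simp
    then show ?thesis by (simp add: Hom_0)
  next
    case (Suc n)
    have "Phi (D F) = monom (D F) n"
    proof (rule poly_eqI)
      fix k show "coeff (Phi (D F)) k = coeff (monom (D F) n) k"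
        using arg_cong[OF e, of "\<lambda>p. coeff p (Suc k)"] Suc by simp
    qed
    then show ?thesis using Suc by (simp add: Hom_def)
  qed
qed

lemma Hom_d3: assumes "Hom d F" shows "Hom (d - 1) (dx3 F)" "Hom (d - 1) (dy3 F)" "Hom (d - 1) (dz3 F)"
  using Hom_deriv_aux[OF dx3_der(3) Phi_d3(1) assms] Hom_deriv_aux[OF dy3_der(3) Phi_d3(2) assms]
    Hom_deriv_aux[OF dz3_der(3) Phi_d3(3) assms] by auto

lemma euler: assumes "Hom d F" shows "PX * dx3 F + PY * dy3 F + PZ * dz3 F = of_nat d * F"
proof -
  have "poly (pderiv (Phi F)) 1 = of_nat d * F"
    using assms by (simp add: Hom_def pderiv_monom poly_monom)
  then show ?thesis unfolding Phi_dt by (simp add: poly_Phi_1 mult.commute)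
qed

lemma eval3_Phi: "eval3 (poly (Phi F) (emb t)) v = eval3 F (t *s v)"
  by (rule rhom_poly3_unique[OF rhom_comp[OF rhom_eval3 rhom_comp[OF rhom_poly rhom_Phi]] rhom_eval3])
    (simp_all add: Phi_gen poly_monom eval3_hom eval3_gen)

lemma Hom_iff_eval: "Hom d F \<longleftrightarrow> (\<forall>t v. eval3 F (t *s v) = t ^ d * eval3 F v)"
proof
  assume "Hom d F"
  then show "\<forall>t v. eval3 F (t *s v) = t ^ d * eval3 F v"
    using eval3_Phi[symmetric] by (simp add: Hom_def poly_monom eval3_hom eval3_gen)
next
  assume h: "\<forall>t v. eval3 F (t *s v) = t ^ d * eval3 F v"
  have "Phi F - monom F d = 0"
  proof (rule poly_eq_0_if_const_roots)
    show "inj emb" by (simp add: inj_def emb_def)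
    fix t show "poly (Phi F - monom F d) (emb t) = 0"
      by (rule eval3_eq_0_imp) (simp add: eval3_hom eval3_Phi h poly_monom eval3_gen)
  qed
  then show "Hom d F" by (simp add: Hom_def)
qed

text \<open>One induction per variable: \<open>E1\<close> and \<open>E2\<close> are the two inner
  stages of the evaluation \<open>Phi\<close>, and each stage shifts the exponent of its own
  variable and that of t together.\<close>

lemma coeff_Phi: "coeff3 (coeff (Phi F) n) i j k = (if i + j + k = n then coeff3 F i j k else 0)"
proof -
  define E1 where "E1 h = poly (map_poly (\<lambda>c. [:emb c:]) h) (monom PX 1)" for h
  define E2 where "E2 g = poly (map_poly E1 g) (monom PY 1)" for g
  have mX: "coeff (monom PX 1 * p) n = (if n = 0 then 0 else PX * coeff p (n - 1))"
       "coeff (monom PY 1 * p) n = (if n = 0 then 0 else PY * coeff p (n - 1))"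
       "coeff (monom PZ 1 * p) n = (if n = 0 then 0 else PZ * coeff p (n - 1))" for p n
    by (auto simp: coeff_monom_mult)
  have X: "coeff3 (PX * p) i j k = (if i = 0 then 0 else coeff3 p (i - 1) j k)" for p i j k
    by (cases i) (simp_all add: coeff3_def PX_def)
  have Y: "coeff3 (PY * p) i j k = (if j = 0 then 0 else coeff3 p i (j - 1) k)" for p i j k
    by (cases j) (simp_all add: coeff3_def PY_def)
  have Z: "coeff3 (PZ * p) i j k = (if k = 0 then 0 else coeff3 p i j (k - 1))" for p i j k
    by (cases k) (simp_all add: coeff3_def PZ_def)
  have em: "coeff3 (coeff [:emb c:] n) i j k = (if n = 0 \<and> i = 0 \<and> j = 0 \<and> k = 0 then c else 0)" for c n i j k
    by (auto simp: emb_def coeff3_def coeff_pCons split: nat.splits)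
  have em0: "coeff3 (emb c) i j k = (if i = 0 \<and> j = 0 \<and> k = 0 then c else 0)" for c i j k
    using em[of c 0] by simp
  note mX = mX[unfolded One_nat_def] mX
  have add: "coeff3 (p + q) i j k = coeff3 p i j k + coeff3 q i j k" for p q i j k by (simp add: coeff3_def)
  have z3: "coeff3 0 i j k = 0" for i j k by (simp add: coeff3_def)
  have c0: "[:emb 0:] = 0" by (simp add: emb_def)
  have 1: "coeff3 (coeff (E1 h) n) i j k = (if j = 0 \<and> k = 0 \<and> i = n then coeff h i else 0)" for h n i j k
  proof (induction h arbitrary: n i)
    case 0 then show ?case by (simp add: E1_def z3)
  next
    case (pCons a h)
    have "E1 (pCons a h) = [:emb a:] + monom PX 1 * E1 h" by (simp add: E1_def map_poly_pCons c0)
    then show ?case by (cases i; cases n) (auto simp: add em em0 mX X pCons.IH z3)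
  qed
  have E10: "E1 0 = 0" by (simp add: E1_def)
  have 2: "coeff3 (coeff (E2 g) n) i j k = (if k = 0 \<and> i + j = n then coeff (coeff g j) i else 0)" for g n i j k
  proof (induction g arbitrary: n j)
    case 0 then show ?case by (simp add: E2_def z3)
  next
    case (pCons a h)
    have "E2 (pCons a h) = E1 a + monom PY 1 * E2 h" by (simp add: E2_def map_poly_pCons E10)
    then show ?case by (cases j; cases n) (auto simp: add 1 mX Y pCons.IH z3)
  qed
  have E20: "E2 0 = 0" by (simp add: E2_def)
  show ?thesis
  proof (induction F arbitrary: n k)
    case 0 then show ?case by (simp add: Phi_hom z3)
  next
    case (pCons a h)
    have "Phi (pCons a h) = E2 a + monom PZ 1 * Phi h"
      by (simp add: Phi_def ev3_def map_poly_pCons E20[unfolded E2_def E1_def[abs_def]] E2_def E1_def[abs_def])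
    then show ?case by (cases k; cases n) (auto simp: add 2 mX Z pCons.IH z3, auto simp: coeff3_def)
  qed
qed

lemma Hom_iff_homogeneous3: "Hom d F \<longleftrightarrow> homogeneous3 d F"
proof
  assume h: "Hom d F"
  show "homogeneous3 d F" unfolding homogeneous3_def
  proof (intro allI impI)
    fix i j k assume nz: "coeff3 F i j k \<noteq> 0"
    have "coeff3 (coeff (Phi F) (i + j + k)) i j k = coeff3 F i j k" by (simp add: coeff_Phi)
    with nz h show "i + j + k = d" by (auto simp: Hom_def coeff3_def split: if_splits)
  qed
next
  assume h: "homogeneous3 d F"
  show "Hom d F" unfolding Hom_def
  proof (rule poly_eqI)
    fix n
    have "coeff3 (coeff (Phi F) n) i j k = coeff3 (coeff (monom F d) n) i j k" for i j k
      using h by (auto simp: coeff_Phi homogeneous3_def) (auto simp: coeff3_def)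
    then show "coeff (Phi F) n = coeff (monom F d) n"
      by (intro poly_eqI) (simp add: coeff3_def)
  qed
qed

definition hpart :: "nat \<Rightarrow> poly3 \<Rightarrow> poly3" where "hpart n F = coeff (Phi F) n"

lemma Hom_hpart: "Hom n (hpart n F)"
  unfolding Hom_iff_homogeneous3 homogeneous3_def hpart_def by (auto simp: coeff_Phi split: if_splits)

lemma coeff_mult_monom: "coeff (p * monom c m) n = (if n < m then 0 else coeff p (n - m) * c)"
  using coeff_monom_mult[of c m p n] by (simp add: mult.commute not_less split: if_splits)

text \<open>Applied to both sides of a relation between forms, this makes the coefficients of the
  relation homogeneous.\<close>

lemma hpart_mult: "Hom d F \<Longrightarrow> hpart (n + d) (a * F) = hpart n a * F"
  unfolding Hom_def hpart_def Phi_hom by (simp add: coeff_mult_monom)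

lemma hpart_mult_less: "Hom d F \<Longrightarrow> n < d \<Longrightarrow> hpart n (a * F) = 0"
  unfolding Hom_def hpart_def Phi_hom by (simp add: coeff_mult_monom)

lemma hpart_Hom: "Hom d F \<Longrightarrow> hpart d F = F" by (simp add: Hom_def hpart_def)

lemma hpart_add: "hpart n (a + b) = hpart n a + hpart n b" by (simp add: hpart_def Phi_hom)

text \<open>Here \<open>degree\<close> is the degree in z. Passing to homogeneous parts thus keeps
  the degree bound on the remainder of a division.\<close>

lemma degree_hpart_le: "degree (hpart n F) \<le> degree F"
proof (rule degree_le, intro allI impI poly_eqI)
  fix k i j assume "degree F < k"
  then have "coeff3 F j i k = 0" by (simp add: coeff3_def coeff_eq_0)
  then have "coeff3 (hpart n F) j i k = 0" by (simp add: hpart_def coeff_Phi)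
  then show "coeff (coeff (coeff (hpart n F) k) i) j = coeff (coeff 0 i) j" by (simp add: coeff3_def)
qed

section \<open>Binary forms and the discriminant\<close>

lemma eval2_simps [simp]: "eval2 1 z = 1" "eval2 (f - g) z = eval2 f z - eval2 g z" "eval2 (- f) z = - eval2 f z"
  by (simp_all add: eval2_def split_beta)

lemma rhom_eval2: "rhom (\<lambda>f. eval2 f z)"
  by (simp add: rhom_def eval2_arith)

lemma eval3_const: "eval3 [:c:] v = eval2 c (v $ 1, v $ 2)"
  by (simp add: eval3_def eval2_def)

text \<open>
  The last variable \<open>z\<close> is the main one: \<open>lz a b F\<close> is \<open>F (a, b, z)\<close>.  The form \<open>lin a b\<close> vanishes at \<open>(a, b)\<close>, and
  \<open>res a b c\<close> is the restriction of \<open>c\<close> to the line \<open>t \<mapsto> (t a, t b)\<close>.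
\<close>

definition lz :: "complex \<Rightarrow> complex \<Rightarrow> poly3 \<Rightarrow> complex poly" where
  "lz a b F = map_poly (\<lambda>c. eval2 c (a, b)) F"

lemma rhom_lz: "rhom (lz a b)"
proof -
  have "lz a b = map_poly (\<lambda>c. eval2 c (a, b))" by (auto simp: lz_def)
  then show ?thesis using rhom_map_poly[OF rhom_eval2] by simp
qed

lemmas lz_hom = rhomD[OF rhom_lz]

lemma poly_lz: "poly (lz a b F) z = eval3 F (vector [a, b, z])"
proof -
  have r: "rhom (\<lambda>F. poly (lz a b F) z)" by (rule rhom_comp[OF rhom_poly rhom_lz])
  have [simp]: "eval2 [:[:c:]:] (a,b) = c" "eval2 [:[:0,1:]:] (a,b) = a" "eval2 [:0,1:] (a,b) = b" "eval2 0 (a,b) = 0" for c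
    by (simp_all add: eval2_def)
  show ?thesis
    by (rule rhom_poly3_unique[OF r rhom_eval3])
      (simp_all add: eval3_gen, simp_all add: lz_def emb_def PX_def PY_def PZ_def map_poly_pCons)
qed

lemma coeff_lz: "coeff (lz a b F) k = eval2 (coeff F k) (a, b)"
  by (simp add: lz_def coeff_map_poly eval2_arith)

definition lin :: "complex \<Rightarrow> complex \<Rightarrow> poly2" where "lin a b = [:[:0, b:], [:- a:]:]"

lemma eval2_lin: "eval2 (lin a b) (s, t) = b * s - a * t"
  by (simp add: lin_def eval2_def algebra_simps)

lemma lin_nz: "(a, b) \<noteq> (0, 0) \<Longrightarrow> lin a b \<noteq> 0" by (auto simp: lin_def)

lemma eval_nth: "vector [a, b, c] $ (1::3) = (a::complex)" "vector [a, b, c] $ (2::3) = b" "vector [a, b, c] $ (3::3) = c"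
  by simp_all

lemma Hom_const_iff: "Hom n [:c:] \<longleftrightarrow> (\<forall>t a b. eval2 c (t * a, t * b) = t ^ n * eval2 c (a, b))"
proof
  assume h: "Hom n [:c:]"
  show "\<forall>t a b. eval2 c (t * a, t * b) = t ^ n * eval2 c (a, b)"
  proof (intro allI)
    fix t a b
    have "eval3 [:c:] (t *s vector [a, b, 0]) = t ^ n * eval3 [:c:] (vector [a, b, 0])"
      using h unfolding Hom_iff_eval by blast
    then show "eval2 c (t * a, t * b) = t ^ n * eval2 c (a, b)" by (simp add: eval3_const)
  qed
qed (simp add: Hom_iff_eval eval3_const)

lemma Hom_lin: "Hom 1 [:lin a b:]"
  by (simp add: Hom_const_iff eval2_lin algebra_simps)

definition res :: "complex \<Rightarrow> complex \<Rightarrow> poly2 \<Rightarrow> complex poly" where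
  "res a b c = poly (map_poly (\<lambda>h. pcompose h [:0, a:]) c) [:0, b:]"

lemma rhom_pcompose: "rhom (\<lambda>h. pcompose h q)"
  by (simp add: rhom_def pcompose_1 pcompose_add pcompose_mult)

lemma rhom_res: "rhom (res a b)"
  unfolding res_def by (rule rhom_ev1[OF rhom_pcompose])

lemma poly_res: "poly (res a b c) t = eval2 c (t * a, t * b)"
  by (induction c) (simp_all add: res_def eval2_def map_poly_pCons poly_pcompose)

lemma poly_poly_eval: "poly (poly c q) s = poly (poly c [:poly q s:]) s"
  by (induction c) simp_all

text \<open>For \<open>a\<close> nonzero the form is monic in y up to a constant, and the factor
  theorem over \<complex>[x] applies. For \<open>a = 0\<close> it is a multiple of x, and every
  coefficient has to vanish at x = 0.\<close>

lemma lin_dvd_iff: assumes ab: "(a, b) \<noteq> (0, 0)" shows "lin a b dvd c \<longleftrightarrow> res a b c = 0"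
proof
  assume "lin a b dvd c"
  then obtain s where "c = lin a b * s" by (elim dvdE)
  then have "poly (res a b c) t = poly 0 t" for t by (simp add: poly_res eval2_arith eval2_lin)
  then show "res a b c = 0" by (simp add: poly_eq_poly_eq_iff[symmetric] fun_eq_iff)
next
  assume r: "res a b c = 0"
  then have r': "eval2 c (t * a, t * b) = 0" for t using poly_res[of a b c t] by simp
  show "lin a b dvd c"
  proof (cases "a = 0")
    case False
    have "poly (poly c [:0, b / a:]) s = 0" for s
      using r'[of "s / a"] False poly_poly_eval[of c "[:0, b / a:]" s] by (simp add: eval2_def)
    then have "poly c [:0, b / a:] = 0" by (metis poly_all_0_iff_0)
    then have d: "[:- [:0, b / a:], 1:] dvd c" by (simp add: poly_eq_0_iff_dvd)
    have "[:- [:0, b / a:], 1:] = lin a b * [:[:- 1 / a:]:]" using False by (simp add: lin_def one_pCons)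
    with d show ?thesis by (metis dvd_mult_left)
  next
    case True
    then have b: "b \<noteq> 0" using ab by simp
    have "poly (map_poly (\<lambda>h. poly h 0) c) s = 0" for s
    proof -
      have "poly (map_poly (\<lambda>h. poly h 0) c) s = eval2 c (0, s)"
        by (induction c) (simp_all add: eval2_def map_poly_pCons)
      then show ?thesis using r'[of "s / b"] True b by simp
    qed
    then have "map_poly (\<lambda>h. poly h 0) c = 0" by (metis poly_all_0_iff_0)
    then have "poly (coeff c n) 0 = 0" for n by (metis coeff_0 coeff_map_poly poly_0)
    then have "[:0, 1:] dvd coeff c n" for n using poly_eq_0_iff_dvd[of "coeff c n" 0] by simp
    moreover have "[:0, b:] dvd [:0, 1::complex:]"
    proof
      show "[:0, 1:] = [:0, b:] * [:1 / b:]" using b by simp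
    qed
    ultimately have "[:0, b:] dvd coeff c n" for n using dvd_trans by blast
    then show ?thesis using True by (simp add: lin_def const_poly_dvd_iff)
  qed
qed

lemma clin_dvd_iff: assumes "(a, b) \<noteq> (0, 0)" shows "[:lin a b:] dvd F \<longleftrightarrow> map_poly (res a b) F = 0"
proof -
  have z: "res a b 0 = 0" by (rule rhomD(4)[OF rhom_res])
  show ?thesis
    by (simp add: const_poly_dvd_iff lin_dvd_iff[OF assms] poly_eq_iff coeff_map_poly[of "res a b", OF z])
qed

text \<open>Restriction to the line is a ring homomorphism into a domain, and by
  \<open>clin_dvd_iff\<close> its kernel consists of the multiples of the form.\<close>

lemma clin_prime:
  assumes "(a, b) \<noteq> (0, 0)" "[:lin a b:] dvd F * G" shows "[:lin a b:] dvd F \<or> [:lin a b:] dvd G"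
  using assms(2) unfolding clin_dvd_iff[OF assms(1)] rhomD(3)[OF rhom_map_poly[OF rhom_res]] by simp

text \<open>By homogeneity, vanishing over the single direction (\<open>a\<close>, \<open>b\<close>)
  spreads to all its nonzero multiples.\<close>

lemma clin_dvd_Hom: assumes ab: "(a, b) \<noteq> (0, 0)" and h: "Hom n F" and z: "lz a b F = 0"
  shows "[:lin a b:] dvd F"
  unfolding clin_dvd_iff[OF ab]
proof (rule poly_eqI)
  fix k
  have e: "eval2 (coeff F k) (t * a, t * b) = 0" if "t \<noteq> 0" for t
  proof -
    have "poly (lz (t * a) (t * b) F) s = 0" for s
    proof -
      have "vector [t * a, t * b, s] = t *s (vector [a, b, s / t] :: complex ^ 3)" using that by (simp add: vec_eq_iff forall_3)
      then have "poly (lz (t * a) (t * b) F) s = t ^ n * poly (lz a b F) (s / t)"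
        using h by (simp add: poly_lz Hom_iff_eval)
      then show ?thesis using z by simp
    qed
    then have "lz (t * a) (t * b) F = 0" by (metis poly_all_0_iff_0)
    then show ?thesis by (metis coeff_lz coeff_0)
  qed
  \<comment> \<open>The factor t takes care of t = 0, where the scaling argument says
    nothing.\<close>
  have "[:0, 1:] * res a b (coeff F k) = 0"
  proof -
    have "poly ([:0, 1:] * res a b (coeff F k)) t = 0" for t
      using e[of t] by (auto simp: poly_res)
    then show ?thesis by (metis poly_all_0_iff_0)
  qed
  then show "coeff (map_poly (res a b) F) k = coeff 0 k"
    by (simp add: coeff_map_poly rhomD(4)[OF rhom_res])
qed

lemma Hom_quotient: assumes "Hom d (A * B)" "Hom e A" "A \<noteq> 0" "B \<noteq> 0"
  shows "e \<le> d \<and> Hom (d - e) B"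
proof -
  have m: "monom A e * Phi B = monom (A * B) d" using assms(1,2) by (simp add: Hom_def Phi_hom)
  have c: "A * coeff (Phi B) k = (if k + e = d then A * B else 0)" for k
    using arg_cong[OF m, of "\<lambda>p. coeff p (k + e)"] by (auto simp: coeff_monom_mult)
  have c': "coeff (Phi B) k = (if k + e = d then B else 0)" for k
    using assms(3) c[of k] by (cases "k + e = d") simp_all
  have "e \<le> d"
  proof (rule ccontr)
    assume "\<not> e \<le> d"
    then have "Phi B = 0" by (intro poly_eqI) (simp add: c')
    then show False using poly_Phi_1[of B] assms(4) by simp
  qed
  moreover have "Phi B = monom B (d - e)" using \<open>e \<le> d\<close> by (intro poly_eqI) (auto simp: c')
  ultimately show ?thesis by (simp add: Hom_def)
qed

lemma Hom_coeff: assumes "Hom n F" "coeff F k \<noteq> 0" shows "k \<le> n \<and> Hom (n - k) [:coeff F k:]"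
proof -
  have h: "coeff (coeff (coeff F k) j) i \<noteq> 0 \<Longrightarrow> i + j + k = n" for i j
    using assms(1) by (simp add: Hom_iff_homogeneous3 homogeneous3_def coeff3_def)
  obtain i j where "coeff (coeff (coeff F k) j) i \<noteq> 0" using assms(2) by (metis poly_eqI coeff_0)
  then have "k \<le> n" using h by fastforce
  moreover have "Hom (n - k) [:coeff F k:]"
    unfolding Hom_iff_homogeneous3 homogeneous3_def coeff3_def
  proof (intro allI impI)
    fix i j m assume "coeff (coeff (coeff [:coeff F k:] m) j) i \<noteq> 0"
    then show "i + j + m = n - k" using h[of j i] by (cases m) auto
  qed
  ultimately show ?thesis by simp
qed

lemma Hom0_const: assumes "Hom 0 [:c:]" shows "c = [:[:eval2 c (0, 0):]:]"
proof -
  have "c - [:[:eval2 c (0, 0):]:] = 0"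
  proof (rule eval2_eq_0_imp)
    fix a b
    have "eval2 c (a, b) = eval2 c (0, 0)" using assms unfolding Hom_const_iff by (metis mult_1 mult_zero_left power_0)
    then show "poly (poly (c - [:[:eval2 c (0, 0):]:]) [:b:]) a = 0" by (simp add: eval2_def)
  qed
  then show ?thesis by simp
qed

text \<open>Dehomogenize by x = 1. If \<open>p\<close> is constant, the form is a multiple of
  \<open>x ^ n\<close>, which vanishes at (0, 1).\<close>

lemma binary_form_zero: assumes "Hom n [:c:]" "n > 0" shows "\<exists>a b. (a, b) \<noteq> (0, 0) \<and> eval2 c (a, b) = 0"
proof -
  define p where "p = map_poly (\<lambda>h. poly h 1) c"
  have "poly (map_poly (\<lambda>h. poly h 1) c) t = eval2 c (1, t)" for c t
    by (induction c) (simp_all add: eval2_def map_poly_pCons)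
  then have p: "poly p t = eval2 c (1, t)" for t by (simp add: p_def)
  show ?thesis
  proof (cases "degree p = 0")
    case False
    then obtain t where "poly p t = 0" using Fundamental_Theorem_Algebra.fundamental_theorem_of_algebra[of p] constant_degree[of p] by auto
    then have "((1::complex), t) \<noteq> (0, 0) \<and> eval2 c (1, t) = 0" using p by simp
    then show ?thesis by blast
  next
    case True
    then obtain k where k: "p = [:k:]" by (rule degree_eq_zeroE)
    define q where "q = poly c [:1:]"
    have q: "poly q s = eval2 c (s, 1)" for s by (simp add: q_def eval2_def)
    have "poly ([:0, 1:] * (q - monom k n)) s = 0" for s
    proof (cases "s = 0")
      case False
      have "eval2 c (s * 1, s * (1 / s)) = s ^ n * eval2 c (1, 1 / s)" using assms(1) unfolding Hom_const_iff by blast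
      then have "eval2 c (s, 1) = s ^ n * k" using False p[of "1 / s"] k by simp
      then show ?thesis by (simp add: q poly_monom)
    qed simp
    then have "[:0, 1:] * (q - monom k n) = 0" by (metis poly_all_0_iff_0)
    then have "q = monom k n" by simp
    then have "eval2 c (0, 1) = 0" using q[of 0] assms(2) by (simp add: poly_monom zero_power)
    then have "(0, 1) \<noteq> (0, 0 :: complex) \<and> eval2 c (0, 1) = 0" by simp
    then show ?thesis by blast
  qed
qed

text \<open>Every later induction on the degree of a form in x and y splits off one linear factor in
  this way.\<close>

lemma binary_form_factor:
  assumes "Hom (Suc n) [:c:]" "c \<noteq> 0"
  obtains a b c' where "(a, b) \<noteq> (0, 0)" "c = lin a b * c'" "Hom n [:c':]" "c' \<noteq> 0"
proof -
  obtain a b where ab: "(a, b) \<noteq> (0, 0)" and z: "eval2 c (a, b) = 0" using binary_form_zero[OF assms(1)] by blast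
  have "lz a b [:c:] = 0" using z by (simp add: lz_def map_poly_pCons eval2_arith)
  then have "[:lin a b:] dvd [:c:]" by (rule clin_dvd_Hom[OF ab assms(1)])
  then obtain c' where c': "c = lin a b * c'" by (auto elim: dvdE)
  then have "Hom (Suc n - 1) [:c':]"
    using Hom_quotient[of "Suc n" "[:lin a b:]" "[:c':]" 1] assms Hom_lin by (auto simp: mult.commute)
  then show ?thesis using that[OF ab c'] assms(2) c' by auto
qed

text \<open>Monic in \<open>z\<close> up to a constant, i.e. for a form \<open>P\<close> not vanishing at the projection centre \<open>[0 : 0 : 1]\<close>.\<close>

definition monz :: "poly3 \<Rightarrow> bool" where "monz P \<longleftrightarrow> (\<exists>c\<noteq>0. lead_coeff P = [:[:c:]:])"

text \<open>A Gauss lemma. Each linear factor of \<open>\<gamma>\<close> is prime, so it divides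
  \<open>g\<close> or \<open>a\<close>; the factors found in \<open>g\<close> are collected in
  \<open>\<gamma>\<^sub>1\<close>, those found in \<open>a\<close> are cancelled.\<close>

lemma content_removal:
  assumes "Hom m [:\<gamma>:]" "\<gamma> \<noteq> 0" "[:\<gamma>:] * P = g * a"
  shows "\<exists>\<gamma>\<^sub>1 g\<^sub>0 a\<^sub>0. \<gamma>\<^sub>1 \<noteq> 0 \<and> g = [:\<gamma>\<^sub>1:] * g\<^sub>0 \<and> P = g\<^sub>0 * a\<^sub>0 \<and> (\<exists>k. Hom k [:\<gamma>\<^sub>1:])"
  using assms
proof (induction m arbitrary: \<gamma> g a)
  case 0
  obtain c where c: "\<gamma> = [:[:c:]:]" using Hom0_const[OF 0(1)] by blast
  then have "c \<noteq> 0" using 0 by auto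
  have "emb c * P = g * a" using 0(3) c by (simp add: emb_def)
  then have "emb (1 / c) * (emb c * P) = g * (emb (1 / c) * a)" by (simp add: algebra_simps)
  moreover have "emb (1 / c) * emb c = 1" using \<open>c \<noteq> 0\<close> by (simp add: emb_def one_pCons)
  ultimately have "P = g * (emb (1 / c) * a)" by (metis mult.assoc mult_1)
  moreover have "g = [:1:] * g" by simp
  moreover have "Hom 0 [:1:]" using Hom_1 unfolding one_pCons[where ?'a = "complex poly poly"] .
  ultimately show ?case by (metis one_neq_zero)
next
  case (Suc m)
  obtain u v \<gamma>' where f: "(u, v) \<noteq> (0, 0)" "\<gamma> = lin u v * \<gamma>'" "Hom m [:\<gamma>':]" "\<gamma>' \<noteq> 0"
    using binary_form_factor[OF Suc.prems(1,2)] by blast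
  let ?l = "[:lin u v:]"
  have l0: "?l \<noteq> 0" using lin_nz[OF f(1)] by simp
  have e: "?l * ([:\<gamma>':] * P) = g * a" using Suc.prems(3) f(2) by (simp add: mult.commute)
  then have "?l dvd g * a" by (metis dvd_triv_left)
  then consider "?l dvd g" | "?l dvd a" using clin_prime[OF f(1)] by blast
  then show ?case
  proof cases
    case 1
    then obtain g' where g': "g = ?l * g'" by (elim dvdE)
    then have "?l * ([:\<gamma>':] * P) = ?l * (g' * a)" using e by (simp only: mult.assoc)
    then have "[:\<gamma>':] * P = g' * a" using l0 by (metis mult_left_cancel)
    from Suc.IH[OF f(3,4) this] obtain \<gamma>\<^sub>1 g\<^sub>0 a\<^sub>0 k where
      i: "\<gamma>\<^sub>1 \<noteq> 0" "g' = [:\<gamma>\<^sub>1:] * g\<^sub>0" "P = g\<^sub>0 * a\<^sub>0" "Hom k [:\<gamma>\<^sub>1:]" by blast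
    have "g = [:lin u v * \<gamma>\<^sub>1:] * g\<^sub>0" using g' i(2) by (simp add: mult.commute)
    moreover have "lin u v * \<gamma>\<^sub>1 \<noteq> 0" using i(1) lin_nz[OF f(1)] by simp
    moreover have "Hom (1 + k) [:lin u v * \<gamma>\<^sub>1:]" using Hom_mult[OF Hom_lin i(4)] by (simp add: mult.commute)
    ultimately show ?thesis using i(3) by blast
  next
    case 2
    then obtain a' where a': "a = ?l * a'" by (elim dvdE)
    then have "?l * ([:\<gamma>':] * P) = ?l * (g * a')" using e by (simp only: mult.left_commute)
    then have "[:\<gamma>':] * P = g * a'" using l0 by (metis mult_left_cancel)
    from Suc.IH[OF f(3,4) this] show ?thesis .
  qed
qed

text \<open>The leading coefficient is an invertible constant, so scaling turns pseudo-division into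
  division.\<close>

lemma monz_division: assumes "monz g" shows "\<exists>s r. f = g * s + r \<and> (r = 0 \<or> degree r < degree g)"
proof -
  obtain c where c: "c \<noteq> 0" "lead_coeff g = [:[:c:]:]" using assms by (auto simp: monz_def)
  then have g0: "g \<noteq> 0" by auto
  obtain q r where qr: "pseudo_divmod f g = (q, r)" by fastforce
  define N where "N = Suc (degree f) - degree g"
  have p: "smult ([:[:c:]:] ^ N) f = g * q + r" "r = 0 \<or> degree r < degree g"
    using pseudo_divmod[OF g0 qr] c(2) by (simp_all add: N_def)
  define u :: poly2 where "u = [:[:(1 / c) ^ N:]:]"
  have "[:[:c:]:] ^ N = [:[:c ^ N:]:]" by (induction N) (simp_all add: one_pCons)
  then have u: "u * [:[:c:]:] ^ N = 1" using c(1) by (simp add: u_def one_pCons power_divide)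
  have "f = smult (u * [:[:c:]:] ^ N) f" by (simp add: u)
  also have "\<dots> = smult u (g * q + r)" using p(1) by (metis smult_smult)
  also have "\<dots> = g * smult u q + smult u r" by (simp add: smult_add_right)
  finally show ?thesis using p(2) by (metis degree_smult_le le_less_trans smult_0_right)
qed

text \<open>If \<open>r\<close> is the remainder of \<open>f\<close> modulo \<open>g\<close>, then
  \<open>g\<close> divides \<open>[:\<delta>:] * r\<close>, whose degree in z is that of
  \<open>r\<close> and hence too small unless \<open>r\<close> is zero.\<close>

lemma monz_dvd_cancel: assumes "monz g" "\<delta> \<noteq> 0" "g dvd [:\<delta>:] * f" shows "g dvd f"
proof -
  have g0: "g \<noteq> 0" using assms(1) by (auto simp: monz_def)
  obtain s r where sr: "f = g * s + r" "r = 0 \<or> degree r < degree g" using monz_division[OF assms(1)] by blast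
  obtain t where "[:\<delta>:] * f = g * t" using assms(3) by (elim dvdE)
  then have e: "[:\<delta>:] * r = g * (t - [:\<delta>:] * s)" using sr(1) by (simp add: algebra_simps)
  have "r = 0"
  proof (rule ccontr)
    assume r: "r \<noteq> 0"
    then have "t - [:\<delta>:] * s \<noteq> 0" using e assms(2) by auto
    then have "degree g \<le> degree (g * (t - [:\<delta>:] * s))" using g0 by (simp add: degree_mult_eq)
    also have "\<dots> = degree r" using e assms(2) by (metis degree_smult_eq mult.commute mult_pCons_left mult_zero_left pCons_0_0 add_0_right)
    finally show False using sr(2) r by simp
  qed
  then show ?thesis using sr(1) by simp
qed

text \<open>The leading coefficient of a factor divides a unit of \<complex>[x,y], hence is a
  nonzero constant.\<close>

lemma monz_dvd: assumes "monz (g * a)" shows "monz g"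
proof -
  obtain c where c: "c \<noteq> 0" "lead_coeff g * lead_coeff a = [:[:c:]:]" using assms by (auto simp: monz_def lead_coeff_mult)
  have "lead_coeff g dvd 1"
  proof
    show "1 = lead_coeff g * (lead_coeff a * [:[:1 / c:]:])" using c by (simp add: mult.assoc[symmetric] one_pCons)
  qed
  then obtain h where "lead_coeff g = [:h:]" "h dvd 1" unfolding is_unit_poly_iff by blast
  moreover then obtain k where "h = [:k:]" "k dvd 1" unfolding is_unit_poly_iff by blast
  ultimately show ?thesis by (auto simp: monz_def)
qed

section \<open>Ideals with two generators and the discriminant\<close>

definition ideal2 :: "'a::comm_ring_1 \<Rightarrow> 'a \<Rightarrow> 'a set" where "ideal2 f g = {a * f + b * g | a b. True}"

lemma ideal2I: "h = a * f + b * g \<Longrightarrow> h \<in> ideal2 f g" by (auto simp: ideal2_def)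
lemma ideal2_gen: "f \<in> ideal2 f g" "g \<in> ideal2 f g"
  by (rule ideal2I[of _ 1 _ 0], simp) (rule ideal2I[of _ 0 _ 1], simp)
lemma ideal2_mult: "h \<in> ideal2 f g \<Longrightarrow> c * h \<in> ideal2 f g"
  unfolding ideal2_def by (clarify, rule_tac x = "c * a" in exI, rule_tac x = "c * b" in exI) (simp add: algebra_simps)
lemma ideal2_add: "h \<in> ideal2 f g \<Longrightarrow> k \<in> ideal2 f g \<Longrightarrow> h + k \<in> ideal2 f g"
  unfolding ideal2_def by (clarify, rule_tac x = "a + aa" in exI, rule_tac x = "b + ba" in exI) (simp add: algebra_simps)
lemma ideal2_diff: "h \<in> ideal2 f g \<Longrightarrow> k \<in> ideal2 f g \<Longrightarrow> h - k \<in> ideal2 f g"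
  using ideal2_add[of h f g "- 1 * k"] ideal2_mult[of k f g "- 1"] by simp

text \<open>
  An element \<open>g\<close> of least degree in \<open>z\<close> of the ideal \<open>(P, P\<^sub>z)\<close> divides \<open>P\<close> and \<open>P\<^sub>z\<close> up to a form in \<open>x, y\<close>; if it is not
  constant in \<open>z\<close>, then \<open>P\<close> has a multiple factor.
\<close>

lemma discriminant_or_not_squarefree:
  assumes "Hom d P" "monz P"
  shows "(\<exists>\<Delta> n. \<Delta> \<noteq> 0 \<and> Hom n [:\<Delta>:] \<and> [:\<Delta>:] \<in> ideal2 P (dz3 P)) \<or> \<not> squarefree P"
  using assms
proof (induction "degree P" arbitrary: P d rule: less_induct)
  case less
  have P0: "P \<noteq> 0" using less.prems(2) by (auto simp: monz_def)
  show ?case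
  proof (cases "degree P = 0")
    case True
    then obtain c where c: "P = [:c:]" by (rule degree_eq_zeroE)
    have "P \<in> ideal2 P (dz3 P)" by (rule ideal2_gen)
    then show ?thesis using c less.prems(1) P0 by auto
  next
    case False
    define M where "M g \<longleftrightarrow> g \<noteq> 0 \<and> (\<exists>n. Hom n g) \<and> g \<in> ideal2 P (dz3 P)" for g
    have "dz3 P \<noteq> 0" using False by (simp add: dz3_def pderiv_eq_0_iff)
    then have MP': "M (dz3 P)" using Hom_d3(3)[OF less.prems(1)] ideal2_gen(2) by (auto simp: M_def)
    define g where "g = arg_min degree M"
    have g: "M g" and gmin: "M h \<Longrightarrow> degree g \<le> degree h" for h
      using arg_min_nat_lemma[of M "dz3 P" degree] MP' unfolding g_def by auto
    have "degree g \<le> degree (dz3 P)" by (rule gmin[OF MP'])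
    then have dg: "degree g < degree P" using False by (simp add: dz3_def degree_pderiv)
    obtain n where gn: "Hom n g" and g0: "g \<noteq> 0" and gI: "g \<in> ideal2 P (dz3 P)" using g by (auto simp: M_def)
    show ?thesis
    proof (cases "degree g = 0")
      case True
      then obtain c where "g = [:c:]" by (rule degree_eq_zeroE)
      then show ?thesis using gn g0 gI by auto
    next
      case dg0: False
      \<comment> \<open>Pseudo-division of \<open>f\<close> by \<open>g\<close>, followed by taking
        the homogeneous part of the right degree: the remainder becomes a form in the ideal of
        degree below that of \<open>g\<close>, so it vanishes by minimality.\<close>
      have div: "\<exists>\<gamma> m a. \<gamma> \<noteq> 0 \<and> Hom m [:\<gamma>:] \<and> [:\<gamma>:] * f = g * a" if f: "Hom e f" "f \<in> ideal2 P (dz3 P)" for e f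
      proof -
        have lc: "Hom (n - degree g) [:lead_coeff g:]" using Hom_coeff[OF gn, of "degree g"] g0 by simp
        define N where "N = Suc (degree f) - degree g"
        obtain q r where qr: "pseudo_divmod f g = (q, r)" by fastforce
        define \<gamma> where "\<gamma> = lead_coeff g ^ N"
        have p: "[:\<gamma>:] * f = g * q + r" "r = 0 \<or> degree r < degree g"
          using pseudo_divmod[OF g0 qr] by (simp_all add: N_def \<gamma>_def)
        have "\<exists>m. Hom m [:lead_coeff g ^ N:]"
        proof (induction N)
          case 0 then show ?case using Hom_1 by (auto simp: one_pCons)
        next
          case (Suc N)
          then obtain m where "Hom m [:lead_coeff g ^ N:]" by blast
          from Hom_mult[OF lc this] show ?case by (auto simp: mult.commute)
        qed
        then obtain m where m: "Hom m [:\<gamma>:]" by (auto simp: \<gamma>_def)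
        have mf: "Hom (m + e) ([:\<gamma>:] * f)" by (rule Hom_mult[OF m f(1)])
        have hq: "hpart (m + e) (g * q) = g * (if n \<le> m + e then hpart (m + e - n) q else 0)"
          using hpart_mult[OF gn, of "m + e - n" q] hpart_mult_less[OF gn, of "m + e" q] by (auto simp: mult.commute)
        then obtain a where a: "hpart (m + e) (g * q) = g * a" by blast
        have e1: "[:\<gamma>:] * f = g * a + hpart (m + e) r"
          using hpart_Hom[OF mf] p(1) a by (metis hpart_add)
        have "hpart (m + e) r = 0"
        proof (rule ccontr)
          assume nz: "hpart (m + e) r \<noteq> 0"
          then have r0: "r \<noteq> 0" by (auto simp: hpart_def Phi_hom)
          have "hpart (m + e) r = [:\<gamma>:] * f - a * g" using e1 by (simp add: mult.commute)
          then have "hpart (m + e) r \<in> ideal2 P (dz3 P)" using f(2) gI by (auto intro!: ideal2_diff ideal2_mult simp del: mult_pCons_left)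
          then have "degree g \<le> degree (hpart (m + e) r)" using nz Hom_hpart gmin by (auto simp: M_def)
          then show False using degree_hpart_le[of "m + e" r] p(2) r0 by linarith
        qed
        then have "[:\<gamma>:] * f = g * a" using e1 by simp
        moreover have "\<gamma> \<noteq> 0" using g0 by (simp add: \<gamma>_def)
        ultimately show ?thesis using m by blast
      qed
      obtain \<gamma> m a where 1: "\<gamma> \<noteq> 0" "Hom m [:\<gamma>:]" "[:\<gamma>:] * P = g * a"
        using div[OF less.prems(1) ideal2_gen(1)] by blast
      obtain \<gamma>' m' a' where 2: "\<gamma>' \<noteq> 0" "Hom m' [:\<gamma>':]" "[:\<gamma>':] * dz3 P = g * a'"
        using div[OF Hom_d3(3)[OF less.prems(1)] ideal2_gen(2)] by blast
      obtain \<gamma>\<^sub>1 g\<^sub>0 a\<^sub>0 k where 3: "\<gamma>\<^sub>1 \<noteq> 0" "g = [:\<gamma>\<^sub>1:] * g\<^sub>0" "P = g\<^sub>0 * a\<^sub>0" "Hom k [:\<gamma>\<^sub>1:]"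
        using content_removal[OF 1(2,1,3)] by blast
      have mg: "monz g\<^sub>0" using less.prems(2) 3(3) monz_dvd by blast
      have g00: "g\<^sub>0 \<noteq> 0" using g0 3(2) by auto
      have dgg: "degree g\<^sub>0 = degree g" using 3(1,2) by simp
      have hg: "Hom (n - k) g\<^sub>0" using Hom_quotient[of n "[:\<gamma>\<^sub>1:]" g\<^sub>0 k] gn 3 g00 by auto
      have "g\<^sub>0 dvd [:\<gamma>':] * dz3 P" unfolding 2(3) 3(2) by (simp only: mult.assoc dvd_mult dvd_triv_left)
      then have gP': "g\<^sub>0 dvd dz3 P" by (rule monz_dvd_cancel[OF mg 2(1)])
      \<comment> \<open>If \<open>g\<^sub>0\<close> is squarefree, it has by induction a
        discriminant \<open>\<Delta>\<close> of its own. As \<open>g\<^sub>0\<close> divides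
        \<open>P\<close> and \<open>dz3 P\<close>, it divides
        \<open>dz3 g\<^sub>0 * a\<^sub>0\<close>, thus \<open>[:\<Delta>:] * a\<^sub>0\<close>, thus
        \<open>a\<^sub>0\<close>; then its square divides \<open>P\<close>.\<close>
      have "(\<exists>\<Delta> n. \<Delta> \<noteq> 0 \<and> Hom n [:\<Delta>:] \<and> [:\<Delta>:] \<in> ideal2 g\<^sub>0 (dz3 g\<^sub>0)) \<or> \<not> squarefree g\<^sub>0"
        by (rule less.hyps[OF _ hg mg]) (simp add: dgg dg)
      then have "\<not> squarefree P"
      proof
        assume "\<not> squarefree g\<^sub>0"
        then show ?thesis unfolding squarefree_def 3(3) by (meson dvd_mult2)
      next
        assume "\<exists>\<Delta> n. \<Delta> \<noteq> 0 \<and> Hom n [:\<Delta>:] \<and> [:\<Delta>:] \<in> ideal2 g\<^sub>0 (dz3 g\<^sub>0)"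
        then obtain \<Delta> u v where D: "\<Delta> \<noteq> 0" "[:\<Delta>:] = u * g\<^sub>0 + v * dz3 g\<^sub>0" by (auto simp: ideal2_def)
        have "dz3 P = g\<^sub>0 * dz3 a\<^sub>0 + dz3 g\<^sub>0 * a\<^sub>0" by (simp add: 3(3) dz3_der)
        then have d: "g\<^sub>0 dvd dz3 g\<^sub>0 * a\<^sub>0" using gP' by (metis dvd_add_right_iff dvd_triv_left)
        have "[:\<Delta>:] * a\<^sub>0 = g\<^sub>0 * (u * a\<^sub>0) + v * (dz3 g\<^sub>0 * a\<^sub>0)" unfolding D(2) by (simp add: algebra_simps)
        then have "g\<^sub>0 dvd [:\<Delta>:] * a\<^sub>0" using d by (simp only: dvd_add dvd_mult dvd_triv_left)
        then have "g\<^sub>0 dvd a\<^sub>0" by (rule monz_dvd_cancel[OF mg D(1)])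
        then have "g\<^sub>0 ^ 2 dvd P" unfolding 3(3) by (simp add: power2_eq_square mult_dvd_mono)
        moreover have "\<not> g\<^sub>0 dvd 1" using dg0 dgg by (metis degree_pCons_0 is_unit_polyE)
        ultimately show ?thesis unfolding squarefree_def by blast
      qed
      then show ?thesis by blast
    qed
  qed
qed

section \<open>Formal localisation along a line through the projection centre\<close>

type_synonym ser2 = "complex fps fps"

definition kap :: "complex \<Rightarrow> ser2" where "kap c = fps_const (fps_const c)"
definition VY :: ser2 where "VY = fps_X"
definition VZ :: ser2 where "VZ = fps_const fps_X"

text \<open>
  The expansion of a form at \<open>q + Y e + Z p\<close> with \<open>e = (e\<^sub>1, e\<^sub>2, 0)\<close> and \<open>p = (0, 0, 1)\<close>, a power series in \<open>Y\<close> whose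
  coefficients are power series in \<open>Z\<close>.  The line through \<open>q\<close> and \<open>p\<close> is \<open>Y = 0\<close>.
\<close>

definition loc :: "complex \<Rightarrow> complex \<Rightarrow> complex \<Rightarrow> complex \<Rightarrow> complex \<Rightarrow> poly3 \<Rightarrow> ser2" where
  "loc q\<^sub>1 q\<^sub>2 q\<^sub>3 e\<^sub>1 e\<^sub>2 = ev3 kap (kap q\<^sub>1 + VY * kap e\<^sub>1) (kap q\<^sub>2 + VY * kap e\<^sub>2) (kap q\<^sub>3 + VZ)"

lemma rhom_kap: "rhom kap" by (simp add: rhom_def kap_def fps_const_add[symmetric] fps_const_mult[symmetric] del: fps_const_add fps_const_mult)

lemmas kap_hom = rhomD[OF rhom_kap]

lemma rhom_loc: "rhom (loc q\<^sub>1 q\<^sub>2 q\<^sub>3 e\<^sub>1 e\<^sub>2)" unfolding loc_def by (rule rhom_ev3[OF rhom_kap])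

lemmas loc_hom = rhomD[OF rhom_loc]

lemma loc_gen: "loc q\<^sub>1 q\<^sub>2 q\<^sub>3 e\<^sub>1 e\<^sub>2 (emb c) = kap c" "loc q\<^sub>1 q\<^sub>2 q\<^sub>3 e\<^sub>1 e\<^sub>2 PX = kap q\<^sub>1 + VY * kap e\<^sub>1"
  "loc q\<^sub>1 q\<^sub>2 q\<^sub>3 e\<^sub>1 e\<^sub>2 PY = kap q\<^sub>2 + VY * kap e\<^sub>2" "loc q\<^sub>1 q\<^sub>2 q\<^sub>3 e\<^sub>1 e\<^sub>2 PZ = kap q\<^sub>3 + VZ"
  by (simp_all add: loc_def ev3_gen[OF rhom_kap])

lemma rhom_nth0: "rhom (\<lambda>f :: 'a::comm_ring_1 fps. fps_nth f 0)"
  by (simp add: rhom_def)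

lemma rhom_fps_of_poly: "rhom (fps_of_poly :: 'a::comm_ring_1 poly \<Rightarrow> _)"
  by (simp add: rhom_def fps_of_poly_add fps_of_poly_mult)

lemma dvd_nth0: "f dvd g \<Longrightarrow> fps_nth f 0 dvd fps_nth (g :: 'a::comm_ring_1 fps) 0"
  by (elim dvdE) simp

text \<open>At Y = 0 the expansion is the Taylor expansion at \<open>q\<^sub>3\<close> of the
  restriction to the line joining q and p. Divisibility of series thus has consequences for
  polynomials in one variable.\<close>

lemma loc_nth0: "fps_nth (loc q\<^sub>1 q\<^sub>2 q\<^sub>3 e\<^sub>1 e\<^sub>2 F) 0 = fps_of_poly (pcompose (lz q\<^sub>1 q\<^sub>2 F) [:q\<^sub>3, 1:])"
proof -
  have [simp]: "lz q\<^sub>1 q\<^sub>2 (emb c) = [:c:]" "lz q\<^sub>1 q\<^sub>2 PX = [:q\<^sub>1:]" "lz q\<^sub>1 q\<^sub>2 PY = [:q\<^sub>2:]" "lz q\<^sub>1 q\<^sub>2 PZ = [:0, 1:]" for c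
    by (simp_all add: lz_def emb_def PX_def PY_def PZ_def map_poly_pCons eval2_def)
  show ?thesis
    by (rule rhom_poly3_unique[OF rhom_comp[OF rhom_nth0 rhom_loc] rhom_comp[OF rhom_fps_of_poly rhom_comp[OF rhom_pcompose rhom_lz]]])
      (simp_all add: loc_gen, simp_all add: kap_def VY_def VZ_def fps_of_poly_pCons pcompose_pCons)
qed

lemma clin_eq: "[:lin a b:] = emb b * PX - emb a * PY"
  by (simp add: lin_def emb_def PX_def PY_def)

lemma loc_lin: "loc q\<^sub>1 q\<^sub>2 q\<^sub>3 e\<^sub>1 e\<^sub>2 [:lin a b:] = kap (b * q\<^sub>1 - a * q\<^sub>2) + VY * kap (b * e\<^sub>1 - a * e\<^sub>2)"
  unfolding clin_eq by (simp add: loc_hom loc_gen kap_hom algebra_simps)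

text \<open>The coefficient ring \<complex>[[Z]] is not a field, so the inverse is obtained in two
  stages, first for the term without Y.\<close>

lemma unit2I: assumes "fps_nth (fps_nth (u :: ser2) 0) 0 \<noteq> 0" shows "\<exists>w. u * w = 1"
proof -
  have "fps_nth u 0 * inverse (fps_nth u 0) = 1" using assms by (simp add: inverse_mult_eq_1')
  then have "u * fps_right_inverse u (inverse (fps_nth u 0)) = 1" by (rule fps_right_inverse)
  then show ?thesis by blast
qed

lemma kap_unit: "c \<noteq> 0 \<Longrightarrow> kap c * kap (1 / c) = 1"
  using kap_hom(1) kap_hom(3)[of c "1/c"] by simp

lemma VY_factor: assumes "fps_nth (V :: ser2) 0 = 0" shows "\<exists>V'. V = VY * V'"
proof
  show "V = VY * fps_shift 1 V" using assms
    by (intro fps_ext) (simp add: VY_def)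
qed

text \<open>A series that is nonzero on Y = 0 is prime to Y: comparison of the terms without Y shows
  that Y divides the quotient.\<close>

lemma VY_cancel: assumes "fps_nth f 0 \<noteq> 0" "f dvd VY * W" shows "f dvd W"
proof -
  obtain V where V: "VY * W = f * V" using assms(2) by (elim dvdE)
  have "fps_nth f 0 * fps_nth V 0 = 0" using arg_cong[OF V, of "\<lambda>g. fps_nth g 0"] by (simp add: VY_def)
  then obtain V' where "V = VY * V'" using assms(1) VY_factor by force
  then have "VY * W = VY * (f * V')" using V by (simp only: mult.left_commute)
  moreover have "VY \<noteq> 0" by (simp add: VY_def)
  ultimately show ?thesis by (metis mult_left_cancel dvd_triv_left)
qed

lemma unit_dvd_cancel: assumes "(u :: ser2) * w = 1" "f dvd u * W" shows "f dvd W"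
proof -
  have "w * (u * W) = (u * w) * W" by (simp only: mult_ac)
  then have "w * (u * W) = W" unfolding assms(1) by simp
  then show ?thesis using dvd_mult[OF assms(2), of w] by metis
qed

text \<open>A linear factor of \<open>\<Delta>\<close> expands to a unit if it does not vanish at q,
  and to a nonzero constant times Y if it does. Both can be cancelled.\<close>

lemma loc_form_cancel:
  assumes "q\<^sub>1 * e\<^sub>2 \<noteq> q\<^sub>2 * e\<^sub>1" "Hom n [:\<Delta>:]" "\<Delta> \<noteq> 0" "fps_nth f 0 \<noteq> 0"
    "f dvd loc q\<^sub>1 q\<^sub>2 q\<^sub>3 e\<^sub>1 e\<^sub>2 [:\<Delta>:] * W"
  shows "f dvd W"
  using assms(2,3,5)
proof (induction n arbitrary: \<Delta>)
  case 0
  obtain c where "\<Delta> = [:[:c:]:]" using Hom0_const[OF 0(1)] by blast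
  then have c: "[:\<Delta>:] = emb c" by (simp add: emb_def)
  then have "c \<noteq> 0" using 0(2) by (auto simp: emb_def)
  moreover have "f dvd kap c * W" using 0(3) unfolding c loc_gen .
  ultimately show ?case using unit_dvd_cancel[OF kap_unit] by blast
next
  case (Suc n)
  obtain u v \<gamma> where f: "(u, v) \<noteq> (0, 0)" "\<Delta> = lin u v * \<gamma>" "Hom n [:\<gamma>:]" "\<gamma> \<noteq> 0"
    using binary_form_factor[OF Suc.prems(1,2)] by blast
  have "[:\<Delta>:] = [:lin u v:] * [:\<gamma>:]" using f(2) by (simp add: mult.commute)
  then have d: "f dvd loc q\<^sub>1 q\<^sub>2 q\<^sub>3 e\<^sub>1 e\<^sub>2 [:lin u v:] * (loc q\<^sub>1 q\<^sub>2 q\<^sub>3 e\<^sub>1 e\<^sub>2 [:\<gamma>:] * W)"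
    using Suc.prems(3) by (simp only: loc_hom mult.assoc)
  have "f dvd loc q\<^sub>1 q\<^sub>2 q\<^sub>3 e\<^sub>1 e\<^sub>2 [:\<gamma>:] * W"
  proof (cases "v * q\<^sub>1 - u * q\<^sub>2 = 0")
    case True
    \<comment> \<open>A nonzero linear form cannot vanish on the independent vectors
      (\<open>q\<^sub>1\<close>, \<open>q\<^sub>2\<close>) and (\<open>e\<^sub>1\<close>,
      \<open>e\<^sub>2\<close>) at once.\<close>
    have "v * e\<^sub>1 - u * e\<^sub>2 \<noteq> 0"
    proof
      assume z: "v * e\<^sub>1 - u * e\<^sub>2 = 0"
      have "v * (q\<^sub>1 * e\<^sub>2 - q\<^sub>2 * e\<^sub>1) = (v * q\<^sub>1 - u * q\<^sub>2) * e\<^sub>2 - q\<^sub>2 * (v * e\<^sub>1 - u * e\<^sub>2)" by (simp add: algebra_simps)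
      moreover have "u * (q\<^sub>1 * e\<^sub>2 - q\<^sub>2 * e\<^sub>1) = (v * q\<^sub>1 - u * q\<^sub>2) * e\<^sub>1 - q\<^sub>1 * (v * e\<^sub>1 - u * e\<^sub>2)" by (simp add: algebra_simps)
      ultimately show False using z True assms(1) f(1) by auto
    qed
    note k = kap_unit[OF this]
    have "f dvd kap (v * e\<^sub>1 - u * e\<^sub>2) * (VY * (loc q\<^sub>1 q\<^sub>2 q\<^sub>3 e\<^sub>1 e\<^sub>2 [:\<gamma>:] * W))"
      using d unfolding loc_lin True by (simp add: kap_hom mult_ac)
    from VY_cancel[OF assms(4) unit_dvd_cancel[OF k this]] show ?thesis .
  next
    case False
    then have "fps_nth (fps_nth (loc q\<^sub>1 q\<^sub>2 q\<^sub>3 e\<^sub>1 e\<^sub>2 [:lin u v:]) 0) 0 \<noteq> 0"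
      unfolding loc_lin by (simp add: kap_def VY_def)
    then show ?thesis using unit2I unit_dvd_cancel[OF _ d] by blast
  qed
  then show ?case by (rule Suc.IH[OF f(3,4)])
qed

text \<open>Divisibility in \<complex>[z] is decided at the roots of the divisor. A common root is
  removed from \<open>f\<close> and \<open>B\<close>; its linear factor can be cancelled from the
  expansions at every remaining root, because power series form a domain.\<close>

lemma poly_dvd_of_local:
  assumes "\<And>r. poly f r = 0 \<Longrightarrow> fps_of_poly (pcompose f [:r, 1:]) dvd fps_of_poly (pcompose B [:r, 1::complex:])" "f \<noteq> 0"
  shows "f dvd B"
  using assms
proof (induction "degree f" arbitrary: f B)
  case 0
  then obtain c where "f = [:c:]" by (metis degree_eq_zeroE)
  then have "1 = f * [:1 / c:]" using 0 by (simp add: one_pCons)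
  then show ?case by (metis dvdI unit_imp_dvd)
next
  case (Suc n)
  then obtain r where r: "poly f r = 0"
    using Fundamental_Theorem_Algebra.fundamental_theorem_of_algebra[of f] constant_degree[of f] by auto
  have d: "fps_of_poly (pcompose f [:r, 1:]) dvd fps_of_poly (pcompose B [:r, 1:])" by (rule Suc.prems(1)[OF r])
  have n0: "fps_nth (fps_of_poly (pcompose g [:r, 1:])) 0 = poly g r" for g
    by (simp add: poly_0_coeff_0[symmetric] poly_pcompose)
  have "poly B r = 0" using dvd_nth0[OF d] r by (simp add: n0 del: fps_of_poly_nth)
  then obtain B' where B': "B = [:- r, 1:] * B'" unfolding poly_eq_0_iff_dvd by (elim dvdE)
  obtain f' where f': "f = [:- r, 1:] * f'" using r unfolding poly_eq_0_iff_dvd by (elim dvdE)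
  have f0: "f' \<noteq> 0" using Suc.prems(2) f' by auto
  have "degree f = Suc (degree f')" unfolding f' by (subst degree_mult_eq) (use f0 in auto)
  then have "n = degree f'" using Suc.hyps(2) by simp
  have "f' dvd B'"
  proof (rule Suc.hyps(1)[OF \<open>n = degree f'\<close> _ f0])
    fix s assume "poly f' s = 0"
    then have "poly f s = 0" by (simp add: f')
    from Suc.prems(1)[OF this] show "fps_of_poly (pcompose f' [:s, 1:]) dvd fps_of_poly (pcompose B' [:s, 1:])"
      unfolding f' B' by (simp add: pcompose_mult fps_of_poly_mult pcompose_pCons dvd_mult_cancel_left del: mult_pCons_left)
  qed
  then show ?case unfolding f' B' by (rule mult_dvd_mono[OF dvd_refl])
qed

lemma hpart_mult': assumes "Hom d F" shows "\<exists>a'. (\<exists>i. Hom i a') \<and> hpart n (a * F) = a' * F \<and> degree a' \<le> degree a \<and> (a = 0 \<longrightarrow> a' = 0)"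
proof (cases "d \<le> n")
  case True
  then show ?thesis using hpart_mult[OF assms, of "n - d" a] Hom_hpart degree_hpart_le
    by (intro exI[of _ "hpart (n - d) a"]) (auto simp: hpart_def Phi_hom)
next
  case False
  then show ?thesis using hpart_mult_less[OF assms, of n a] Hom_0 by (intro exI[of _ 0]) auto
qed

lemma degree_lz_le: "degree (lz a b F) \<le> degree F"
  by (rule degree_le) (simp add: coeff_lz coeff_eq_0 eval2_arith)

lemma degree_lz: assumes "monz F" shows "degree (lz a b F) = degree F" "lz a b F \<noteq> 0"
proof -
  obtain c where c: "c \<noteq> 0" "lead_coeff F = [:[:c:]:]" using assms by (auto simp: monz_def)
  then have *: "coeff (lz a b F) (degree F) \<noteq> 0" by (simp add: coeff_lz eval2_const)
  then show "lz a b F \<noteq> 0" by auto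
  have "degree (lz a b F) \<le> degree F" by (rule degree_lz_le)
  then show "degree (lz a b F) = degree F" using * le_degree by (metis antisym)
qed

text \<open>
  Write \<open>l K = A F + r F\<^sub>z\<close> with \<open>r\<close> of degree less than \<open>d\<close> in \<open>z\<close>.  On the line \<open>l = 0\<close> the local hypotheses force \<open>F\<close> to
  divide \<open>r\<close>, hence \<open>r\<close> and then \<open>A\<close> vanish there, and \<open>l\<close> can be cancelled.
\<close>

lemma polar_ideal_step:
  assumes F: "Hom d F" "monz F" and K: "Hom k K" and q: "(q\<^sub>1, q\<^sub>2) \<noteq> (0, 0)" and e: "q\<^sub>1 * e\<^sub>2 \<noteq> q\<^sub>2 * e\<^sub>1"
    and D: "Hom n [:\<Delta>:]" "\<Delta> \<noteq> 0" "[:\<Delta>:] \<in> ideal2 F (dz3 F)"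
    and l: "[:lin q\<^sub>1 q\<^sub>2:] * K \<in> ideal2 F (dz3 F)"
    and local: "\<And>q\<^sub>3. eval3 F (vector [q\<^sub>1, q\<^sub>2, q\<^sub>3]) = 0 \<Longrightarrow>
      loc q\<^sub>1 q\<^sub>2 q\<^sub>3 e\<^sub>1 e\<^sub>2 K \<in> ideal2 (loc q\<^sub>1 q\<^sub>2 q\<^sub>3 e\<^sub>1 e\<^sub>2 F) (loc q\<^sub>1 q\<^sub>2 q\<^sub>3 e\<^sub>1 e\<^sub>2 (dz3 F))"
  shows "K \<in> ideal2 F (dz3 F)"
proof -
  let ?l = "[:lin q\<^sub>1 q\<^sub>2:]"
  obtain a b where ab: "?l * K = a * F + b * dz3 F" using l by (auto simp: ideal2_def)
  obtain s r where sr: "b = F * s + r" "r = 0 \<or> degree r < degree F" using monz_division[OF F(2)] by blast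
  have e1: "?l * K = (a + s * dz3 F) * F + r * dz3 F" unfolding ab sr(1) by (simp add: algebra_simps)
  \<comment> \<open>Homogeneous parts turn both coefficients into forms, which is needed to divide
    them by the linear form at the end, and they do not raise the degree of
    \<open>r\<close>.\<close>
  obtain A where A: "\<exists>i. Hom i A" "hpart (1 + k) ((a + s * dz3 F) * F) = A * F" using hpart_mult'[OF F(1)] by blast
  obtain B where B: "\<exists>i. Hom i B" "hpart (1 + k) (r * dz3 F) = B * dz3 F" "degree B \<le> degree r" "r = 0 \<longrightarrow> B = 0"
    using hpart_mult'[OF Hom_d3(3)[OF F(1)]] by blast
  have "hpart (1 + k) (?l * K) = ?l * K" by (rule hpart_Hom[OF Hom_mult[OF Hom_lin K]])
  then have e2: "?l * K = A * F + B * dz3 F" unfolding e1 hpart_add A(2) B(2) by (rule sym)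
  have dB: "B = 0 \<or> degree B < degree F" using sr(2) B(3,4) by linarith
  have "lz q\<^sub>1 q\<^sub>2 F dvd lz q\<^sub>1 q\<^sub>2 B"
  proof (rule poly_dvd_of_local[OF _ degree_lz(2)[OF F(2)]])
    fix q\<^sub>3 assume z: "poly (lz q\<^sub>1 q\<^sub>2 F) q\<^sub>3 = 0"
    define L where "L = loc q\<^sub>1 q\<^sub>2 q\<^sub>3 e\<^sub>1 e\<^sub>2"
    have Lh: "L (u + v) = L u + L v" "L (u * v) = L u * L v" for u v by (simp_all add: L_def loc_hom)
    obtain a' b' where loc: "L K = a' * L F + b' * L (dz3 F)"
      using local[of q\<^sub>3] z by (auto simp: poly_lz ideal2_def L_def)
    obtain u v where uv: "[:\<Delta>:] = u * F + v * dz3 F" using D(3) by (auto simp: ideal2_def)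
    have f0: "fps_nth (L F) 0 \<noteq> 0"
      using degree_lz(2)[OF F(2)] by (simp add: L_def loc_nth0 pcompose_eq_0_iff)
    obtain \<delta> where Ll: "L ?l = VY * \<delta>" by (rule that[of "kap (q\<^sub>2 * e\<^sub>1 - q\<^sub>1 * e\<^sub>2)"]) (simp add: L_def loc_lin mult.commute kap_hom(4))
    \<comment> \<open>The local relation for \<open>K\<close>, multiplied by the expansion of the
      linear form, is subtracted from the global one. The coefficient \<open>W\<close> agrees with
      \<open>L B\<close> on Y = 0, and \<open>L F\<close> divides \<open>W * L (dz3 F)\<close>,
      hence also \<open>L [:\<Delta>:] * W\<close>.\<close>
    define W where "W = L B - VY * \<delta> * b'"
    have "L F dvd W * L (dz3 F)"
    proof
      have "L A * L F + L B * L (dz3 F) = VY * \<delta> * (a' * L F + b' * L (dz3 F))"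
        using arg_cong[OF e2, of L] unfolding Lh Ll loc by simp
      then show "W * L (dz3 F) = L F * (VY * \<delta> * a' - L A)" unfolding W_def by (simp add: algebra_simps)
    qed
    moreover have "L [:\<Delta>:] * W = L F * (L u * W) + L v * (W * L (dz3 F))" unfolding uv Lh by (simp add: algebra_simps)
    ultimately have "L F dvd L [:\<Delta>:] * W" by (simp only: dvd_add dvd_mult dvd_triv_left)
    then have "L F dvd W" unfolding L_def using loc_form_cancel[OF e D(1,2) f0[unfolded L_def]] by blast
    then have "fps_nth (L F) 0 dvd fps_nth W 0" by (rule dvd_nth0)
    moreover have "fps_nth W 0 = fps_nth (L B) 0" by (simp add: W_def VY_def)
    ultimately show "fps_of_poly (pcompose (lz q\<^sub>1 q\<^sub>2 F) [:q\<^sub>3, 1:]) dvd fps_of_poly (pcompose (lz q\<^sub>1 q\<^sub>2 B) [:q\<^sub>3, 1:])"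
      by (simp add: L_def loc_nth0)
  qed
  moreover have "lz q\<^sub>1 q\<^sub>2 B = 0 \<or> degree (lz q\<^sub>1 q\<^sub>2 B) < degree (lz q\<^sub>1 q\<^sub>2 F)"
    using dB degree_lz_le[of q\<^sub>1 q\<^sub>2 B] unfolding degree_lz(1)[OF F(2)] by (auto simp: lz_hom)
  ultimately have B0: "lz q\<^sub>1 q\<^sub>2 B = 0" by (meson dvd_imp_degree_le not_le)
  obtain i j where ij: "Hom i A" "Hom j B" using A B by blast
  obtain B' where B': "B = ?l * B'" using clin_dvd_Hom[OF q ij(2) B0] by (elim dvdE)
  have ll: "lz q\<^sub>1 q\<^sub>2 ?l = 0" by (simp add: lz_def map_poly_pCons eval2_lin eval2_arith)
  have "lz q\<^sub>1 q\<^sub>2 A * lz q\<^sub>1 q\<^sub>2 F = 0"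
    using arg_cong[OF e2, of "lz q\<^sub>1 q\<^sub>2"] unfolding lz_hom ll B0 by (metis add.right_neutral mult_zero_left)
  then have "lz q\<^sub>1 q\<^sub>2 A = 0" using degree_lz(2)[OF F(2)] by simp
  then obtain A' where A': "A = ?l * A'" using clin_dvd_Hom[OF q ij(1)] by (auto elim: dvdE)
  have "?l * K = ?l * (A' * F + B' * dz3 F)" unfolding e2 A' B' by (simp only: distrib_left mult.assoc)
  moreover have "?l \<noteq> 0" using lin_nz[OF q] by simp
  ultimately have "K = A' * F + B' * dz3 F" by (subst (asm) mult_left_cancel)
  then show ?thesis by (rule ideal2I)
qed

text \<open>The multiple \<open>[:\<Delta>:] * K\<close> lies in the ideal, and
  \<open>polar_ideal_step\<close> removes the linear factors of \<open>\<Delta>\<close> one after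
  the other. The local hypothesis passes to multiples of \<open>K\<close>, so it is available at
  each stage.\<close>

theorem polar_ideal_of_local:
  assumes F: "Hom d F" "monz F" "squarefree F" and K: "Hom k K"
    and local: "\<And>q\<^sub>1 q\<^sub>2. (q\<^sub>1, q\<^sub>2) \<noteq> (0, 0) \<Longrightarrow> \<exists>e\<^sub>1 e\<^sub>2. q\<^sub>1 * e\<^sub>2 \<noteq> q\<^sub>2 * e\<^sub>1 \<and> (\<forall>q\<^sub>3. eval3 F (vector [q\<^sub>1, q\<^sub>2, q\<^sub>3]) = 0 \<longrightarrow>
      loc q\<^sub>1 q\<^sub>2 q\<^sub>3 e\<^sub>1 e\<^sub>2 K \<in> ideal2 (loc q\<^sub>1 q\<^sub>2 q\<^sub>3 e\<^sub>1 e\<^sub>2 F) (loc q\<^sub>1 q\<^sub>2 q\<^sub>3 e\<^sub>1 e\<^sub>2 (dz3 F)))"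
  shows "K \<in> ideal2 F (dz3 F)"
proof -
  obtain \<Delta> n where D: "Hom n [:\<Delta>:]" "\<Delta> \<noteq> 0" "[:\<Delta>:] \<in> ideal2 F (dz3 F)"
    using discriminant_or_not_squarefree[OF F(1,2)] F(3) by blast
  have "K \<in> ideal2 F (dz3 F)" if "Hom m [:\<gamma>:]" "\<gamma> \<noteq> 0" "[:\<gamma>:] * K \<in> ideal2 F (dz3 F)" for m \<gamma>
    using that
  proof (induction m arbitrary: \<gamma>)
    case 0
    obtain c where "\<gamma> = [:[:c:]:]" using Hom0_const[OF 0(1)] by blast
    then have c: "[:\<gamma>:] = emb c" by (simp add: emb_def)
    then have "c \<noteq> 0" using 0(2) by (auto simp: emb_def)
    then have 1: "emb (1 / c) * emb c = 1" using rhomD(1)[OF rhom_emb] rhomD(3)[OF rhom_emb, of "1 / c" c] by simp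
    have "emb (1 / c) * ([:\<gamma>:] * K) = K" unfolding c mult.assoc[symmetric] 1 by simp
    then show ?case using ideal2_mult[OF 0(3), of "emb (1 / c)"] by simp
  next
    case (Suc m)
    obtain u v \<gamma>' where f: "(u, v) \<noteq> (0, 0)" "\<gamma> = lin u v * \<gamma>'" "Hom m [:\<gamma>':]" "\<gamma>' \<noteq> 0"
      using binary_form_factor[OF Suc.prems(1,2)] by blast
    obtain e\<^sub>1 e\<^sub>2 where e: "u * e\<^sub>2 \<noteq> v * e\<^sub>1" "\<And>q\<^sub>3. eval3 F (vector [u, v, q\<^sub>3]) = 0 \<Longrightarrow>
      loc u v q\<^sub>3 e\<^sub>1 e\<^sub>2 K \<in> ideal2 (loc u v q\<^sub>3 e\<^sub>1 e\<^sub>2 F) (loc u v q\<^sub>3 e\<^sub>1 e\<^sub>2 (dz3 F))"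
      using local[OF f(1)] by blast
    have "[:lin u v:] * ([:\<gamma>':] * K) \<in> ideal2 F (dz3 F)" using Suc.prems(3) f(2) by (simp add: mult.commute)
    then have "[:\<gamma>':] * K \<in> ideal2 F (dz3 F)"
      by (rule polar_ideal_step[OF F(1,2) Hom_mult[OF f(3) K] f(1) e(1) D])
        (simp only: loc_hom, rule ideal2_mult, rule e(2))
    then show ?case by (rule Suc.IH[OF f(3,4)])
  qed
  moreover have "[:\<Delta>:] * K \<in> ideal2 F (dz3 F)" using ideal2_mult[OF D(3), of K] by (simp only: mult.commute)
  ultimately show ?thesis using D by blast
qed

section \<open>Logarithmic derivations\<close>

lemma D0_iff: "\<theta> \<in> D\<^sub>0 G \<longleftrightarrow> \<theta> $ 1 * dx3 G + \<theta> $ 2 * dy3 G + \<theta> $ 3 * dz3 G = 0"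
  by (simp add: D\<^sub>0_def)

text \<open>A homogeneous basis of two elements, written with explicit coefficients instead of spans
  so that it can be transported along a linear change of coordinates.\<close>

definition log_basis :: "poly3 \<Rightarrow> poly3 ^ 3 \<Rightarrow> poly3 ^ 3 \<Rightarrow> bool" where
  "log_basis G \<theta>\<^sub>1 \<theta>\<^sub>2 \<longleftrightarrow> (\<exists>d. \<forall>i. Hom d (\<theta>\<^sub>1 $ i)) \<and> (\<exists>d. \<forall>i. Hom d (\<theta>\<^sub>2 $ i)) \<and>
     \<theta>\<^sub>1 \<in> D\<^sub>0 G \<and> \<theta>\<^sub>2 \<in> D\<^sub>0 G \<and> (\<forall>\<theta>\<in>D\<^sub>0 G. \<exists>a b. \<theta> = a *s \<theta>\<^sub>1 + b *s \<theta>\<^sub>2) \<and>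
     (\<forall>a b. a *s \<theta>\<^sub>1 + b *s \<theta>\<^sub>2 = 0 \<longrightarrow> a = 0 \<and> b = 0)"

lemma log_basisD: assumes "log_basis G \<theta>\<^sub>1 \<theta>\<^sub>2"
  shows "\<exists>d. \<forall>i. Hom d (\<theta>\<^sub>1 $ i)" "\<exists>d. \<forall>i. Hom d (\<theta>\<^sub>2 $ i)"
     "\<theta>\<^sub>1 \<in> D\<^sub>0 G" "\<theta>\<^sub>2 \<in> D\<^sub>0 G" "\<And>\<theta>. \<theta> \<in> D\<^sub>0 G \<Longrightarrow> \<exists>a b. \<theta> = a *s \<theta>\<^sub>1 + b *s \<theta>\<^sub>2"
     "\<And>a b. a *s \<theta>\<^sub>1 + b *s \<theta>\<^sub>2 = 0 \<Longrightarrow> a = 0 \<and> b = 0"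
  using assms unfolding log_basis_def by blast+

definition free2 :: "poly3 \<Rightarrow> bool" where "free2 G \<longleftrightarrow> (\<exists>\<theta>\<^sub>1 \<theta>\<^sub>2. log_basis G \<theta>\<^sub>1 \<theta>\<^sub>2)"

lemma free2_free_curve: assumes "free2 G" shows "free_curve G"
proof -
  interpret module "(*s) :: poly3 \<Rightarrow> poly3 ^ 3 \<Rightarrow> poly3 ^ 3" by (rule module_poly3)
  obtain \<theta>\<^sub>1 \<theta>\<^sub>2 where "log_basis G \<theta>\<^sub>1 \<theta>\<^sub>2" using assms by (auto simp: free2_def)
  note h = log_basisD[OF this]
  have ne: "\<theta>\<^sub>1 \<noteq> \<theta>\<^sub>2"
  proof
    assume "\<theta>\<^sub>1 = \<theta>\<^sub>2"
    then have "1 *s \<theta>\<^sub>1 + (- 1) *s \<theta>\<^sub>2 = 0" by (simp add: vec_eq_iff)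
    then show False using h(6) by fastforce
  qed
  have "\<not> dependent {\<theta>\<^sub>1, \<theta>\<^sub>2}"
    using ne h(6) by (auto simp: dependent_finite)
  moreover have "span {\<theta>\<^sub>1, \<theta>\<^sub>2} = D\<^sub>0 G"
  proof
    show "D\<^sub>0 G \<subseteq> span {\<theta>\<^sub>1, \<theta>\<^sub>2}"
      using h(5) by (fastforce intro: span_add span_scale span_base)
    have "subspace (D\<^sub>0 G)"
      unfolding subspace_def D0_iff
    proof (intro conjI allI impI ballI)
      fix x y :: "poly3 ^ 3" and c :: poly3
      assume x: "x \<in> D\<^sub>0 G" and y: "y \<in> D\<^sub>0 G"
      have "(x + y) $ 1 * dx3 G + (x + y) $ 2 * dy3 G + (x + y) $ 3 * dz3 G =
        (x $ 1 * dx3 G + x $ 2 * dy3 G + x $ 3 * dz3 G) + (y $ 1 * dx3 G + y $ 2 * dy3 G + y $ 3 * dz3 G)"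
        by (simp add: algebra_simps)
      then show "(x + y) $ 1 * dx3 G + (x + y) $ 2 * dy3 G + (x + y) $ 3 * dz3 G = 0"
        using x y by (simp add: D0_iff)
    next
      fix x :: "poly3 ^ 3" and c :: poly3
      assume x: "x \<in> D\<^sub>0 G"
      have "(c *s x) $ 1 * dx3 G + (c *s x) $ 2 * dy3 G + (c *s x) $ 3 * dz3 G =
        c * (x $ 1 * dx3 G + x $ 2 * dy3 G + x $ 3 * dz3 G)" by (simp add: algebra_simps)
      then show "(c *s x) $ 1 * dx3 G + (c *s x) $ 2 * dy3 G + (c *s x) $ 3 * dz3 G = 0"
        using x by (simp add: D0_iff)
    qed simp
    then show "span {\<theta>\<^sub>1, \<theta>\<^sub>2} \<subseteq> D\<^sub>0 G" using h(3,4) by (intro span_minimal) auto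
  qed
  ultimately show ?thesis unfolding free_curve_def Hom_iff_homogeneous3[symmetric]
    using h(1,2) by (intro exI[of _ "{\<theta>\<^sub>1, \<theta>\<^sub>2}"]) auto
qed

section \<open>Linear changes of coordinates\<close>

definition lform :: "complex ^ 3 \<Rightarrow> poly3" where
  "lform a = emb (a $ 1) * PX + emb (a $ 2) * PY + emb (a $ 3) * PZ"

definition lsub :: "complex ^ 3 ^ 3 \<Rightarrow> poly3 \<Rightarrow> poly3" where
  "lsub T = ev3 emb (lform (T $ 1)) (lform (T $ 2)) (lform (T $ 3))"

lemma rhom_lsub: "rhom (lsub T)" unfolding lsub_def by (rule rhom_ev3[OF rhom_emb])

lemmas lsub_hom = rhomD[OF rhom_lsub]

lemma lsub_gen: "lsub T (emb c) = emb c" "lsub T PX = lform (T $ 1)" "lsub T PY = lform (T $ 2)" "lsub T PZ = lform (T $ 3)"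
  by (simp_all add: lsub_def ev3_gen[OF rhom_emb])

lemma eval3_lform: "eval3 (lform a) v = (\<Sum>i\<in>UNIV. a $ i * v $ i)"
  by (simp add: lform_def eval3_hom eval3_gen sum_3)

lemma eval3_lsub: "eval3 (lsub T F) v = eval3 F (T *v v)"
  by (rule rhom_poly3_unique[OF rhom_comp[OF rhom_eval3 rhom_lsub] rhom_eval3])
    (simp_all add: lsub_gen eval3_gen eval3_lform matrix_vector_mult_def)

lemma lsub_lsub: "lsub S (lsub T F) = lsub (T ** S) F"
  by (rule eval3_ext) (simp add: eval3_lsub matrix_vector_mul_assoc)

lemma lsub_mat1: "lsub (mat 1) F = F"
  by (rule eval3_ext) (simp add: eval3_lsub)

lemma Hom_lsub: "Hom d F \<Longrightarrow> Hom d (lsub T F)"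
  unfolding Hom_iff_eval eval3_lsub by (metis vector_scalar_commute)

definition grad :: "poly3 \<Rightarrow> poly3 ^ 3" where "grad G = vector [dx3 G, dy3 G, dz3 G]"

lemma grad_nth: "grad G $ 1 = dx3 G" "grad G $ 2 = dy3 G" "grad G $ 3 = dz3 G"
  by (simp_all add: grad_def)

lemma D0_grad: "\<theta> \<in> D\<^sub>0 G \<longleftrightarrow> (\<Sum>i\<in>UNIV. \<theta> $ i * grad G $ i) = 0"
  by (simp add: D0_iff sum_3 grad_nth)

lemma grad_lsub: "grad (lsub T G) $ j = (\<Sum>i\<in>UNIV. emb (T $ i $ j) * lsub T (grad G $ i))"
proof -
  have l: "dx3 (lform a) = emb (a $ 1)" "dy3 (lform a) = emb (a $ 2)" "dz3 (lform a) = emb (a $ 3)" for a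
    by (simp_all add: lform_def dx3_der dy3_der dz3_der)
  have c: "D (lsub T G) = lsub T (dx3 G) * D (lform (T $ 1)) + lsub T (dy3 G) * D (lform (T $ 2)) + lsub T (dz3 G) * D (lform (T $ 3))"
    if "der D" "\<And>c. D (emb c) = 0" for D
    unfolding lsub_def by (rule ev3_chain[OF rhom_emb that])
  have "\<forall>j. grad (lsub T G) $ j = (\<Sum>i\<in>UNIV. emb (T $ i $ j) * lsub T (grad G $ i))"
    unfolding forall_3 grad_nth sum_3
    by (simp add: c[OF der_d3(1)] c[OF der_d3(2)] c[OF der_d3(3)] l mult.commute)
  then show ?thesis by blast
qed

text \<open>The push-forward of a vector field by \<open>T\<close> when \<open>S\<close> is the
  inverse of \<open>T\<close>: the matrix \<open>T\<close> acts on the components and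
  \<open>S\<close> on the arguments.\<close>

definition dsub :: "complex ^ 3 ^ 3 \<Rightarrow> complex ^ 3 ^ 3 \<Rightarrow> poly3 ^ 3 \<Rightarrow> poly3 ^ 3" where
  "dsub T S \<theta> = (\<chi> i. lsub S (\<Sum>j\<in>UNIV. emb (T $ i $ j) * \<theta> $ j))"

lemma lsub_sum: "lsub S (\<Sum>i\<in>A. f i) = (\<Sum>i\<in>A. lsub S (f i))"
  by (induction A rule: infinite_finite_induct) (simp_all add: lsub_hom)

text \<open>By the chain rule the gradient of G composed with \<open>T\<close> is the transpose of
  \<open>T\<close> applied to the gradient of G; in the pairing the transpose moves over to the
  vector field.\<close>

lemma dsub_D0: assumes "T ** S = mat 1" "\<theta> \<in> D\<^sub>0 (lsub T G)" shows "dsub T S \<theta> \<in> D\<^sub>0 G"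
proof -
  have i: "lsub S (lsub T H) = H" for H by (simp add: lsub_lsub assms(1) lsub_mat1)
  have "(\<Sum>i\<in>UNIV. dsub T S \<theta> $ i * grad G $ i) = lsub S (\<Sum>i\<in>UNIV. (\<Sum>j\<in>UNIV. emb (T $ i $ j) * \<theta> $ j) * lsub T (grad G $ i))"
    by (simp add: dsub_def lsub_hom lsub_sum i)
  also have "(\<Sum>i\<in>UNIV. (\<Sum>j\<in>UNIV. emb (T $ i $ j) * \<theta> $ j) * lsub T (grad G $ i))
      = (\<Sum>j\<in>UNIV. \<theta> $ j * grad (lsub T G) $ j)"
    unfolding grad_lsub sum_distrib_left sum_distrib_right
    by (subst sum.swap) (simp add: mult_ac)
  also have "\<dots> = 0" using assms(2) by (simp add: D0_grad)
  finally show ?thesis by (simp add: D0_grad lsub_hom)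
qed

lemma emb_sum: "emb (\<Sum>i\<in>A. f i) = (\<Sum>i\<in>A. emb (f i))"
  by (induction A rule: infinite_finite_induct) (simp_all add: rhomD[OF rhom_emb])

lemma dsub_dsub: assumes "T ** S = mat 1" shows "dsub T S (dsub S T \<theta>) = \<theta>"
proof -
  have i: "lsub S (lsub T H) = H" for H by (simp add: lsub_lsub assms(1) lsub_mat1)
  have t: "(\<Sum>k\<in>UNIV. T $ i $ k * S $ k $ j) = (if i = j then 1 else 0)" for i j
    using assms by (simp add: matrix_matrix_mult_def mat_def vec_eq_iff)
  have "dsub T S (dsub S T \<theta>) $ i = \<theta> $ i" for i
  proof -
    have "dsub T S (dsub S T \<theta>) $ i = (\<Sum>k\<in>UNIV. \<Sum>j\<in>UNIV. emb (T $ i $ k * S $ k $ j) * \<theta> $ j)"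
      by (simp add: dsub_def lsub_hom lsub_sum lsub_gen i rhomD[OF rhom_emb] sum_distrib_left mult.assoc)
    also have "\<dots> = (\<Sum>j\<in>UNIV. emb (\<Sum>k\<in>UNIV. T $ i $ k * S $ k $ j) * \<theta> $ j)"
      by (subst sum.swap) (simp add: emb_sum sum_distrib_right)
    also have "\<dots> = (\<Sum>j\<in>UNIV. if j = i then \<theta> $ j else 0)"
      unfolding t by (rule sum.cong) (auto simp: rhomD[OF rhom_emb])
    finally show ?thesis by simp
  qed
  then show ?thesis by (simp add: vec_eq_iff)
qed

lemma dsub_lin: "dsub T S (a *s \<theta> + b *s \<theta>') = lsub S a *s dsub T S \<theta> + lsub S b *s dsub T S \<theta>'"
  unfolding vec_eq_iff
proof
  fix i
  have "(\<Sum>j\<in>UNIV. emb (T $ i $ j) * (a *s \<theta> + b *s \<theta>') $ j) =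
     a * (\<Sum>j\<in>UNIV. emb (T $ i $ j) * \<theta> $ j) + b * (\<Sum>j\<in>UNIV. emb (T $ i $ j) * \<theta>' $ j)"
    by (simp add: sum_distrib_left sum.distrib[symmetric] distrib_left mult.left_commute)
  then show "dsub T S (a *s \<theta> + b *s \<theta>') $ i = (lsub S a *s dsub T S \<theta> + lsub S b *s dsub T S \<theta>') $ i"
    by (simp only: dsub_def vec_lambda_beta vector_add_component vector_smult_component lsub_hom)
qed

lemma Hom_sum: "(\<And>i. i \<in> A \<Longrightarrow> Hom d (f i)) \<Longrightarrow> Hom d (sum f A)"
  by (induction A rule: infinite_finite_induct) (auto simp: Hom_0 Hom_add)

lemma Hom_dsub: assumes "\<And>i. Hom d (\<theta> $ i)" shows "Hom d (dsub T S \<theta> $ i)"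
proof -
  have "Hom d (emb (T $ i $ j) * \<theta> $ j)" for j using Hom_mult[OF Hom_emb assms] by simp
  then show ?thesis by (simp add: dsub_def Hom_lsub Hom_sum)
qed

lemma free2_lsub: assumes TS: "T ** S = mat 1" "S ** T = mat 1" and f: "free2 (lsub T G)" shows "free2 G"
proof -
  obtain \<theta>\<^sub>1 \<theta>\<^sub>2 where "log_basis (lsub T G) \<theta>\<^sub>1 \<theta>\<^sub>2" using f by (auto simp: free2_def)
  note h = log_basisD[OF this]
  have G: "lsub S (lsub T G) = G" by (simp add: lsub_lsub TS(1) lsub_mat1)
  have i: "lsub S (lsub T H) = H" "lsub T (lsub S H) = H" for H by (simp_all add: lsub_lsub TS lsub_mat1)
  show ?thesis unfolding free2_def log_basis_def
  proof (rule exI[of _ "dsub T S \<theta>\<^sub>1"], rule exI[of _ "dsub T S \<theta>\<^sub>2"], intro conjI ballI allI impI)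
    show "\<exists>d. \<forall>i. Hom d (dsub T S \<theta>\<^sub>1 $ i)" "\<exists>d. \<forall>i. Hom d (dsub T S \<theta>\<^sub>2 $ i)"
      using h(1,2) Hom_dsub by meson+
    show "dsub T S \<theta>\<^sub>1 \<in> D\<^sub>0 G" "dsub T S \<theta>\<^sub>2 \<in> D\<^sub>0 G" using dsub_D0[OF TS(1)] h(3,4) by auto
  next
    fix \<theta> assume "\<theta> \<in> D\<^sub>0 G"
    then have "dsub S T \<theta> \<in> D\<^sub>0 (lsub T G)" using dsub_D0[OF TS(2)] G by simp
    then obtain a b where "dsub S T \<theta> = a *s \<theta>\<^sub>1 + b *s \<theta>\<^sub>2" using h(5) by blast
    then have "\<theta> = lsub S a *s dsub T S \<theta>\<^sub>1 + lsub S b *s dsub T S \<theta>\<^sub>2"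
      using dsub_dsub[OF TS(1), of \<theta>] by (simp add: dsub_lin)
    then show "\<exists>a b. \<theta> = a *s dsub T S \<theta>\<^sub>1 + b *s dsub T S \<theta>\<^sub>2" by blast
  next
    fix a b assume z: "a *s dsub T S \<theta>\<^sub>1 + b *s dsub T S \<theta>\<^sub>2 = 0"
    have "dsub S T (a *s dsub T S \<theta>\<^sub>1 + b *s dsub T S \<theta>\<^sub>2) = 0"
      unfolding z by (simp add: dsub_def vec_eq_iff lsub_hom)
    then have "lsub T a *s \<theta>\<^sub>1 + lsub T b *s \<theta>\<^sub>2 = 0" by (simp only: dsub_lin dsub_dsub[OF TS(2)])
    then have "lsub T a = 0 \<and> lsub T b = 0" by (rule h(6))
    then show "a = 0" "b = 0" using i(1)[of a] i(1)[of b] by (auto simp: lsub_hom)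
  qed
qed

section \<open>A basis for a curve with lines added\<close>

definition line_prod :: "(complex \<times> complex) set \<Rightarrow> poly2" where "line_prod S = (\<Prod>(a, b)\<in>S. lin a b)"

definition distinct_lines :: "(complex \<times> complex) set \<Rightarrow> bool" where
  "distinct_lines S \<longleftrightarrow> finite S \<and> (\<forall>s\<in>S. s \<noteq> (0, 0) \<and> (\<forall>s'\<in>S. s' \<noteq> s \<longrightarrow> fst s * snd s' \<noteq> snd s * fst s'))"

lemma distinct_linesD:
  assumes "distinct_lines S" "(a, b) \<in> S"
  shows "(a, b) \<noteq> (0, 0)" "(a', b') \<in> S \<Longrightarrow> (a', b') \<noteq> (a, b) \<Longrightarrow> b' * a \<noteq> a' * b"
proof -
  have *: "s \<noteq> (0, 0)" "s' \<in> S \<Longrightarrow> s' \<noteq> s \<Longrightarrow> fst s * snd s' \<noteq> snd s * fst s'" if "s \<in> S" for s s'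
    using assms(1) that unfolding distinct_lines_def by blast+
  show "(a, b) \<noteq> (0, 0)" by (rule *(1)[OF assms(2)])
  show "(a', b') \<in> S \<Longrightarrow> (a', b') \<noteq> (a, b) \<Longrightarrow> b' * a \<noteq> a' * b"
    using *(2)[OF assms(2), of "(a', b')"] by (simp add: mult.commute)
qed

lemma distinct_lines_subset: "distinct_lines S \<Longrightarrow> S' \<subseteq> S \<Longrightarrow> distinct_lines S'"
  unfolding distinct_lines_def using finite_subset by blast

lemma lin_not_dvd: assumes "b' * a \<noteq> a' * b" "(a, b) \<noteq> (0, 0)" shows "\<not> [:lin a b:] dvd [:lin a' b':]"
proof
  assume "[:lin a b:] dvd [:lin a' b':]"
  then have "lin a b dvd lin a' b'" by simp
  then have "poly (res a b (lin a' b')) 1 = 0" unfolding lin_dvd_iff[OF assms(2)] by simp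
  then show False using assms(1) by (simp add: poly_res eval2_lin)
qed

lemma clin_dvd_line_prod:
  assumes "finite S" "(a, b) \<noteq> (0, 0)" "\<And>a' b'. (a', b') \<in> S \<Longrightarrow> b' * a \<noteq> a' * b"
  shows "\<not> [:lin a b:] dvd [:line_prod S:]"
  using assms(1,3)
proof (induction S rule: finite_induct)
  case empty
  have "\<not> lin a b dvd 1"
  proof
    assume "lin a b dvd 1"
    then show False unfolding lin_dvd_iff[OF assms(2)] by (simp add: rhomD(1)[OF rhom_res])
  qed
  then show ?case by (simp add: line_prod_def)
next
  case (insert s S)
  obtain a' b' where s: "s = (a', b')" by (cases s)
  have "[:line_prod (insert s S):] = [:lin a' b':] * [:line_prod S:]"
    using insert.hyps by (simp add: line_prod_def s mult.commute)
  moreover have "\<not> [:lin a b:] dvd [:lin a' b':]"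
    by (rule lin_not_dvd[OF insert.prems assms(2)]) (simp add: s)
  ultimately show ?case using clin_prime[OF assms(2)] insert by (metis insertCI)
qed

text \<open>The linear forms are primes no two of which are associated, so their divisibilities
  combine.\<close>

lemma line_prod_dvd:
  assumes "distinct_lines S" "\<And>a b. (a, b) \<in> S \<Longrightarrow> [:lin a b:] dvd W"
  shows "[:line_prod S:] dvd W"
proof -
  have "finite S" using assms(1) by (simp add: distinct_lines_def)
  then show ?thesis using assms
  proof (induction S rule: finite_induct)
    case empty then show ?case by (simp add: line_prod_def flip: one_pCons)
  next
    case (insert s S)
    obtain a b where s: "s = (a, b)" by (cases s)
    have ab: "(a, b) \<noteq> (0, 0)" using distinct_linesD(1)[OF insert.prems(1)] s by auto
    have "distinct_lines S" using distinct_lines_subset[OF insert.prems(1)] by auto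
    then have "[:line_prod S:] dvd W" using insert by auto
    then obtain V where V: "W = [:line_prod S:] * V" by (elim dvdE)
    have n: "b' * a \<noteq> a' * b" if "(a', b') \<in> S" for a' b'
      using distinct_linesD(2)[OF insert.prems(1), of a b a' b'] insert.hyps(2) that s by auto
    have "[:lin a b:] dvd [:line_prod S:] * V" using insert.prems(2) V s by auto
    then have "[:lin a b:] dvd V" using clin_prime[OF ab] clin_dvd_line_prod[OF insert.hyps(1) ab n] by blast
    then obtain U where "V = [:lin a b:] * U" by (elim dvdE)
    then have "W = ([:line_prod S:] * [:lin a b:]) * U" using V by (simp only: mult.assoc)
    moreover have "[:line_prod S:] * [:lin a b:] = [:line_prod (insert s S):]" using insert.hyps by (simp add: line_prod_def s mult.commute)
    ultimately show ?case by (metis dvd_triv_left)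
  qed
qed

lemma line_prod_Hom: assumes "distinct_lines S" shows "Hom (card S) [:line_prod S:]" "line_prod S \<noteq> 0"
proof -
  have "finite S" using assms by (simp add: distinct_lines_def)
  then have "Hom (card S) [:line_prod S:] \<and> line_prod S \<noteq> 0" using assms
  proof (induction S rule: finite_induct)
    case empty then show ?case using Hom_1 by (simp add: line_prod_def flip: one_pCons)
  next
    case (insert s S)
    obtain a b where s: "s = (a, b)" by (cases s)
    have ab: "(a, b) \<noteq> (0, 0)" using distinct_linesD(1)[OF insert.prems(1)] s by auto
    have i: "Hom (card S) [:line_prod S:] \<and> line_prod S \<noteq> 0" using insert.IH distinct_lines_subset[OF insert.prems(1)] by blast
    have e: "[:line_prod (insert s S):] = [:lin a b:] * [:line_prod S:]"
      using insert.hyps by (simp add: line_prod_def s mult.commute)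
    have "Hom (1 + card S) [:line_prod (insert s S):]" unfolding e using Hom_mult[OF Hom_lin] i by blast
    moreover have "line_prod (insert s S) \<noteq> 0" using insert.hyps i lin_nz[OF ab] by (simp add: line_prod_def s)
    ultimately show ?case using insert.hyps by simp
  qed
  then show "Hom (card S) [:line_prod S:]" "line_prod S \<noteq> 0" by auto
qed

lemma monz_not_clin_dvd: assumes "monz F" shows "\<not> [:lin a b:] dvd F"
proof
  assume "[:lin a b:] dvd F"
  then obtain G where "F = [:lin a b:] * G" by (elim dvdE)
  moreover have "lz a b [:lin a b:] = 0" by (simp add: lz_def map_poly_pCons eval2_lin eval2_arith)
  ultimately have "lz a b F = 0" by (simp only: lz_hom mult_zero_left)
  then show False using degree_lz(2)[OF assms] by blast
qed

text \<open>On the line the vector (x, y) is proportional to (\<open>\<alpha>\<close>,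
  \<open>\<beta>\<close>), so the two determinants vanish there together. Multiplication by
  whichever of the two constants is nonzero makes this precise.\<close>

lemma clin_dvd_wedge:
  assumes ab: "(\<alpha>, \<beta>) \<noteq> (0, 0)" and "[:lin \<alpha> \<beta>:] dvd emb \<beta> * a - emb \<alpha> * b"
  shows "[:lin \<alpha> \<beta>:] dvd a * PY - b * PX"
proof -
  let ?l = "[:lin \<alpha> \<beta>:]"
  have 1: "emb \<alpha> * (a * PY - b * PX) = PX * (emb \<beta> * a - emb \<alpha> * b) - a * ?l"
    unfolding clin_eq by (simp add: algebra_simps)
  have 2: "emb \<beta> * (a * PY - b * PX) = PY * (emb \<beta> * a - emb \<alpha> * b) - b * ?l"
    unfolding clin_eq by (simp add: algebra_simps)
  have d: "?l dvd emb \<alpha> * (a * PY - b * PX)" "?l dvd emb \<beta> * (a * PY - b * PX)"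
    unfolding 1 2 using assms(2) by (simp_all only: dvd_diff dvd_mult dvd_refl)
  have u: "?l dvd W" if "c \<noteq> 0" "?l dvd emb c * W" for c W
  proof -
    have "emb (1 / c) * emb c = 1" using that(1) rhomD(1)[OF rhom_emb] rhomD(3)[OF rhom_emb, of "1 / c" c] by simp
    then have "emb (1 / c) * (emb c * W) = W" by (simp only: mult.assoc[symmetric] mult_1)
    then show ?thesis using dvd_mult[OF that(2), of "emb (1 / c)"] by metis
  qed
  show ?thesis using ab d u by blast
qed

lemma PX_dvd: assumes "PY * A = PX * B" shows "\<exists>u. A = PX * u \<and> B = PY * u"
proof -
  have X: "PX = [:lin 0 1:]" by (simp add: PX_def lin_def)
  have Y: "PY = [:lin (- 1) 0:]" by (simp add: PY_def lin_def one_pCons)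
  have "\<not> [:lin 0 1:] dvd PY" unfolding Y by (rule lin_not_dvd) auto
  moreover have "[:lin 0 1:] dvd PY * A" unfolding assms X[symmetric] by simp
  ultimately have "PX dvd A" using clin_prime[of 0 1] X by auto
  then obtain u where u: "A = PX * u" by (elim dvdE)
  have "PX * B = PX * (PY * u)" using assms u by (simp only: mult.left_commute)
  moreover have "PX \<noteq> 0" by (simp add: PX_def)
  ultimately show ?thesis using u by (metis mult_left_cancel)
qed

text \<open>Generation is proved by reduction. A field in \<open>D\<^sub>0\<close> is tangent to
  every line of \<open>Q\<close>, so its wedge with the radial field is divisible by
  \<open>Q\<close>, and subtracting a multiple of \<open>\<theta>\<^sub>2\<close> before its Euler
  correction makes its x,y-part radial. After removal of an Euler multiple there remains a
  z-component \<open>r\<close> such that \<open>F\<close> divides \<open>r * dz3 F\<close>; then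
  \<open>F\<close> divides \<open>r\<close>, since it is coprime to its z-derivative.\<close>

theorem free2_lines_times:
  assumes F: "Hom d F" "monz F" "squarefree F" and S: "distinct_lines S" "S \<noteq> {}"
    and K: "dx3 [:line_prod S:] * dy3 F - dy3 [:line_prod S:] * dx3 F \<in> ideal2 F (dz3 F)"
  shows "free2 ([:line_prod S:] * F)"
proof -
  define Q where "Q = [:line_prod S:]"
  define m where "m = card S"
  have fS: "finite S" using S by (simp add: distinct_lines_def)
  have m: "m \<ge> 1" using S(2) fS by (simp add: m_def Suc_le_eq card_gt_0_iff)
  have Q: "Hom m Q" "Q \<noteq> 0" using line_prod_Hom[OF S(1)] by (auto simp: Q_def m_def)
  have F0: "F \<noteq> 0" using F(2) by (auto simp: monz_def)
  \<comment> \<open>The degree of \<open>Q * F\<close>. The inverses \<open>\<epsilon>\<close> of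
    \<open>e\<close> and \<open>\<mu>\<close> of \<open>m\<close> undo the factors in the Euler
    identities of \<open>Q * F\<close> and of \<open>Q\<close>.\<close>
  define e where "e = d + m"
  have inv: "emb (1 / of_nat n) * of_nat n = 1" if "n \<ge> 1" for n
  proof -
    have "emb (1 / of_nat n) * emb (of_nat n) = 1" using that rhomD(1)[OF rhom_emb] rhomD(3)[OF rhom_emb, of "1 / of_nat n" "of_nat n"] by simp
    then show ?thesis by (simp only: rhomD(8)[OF rhom_emb])
  qed
  define \<epsilon> where "\<epsilon> = emb (1 / of_nat e)"
  have \<epsilon>: "\<epsilon> * of_nat e = 1" using inv[of e] m by (simp add: \<epsilon>_def e_def)
  define \<mu> where "\<mu> = emb (1 / of_nat m)"
  have \<mu>: "\<mu> * of_nat m = 1" using inv[OF m] by (simp add: \<mu>_def)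
  have Qz: "dz3 Q = 0" by (simp add: Q_def dz3_def pderiv_pCons)
  have EQ: "PX * dx3 Q + PY * dy3 Q = of_nat m * Q" using euler[OF Q(1)] Qz by simp
  have EF: "PX * dx3 F + PY * dy3 F + PZ * dz3 F = of_nat d * F" by (rule euler[OF F(1)])
  have G: "dx3 (Q * F) = Q * dx3 F + dx3 Q * F" "dy3 (Q * F) = Q * dy3 F + dy3 Q * F" "dz3 (Q * F) = Q * dz3 F"
    by (simp_all add: dx3_der dy3_der dz3_der Qz)
  \<comment> \<open>The natural degree of \<open>\<alpha>\<close> is \<open>m - 2\<close>, which is
    meaningless for m = 1; there \<open>\<alpha>\<close> is zero, because no multiple of
    \<open>F\<close> has a part in degree d - 1. Requiring homogeneity of the products with the
    variables covers both cases.\<close>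
  obtain \<alpha> \<beta> where AB: "dx3 Q * dy3 F - dy3 Q * dx3 F = \<alpha> * F + \<beta> * dz3 F"
    and hom: "Hom (m - 1) (PX * \<alpha>)" "Hom (m - 1) (PY * \<alpha>)" "Hom (m - 1) (PZ * \<alpha>)" "Hom (m - 1) \<beta>"
  proof (cases "d = 0")
    case True
    have "eval3 F v = eval3 F 0" for v
      using F(1) unfolding Hom_iff_eval True by (metis mult_1 power_0 vector_smult_lzero)
    then have "F = emb (eval3 F 0)" by (intro eval3_ext) (simp add: eval3_gen)
    then have "dx3 F = 0" "dy3 F = 0" by (metis d3_gen(1), metis d3_gen(2))
    then show ?thesis using that[of 0 0] by (simp add: Hom_0)
  next
    case False
    obtain a b where ab: "dx3 Q * dy3 F - dy3 Q * dx3 F = a * F + b * dz3 F" using K by (auto simp: ideal2_def Q_def)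
    define N where "N = (m - 1) + (d - 1)"
    have hK: "Hom N (dx3 Q * dy3 F - dy3 Q * dx3 F)" unfolding N_def
      by (intro Hom_diff Hom_mult Hom_d3 Q(1) F(1))
    define \<alpha> where "\<alpha> = (if m = 1 then 0 else hpart (m - 2) a)"
    have a: "hpart N (a * F) = \<alpha> * F"
    proof (cases "m = 1")
      case True then show ?thesis using hpart_mult_less[OF F(1), of N a] False by (simp add: N_def \<alpha>_def)
    next
      case m1: False
      then have "N = (m - 2) + d" using m False by (simp add: N_def)
      then show ?thesis using hpart_mult[OF F(1)] m1 by (simp add: \<alpha>_def)
    qed
    have b: "hpart N (b * dz3 F) = hpart (m - 1) b * dz3 F"
      unfolding N_def by (rule hpart_mult[OF Hom_d3(3)[OF F(1)]])
    have "dx3 Q * dy3 F - dy3 Q * dx3 F = \<alpha> * F + hpart (m - 1) b * dz3 F"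
      using hpart_Hom[OF hK] unfolding ab hpart_add a b by simp
    moreover have "Hom (m - 1) (P * \<alpha>)" if "Hom 1 P" for P
    proof (cases "m = 1")
      case True then show ?thesis by (simp add: \<alpha>_def Hom_0)
    next
      case m1: False
      then have "m - 1 = 1 + (m - 2)" using m by simp
      then show ?thesis using Hom_mult[OF that Hom_hpart] m1 by (simp add: \<alpha>_def)
    qed
    ultimately show ?thesis using that Hom_PXYZ Hom_hpart by blast
  qed
  \<comment> \<open>The field with z-component \<open>F\<close> multiplies \<open>Q * F\<close> by
    \<open>dz3 F\<close>, and the uncorrected second field multiplies it by \<open>\<alpha>\<close>.
    The Euler field multiplies it by \<open>e\<close>, so subtracting these factors times
    \<open>\<epsilon>\<close> times the Euler field leaves fields that annihilate it.\<close>
  define \<theta>\<^sub>1 :: "poly3 ^ 3" where "\<theta>\<^sub>1 = vector [- (\<epsilon> * dz3 F * PX), - (\<epsilon> * dz3 F * PY), F - \<epsilon> * dz3 F * PZ]"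
  define \<theta>\<^sub>2 :: "poly3 ^ 3" where "\<theta>\<^sub>2 = vector [- dy3 Q - \<epsilon> * (PX * \<alpha>), dx3 Q - \<epsilon> * (PY * \<alpha>), - \<beta> - \<epsilon> * (PZ * \<alpha>)]"
  have t1: "\<theta>\<^sub>1 $ 1 = - (\<epsilon> * dz3 F * PX)" "\<theta>\<^sub>1 $ 2 = - (\<epsilon> * dz3 F * PY)" "\<theta>\<^sub>1 $ 3 = F - \<epsilon> * dz3 F * PZ"
    and t2: "\<theta>\<^sub>2 $ 1 = - dy3 Q - \<epsilon> * (PX * \<alpha>)" "\<theta>\<^sub>2 $ 2 = dx3 Q - \<epsilon> * (PY * \<alpha>)" "\<theta>\<^sub>2 $ 3 = - \<beta> - \<epsilon> * (PZ * \<alpha>)"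
    by (simp_all add: \<theta>\<^sub>1_def \<theta>\<^sub>2_def)
  have E: "PX * dx3 (Q * F) + PY * dy3 (Q * F) + PZ * dz3 (Q * F) = of_nat e * (Q * F)"
  proof -
    have "PX * dx3 (Q * F) + PY * dy3 (Q * F) + PZ * dz3 (Q * F) =
      Q * (PX * dx3 F + PY * dy3 F + PZ * dz3 F) + F * (PX * dx3 Q + PY * dy3 Q)" unfolding G by (simp add: algebra_simps)
    then show ?thesis unfolding EF EQ by (simp add: e_def algebra_simps)
  qed
  have D1: "\<theta>\<^sub>1 \<in> D\<^sub>0 (Q * F)"
  proof -
    have "\<theta>\<^sub>1 $ 1 * dx3 (Q * F) + \<theta>\<^sub>1 $ 2 * dy3 (Q * F) + \<theta>\<^sub>1 $ 3 * dz3 (Q * F) =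
       F * dz3 (Q * F) - \<epsilon> * dz3 F * (PX * dx3 (Q * F) + PY * dy3 (Q * F) + PZ * dz3 (Q * F))"
      unfolding t1 by (simp add: algebra_simps)
    also have "\<dots> = F * (Q * dz3 F) - (\<epsilon> * of_nat e) * (dz3 F * (Q * F))" unfolding E unfolding G(3) by (simp only: mult_ac)
    also have "\<dots> = 0" unfolding \<epsilon> by (simp add: mult_ac)
    finally show ?thesis by (simp add: D0_iff)
  qed
  have xi: "- dy3 Q * dx3 (Q * F) + dx3 Q * dy3 (Q * F) - \<beta> * dz3 (Q * F) = \<alpha> * (Q * F)"
  proof -
    have "- dy3 Q * dx3 (Q * F) + dx3 Q * dy3 (Q * F) - \<beta> * dz3 (Q * F) =
      Q * (dx3 Q * dy3 F - dy3 Q * dx3 F) - Q * (\<beta> * dz3 F)" unfolding G by (simp add: algebra_simps)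
    then show ?thesis unfolding AB by (simp add: algebra_simps)
  qed
  have D2: "\<theta>\<^sub>2 \<in> D\<^sub>0 (Q * F)"
  proof -
    have "\<theta>\<^sub>2 $ 1 * dx3 (Q * F) + \<theta>\<^sub>2 $ 2 * dy3 (Q * F) + \<theta>\<^sub>2 $ 3 * dz3 (Q * F) =
       (- dy3 Q * dx3 (Q * F) + dx3 Q * dy3 (Q * F) - \<beta> * dz3 (Q * F))
       - \<epsilon> * \<alpha> * (PX * dx3 (Q * F) + PY * dy3 (Q * F) + PZ * dz3 (Q * F))"
      unfolding t2 by (simp add: algebra_simps)
    also have "\<dots> = \<alpha> * (Q * F) - (\<epsilon> * of_nat e) * (\<alpha> * (Q * F))" unfolding E xi by (simp only: mult_ac)
    also have "\<dots> = 0" unfolding \<epsilon> by (simp add: mult_ac)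
    finally show ?thesis by (simp add: D0_iff)
  qed
  have H1: "Hom d (\<theta>\<^sub>1 $ i)" for i
  proof -
    have "Hom d (\<epsilon> * dz3 F * P)" if "Hom 1 P" for P
    proof (cases "d = 0")
      case True
      have "eval3 F v = eval3 F 0" for v
        using F(1) unfolding Hom_iff_eval True by (metis mult_1 power_0 vector_smult_lzero)
      then have "F = emb (eval3 F 0)" by (intro eval3_ext) (simp add: eval3_gen)
      then have "dz3 F = 0" by (metis d3_gen(3))
      then show ?thesis by (simp add: Hom_0)
    next
      case False
      have "Hom (0 + (d - 1) + 1) (\<epsilon> * dz3 F * P)" unfolding \<epsilon>_def
        by (intro Hom_mult Hom_emb Hom_d3 F(1) that)
      then show ?thesis using False by simp
    qed
    then have "Hom d (- (\<epsilon> * dz3 F * PX))" "Hom d (- (\<epsilon> * dz3 F * PY))" "Hom d (F - \<epsilon> * dz3 F * PZ)"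
      using Hom_minus Hom_diff F(1) Hom_PXYZ by blast+
    then have "\<forall>i. Hom d (\<theta>\<^sub>1 $ i)" unfolding forall_3 t1 by blast
    then show ?thesis by blast
  qed
  have H2: "Hom (m - 1) (\<theta>\<^sub>2 $ i)" for i
  proof -
    have \<epsilon>h: "Hom (m - 1) (\<epsilon> * P)" if "Hom (m - 1) P" for P
      using Hom_mult[OF Hom_emb that] by (simp add: \<epsilon>_def)
    have "Hom (m - 1) (- dy3 Q - \<epsilon> * (PX * \<alpha>))" "Hom (m - 1) (dx3 Q - \<epsilon> * (PY * \<alpha>))" "Hom (m - 1) (- \<beta> - \<epsilon> * (PZ * \<alpha>))"
      by (intro Hom_diff Hom_minus \<epsilon>h Hom_d3[OF Q(1)] hom)+
    then have "\<forall>i. Hom (m - 1) (\<theta>\<^sub>2 $ i)" unfolding forall_3 t2 by blast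
    then show ?thesis by blast
  qed
  have gen: "\<exists>a b. \<theta> = a *s \<theta>\<^sub>1 + b *s \<theta>\<^sub>2" if "\<theta> \<in> D\<^sub>0 (Q * F)" for \<theta>
  proof -
    define a b c where "a = \<theta> $ 1" and "b = \<theta> $ 2" and "c = \<theta> $ 3"
    have 0: "a * dx3 (Q * F) + b * dy3 (Q * F) + c * dz3 (Q * F) = 0" using that by (simp add: D0_iff a_def b_def c_def)
    \<comment> \<open>For each linear factor of \<open>Q\<close>, all terms of the relation are
      divisible by it except the one in which the derivative falls on this factor. The other factors
      of \<open>Q\<close>, and \<open>F\<close>, are prime to it.\<close>
    have "Q dvd a * PY - b * PX" unfolding Q_def
    proof (rule line_prod_dvd[OF S(1)])
      fix s t assume st: "(s, t) \<in> S"
      let ?l = "[:lin s t:]"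
      define Q' where "Q' = [:line_prod (S - {(s, t)}):]"
      have st0: "(s, t) \<noteq> (0, 0)" by (rule distinct_linesD(1)[OF S(1) st])
      have QQ: "Q = ?l * Q'" unfolding Q_def Q'_def line_prod_def by (subst prod.remove[OF fS st]) (simp add: mult.commute)
      have nd: "\<not> ?l dvd Q'" unfolding Q'_def
      proof (rule clin_dvd_line_prod[OF _ st0])
        fix s' t' assume "(s', t') \<in> S - {(s, t)}"
        then show "t' * s \<noteq> s' * t" using distinct_linesD(2)[OF S(1) st] by blast
      qed (use fS in simp)
      have dl: "dx3 ?l = emb t" "dy3 ?l = - emb s"
        unfolding clin_eq by (simp_all add: dx3_der dy3_der)
      have dQ: "dx3 Q = ?l * dx3 Q' + emb t * Q'" "dy3 Q = ?l * dy3 Q' - emb s * Q'"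
        unfolding QQ dx3_der(2) dy3_der(2) dl by simp_all
      have "(emb t * a - emb s * b) * Q' * F + ?l * ((a * dx3 Q' + b * dy3 Q') * F + Q' * (a * dx3 F + b * dy3 F + c * dz3 F)) = 0"
        using 0 unfolding G dQ unfolding QQ by (simp add: algebra_simps del: mult_pCons_left mult_pCons_right)
      then have "(emb t * a - emb s * b) * Q' * F = ?l * (- ((a * dx3 Q' + b * dy3 Q') * F + Q' * (a * dx3 F + b * dy3 F + c * dz3 F)))"
        by (simp only: mult_minus_right add_eq_0_iff2)
      then have "?l dvd (emb t * a - emb s * b) * Q' * F" by (simp only: dvd_triv_left)
      then have "?l dvd emb t * a - emb s * b" using clin_prime[OF st0] nd monz_not_clin_dvd[OF F(2)] by blast
      then show "?l dvd a * PY - b * PX" by (rule clin_dvd_wedge[OF st0])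
    qed
    then obtain w where w: "a * PY - b * PX = Q * w" by (elim dvdE)
    \<comment> \<open>By Euler's identity the wedge of (- \<open>dy3 Q\<close>,
      \<open>dx3 Q\<close>) with (x, y) is -m times \<open>Q\<close>; this explains the factor
      -1/m.\<close>
    define v where "v = - (\<mu> * w)"
    have "PY * (a + v * dy3 Q) = PX * (b - v * dx3 Q)"
    proof -
      have "PY * (a + v * dy3 Q) - PX * (b - v * dx3 Q) = (a * PY - b * PX) + v * (PX * dx3 Q + PY * dy3 Q)"
        by (simp add: algebra_simps)
      also have "\<dots> = Q * w - (\<mu> * of_nat m) * (Q * w)" unfolding w EQ v_def by (simp add: algebra_simps)
      finally show ?thesis unfolding \<mu> by simp
    qed
    then obtain u where u: "a + v * dy3 Q = PX * u" "b - v * dx3 Q = PY * u" using PX_dvd by blast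
    have a: "a = PX * u - v * dy3 Q" and b: "b = PY * u + v * dx3 Q" using u by (simp_all add: algebra_simps)
    define r where "r = c - u * PZ + v * \<beta>"
    have "a * dx3 (Q * F) + b * dy3 (Q * F) + c * dz3 (Q * F) =
       u * (PX * dx3 (Q * F) + PY * dy3 (Q * F) + PZ * dz3 (Q * F))
       + v * (- dy3 Q * dx3 (Q * F) + dx3 Q * dy3 (Q * F) - \<beta> * dz3 (Q * F)) + r * dz3 (Q * F)"
      unfolding a b r_def by (simp add: algebra_simps)
    then have "Q * (F * (of_nat e * u + v * \<alpha>) + r * dz3 F) = 0"
      using 0 unfolding E xi unfolding G(3) by (simp add: algebra_simps)
    then have r1: "F * (of_nat e * u + v * \<alpha>) + r * dz3 F = 0" using Q(2) by simp
    \<comment> \<open>Coprimality of \<open>F\<close> and \<open>dz3 F\<close> is used through the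
      discriminant: \<open>[:\<Delta>:] * r\<close> is a multiple of \<open>F\<close>, and
      \<open>\<Delta>\<close> can be cancelled because \<open>F\<close> is monic up to a
      constant.\<close>
    obtain \<Delta> s t where D: "\<Delta> \<noteq> 0" "[:\<Delta>:] = s * F + t * dz3 F"
      using discriminant_or_not_squarefree[OF F(1,2)] F(3) by (auto simp: ideal2_def)
    have "r * dz3 F = F * (- (of_nat e * u + v * \<alpha>))" using r1 by (simp only: mult_minus_right add_eq_0_iff)
    then have "t * (r * dz3 F) = F * (t * (- (of_nat e * u + v * \<alpha>)))" by (simp only: mult.left_commute)
    moreover have "[:\<Delta>:] * r = F * (s * r) + t * (r * dz3 F)"
      unfolding D(2) by (simp add: algebra_simps)
    ultimately have "[:\<Delta>:] * r = F * (s * r + t * (- (of_nat e * u + v * \<alpha>)))"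
      by (simp only: distrib_left)
    then have "F dvd [:\<Delta>:] * r" by (simp only: dvd_triv_left)
    then have "F dvd r" by (rule monz_dvd_cancel[OF F(2) D(1)])
    then obtain r' where r': "r = F * r'" by (elim dvdE)
    have "F * ((of_nat e * u + v * \<alpha>) + r' * dz3 F) = 0" using r1 unfolding r' by (simp add: algebra_simps)
    then have r0: "(of_nat e * u + v * \<alpha>) + r' * dz3 F = 0" using F0 mult_eq_0_iff by blast
    have r2: "of_nat e * u = - (v * \<alpha>) - r' * dz3 F"
    proof -
      have "of_nat e * u = ((of_nat e * u + v * \<alpha>) + r' * dz3 F) - v * \<alpha> - r' * dz3 F" by simp
      then show ?thesis unfolding r0 by simp
    qed
    have "u = (\<epsilon> * of_nat e) * u" unfolding \<epsilon> by simp
    also have "\<dots> = \<epsilon> * (- (v * \<alpha>) - r' * dz3 F)" unfolding r2[symmetric] by (simp only: mult.assoc)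
    finally have u': "u = - (\<epsilon> * v * \<alpha>) - \<epsilon> * r' * dz3 F" by (simp add: algebra_simps)
    have c: "c = F * r' + u * PZ - v * \<beta>" using r' unfolding r_def by (simp add: algebra_simps)
    have "\<theta> = r' *s \<theta>\<^sub>1 + v *s \<theta>\<^sub>2"
      unfolding vec_eq_iff forall_3 vector_add_component vector_smult_component t1 t2 a_def[symmetric] b_def[symmetric] c_def[symmetric] a b c
      unfolding u' by (simp add: algebra_simps)
    then show ?thesis by blast
  qed
  have ind: "a = 0 \<and> b = 0" if z: "a *s \<theta>\<^sub>1 + b *s \<theta>\<^sub>2 = 0" for a b
  proof -
    have c: "a * \<theta>\<^sub>1 $ i + b * \<theta>\<^sub>2 $ i = 0" for i using z by (simp add: vec_eq_iff)
    \<comment> \<open>The wedge with the radial field kills the radial x,y-parts of both generators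
      and leaves m times \<open>b * Q\<close>.\<close>
    have "PX * (a * \<theta>\<^sub>1 $ 2 + b * \<theta>\<^sub>2 $ 2) - PY * (a * \<theta>\<^sub>1 $ 1 + b * \<theta>\<^sub>2 $ 1) = b * (PX * dx3 Q + PY * dy3 Q)"
      unfolding t1 t2 by (simp add: algebra_simps)
    then have "b * (of_nat m * Q) = 0" unfolding c EQ by simp
    then have b: "b = 0" using Q(2) m by auto
    have "a * (dz3 F * (\<epsilon> * PX)) = 0" using c[of 1] unfolding b t1 by (simp add: mult_ac)
    then have "a = 0 \<or> dz3 F = 0" using \<epsilon> by (auto simp: PX_def)
    then show ?thesis
    proof
      assume "dz3 F = 0"
      then have "a * F = 0" using c[of 3] unfolding b t1 by simp
      then show ?thesis using F0 b by simp
    qed (simp add: b)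
  qed
  show ?thesis unfolding free2_def log_basis_def Q_def[symmetric] using H1 H2 D1 D2 gen ind by blast
qed

section \<open>Freeness from the local condition at the multiple points\<close>

lemma der_fps_deriv: "der (fps_deriv :: 'a::comm_ring_1 fps \<Rightarrow> _)"
  by (simp add: der_def)

lemma fps_deriv_kap [simp]: "fps_deriv (kap c) = 0" "fps_deriv VZ = 0" "fps_deriv VY = 1"
  by (simp_all add: kap_def VZ_def VY_def)

lemma fps_deriv_loc:
  "fps_deriv (loc q\<^sub>1 q\<^sub>2 q\<^sub>3 e\<^sub>1 e\<^sub>2 F) = kap e\<^sub>1 * loc q\<^sub>1 q\<^sub>2 q\<^sub>3 e\<^sub>1 e\<^sub>2 (dx3 F) + kap e\<^sub>2 * loc q\<^sub>1 q\<^sub>2 q\<^sub>3 e\<^sub>1 e\<^sub>2 (dy3 F)"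
  unfolding loc_def by (subst ev3_chain[OF rhom_kap der_fps_deriv]) (simp_all add: mult.commute)

lemma fps_nth_loc_00: "fps_nth (fps_nth (loc q\<^sub>1 q\<^sub>2 q\<^sub>3 e\<^sub>1 e\<^sub>2 F) 0) 0 = eval3 F (vector [q\<^sub>1, q\<^sub>2, q\<^sub>3])"
  by (simp add: loc_nth0 poly_0_coeff_0[symmetric] poly_pcompose poly_lz)

lemma loc_unit: assumes "eval3 G (vector [q\<^sub>1, q\<^sub>2, q\<^sub>3]) \<noteq> 0" shows "\<exists>w. loc q\<^sub>1 q\<^sub>2 q\<^sub>3 e\<^sub>1 e\<^sub>2 G * w = 1"
  by (rule unit2I) (simp add: fps_nth_loc_00 assms)

lemma ideal2_unit: assumes "g * w = 1" shows "h \<in> ideal2 f g"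
proof (rule ideal2I)
  have "h * w * g = h * (g * w)" by (simp only: mult_ac)
  then show "h = 0 * f + (h * w) * g" using assms by simp
qed

text \<open>Cramer's rule for the vectors (x, y) and e, whose determinant is constant on the whole
  chart. It expresses the Jacobian of \<open>Q\<close> and \<open>F\<close> in x, y through their
  derivatives along e and the sums in Euler's identities; the latter are known modulo the
  ideal.\<close>

lemma local_wedge:
  assumes F: "Hom d F" and Q: "Hom m Q" "dz3 Q = 0" and e: "q\<^sub>1 * e\<^sub>2 \<noteq> q\<^sub>2 * e\<^sub>1"
    and L: "L = loc q\<^sub>1 q\<^sub>2 q\<^sub>3 e\<^sub>1 e\<^sub>2"
    and loc: "L Q * fps_deriv (L F) \<in> ideal2 (L F) (L (dz3 F))"
  shows "L (dx3 Q * dy3 F - dy3 Q * dx3 F) \<in> ideal2 (L F) (L (dz3 F))"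
proof -
  note Lh = loc_hom[of q\<^sub>1 q\<^sub>2 q\<^sub>3 e\<^sub>1 e\<^sub>2, folded L] and Lg = loc_gen[of q\<^sub>1 q\<^sub>2 q\<^sub>3 e\<^sub>1 e\<^sub>2, folded L]
  define I where "I = ideal2 (L F) (L (dz3 F))"
  let ?\<delta> = "q\<^sub>1 * e\<^sub>2 - q\<^sub>2 * e\<^sub>1"
  define Qe where "Qe = kap e\<^sub>1 * L (dx3 Q) + kap e\<^sub>2 * L (dy3 Q)"
  have Fe: "fps_deriv (L F) = kap e\<^sub>1 * L (dx3 F) + kap e\<^sub>2 * L (dy3 F)" unfolding L by (rule fps_deriv_loc)
  have EQ: "L PX * L (dx3 Q) + L PY * L (dy3 Q) = of_nat m * L Q"
    using arg_cong[OF euler[OF Q(1)], of L] by (simp add: Q(2) Lh)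
  have EF: "L PX * L (dx3 F) + L PY * L (dy3 F) = of_nat d * L F - L PZ * L (dz3 F)"
    using arg_cong[OF euler[OF F], of L] by (simp add: Lh algebra_simps)
  have del: "L PX * kap e\<^sub>2 - L PY * kap e\<^sub>1 = kap ?\<delta>" unfolding Lg by (simp add: kap_hom algebra_simps)
  have "kap ?\<delta> * L (dx3 Q * dy3 F - dy3 Q * dx3 F) =
    (L PX * L (dx3 Q) + L PY * L (dy3 Q)) * fps_deriv (L F) - Qe * (L PX * L (dx3 F) + L PY * L (dy3 F))"
    unfolding del[symmetric] Fe Qe_def Lh by (simp add: algebra_simps)
  also have "\<dots> = of_nat m * (L Q * fps_deriv (L F)) - (Qe * of_nat d) * L F + (Qe * L PZ) * L (dz3 F)"
    unfolding EQ EF by (simp add: algebra_simps)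
  also have "\<dots> \<in> I" unfolding I_def
    by (intro ideal2_add ideal2_diff ideal2_mult loc ideal2_gen)
  finally have "kap (1 / ?\<delta>) * (kap ?\<delta> * L (dx3 Q * dy3 F - dy3 Q * dx3 F)) \<in> I" unfolding I_def by (rule ideal2_mult)
  moreover have "kap (1 / ?\<delta>) * (kap ?\<delta> * W) = W" for W
    using kap_unit[of ?\<delta>] e by (simp only: mult.assoc[symmetric] mult.commute[of "kap (1 / ?\<delta>)"]) simp
  ultimately show ?thesis by (simp add: I_def)
qed

text \<open>Where \<open>dz3 F\<close> does not vanish the ideal is the whole ring. At the remaining
  points one of the lines passes through q, so the expansion of the product of lines is a multiple
  of Y, and the hypothesis suffices for \<open>local_wedge\<close>.\<close>

theorem free2_of_local:
  assumes F: "Hom d F" "monz F" "squarefree F" and S: "distinct_lines S" "S \<noteq> {}"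
    and loc: "\<And>q\<^sub>1 q\<^sub>2 q\<^sub>3 e\<^sub>1 e\<^sub>2. q\<^sub>1 * e\<^sub>2 \<noteq> q\<^sub>2 * e\<^sub>1 \<Longrightarrow> eval3 F (vector [q\<^sub>1, q\<^sub>2, q\<^sub>3]) = 0 \<Longrightarrow> eval3 (dz3 F) (vector [q\<^sub>1, q\<^sub>2, q\<^sub>3]) = 0 \<Longrightarrow>
      (\<exists>(a, b)\<in>S. b * q\<^sub>1 = a * q\<^sub>2) \<and>
      VY * fps_deriv (loc q\<^sub>1 q\<^sub>2 q\<^sub>3 e\<^sub>1 e\<^sub>2 F) \<in> ideal2 (loc q\<^sub>1 q\<^sub>2 q\<^sub>3 e\<^sub>1 e\<^sub>2 F) (loc q\<^sub>1 q\<^sub>2 q\<^sub>3 e\<^sub>1 e\<^sub>2 (dz3 F))"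
  shows "free2 ([:line_prod S:] * F)"
proof (rule free2_lines_times[OF F S])
  let ?Q = "[:line_prod S:]"
  have Q: "Hom (card S) ?Q" by (rule line_prod_Hom(1)[OF S(1)])
  have Qz: "dz3 ?Q = 0" by (simp add: dz3_def pderiv_pCons)
  have "Hom ((card S - 1) + (d - 1)) (dx3 ?Q * dy3 F - dy3 ?Q * dx3 F)"
    by (intro Hom_diff Hom_mult Hom_d3 Q F(1))
  then show "dx3 ?Q * dy3 F - dy3 ?Q * dx3 F \<in> ideal2 F (dz3 F)"
  proof (rule polar_ideal_of_local[OF F])
    fix q\<^sub>1 q\<^sub>2 :: complex assume q: "(q\<^sub>1, q\<^sub>2) \<noteq> (0, 0)"
    obtain e\<^sub>1 e\<^sub>2 where e: "q\<^sub>1 * e\<^sub>2 \<noteq> q\<^sub>2 * e\<^sub>1"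
    proof (cases "q\<^sub>1 = 0")
      case True then show ?thesis using q that[of 0 1] by simp
    qed (use that[of 1 0] in simp)
    have "loc q\<^sub>1 q\<^sub>2 q\<^sub>3 e\<^sub>1 e\<^sub>2 (dx3 ?Q * dy3 F - dy3 ?Q * dx3 F) \<in> ideal2 (loc q\<^sub>1 q\<^sub>2 q\<^sub>3 e\<^sub>1 e\<^sub>2 F) (loc q\<^sub>1 q\<^sub>2 q\<^sub>3 e\<^sub>1 e\<^sub>2 (dz3 F))"
      if z: "eval3 F (vector [q\<^sub>1, q\<^sub>2, q\<^sub>3]) = 0" for q\<^sub>3
    proof (cases "eval3 (dz3 F) (vector [q\<^sub>1, q\<^sub>2, q\<^sub>3]) = 0")
      case False
      then obtain w where "loc q\<^sub>1 q\<^sub>2 q\<^sub>3 e\<^sub>1 e\<^sub>2 (dz3 F) * w = 1" using loc_unit by blast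
      then show ?thesis by (rule ideal2_unit)
    next
      case True
      define L where "L = loc q\<^sub>1 q\<^sub>2 q\<^sub>3 e\<^sub>1 e\<^sub>2"
      obtain a b where ab: "(a, b) \<in> S" "b * q\<^sub>1 = a * q\<^sub>2" and l: "VY * fps_deriv (L F) \<in> ideal2 (L F) (L (dz3 F))"
        using loc[OF e z True] unfolding L_def by blast
      have fS: "finite S" using S by (simp add: distinct_lines_def)
      have "?Q = [:lin a b:] * [:line_prod (S - {(a, b)}):]"
        unfolding line_prod_def by (subst prod.remove[OF fS ab(1)]) (simp add: mult.commute)
      then have "L ?Q = VY * (kap (b * e\<^sub>1 - a * e\<^sub>2) * L [:line_prod (S - {(a, b)}):])"
        unfolding L_def using ab(2) by (simp only: loc_hom loc_lin kap_hom diff_self mult.assoc add_0_left)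
      then have "L ?Q * fps_deriv (L F) = (kap (b * e\<^sub>1 - a * e\<^sub>2) * L [:line_prod (S - {(a, b)}):]) * (VY * fps_deriv (L F))"
        by (simp only: mult_ac)
      then have "L ?Q * fps_deriv (L F) \<in> ideal2 (L F) (L (dz3 F))" using ideal2_mult[OF l] by metis
      from local_wedge[OF F(1) Q Qz e L_def this] show ?thesis unfolding L_def .
    qed
    then show "\<exists>e\<^sub>1 e\<^sub>2. q\<^sub>1 * e\<^sub>2 \<noteq> q\<^sub>2 * e\<^sub>1 \<and> (\<forall>q\<^sub>3. eval3 F (vector [q\<^sub>1, q\<^sub>2, q\<^sub>3]) = 0 \<longrightarrow>
      loc q\<^sub>1 q\<^sub>2 q\<^sub>3 e\<^sub>1 e\<^sub>2 (dx3 ?Q * dy3 F - dy3 ?Q * dx3 F) \<in> ideal2 (loc q\<^sub>1 q\<^sub>2 q\<^sub>3 e\<^sub>1 e\<^sub>2 F) (loc q\<^sub>1 q\<^sub>2 q\<^sub>3 e\<^sub>1 e\<^sub>2 (dz3 F)))"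
      using e by blast
  qed
qed

text \<open>Without such a point the local criterion would put 1 into the ideal generated by
  \<open>F\<close> and \<open>dz3 F\<close>, two forms of positive degree.\<close>

lemma exists_multiple_point:
  assumes F: "Hom d F" "monz F" "squarefree F" and "d \<ge> 2"
  shows "\<exists>q\<^sub>1 q\<^sub>2 q\<^sub>3. (q\<^sub>1, q\<^sub>2) \<noteq> (0, 0) \<and> eval3 F (vector [q\<^sub>1, q\<^sub>2, q\<^sub>3]) = 0 \<and> eval3 (dz3 F) (vector [q\<^sub>1, q\<^sub>2, q\<^sub>3]) = 0"
proof (rule ccontr)
  assume n: "\<not> ?thesis"
  have "1 \<in> ideal2 F (dz3 F)"
  proof (rule polar_ideal_of_local[OF F Hom_1])
    fix q\<^sub>1 q\<^sub>2 :: complex assume q: "(q\<^sub>1, q\<^sub>2) \<noteq> (0, 0)"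
    obtain e\<^sub>1 e\<^sub>2 where e: "q\<^sub>1 * e\<^sub>2 \<noteq> q\<^sub>2 * e\<^sub>1"
    proof (cases "q\<^sub>1 = 0")
      case True then show ?thesis using q that[of 0 1] by simp
    qed (use that[of 1 0] in simp)
    have "loc q\<^sub>1 q\<^sub>2 q\<^sub>3 e\<^sub>1 e\<^sub>2 1 \<in> ideal2 (loc q\<^sub>1 q\<^sub>2 q\<^sub>3 e\<^sub>1 e\<^sub>2 F) (loc q\<^sub>1 q\<^sub>2 q\<^sub>3 e\<^sub>1 e\<^sub>2 (dz3 F))"
      if "eval3 F (vector [q\<^sub>1, q\<^sub>2, q\<^sub>3]) = 0" for q\<^sub>3
    proof -
      have "eval3 (dz3 F) (vector [q\<^sub>1, q\<^sub>2, q\<^sub>3]) \<noteq> 0" using n q that by blast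
      then obtain w where "loc q\<^sub>1 q\<^sub>2 q\<^sub>3 e\<^sub>1 e\<^sub>2 (dz3 F) * w = 1" using loc_unit by blast
      then show ?thesis by (rule ideal2_unit)
    qed
    then show "\<exists>e\<^sub>1 e\<^sub>2. q\<^sub>1 * e\<^sub>2 \<noteq> q\<^sub>2 * e\<^sub>1 \<and> (\<forall>q\<^sub>3. eval3 F (vector [q\<^sub>1, q\<^sub>2, q\<^sub>3]) = 0 \<longrightarrow>
      loc q\<^sub>1 q\<^sub>2 q\<^sub>3 e\<^sub>1 e\<^sub>2 1 \<in> ideal2 (loc q\<^sub>1 q\<^sub>2 q\<^sub>3 e\<^sub>1 e\<^sub>2 F) (loc q\<^sub>1 q\<^sub>2 q\<^sub>3 e\<^sub>1 e\<^sub>2 (dz3 F)))"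
      using e by blast
  qed
  then obtain a b where ab: "1 = a * F + b * dz3 F" by (auto simp: ideal2_def)
  have "eval3 G 0 = 0" if "Hom n G" "n > 0" for n G
  proof -
    have "eval3 G (0 *s 0) = 0 ^ n * eval3 G 0" using that(1) unfolding Hom_iff_eval by blast
    then show ?thesis using that(2) by (simp add: zero_power)
  qed
  from this[OF F(1)] this[OF Hom_d3(3)[OF F(1)]] assms(4) have "eval3 F 0 = 0" "eval3 (dz3 F) 0 = 0" by auto
  then show False using arg_cong[OF ab, of "\<lambda>G. eval3 G 0"] by (simp add: eval3_hom)
qed

lemma binary_form_zeros:
  assumes "Hom n [:c:]" "c \<noteq> 0"
  shows "\<exists>S. finite S \<and> (\<forall>(a, b)\<in>S. (a, b) \<noteq> (0, 0)) \<and> (\<forall>u v. eval2 c (u, v) = 0 \<longrightarrow> (\<exists>(a, b)\<in>S. b * u = a * v))"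
  using assms
proof (induction n arbitrary: c)
  case 0
  have "eval2 c (u, v) \<noteq> 0" for u v using Hom0_const[OF 0(1)] 0(2) by (metis eval2_const pCons_0_0)
  then show ?case by (intro exI[of _ "{}"]) auto
next
  case (Suc n)
  obtain a b c' where f: "(a, b) \<noteq> (0, 0)" "c = lin a b * c'" "Hom n [:c':]" "c' \<noteq> 0"
    using binary_form_factor[OF Suc.prems] by blast
  obtain S where S: "finite S" "\<forall>(a, b)\<in>S. (a, b) \<noteq> (0, 0)" "\<forall>u v. eval2 c' (u, v) = 0 \<longrightarrow> (\<exists>(a, b)\<in>S. b * u = a * v)"
    using Suc.IH[OF f(3,4)] by blast
  show ?case
    using S f(1) by (intro exI[of _ "insert (a, b) S"]) (auto simp: f(2) eval2_arith eval2_lin)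
qed

text \<open>All these points lie over zeros of the discriminant.\<close>

lemma finite_multiple_lines:
  assumes F: "Hom d F" "monz F" "squarefree F"
  shows "\<exists>S. finite S \<and> (\<forall>(a, b)\<in>S. (a, b) \<noteq> (0, 0)) \<and> (\<forall>q\<^sub>1 q\<^sub>2 q\<^sub>3. eval3 F (vector [q\<^sub>1, q\<^sub>2, q\<^sub>3]) = 0 \<longrightarrow> eval3 (dz3 F) (vector [q\<^sub>1, q\<^sub>2, q\<^sub>3]) = 0 \<longrightarrow>
     (\<exists>(a, b)\<in>S. b * q\<^sub>1 = a * q\<^sub>2))"
proof -
  obtain \<Delta> n a b where D: "\<Delta> \<noteq> 0" "Hom n [:\<Delta>:]" "[:\<Delta>:] = a * F + b * dz3 F"
    using discriminant_or_not_squarefree[OF F(1,2)] F(3) by (auto simp: ideal2_def)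
  have "eval2 \<Delta> (q\<^sub>1, q\<^sub>2) = 0" if "eval3 F (vector [q\<^sub>1, q\<^sub>2, q\<^sub>3]) = 0" "eval3 (dz3 F) (vector [q\<^sub>1, q\<^sub>2, q\<^sub>3]) = 0" for q\<^sub>1 q\<^sub>2 q\<^sub>3
    using arg_cong[OF D(3), of "\<lambda>G. eval3 G (vector [q\<^sub>1, q\<^sub>2, q\<^sub>3])"] that by (simp add: eval3_hom eval3_const)
  then show ?thesis using binary_form_zeros[OF D(2,1)] by meson
qed

section \<open>The local condition for formal power series\<close>

definition dzs :: "ser2 \<Rightarrow> ser2" where "dzs f = Abs_fps (\<lambda>n. fps_deriv (fps_nth f n))"

lemma dzs_nth [simp]: "fps_nth (dzs f) n = fps_deriv (fps_nth f n)" by (simp add: dzs_def)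

lemma fps_deriv_sum': "fps_deriv (\<Sum>i\<in>A. f i) = (\<Sum>i\<in>A. fps_deriv (f i :: complex fps))"
  by (induction A rule: infinite_finite_induct) simp_all

lemma der_dzs: "der dzs"
  unfolding der_def
proof (intro conjI allI)
  fix a b
  show "dzs (a + b) = dzs a + dzs b" by (rule fps_ext) simp
  show "dzs (a * b) = a * dzs b + dzs a * b"
    by (rule fps_ext) (simp add: fps_mult_nth fps_deriv_sum' sum.distrib)
qed

lemmas dzs_der = derD[OF der_dzs] and fd_der = derD[OF der_fps_deriv]

lemma dzs_kap [simp]: "dzs (kap c) = 0" "dzs VZ = 1" "dzs VY = 0"
  by (rule fps_ext; simp add: kap_def VZ_def VY_def fps_X_nth)+

lemma VY_shift: assumes "fps_nth V 0 = 0" shows "V = VY * fps_shift 1 V"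
  using assms by (intro fps_ext) (simp add: VY_def)

lemma subdegree_pos: "p \<noteq> 0 \<Longrightarrow> fps_nth p 0 = 0 \<Longrightarrow> subdegree p > 0"
  using subdegree_eq_0_iff[of p] by auto

lemma dzs_loc: "dzs (loc q\<^sub>1 q\<^sub>2 q\<^sub>3 e\<^sub>1 e\<^sub>2 F) = loc q\<^sub>1 q\<^sub>2 q\<^sub>3 e\<^sub>1 e\<^sub>2 (dz3 F)"
  unfolding loc_def by (subst ev3_chain[OF rhom_kap der_dzs]) (simp_all add: dzs_der)

text \<open>The first index is the exponent of Y, the second that of Z.\<close>

definition cf :: "ser2 \<Rightarrow> nat \<Rightarrow> nat \<Rightarrow> complex" where "cf f i j = fps_nth (fps_nth f i) j"

lemma cf_arith: "cf (f + g) i j = cf f i j + cf g i j" "cf (f - g) i j = cf f i j - cf g i j" "cf (- f) i j = - cf f i j"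
  by (simp_all add: cf_def)

lemma cf_mult: "cf (f * g) 0 0 = cf f 0 0 * cf g 0 0"
  "cf (f * g) 1 0 = cf f 0 0 * cf g 1 0 + cf f 1 0 * cf g 0 0"
  "cf (f * g) 0 1 = cf f 0 0 * cf g 0 1 + cf f 0 1 * cf g 0 0"
  by (simp_all add: cf_def fps_mult_nth)

lemma cf_der: "cf (fps_deriv f) i j = of_nat (Suc i) * cf f (Suc i) j" "cf (dzs f) i j = of_nat (Suc j) * cf f i (Suc j)"
  by (simp_all add: cf_def fps_of_nat[symmetric] del: of_nat_Suc)

lemma cf_of_nat: "cf (of_nat n) i j = (if i = 0 \<and> j = 0 then of_nat n else 0)"
  by (simp add: cf_def fps_of_nat[symmetric])

lemma cf_VY: "cf (VY * f) 0 j = 0" "cf (VY * f) (Suc i) j = cf f i j"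
  by (simp_all add: cf_def VY_def)

lemma unit_cf: "cf u 0 0 \<noteq> 0 \<Longrightarrow> \<exists>w. u * w = 1" unfolding cf_def by (rule unit2I)

lemma unit_cf_nz: assumes "u * w = 1" shows "cf u 0 0 \<noteq> 0"
  using cf_mult(1)[of u w] assms by (auto simp: cf_def)

text \<open>\<open>D\<close> multiplies \<open>VY * u * f\<close> by a series. Since
  \<open>f\<close> is prime to Y, it follows that Y divides \<open>\<alpha>\<close>, the value of
  \<open>D\<close> at Y, and then that \<open>D f\<close> is a multiple of \<open>f\<close>. Once
  the quotient of \<open>\<alpha>\<close> by Y is known to be a unit, division by it gives the
  claim.\<close>

lemma quasi_homogeneous_local:
  assumes g: "VY * u * f = e * h" and u: "u * u' = 1" and e: "e * e' = 1" and f0: "fps_nth f 0 \<noteq> 0"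
    and hy: "fps_deriv h = H\<^sub>1 * fps_deriv P\<^sub>1 + H\<^sub>2 * fps_deriv P\<^sub>2"
    and hz: "dzs h = H\<^sub>1 * dzs P\<^sub>1 + H\<^sub>2 * dzs P\<^sub>2"
    and w: "of_nat w\<^sub>1 * P\<^sub>1 * H\<^sub>1 + of_nat w\<^sub>2 * P\<^sub>2 * H\<^sub>2 = of_nat N * h" "w\<^sub>1 > 0" "w\<^sub>2 > 0"
    and P: "cf P\<^sub>1 0 0 = 0" "cf P\<^sub>2 0 0 = 0" "cf P\<^sub>1 1 0 * cf P\<^sub>2 0 1 \<noteq> cf P\<^sub>1 0 1 * cf P\<^sub>2 1 0"
  shows "VY * fps_deriv f \<in> ideal2 f (dzs f)"
proof -
  txt \<open>\<open>D\<close> is the Jacobian of \<open>(P\<^sub>1, P\<^sub>2)\<close> times the Euler field of weights \<open>(w\<^sub>1, w\<^sub>2)\<close> in the coordinates \<open>P\<^sub>1, P\<^sub>2\<close>.\<close>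
  define \<alpha> where "\<alpha> = of_nat w\<^sub>1 * P\<^sub>1 * dzs P\<^sub>2 - of_nat w\<^sub>2 * P\<^sub>2 * dzs P\<^sub>1"
  define \<beta> where "\<beta> = of_nat w\<^sub>2 * P\<^sub>2 * fps_deriv P\<^sub>1 - of_nat w\<^sub>1 * P\<^sub>1 * fps_deriv P\<^sub>2"
  define D where "D g = \<alpha> * fps_deriv g + \<beta> * dzs g" for g
  have Dm: "D (a * b) = a * D b + D a * b" for a b by (simp add: D_def dzs_der fd_der algebra_simps)
  have DY: "D VY = \<alpha>" by (simp add: D_def)
  define J where "J = fps_deriv P\<^sub>1 * dzs P\<^sub>2 - dzs P\<^sub>1 * fps_deriv P\<^sub>2"
  have "D h = J * (of_nat w\<^sub>1 * P\<^sub>1 * H\<^sub>1 + of_nat w\<^sub>2 * P\<^sub>2 * H\<^sub>2)"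
    unfolding D_def hy hz \<alpha>_def \<beta>_def J_def by (simp add: algebra_simps)
  then have Dh: "D h = J * of_nat N * h" unfolding w by (simp only: mult.assoc)
  define \<gamma> where "\<gamma> = J * of_nat N + D e * e'"
  have "D e * h = D e * (e * e') * h" unfolding e by simp
  then have "D (e * h) = \<gamma> * (e * h)" unfolding Dm Dh \<gamma>_def by (simp add: algebra_simps)
  then have Dg: "D (VY * u * f) = \<gamma> * (VY * u * f)" unfolding g .
  have 1: "\<alpha> * (u * f) = VY * (\<gamma> * u * f - D u * f - u * D f)"
    using Dg unfolding Dm DY by (simp add: algebra_simps)
  have "fps_nth \<alpha> 0 * (fps_nth u 0 * fps_nth f 0) = 0"
    using arg_cong[OF 1, of "\<lambda>g. fps_nth g 0"] by (simp add: VY_def)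
  moreover have "fps_nth u 0 \<noteq> 0" using unit_cf_nz[OF u] by (auto simp: cf_def)
  ultimately obtain \<alpha>' where \<alpha>': "\<alpha> = VY * \<alpha>'" using f0 VY_factor by force
  have "VY * (\<alpha>' * (u * f)) = VY * (\<gamma> * u * f - D u * f - u * D f)" using 1 unfolding \<alpha>' by (simp only: mult.assoc)
  moreover have "VY \<noteq> 0" by (simp add: VY_def)
  ultimately have 2: "\<alpha>' * (u * f) = \<gamma> * u * f - D u * f - u * D f" using mult_left_cancel by blast
  define \<kappa> where "\<kappa> = u' * (\<gamma> * u - D u - \<alpha>' * u)"
  have "u * D f = (\<gamma> * u - D u - \<alpha>' * u) * f" using 2 by (simp add: algebra_simps)
  then have "u' * (u * D f) = \<kappa> * f" unfolding \<kappa>_def by (simp only: mult.assoc)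
  moreover have "u' * (u * D f) = (u * u') * D f" by (simp only: mult_ac)
  ultimately have Df: "D f = \<kappa> * f" unfolding u by simp
  have 3: "\<alpha>' * (VY * fps_deriv f) = \<kappa> * f - \<beta> * dzs f" using Df unfolding D_def \<alpha>' by (simp add: algebra_simps)
  \<comment> \<open>The linear part of \<open>\<alpha>\<close> decides. Divisibility by Y kills its
    Z-coefficient, so either the weights are equal and the Y-coefficient is a weight times the
    Jacobian, or one of the Z-coefficients of \<open>P\<^sub>1\<close>, \<open>P\<^sub>2\<close>
    vanishes and a single nonzero product remains.\<close>
  have "cf \<alpha> 0 1 = 0" unfolding \<alpha>' by (simp add: cf_VY)
  moreover have "cf \<alpha> 0 1 = (of_nat w\<^sub>1 - of_nat w\<^sub>2) * (cf P\<^sub>1 0 1 * cf P\<^sub>2 0 1)"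
    unfolding \<alpha>_def cf_arith cf_mult mult.assoc by (simp add: P cf_of_nat cf_der cf_mult algebra_simps)
  moreover have "cf \<alpha> 1 0 = of_nat w\<^sub>1 * (cf P\<^sub>1 1 0 * cf P\<^sub>2 0 1) - of_nat w\<^sub>2 * (cf P\<^sub>2 1 0 * cf P\<^sub>1 0 1)"
    unfolding \<alpha>_def cf_arith cf_mult mult.assoc by (simp add: P cf_of_nat cf_der cf_mult algebra_simps)
  ultimately have "cf \<alpha> 1 0 \<noteq> 0" using P(3) w(2,3)
    by (cases "w\<^sub>1 = w\<^sub>2") (auto simp: right_diff_distrib[symmetric])
  moreover have "cf \<alpha> 1 0 = cf \<alpha>' 0 0" unfolding \<alpha>' One_nat_def by (rule cf_VY)
  ultimately obtain \<nu> where "\<alpha>' * \<nu> = 1" using unit_cf by force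
  then have "VY * fps_deriv f = \<nu> * (\<alpha>' * (VY * fps_deriv f))" by (simp only: mult.assoc[symmetric] mult.commute[of \<nu>] mult_1)
  also have "\<dots> = (\<nu> * \<kappa>) * f + (- \<nu> * \<beta>) * dzs f" unfolding 3 by (simp add: algebra_simps)
  finally show ?thesis by (rule ideal2I)
qed

text \<open>The series \<open>r - fps_const a * s\<close> is Y times a unit, so Y lies in the ideal
  and only the terms without Y matter.\<close>

lemma division_pair:
  assumes a: "fps_nth r 0 = a * fps_nth s 0" "cf r 1 0 \<noteq> fps_nth a 0 * cf s 1 0" and g: "fps_nth s 0 dvd fps_nth g 0"
  shows "g \<in> ideal2 r s"
proof -
  have "fps_nth (r - fps_const a * s) 0 = 0" using a by simp
  then obtain v where v: "r - fps_const a * s = VY * v" using VY_factor by blast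
  have "cf (r - fps_const a * s) 1 0 = cf v 0 0" unfolding v One_nat_def by (rule cf_VY)
  moreover have "cf (fps_const a * s) 1 0 = fps_nth a 0 * cf s 1 0" by (simp add: cf_def)
  ultimately have "cf v 0 0 = cf r 1 0 - fps_nth a 0 * cf s 1 0" by (simp add: cf_arith)
  then have "cf v 0 0 \<noteq> 0" using a(2) by simp
  then obtain v' where v': "v * v' = 1" using unit_cf by blast
  have "VY = v' * (VY * v)" using v' by (simp only: mult.left_commute[of v'] mult.commute[of v']) simp
  then have Y: "VY \<in> ideal2 r s"
    unfolding v[symmetric] by (metis ideal2_mult ideal2_diff ideal2_gen)
  obtain b where b: "fps_nth g 0 = fps_nth s 0 * b" using g by (elim dvdE)
  have "fps_nth (g - fps_const b * s) 0 = 0" using b by (simp add: mult.commute)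
  then obtain g' where g': "g - fps_const b * s = VY * g'" using VY_factor by blast
  then have "g = fps_const b * s + g' * VY" by (simp add: algebra_simps)
  then show ?thesis using Y by (metis ideal2_mult ideal2_add ideal2_gen(2))
qed

text \<open>Write E = X^n e with a unit e. Then X E' is X^n times a series with constant term n
  e(0), which is invertible in characteristic zero.\<close>

lemma fps_euler_quotient:
  assumes "E \<noteq> (0 :: complex fps)" "fps_nth E 0 = 0"
  shows "\<exists>\<eta>. E = fps_X * \<eta> * fps_deriv E \<and> fps_nth \<eta> 0 = 1 / of_nat (subdegree E)"
proof -
  define n where "n = subdegree E"
  have n: "n > 0" unfolding n_def using assms by (rule subdegree_pos)
  define e where "e = unit_factor E"
  have E: "E = fps_X ^ n * e" by (simp add: n_def e_def subdegree_decompose' mult.commute fps_unit_factor_def fps_shift_times_fps_X_power')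
  have e0: "fps_nth e 0 \<noteq> 0" using assms(1) by (simp add: e_def fps_unit_factor_def n_def)
  define k where "k = of_nat n * e + fps_X * fps_deriv e"
  have "fps_deriv E = of_nat n * fps_X ^ (n - 1) * e + fps_X ^ n * fps_deriv e"
    unfolding E by (simp add: fps_deriv_power fps_of_nat algebra_simps)
  moreover have X: "fps_X ^ n = fps_X * (fps_X ^ (n - 1) :: complex fps)" using n by (cases n) simp_all
  ultimately have E': "fps_deriv E = fps_X ^ (n - 1) * k" unfolding k_def by (simp add: algebra_simps)
  have k0: "fps_nth k 0 = of_nat n * fps_nth e 0" by (simp add: k_def fps_of_nat[symmetric])
  then have ik: "inverse k * k = 1" using n e0 by (simp add: inverse_mult_eq_1)
  have "fps_X * (e * inverse k) * fps_deriv E = (fps_X * fps_X ^ (n - 1)) * e * (inverse k * k)" unfolding E' by (simp only: mult_ac)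
  then have "E = fps_X * (e * inverse k) * fps_deriv E" unfolding ik X[symmetric] by (metis E mult.right_neutral)
  moreover have "fps_nth (e * inverse k) 0 = 1 / of_nat n" using k0 n e0 by (simp add: field_simps)
  ultimately show ?thesis unfolding n_def by blast
qed

text \<open>The restriction of \<open>s\<close> to Y = 0 generates the maximal ideal of
  \<complex>[[Z]], so the coefficients with respect to Y can be reduced to constants one after the
  other.\<close>

lemma weierstrass_division:
  assumes s: "cf s 0 0 = 0" "cf s 0 1 \<noteq> 0"
  shows "\<exists>A C. g = A * s + C \<and> (\<forall>n. \<exists>c. fps_nth C n = fps_const c)"
proof -
  define s\<^sub>0 where "s\<^sub>0 = fps_nth s 0"
  have s0: "fps_nth s\<^sub>0 0 = 0" "fps_nth s\<^sub>0 1 \<noteq> 0" using s by (auto simp: s\<^sub>0_def cf_def)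
  have div: "\<exists>a. p = a * s\<^sub>0" if "fps_nth p 0 = 0" for p
  proof (cases "p = 0")
    case False
    have "subdegree s\<^sub>0 = 1" using s0 by (intro subdegreeI) auto
    moreover have "subdegree p > 0" using False that using subdegree_pos by blast
    ultimately have "s\<^sub>0 dvd p" using False s0 by (subst fps_dvd_iff) auto
    then show ?thesis by (metis dvdE mult.commute)
  qed (auto intro: exI[of _ 0])
  define q where "q g = (SOME a. fps_nth g 0 - fps_const (cf g 0 0) = a * s\<^sub>0)" for g
  have q: "fps_nth g 0 - fps_const (cf g 0 0) = q g * s\<^sub>0" for g
    unfolding q_def by (rule someI_ex, rule div) (simp add: cf_def)
  define step where "step g = fps_shift 1 (g - fps_const (q g) * s - kap (cf g 0 0))" for g
  have step: "g = fps_const (q g) * s + kap (cf g 0 0) + VY * step g" for g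
  proof -
    have "fps_nth (g - fps_const (q g) * s - kap (cf g 0 0)) 0 = 0"
      using q[of g] by (simp add: kap_def s\<^sub>0_def algebra_simps)
    then have "g - fps_const (q g) * s - kap (cf g 0 0) = VY * step g"
      unfolding step_def by (rule VY_shift)
    then show ?thesis by (simp add: algebra_simps)
  qed
  define G where "G n = (step ^^ n) g" for n
  define A where "A k = Abs_fps (\<lambda>n. q (G (n + k)))" for k
  define C where "C k = Abs_fps (\<lambda>n. fps_const (cf (G (n + k)) 0 0))" for k
  have shift: "Abs_fps (\<lambda>n. x (n + k)) = fps_const (x k) + VY * Abs_fps (\<lambda>n. x (n + Suc k))" for x :: "nat \<Rightarrow> complex fps" and k
    by (rule fps_ext) (auto simp: VY_def)
  \<comment> \<open>Each error is Y times the next one, so all of them are divisible by every power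
    of Y.\<close>
  define D where "D k = G k - A k * s - C k" for k
  have D: "D k = VY * D (Suc k)" for k
  proof -
    have "G k = fps_const (q (G k)) * s + kap (cf (G k) 0 0) + VY * G (Suc k)" using step[of "G k"] by (simp add: G_def)
    moreover have "A k = fps_const (q (G k)) + VY * A (Suc k)" unfolding A_def by (rule shift)
    moreover have "C k = kap (cf (G k) 0 0) + VY * C (Suc k)" unfolding C_def kap_def by (rule shift)
    ultimately show ?thesis unfolding D_def by (simp add: algebra_simps)
  qed
  have "fps_nth (D k) m = 0" for k m
  proof (induction m arbitrary: k)
    case 0 show ?case by (subst D) (simp add: VY_def)
  next
    case (Suc m) show ?case by (subst D) (simp add: VY_def Suc)
  qed
  then have "D 0 = 0" by (intro fps_ext) simp
  then have "g = A 0 * s + C 0" by (simp add: D_def G_def algebra_simps)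
  moreover have "\<forall>n. \<exists>c. fps_nth (C 0) n = fps_const c" by (auto simp: C_def)
  ultimately show ?thesis by blast
qed

text \<open>A nonzero series in Y alone is a power of Y times a unit.\<close>

lemma euler_y_only:
  assumes "\<forall>n. \<exists>c. fps_nth C n = fps_const (c::complex)"
  shows "\<exists>b. VY * fps_deriv C = b * C"
proof (cases "C = 0")
  case False
  define k where "k = subdegree C"
  define V where "V = unit_factor C"
  have C: "C = VY ^ k * V" by (simp add: k_def V_def VY_def subdegree_decompose' mult.commute fps_unit_factor_def fps_shift_times_fps_X_power')
  have V0: "fps_nth V 0 \<noteq> 0" using False by (simp add: V_def fps_unit_factor_def k_def)
  obtain c where "fps_nth V 0 = fps_const c" using assms by (auto simp: V_def fps_unit_factor_def)
  then have "cf V 0 0 \<noteq> 0" using V0 by (auto simp: cf_def)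
  then obtain V' where V': "V * V' = 1" using unit_cf by blast
  have dp: "VY * fps_deriv (VY ^ k) = of_nat k * VY ^ k"
    by (induction k) (simp_all add: fd_der algebra_simps)
  have "VY * fps_deriv C = (VY * fps_deriv (VY ^ k)) * V + VY ^ k * VY * fps_deriv V" unfolding C by (simp add: algebra_simps)
  also have "\<dots> = of_nat k * C + VY ^ k * VY * fps_deriv V * (V * V')" unfolding dp V' C by simp
  also have "\<dots> = (of_nat k + VY * fps_deriv V * V') * C" unfolding C by (simp add: algebra_simps)
  finally show ?thesis by blast
qed (auto intro: exI[of _ 0])

text \<open>The critical curve \<open>s = 0\<close> of f in the Z-direction is smooth and
  transversal to the line Y = 0, and f agrees with a series \<open>C\<close> in Y modulo
  \<open>s\<close>. The derivation \<open>\<delta>\<close> annihilates \<open>s\<close>, hence f_y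
  agrees with the derivative of \<open>C\<close> modulo \<open>s\<close>, and Y times the latter is
  a multiple of \<open>C\<close>.\<close>

lemma local_double_tangency:
  assumes "cf f 0 1 = 0" "cf f 0 2 \<noteq> 0"
  shows "VY * fps_deriv f \<in> ideal2 f (dzs f)"
proof -
  define s where "s = dzs f"
  have s: "cf s 0 0 = 0" "cf s 0 1 \<noteq> 0" using assms by (simp_all add: s_def cf_der numeral_2_eq_2)
  obtain A C where AC: "f = A * s + C" and C: "\<forall>n. \<exists>c. fps_nth C n = fps_const c" using weierstrass_division[OF s] by blast
  have Cz: "dzs C = 0"
  proof (rule fps_ext)
    fix n show "fps_nth (dzs C) n = fps_nth 0 n" using C[rule_format, of n] by auto
  qed
  have "cf (dzs s) 0 0 \<noteq> 0" using s(2) by (simp add: cf_der)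
  then obtain w where w: "dzs s * w = 1" using unit_cf by blast
  define \<tau> where "\<tau> = fps_deriv s * w"
  define \<delta> where "\<delta> g = fps_deriv g - \<tau> * dzs g" for g
  have \<delta>m: "\<delta> (a * b) = a * \<delta> b + \<delta> a * b" "\<delta> (a + b) = \<delta> a + \<delta> b" for a b by (simp_all add: \<delta>_def dzs_der fd_der algebra_simps)
  have "\<tau> * dzs s = fps_deriv s * (dzs s * w)" unfolding \<tau>_def by (simp only: mult_ac)
  then have "\<delta> s = 0" unfolding w \<delta>_def by simp
  then have "\<delta> f = \<delta> A * s + fps_deriv C" unfolding arg_cong[OF AC, of \<delta>] \<delta>m by (simp add: \<delta>_def Cz)
  then have fy: "fps_deriv f = fps_deriv C + (\<delta> A + \<tau>) * s" by (simp add: \<delta>_def s_def algebra_simps)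
  obtain b where b: "VY * fps_deriv C = b * C" using euler_y_only[OF C] by blast
  have "C = f - A * s" using AC by simp
  then have bC: "b * C = b * (f - A * s)" by simp
  have "VY * fps_deriv f = b * (f - A * s) + VY * (\<delta> A + \<tau>) * s" unfolding fy distrib_left[of VY "fps_deriv C"] b bC by (simp only: mult.assoc)
  also have "\<dots> = b * f + (VY * (\<delta> A + \<tau>) - b * A) * s" by (simp add: algebra_simps)
  finally show ?thesis unfolding s_def by (rule ideal2I)
qed

text \<open>A nonzero term in Z^2 is treated by \<open>local_double_tangency\<close>. Otherwise f
  has order n \<ge> 3 on the line, and subtracting a suitable multiple of Z f_z from f leaves Y
  times a series \<open>B\<close>. As Y B lies in the ideal, it suffices that f_y lies in (B, f_z),
  which is read off the lowest terms of \<open>B\<close>.\<close>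

theorem local_condition_formal:
  assumes f: "cf f 0 0 = 0" "cf f 0 1 = 0" "fps_nth f 0 \<noteq> 0"
    and c: "cf f 0 2 \<noteq> 0 \<or> cf f 1 0 \<noteq> 0 \<or> cf f 1 1 \<noteq> 0 \<or> (cf f 2 0 \<noteq> 0 \<and> cf f 0 3 \<noteq> 0)"
  shows "VY * fps_deriv f \<in> ideal2 f (dzs f)"
proof (cases "cf f 0 2 = 0")
  case False then show ?thesis by (rule local_double_tangency[OF f(2)])
next
  case f02: True
  define E where "E = fps_nth f 0"
  have E0: "fps_nth E 0 = 0" "fps_nth E 1 = 0" "fps_nth E 2 = 0" using f f02 by (simp_all add: E_def cf_def)
  define n where "n = subdegree E"
  have n3: "n \<ge> 3" unfolding n_def
  proof (rule subdegree_geI)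
    show "E \<noteq> 0" using f by (simp add: E_def)
    fix i :: nat assume "i < 3"
    then have "i = 0 \<or> i = 1 \<or> i = 2" by auto
    then show "fps_nth E i = 0" using E0 by auto
  qed
  obtain \<eta> where \<eta>: "E = fps_X * \<eta> * fps_deriv E" "fps_nth \<eta> 0 = 1 / of_nat n"
    using fps_euler_quotient[of E] f(3) E0 by (auto simp: E_def n_def)
  have "fps_nth (f - VZ * fps_const \<eta> * dzs f) 0 = 0" using \<eta>(1) by (simp add: VZ_def E_def)
  then obtain B where B: "f - VZ * fps_const \<eta> * dzs f = VY * B" using VY_factor by blast
  have Bc: "cf B i j = cf f (Suc i) j - cf (VZ * fps_const \<eta> * dzs f) (Suc i) j" for i j
    using cf_VY(2)[of B i j] unfolding B[symmetric] by (simp add: cf_arith)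
  have Vc: "cf (VZ * fps_const \<eta> * g) i 0 = 0" "cf (VZ * fps_const \<eta> * g) i 1 = cf g i 0 / of_nat n" for i g
  proof -
    have "fps_nth (VZ * fps_const \<eta> * g) i = fps_X * (\<eta> * fps_nth g i)" by (simp add: VZ_def mult.assoc)
    then show "cf (VZ * fps_const \<eta> * g) i 0 = 0" "cf (VZ * fps_const \<eta> * g) i 1 = cf g i 0 / of_nat n"
      by (simp_all add: cf_def fps_mult_nth \<eta>(2))
  qed
  have B1: "cf B 0 0 = cf f 1 0" "cf B 1 0 = cf f 2 0" "cf B 0 1 = cf f 1 1 * (1 - 1 / of_nat n)"
    unfolding Bc One_nat_def[symmetric] Vc by (simp_all add: cf_der numeral_2_eq_2 algebra_simps)
  define I where "I = ideal2 f (dzs f)"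
  have YB: "VY * B \<in> I" unfolding B[symmetric] I_def by (intro ideal2_diff ideal2_mult ideal2_gen)
  have up: "VY * g \<in> I" if "g \<in> ideal2 B (dzs f) \<or> g \<in> ideal2 (dzs f) B" for g
  proof -
    have "ideal2 (dzs f) B \<subseteq> ideal2 B (dzs f)" unfolding ideal2_def by (auto, metis add.commute)
    then have "g \<in> ideal2 B (dzs f)" using that by blast
    then obtain a b where "g = a * B + b * dzs f" by (auto simp: ideal2_def)
    then have "VY * g = a * (VY * B) + (VY * b) * dzs f" by (simp add: algebra_simps)
    then show ?thesis using YB unfolding I_def by (simp add: ideal2_add ideal2_mult ideal2_gen)
  qed
  have E': "fps_nth (dzs f) 0 = fps_deriv E" "fps_deriv E \<noteq> 0" "subdegree (fps_deriv E) = n - 1"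
  proof -
    show "fps_nth (dzs f) 0 = fps_deriv E" by (simp add: E_def)
    show "fps_deriv E \<noteq> 0"
    proof
      assume "fps_deriv E = 0"
      then have "E = 0" using \<eta>(1) by (metis mult_zero_right)
      then show False using f(3) by (simp add: E_def)
    qed
    have "fps_nth E n \<noteq> 0" using f(3) by (simp add: n_def E_def)
    then show "subdegree (fps_deriv E) = n - 1" using n3
      by (intro subdegreeI) (auto simp: n_def intro: nth_less_subdegree_zero)
  qed
  show ?thesis
  proof (cases "cf f 1 0 = 0")
    case False
    then obtain B' where "B * B' = 1" using unit_cf B1(1) by metis
    then have "g = (g * B') * B + 0 * dzs f" for g by (simp add: mult.assoc mult.commute[of B'])
    then have "fps_deriv f \<in> ideal2 B (dzs f)" by (rule ideal2I)
    then show ?thesis using up unfolding I_def by blast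
  next
    case f10: True
    show ?thesis
    proof (cases "cf f 1 1 = 0")
      case False
      \<comment> \<open>As n > 1, the restriction of \<open>B\<close> to the line has order exactly
        one. That of f_z has order at least two, while the coefficient of Y in f_z is nonzero, so
        \<open>division_pair\<close> applies.\<close>
      have "(of_nat n :: complex) \<noteq> 1" "(of_nat n :: complex) \<noteq> 0" using n3 by auto
      then have B01: "cf B 0 1 \<noteq> 0" using False unfolding B1(3) by simp
      have sB: "subdegree (fps_nth B 0) = 1" using B01 B1(1) f10 by (intro subdegreeI) (auto simp: cf_def)
      have nB: "fps_nth B 0 \<noteq> 0" using sB by auto
      have dv: "fps_nth B 0 dvd p" if "fps_nth p 0 = 0" for p
      proof (cases "p = 0")
        case False
        then have "subdegree p > 0" using that using subdegree_pos by blast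
        then show ?thesis using False nB sB by (subst fps_dvd_iff) auto
      qed simp
      have "fps_nth (dzs f) 0 = a * fps_nth B 0 \<Longrightarrow> fps_nth a 0 = 0" for a
      proof -
        assume a: "fps_nth (dzs f) 0 = a * fps_nth B 0"
        have "cf (dzs f) 0 1 = fps_nth a 0 * cf B 0 1" using arg_cong[OF a, of "\<lambda>p. fps_nth p 1"] B1(1) f10
          by (simp add: cf_def fps_mult_nth)
        then show "fps_nth a 0 = 0" using f02 B01 by (simp add: cf_der numeral_2_eq_2)
      qed
      moreover obtain a where "fps_nth (dzs f) 0 = a * fps_nth B 0"
      proof -
        have "fps_nth B 0 dvd fps_nth (dzs f) 0" using f(2) by (intro dv) (simp add: cf_def)
        then show ?thesis using that by (metis dvdE mult.commute)
      qed
      ultimately have "fps_deriv f \<in> ideal2 (dzs f) B"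
        using False f10 by (intro division_pair[of _ a] dv) (auto simp: cf_der, simp add: cf_def)
      then show ?thesis using up unfolding I_def by blast
    next
      case f11: True
      then have c': "cf f 2 0 \<noteq> 0" "cf f 0 3 \<noteq> 0" using c f02 f10 by auto
      \<comment> \<open>Here n = 3, so on the line f_z has order two and divides both
        \<open>B\<close> and f_y; the coefficient of Y in \<open>B\<close> is that of Y^2 in
        f.\<close>
      have "fps_nth E 3 \<noteq> 0" using c'(2) by (simp add: cf_def E_def)
      then have "n \<le> 3" unfolding n_def by (rule subdegree_leI)
      then have n: "n = 3" using n3 by simp
      have dv: "fps_nth (dzs f) 0 dvd p" if "fps_nth p 0 = 0" "fps_nth p 1 = 0" for p
      proof (cases "p = 0")
        case False
        have "subdegree p \<ge> 2"
        proof (rule subdegree_geI[OF False])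
          fix i :: nat assume "i < 2" then have "i = 0 \<or> i = 1" by auto
          then show "fps_nth p i = 0" using that by auto
        qed
        then show ?thesis using False E' n by (subst fps_dvd_iff) auto
      qed simp
      have "fps_nth (dzs f) 0 dvd fps_nth B 0" using B1 f10 f11 by (intro dv) (auto simp: cf_def)
      then obtain a where "fps_nth B 0 = a * fps_nth (dzs f) 0" by (metis dvdE mult.commute)
      then have "fps_deriv f \<in> ideal2 B (dzs f)"
        using f11 f10 c' B1 by (intro division_pair[of _ a] dv) (auto simp: cf_der, simp_all add: cf_def)
      then show ?thesis using up unfolding I_def by blast
    qed
  qed
qed

section \<open>Holomorphic functions of two variables\<close>

abbreviation bid :: "real \<Rightarrow> (complex \<times> complex) set" where "bid R \<equiv> ball 0 R \<times> ball 0 R"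

lemma open_bid: "open (bid R)" by (simp add: open_Times)

lemma holomorphic2_on_subset: "holomorphic2_on g U \<Longrightarrow> V \<subseteq> U \<Longrightarrow> holomorphic2_on g V"
  unfolding holomorphic2_on_def by blast

lemma holomorphic2_on_const: "holomorphic2_on (\<lambda>z. c) U"
  unfolding holomorphic2_on_def by (auto intro!: exI[of _ 0])

lemma holomorphic2_on_fst: "holomorphic2_on fst U"
  unfolding holomorphic2_on_def
  by (rule ballI, rule exI[of _ 1], rule exI[of _ 0]) (auto intro!: derivative_eq_intros)

lemma holomorphic2_on_snd: "holomorphic2_on snd U"
  unfolding holomorphic2_on_def
  by (rule ballI, rule exI[of _ 0], rule exI[of _ 1]) (auto intro!: derivative_eq_intros)

lemma holomorphic2_on_add: assumes "holomorphic2_on g U" "holomorphic2_on h U" shows "holomorphic2_on (\<lambda>z. g z + h z) U"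
  unfolding holomorphic2_on_def
proof
  fix z assume z: "z \<in> U"
  obtain \<alpha> \<beta> \<gamma> \<delta> where "(g has_derivative (\<lambda>h. \<alpha> * fst h + \<beta> * snd h)) (at z)" "(h has_derivative (\<lambda>h. \<gamma> * fst h + \<delta> * snd h)) (at z)"
    using assms z unfolding holomorphic2_on_def by blast
  from has_derivative_add[OF this] have "((\<lambda>z. g z + h z) has_derivative (\<lambda>h. (\<alpha> + \<gamma>) * fst h + (\<beta> + \<delta>) * snd h)) (at z)"
    by (simp add: algebra_simps)
  then show "\<exists>\<alpha> \<beta>. ((\<lambda>z. g z + h z) has_derivative (\<lambda>h. \<alpha> * fst h + \<beta> * snd h)) (at z)" by blast
qed

lemma holomorphic2_on_mult: assumes "holomorphic2_on g U" "holomorphic2_on h U" shows "holomorphic2_on (\<lambda>z. g z * h z) U"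
  unfolding holomorphic2_on_def
proof
  fix z assume z: "z \<in> U"
  obtain \<alpha> \<beta> \<gamma> \<delta> where "(g has_derivative (\<lambda>h. \<alpha> * fst h + \<beta> * snd h)) (at z)" "(h has_derivative (\<lambda>h. \<gamma> * fst h + \<delta> * snd h)) (at z)"
    using assms z unfolding holomorphic2_on_def by blast
  from has_derivative_mult[OF this] have "((\<lambda>z. g z * h z) has_derivative (\<lambda>k. (g z * \<gamma> + \<alpha> * h z) * fst k + (g z * \<delta> + \<beta> * h z) * snd k)) (at z)"
    by (simp add: algebra_simps)
  then show "\<exists>\<alpha> \<beta>. ((\<lambda>z. g z * h z) has_derivative (\<lambda>h. \<alpha> * fst h + \<beta> * snd h)) (at z)" by blast
qed

lemma holomorphic2_on_compose:
  assumes "holomorphic2_on g V" "holomorphic2_on \<phi> U" "holomorphic2_on \<psi> U" "\<And>z. z \<in> U \<Longrightarrow> (\<phi> z, \<psi> z) \<in> V"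
  shows "holomorphic2_on (\<lambda>z. g (\<phi> z, \<psi> z)) U"
  unfolding holomorphic2_on_def
proof
  fix z assume z: "z \<in> U"
  obtain \<alpha> \<beta> \<gamma> \<delta> where d: "(\<phi> has_derivative (\<lambda>h. \<alpha> * fst h + \<beta> * snd h)) (at z)" "(\<psi> has_derivative (\<lambda>h. \<gamma> * fst h + \<delta> * snd h)) (at z)"
    using assms(2,3) z unfolding holomorphic2_on_def by blast
  obtain a b where g: "(g has_derivative (\<lambda>h. a * fst h + b * snd h)) (at (\<phi> z, \<psi> z))"
    using assms(1,4) z unfolding holomorphic2_on_def by blast
  from has_derivative_compose[OF has_derivative_Pair[OF d] g]
  have "((\<lambda>z. g (\<phi> z, \<psi> z)) has_derivative (\<lambda>h. (a * \<alpha> + b * \<gamma>) * fst h + (a * \<beta> + b * \<delta>) * snd h)) (at z)"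
    by (simp add: algebra_simps)
  then show "\<exists>\<alpha> \<beta>. ((\<lambda>z. g (\<phi> z, \<psi> z)) has_derivative (\<lambda>h. \<alpha> * fst h + \<beta> * snd h)) (at z)" by blast
qed

lemma holomorphic2_on_compose1:
  assumes "h holomorphic_on V" "open V" "holomorphic2_on \<phi> U" "\<And>z. z \<in> U \<Longrightarrow> \<phi> z \<in> V"
  shows "holomorphic2_on (\<lambda>z. h (\<phi> z)) U"
  unfolding holomorphic2_on_def
proof
  fix z assume z: "z \<in> U"
  obtain \<alpha> \<beta> where d: "(\<phi> has_derivative (\<lambda>h. \<alpha> * fst h + \<beta> * snd h)) (at z)"
    using assms(3) z unfolding holomorphic2_on_def by blast
  have "(h has_field_derivative deriv h (\<phi> z)) (at (\<phi> z))"
    using assms(1,2) assms(4)[OF z] by (rule holomorphic_derivI)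
  from has_derivative_compose[OF d this[unfolded has_field_derivative_def]]
  have "((\<lambda>z. h (\<phi> z)) has_derivative (\<lambda>k. (deriv h (\<phi> z) * \<alpha>) * fst k + (deriv h (\<phi> z) * \<beta>) * snd k)) (at z)"
    by (simp add: algebra_simps)
  then show "\<exists>\<alpha> \<beta>. ((\<lambda>z. h (\<phi> z)) has_derivative (\<lambda>h. \<alpha> * fst h + \<beta> * snd h)) (at z)" by blast
qed

lemma holomorphic2_on_uminus: "holomorphic2_on g U \<Longrightarrow> holomorphic2_on (\<lambda>z. - g z) U"
  using holomorphic2_on_mult[OF holomorphic2_on_const[of "-1"], of g U] by simp

lemma holomorphic2_on_diff: "holomorphic2_on g U \<Longrightarrow> holomorphic2_on h U \<Longrightarrow> holomorphic2_on (\<lambda>z. g z - h z) U"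
  using holomorphic2_on_add[OF _ holomorphic2_on_uminus, of g U h] by simp

lemma holomorphic2_on_inverse:
  assumes "holomorphic2_on g U" "\<And>z. z \<in> U \<Longrightarrow> g z \<noteq> 0" shows "holomorphic2_on (\<lambda>z. inverse (g z)) U"
  by (rule holomorphic2_on_compose1[of _ "- {0}"]) (use assms in \<open>auto intro!: holomorphic_intros\<close>)

lemmas hol2_intros = holomorphic2_on_const holomorphic2_on_fst holomorphic2_on_snd holomorphic2_on_add
  holomorphic2_on_mult holomorphic2_on_uminus holomorphic2_on_diff

lemma holomorphic2_on_imp_continuous_on: assumes "holomorphic2_on g U" shows "continuous_on U g"
proof (rule continuous_at_imp_continuous_on, rule ballI)
  fix z assume "z \<in> U"
  then obtain \<alpha> \<beta> where "(g has_derivative (\<lambda>h. \<alpha> * fst h + \<beta> * snd h)) (at z)"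
    using assms unfolding holomorphic2_on_def by blast
  then show "isCont g z" by (rule has_derivative_continuous)
qed

lemma has_derivative2_partial:
  assumes "(g has_derivative (\<lambda>h. \<alpha> * fst h + \<beta> * snd h)) (at (y, z))"
  shows "((\<lambda>y. g (y, z)) has_field_derivative \<alpha>) (at y)" "((\<lambda>z. g (y, z)) has_field_derivative \<beta>) (at z)"
proof -
  have "((\<lambda>y. (y, z)) has_derivative (\<lambda>h. (h, 0))) (at y)" by (auto intro!: derivative_eq_intros)
  from has_derivative_compose[OF this assms] show "((\<lambda>y. g (y, z)) has_field_derivative \<alpha>) (at y)"
    by (simp add: has_field_derivative_def)
  have "((\<lambda>z. (y, z)) has_derivative (\<lambda>h. (0, h))) (at z)" by (auto intro!: derivative_eq_intros)
  from has_derivative_compose[OF this assms] show "((\<lambda>z. g (y, z)) has_field_derivative \<beta>) (at z)"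
    by (simp add: has_field_derivative_def)
qed

lemma holomorphic2_on_partial:
  assumes "holomorphic2_on g (bid R)"
  shows "y \<in> ball 0 R \<Longrightarrow> (\<lambda>z. g (y, z)) holomorphic_on ball 0 R" "z \<in> ball 0 R \<Longrightarrow> (\<lambda>y. g (y, z)) holomorphic_on ball 0 R"
proof -
  have d: "\<exists>\<alpha> \<beta>. (g has_derivative (\<lambda>h. \<alpha> * fst h + \<beta> * snd h)) (at (y, z))" if "y \<in> ball 0 R" "z \<in> ball 0 R" for y z
    using assms that unfolding holomorphic2_on_def by blast
  show "(\<lambda>z. g (y, z)) holomorphic_on ball 0 R" if "y \<in> ball 0 R"
    unfolding holomorphic_on_open[OF open_ball] using d[OF that] has_derivative2_partial(2) by blast
  show "(\<lambda>y. g (y, z)) holomorphic_on ball 0 R" if "z \<in> ball 0 R"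
    unfolding holomorphic_on_open[OF open_ball] using d[OF _ that] has_derivative2_partial(1) by blast
qed

lemma germs2_iff: "g \<in> germs2 \<longleftrightarrow> (\<exists>R>0. holomorphic2_on g (bid R))"
proof
  assume "g \<in> germs2"
  then obtain U where U: "open U" "(0, 0) \<in> U" "holomorphic2_on g U" by (auto simp: germs2_def)
  then obtain A B where AB: "open A" "open B" "(0 :: complex) \<in> A" "(0 :: complex) \<in> B" "A \<times> B \<subseteq> U"
    by (elim open_prod_elim) (auto simp: mem_Times_iff)
  then have "open (A \<inter> B)" "0 \<in> A \<inter> B" by auto
  then obtain R where "R > 0" "ball 0 R \<subseteq> A \<inter> B" by (meson openE)
  then have "R > 0 \<and> holomorphic2_on g (bid R)" using AB(5) U(3) by (blast intro: holomorphic2_on_subset)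
  then show "\<exists>R>0. holomorphic2_on g (bid R)" by blast
next
  assume "\<exists>R>0. holomorphic2_on g (bid R)"
  then show "g \<in> germs2" unfolding germs2_def using open_bid by fastforce
qed

section \<open>Cauchy integrals over a product of two circles\<close>

lemma norm_circlepath: "r \<ge> 0 \<Longrightarrow> norm (circlepath 0 r t) = r"
  by (simp add: circlepath norm_mult norm_exp_eq_Re)

lemma continuous_on_circlepath: "continuous_on S (circlepath 0 r)"
  unfolding circlepath by (intro continuous_intros)

text \<open>The velocity of the circle c is 2 pi i times c, which cancels the constant of Cauchy's
  formula and leaves the kernel c/(c - w).\<close>

lemma cauchy_kernel:
  assumes "f holomorphic_on cball 0 r" "norm w < r"
  shows "integral {0..1} (\<lambda>t. f (circlepath 0 r t) * (circlepath 0 r t / (circlepath 0 r t - w))) = f w"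
proof -
  have "((\<lambda>u. f u / (u - w)) has_contour_integral (2 * of_real pi * \<i> * f w)) (circlepath 0 r)"
    using assms by (intro Cauchy_integral_circlepath_simple) auto
  then have "((\<lambda>t. f (circlepath 0 r t) / (circlepath 0 r t - w) * vector_derivative (circlepath 0 r) (at t within {0..1}))
     has_integral (2 * of_real pi * \<i> * f w)) {0..1}" unfolding has_contour_integral_def .
  then have "((\<lambda>t. (2 * of_real pi * \<i>) * (f (circlepath 0 r t) * (circlepath 0 r t / (circlepath 0 r t - w))))
     has_integral (2 * of_real pi * \<i> * f w)) {0..1}"
    by (rule has_integral_eq[rotated]) (simp add: vector_derivative_circlepath01, simp add: circlepath)
  from has_integral_mult_right[OF this, of "1 / (2 * of_real pi * \<i>)"]
  have "((\<lambda>t. f (circlepath 0 r t) * (circlepath 0 r t / (circlepath 0 r t - w))) has_integral f w) {0..1}" by simp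
  then show ?thesis by (rule integral_unique)
qed

text \<open>The double Cauchy integral over a product of circles, with the two kernels left abstract so that it can be differentiated.\<close>

definition torus_integral :: "(real \<times> real \<Rightarrow> complex) \<Rightarrow> (real \<Rightarrow> complex \<Rightarrow> complex) \<Rightarrow> (real \<Rightarrow> complex \<Rightarrow> complex) \<Rightarrow> complex \<times> complex \<Rightarrow> complex" where
  "torus_integral W A B x = integral (cbox (0, 0) (1, 1)) (\<lambda>t. W t * A (fst t) (fst x) * B (snd t) (snd x))"

text \<open>Differentiation under the integral sign in both variables at once. The derivative of the
  integrand is assembled in \<open>fx\<close> as a bounded linear map because
  \<open>leibniz_rule\<close> expects it in this form.\<close>

lemma torus_integral_deriv:
  assumes W: "continuous_on (cbox (0, 0) (1, 1)) W"
    and A: "\<And>s y. s \<in> {0..1} \<Longrightarrow> y \<in> ball 0 r \<Longrightarrow> (A s has_field_derivative A' s y) (at y)"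
    and B: "\<And>s y. s \<in> {0..1} \<Longrightarrow> y \<in> ball 0 r \<Longrightarrow> (B s has_field_derivative B' s y) (at y)"
    and cA: "continuous_on ({0..1} \<times> ball 0 r) (\<lambda>x. A (fst x) (snd x))" "continuous_on ({0..1} \<times> ball 0 r) (\<lambda>x. A' (fst x) (snd x))"
    and cB: "continuous_on ({0..1} \<times> ball 0 r) (\<lambda>x. B (fst x) (snd x))" "continuous_on ({0..1} \<times> ball 0 r) (\<lambda>x. B' (fst x) (snd x))"
    and x: "x \<in> bid r"
  shows "(torus_integral W A B has_derivative (\<lambda>h. torus_integral W A' B x * fst h + torus_integral W A B' x * snd h)) (at x)"
proof -
  let ?C = "cbox (0, 0) (1 :: real, 1 :: real)"
  define a where "a x t = W t * A' (fst t) (fst x) * B (snd t) (snd x)" for x :: "complex \<times> complex" and t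
  define b where "b x t = W t * A (fst t) (fst x) * B' (snd t) (snd x)" for x :: "complex \<times> complex" and t
  define fx where "fx x t = (blinfun_mult_right (a x t) o\<^sub>L fst_blinfun) + (blinfun_mult_right (b x t) o\<^sub>L snd_blinfun)" for x t
  have C: "?C = {0..1} \<times> {0..1}" by (auto simp: cbox_Pair_eq)
  have fxa: "blinfun_apply (fx x t) h = a x t * fst h + b x t * snd h" for x t h
    by (simp add: fx_def blinfun.add_left)
  have kf: "continuous_on (bid r \<times> ?C) (\<lambda>p. K (fst (snd p)) (fst (fst p)))"
    if "continuous_on ({0..1} \<times> ball 0 r) (\<lambda>x. K (fst x) (snd x))" for K :: "real \<Rightarrow> complex \<Rightarrow> complex"
  proof -
    have "continuous_on (bid r \<times> ?C) (\<lambda>p. (\<lambda>x. K (fst x) (snd x)) (fst (snd p), fst (fst p)))"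
      by (rule continuous_on_compose2[OF that]) (auto simp: C intro!: continuous_intros)
    then show ?thesis by simp
  qed
  have ks: "continuous_on (bid r \<times> ?C) (\<lambda>p. K (snd (snd p)) (snd (fst p)))"
    if "continuous_on ({0..1} \<times> ball 0 r) (\<lambda>x. K (fst x) (snd x))" for K :: "real \<Rightarrow> complex \<Rightarrow> complex"
  proof -
    have "continuous_on (bid r \<times> ?C) (\<lambda>p. (\<lambda>x. K (fst x) (snd x)) (snd (snd p), snd (fst p)))"
      by (rule continuous_on_compose2[OF that]) (auto simp: C intro!: continuous_intros)
    then show ?thesis by simp
  qed
  have kW: "continuous_on (bid r \<times> ?C) (\<lambda>p. W (snd p))"
    by (rule continuous_on_compose2[OF W]) (auto intro!: continuous_intros)
  have ca: "continuous_on (bid r \<times> ?C) (\<lambda>p. a (fst p) (snd p))" and cb: "continuous_on (bid r \<times> ?C) (\<lambda>p. b (fst p) (snd p))"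
    unfolding a_def b_def by (intro continuous_on_mult kW kf ks cA cB)+
  have cfx: "continuous_on (bid r \<times> ?C) (\<lambda>(x, t). fx x t)"
    unfolding fx_def case_prod_unfold
    by (intro continuous_intros bounded_linear.continuous_on[OF bounded_linear_blinfun_mult_right] ca cb)
  have c0: "continuous_on (bid r \<times> ?C) (\<lambda>p. W (snd p) * A (fst (snd p)) (fst (fst p)) * B (snd (snd p)) (snd (fst p)))"
    by (intro continuous_on_mult kW kf ks cA cB)
  have sl: "continuous_on ?C (\<lambda>t. k (x, t))" if "continuous_on (bid r \<times> ?C) k" "x \<in> bid r" for k :: "_ \<Rightarrow> 'z::topological_space" and x
    by (rule continuous_on_compose2[OF that(1)]) (use that(2) in \<open>auto intro!: continuous_intros\<close>)
  have L: "((\<lambda>x. integral ?C (\<lambda>t. W t * A (fst t) (fst x) * B (snd t) (snd x))) has_derivative integral ?C (fx x)) (at x within bid r)"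
  proof (rule leibniz_rule)
    fix x t assume xt: "x \<in> bid r" "t \<in> ?C"
    then have "(A (fst t) has_field_derivative A' (fst t) (fst x)) (at (fst x))" "(B (snd t) has_field_derivative B' (snd t) (snd x)) (at (snd x))"
      using A B by (auto simp: C)
    then have d: "((\<lambda>x. A (fst t) (fst x)) has_derivative (\<lambda>h. A' (fst t) (fst x) * fst h)) (at x)"
       "((\<lambda>x. B (snd t) (snd x)) has_derivative (\<lambda>h. B' (snd t) (snd x) * snd h)) (at x)"
      unfolding has_field_derivative_def
      by (auto intro: has_derivative_compose[OF has_derivative_fst[OF has_derivative_ident]] has_derivative_compose[OF has_derivative_snd[OF has_derivative_ident]])
    have "((\<lambda>x. W t * A (fst t) (fst x) * B (snd t) (snd x)) has_derivative blinfun_apply (fx x t)) (at x)"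
      unfolding fxa[abs_def] by (rule derivative_eq_intros d refl)+ (simp add: a_def b_def algebra_simps)
    then show "((\<lambda>x. W t * A (fst t) (fst x) * B (snd t) (snd x)) has_derivative blinfun_apply (fx x t)) (at x within bid r)"
      by (rule has_derivative_at_withinI)
  next
    fix x assume "x \<in> bid r"
    from sl[OF c0 this] show "(\<lambda>t. W t * A (fst t) (fst x) * B (snd t) (snd x)) integrable_on ?C"
      by (intro integrable_continuous) simp
  qed (use cfx x in \<open>auto intro: convex_Times\<close>)
  have fi: "fx x integrable_on ?C"
    using sl[OF cfx x] by (intro integrable_continuous) simp
  have "blinfun_apply (integral ?C (fx x)) h = torus_integral W A' B x * fst h + torus_integral W A B' x * snd h" for h
  proof -
    have "blinfun_apply (integral ?C (fx x)) h = integral ?C (\<lambda>t. blinfun_apply (fx x t) h)"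
      using integral_linear[OF fi blinfun.bounded_linear_left[of h]] by (simp add: o_def)
    also have "\<dots> = integral ?C (\<lambda>t. a x t * fst h) + integral ?C (\<lambda>t. b x t * snd h)"
      unfolding fxa by (intro integral_add integrable_continuous continuous_intros sl[OF ca x, simplified] sl[OF cb x, simplified])
    finally show ?thesis by (simp add: torus_integral_def a_def b_def)
  qed
  then have e: "blinfun_apply (integral ?C (fx x)) = (\<lambda>h. torus_integral W A' B x * fst h + torus_integral W A B' x * snd h)" by blast
  have "torus_integral W A B = (\<lambda>x. integral ?C (\<lambda>t. W t * A (fst t) (fst x) * B (snd t) (snd x)))"
    by (simp add: torus_integral_def fun_eq_iff)
  then show ?thesis using L x unfolding e by (simp add: at_within_open[OF _ open_bid])
qed

text \<open>Cauchy's formula in each variable separately, joined by Fubini's theorem for continuous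
  integrands.\<close>

lemma double_cauchy:
  assumes g: "holomorphic2_on g (bid R)" and r: "0 < r" "r < R" and x: "x \<in> bid r"
  defines "W \<equiv> \<lambda>t. g (circlepath 0 r (fst t), circlepath 0 r (snd t))"
    and "A \<equiv> \<lambda>s y. circlepath 0 r s / (circlepath 0 r s - y)"
  shows "g x = torus_integral W A A x" "continuous_on (cbox (0, 0) (1, 1)) W"
proof -
  have gc: "continuous_on (bid R) g" by (rule holomorphic2_on_imp_continuous_on[OF g])
  have inR: "circlepath 0 r s \<in> ball 0 R" for s using r by (simp add: norm_circlepath)
  show W: "continuous_on (cbox (0, 0) (1, 1)) W" unfolding W_def
    by (rule continuous_on_compose2[OF gc])
      (use inR in \<open>auto intro!: continuous_intros continuous_on_compose2[OF continuous_on_circlepath[of UNIV]]\<close>)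
  have ne: "circlepath 0 r s \<noteq> y" if "y \<in> ball 0 r" for s y using norm_circlepath[of r s] r that by auto
  obtain y z where yz: "x = (y, z)" "y \<in> ball 0 r" "z \<in> ball 0 r" using x by auto
  have cA: "continuous_on S (\<lambda>s. A s w)" if "w \<in> ball 0 r" for w S
    unfolding A_def using ne[OF that] by (intro continuous_intros continuous_on_circlepath) auto
  have c: "continuous_on (cbox (0, 0) (1, 1)) (\<lambda>t. W t * A (fst t) y * A (snd t) z)"
    by (intro continuous_on_mult W continuous_on_compose2[OF cA[of _ UNIV]] yz continuous_intros) auto
  have "torus_integral W A A x = integral (cbox 0 1) (\<lambda>s. integral (cbox 0 1) (\<lambda>t. W (s, t) * A s y * A t z))"
    unfolding torus_integral_def yz(1) fst_conv snd_conv by (subst integral_prod_continuous[OF c]) simp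
  also have "\<dots> = integral {0..1} (\<lambda>s. g (circlepath 0 r s, z) * A s y)"
  proof (simp, rule integral_cong)
    fix s :: real assume "s \<in> {0..1}"
    have "integral {0..1} (\<lambda>t. W (s, t) * A s y * A t z) = A s y * integral {0..1} (\<lambda>t. g (circlepath 0 r s, circlepath 0 r t) * A t z)"
      unfolding integral_mult_right[symmetric] by (rule integral_cong) (simp add: W_def)
    also have "integral {0..1} (\<lambda>t. g (circlepath 0 r s, circlepath 0 r t) * A t z) = g (circlepath 0 r s, z)"
      unfolding A_def
      by (rule cauchy_kernel, rule holomorphic_on_subset[OF holomorphic2_on_partial(1)[OF g inR]]) (use r yz in auto)
    finally show "integral {0..1} (\<lambda>t. W (s, t) * A s y * A t z) = g (circlepath 0 r s, z) * A s y" by simp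
  qed
  also have "\<dots> = g (y, z)" unfolding A_def
    by (rule cauchy_kernel, rule holomorphic_on_subset[OF holomorphic2_on_partial(2)[OF g]]) (use r yz in auto)
  finally show "g x = torus_integral W A A x" by (simp add: yz)
qed

lemma kernel_facts:
  assumes r: "0 < r" and s: "s \<in> {0..1 :: real}" and y: "y \<in> ball 0 r"
  shows "((\<lambda>y. 1 / (circlepath 0 r s - y)) has_field_derivative 1 / (circlepath 0 r s - y)\<^sup>2) (at y)"
    "((\<lambda>y. circlepath 0 r s / (circlepath 0 r s - y)) has_field_derivative circlepath 0 r s / (circlepath 0 r s - y)\<^sup>2) (at y)"
    "((\<lambda>y. circlepath 0 r s / (circlepath 0 r s - y)\<^sup>2) has_field_derivative 2 * circlepath 0 r s / (circlepath 0 r s - y) ^ 3) (at y)"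
proof -
  have ne: "circlepath 0 r s - y \<noteq> 0" using norm_circlepath[of r s] r y by auto
  show "((\<lambda>y. 1 / (circlepath 0 r s - y)) has_field_derivative 1 / (circlepath 0 r s - y)\<^sup>2) (at y)"
    "((\<lambda>y. circlepath 0 r s / (circlepath 0 r s - y)) has_field_derivative circlepath 0 r s / (circlepath 0 r s - y)\<^sup>2) (at y)"
    using ne by (auto intro!: derivative_eq_intros simp: power2_eq_square)
  show "((\<lambda>y. circlepath 0 r s / (circlepath 0 r s - y)\<^sup>2) has_field_derivative 2 * circlepath 0 r s / (circlepath 0 r s - y) ^ 3) (at y)"
  proof -
    have "((\<lambda>w. a / w\<^sup>2) has_field_derivative - 2 * a / w ^ 3) (at w)" if "w \<noteq> 0" for a w :: complex
      using that by (auto intro!: derivative_eq_intros simp: power2_eq_square power3_eq_cube divide_simps)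
    from this[OF ne, of "circlepath 0 r s"] show ?thesis
      by (rule DERIV_chain2[where g = "\<lambda>y. circlepath 0 r s - y" and Db = "- 1", THEN DERIV_cong])
        (auto intro!: derivative_eq_intros)
  qed
qed

lemma kernel_continuous:
  assumes r: "0 < r"
  shows "continuous_on ({0..1} \<times> ball 0 r) (\<lambda>x. 1 / (circlepath 0 r (fst x) - snd x))"
    "continuous_on ({0..1} \<times> ball 0 r) (\<lambda>x. 1 / (circlepath 0 r (fst x) - snd x)\<^sup>2)"
    "continuous_on ({0..1} \<times> ball 0 r) (\<lambda>x. circlepath 0 r (fst x) / (circlepath 0 r (fst x) - snd x))"
    "continuous_on ({0..1} \<times> ball 0 r) (\<lambda>x. circlepath 0 r (fst x) / (circlepath 0 r (fst x) - snd x)\<^sup>2)"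
    "continuous_on ({0..1} \<times> ball 0 r) (\<lambda>x. 2 * circlepath 0 r (fst x) / (circlepath 0 r (fst x) - snd x) ^ 3)"
proof -
  have ne: "circlepath 0 r s \<noteq> y" if "norm y < r" for s y using norm_circlepath[of r s] r that by auto
  show "continuous_on ({0..1} \<times> ball 0 r) (\<lambda>x. 1 / (circlepath 0 r (fst x) - snd x))"
    "continuous_on ({0..1} \<times> ball 0 r) (\<lambda>x. 1 / (circlepath 0 r (fst x) - snd x)\<^sup>2)"
    "continuous_on ({0..1} \<times> ball 0 r) (\<lambda>x. circlepath 0 r (fst x) / (circlepath 0 r (fst x) - snd x))"
    "continuous_on ({0..1} \<times> ball 0 r) (\<lambda>x. circlepath 0 r (fst x) / (circlepath 0 r (fst x) - snd x)\<^sup>2)"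
    "continuous_on ({0..1} \<times> ball 0 r) (\<lambda>x. 2 * circlepath 0 r (fst x) / (circlepath 0 r (fst x) - snd x) ^ 3)"
    using ne by (auto intro!: continuous_intros continuous_on_compose2[OF continuous_on_circlepath[of UNIV]])
qed

text \<open>Differentiability alone says nothing about the regularity of a partial derivative. The
  double Cauchy formula moves the dependence on the point into the kernels, which can be
  differentiated twice.\<close>

lemma holomorphic2_on_dz:
  assumes g: "holomorphic2_on g (bid R)"
  shows "holomorphic2_on (\<lambda>x. deriv (\<lambda>z. g (fst x, z)) (snd x)) (bid R)"
  unfolding holomorphic2_on_def
proof
  fix x assume x: "x \<in> bid R"
  define r where "r = (max (norm (fst x)) (norm (snd x)) + R) / 2"
  have r: "0 < r" "r < R" "x \<in> bid r"
  proof -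
    have n: "norm (fst x) < R" "norm (snd x) < R" using x by auto
    then have "norm (fst x) < R" by simp
    moreover have "0 \<le> norm (fst x)" by simp
    ultimately have "0 < R" by linarith
    then show "0 < r" unfolding r_def by (auto simp: max_def intro!: add_nonneg_pos)
    show "r < R" "x \<in> bid r" using n unfolding r_def mem_Times_iff by (auto simp: max_def)
  qed
  define c where "c = circlepath 0 r"
  define W where "W = (\<lambda>t. g (c (fst t), c (snd t)))"
  define A where "A = (\<lambda>s y. c s / (c s - y))"
  define A' where "A' = (\<lambda>s y. c s / (c s - y)\<^sup>2)"
  define A'' where "A'' = (\<lambda>s y. 2 * c s / (c s - y) ^ 3)"
  have cW: "continuous_on (cbox (0, 0) (1, 1)) W" and ge: "\<And>x. x \<in> bid r \<Longrightarrow> g x = torus_integral W A A x"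
    using double_cauchy(1)[OF g r(1,2)] double_cauchy(2)[OF g r] unfolding W_def A_def c_def by blast+
  note kf = kernel_facts[OF r(1), folded c_def] and kc = kernel_continuous[OF r(1), folded c_def]
  have d1: "(torus_integral W A A has_derivative (\<lambda>h. torus_integral W A' A x * fst h + torus_integral W A A' x * snd h)) (at x)" if "x \<in> bid r" for x
    by (rule torus_integral_deriv[OF cW _ _ _ _ _ _ that]) (simp_all add: A_def A'_def kf kc)
  have d2: "(torus_integral W A A' has_derivative (\<lambda>h. torus_integral W A' A' x * fst h + torus_integral W A A'' x * snd h)) (at x)" if "x \<in> bid r" for x
    by (rule torus_integral_deriv[OF cW _ _ _ _ _ _ that]) (simp_all add: A_def A'_def A''_def kf kc)
  have "torus_integral W A A' x = deriv (\<lambda>z. g (fst x, z)) (snd x)" if x: "x \<in> bid r" for x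
  proof -
    have "(g has_derivative (\<lambda>h. torus_integral W A' A x * fst h + torus_integral W A A' x * snd h)) (at x)"
      by (rule has_derivative_transform_within_open[OF d1[OF x] open_bid x]) (simp add: ge)
    then have "((\<lambda>z. g (fst x, z)) has_field_derivative torus_integral W A A' x) (at (snd x))"
      by (intro has_derivative2_partial(2)) simp
    then show ?thesis by (rule DERIV_imp_deriv[symmetric])
  qed
  then have "((\<lambda>x. deriv (\<lambda>z. g (fst x, z)) (snd x)) has_derivative (\<lambda>h. torus_integral W A' A' x * fst h + torus_integral W A A'' x * snd h)) (at x)"
    by (intro has_derivative_transform_within_open[OF d2[OF r(3)] open_bid r(3)])
  then show "\<exists>\<alpha> \<beta>. ((\<lambda>x. deriv (\<lambda>z. g (fst x, z)) (snd x)) has_derivative (\<lambda>h. \<alpha> * fst h + \<beta> * snd h)) (at x)" by blast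
qed

text \<open>The difference quotient is again a torus integral, since c/(c - y) - 1 = y/(c -
  y).\<close>

lemma holomorphic2_hadamard:
  assumes g: "holomorphic2_on g (bid R)" and r: "0 < r" "r < R"
  shows "\<exists>k. holomorphic2_on k (bid r) \<and> (\<forall>y z. (y, z) \<in> bid r \<longrightarrow> g (y, z) = g (0, z) + y * k (y, z))"
proof -
  define c where "c = circlepath 0 r"
  define W where "W = (\<lambda>t. g (c (fst t), c (snd t)))"
  define A where "A = (\<lambda>s y. c s / (c s - y))"
  define A' where "A' = (\<lambda>s y. c s / (c s - y)\<^sup>2)"
  define B where "B = (\<lambda>s y. 1 / (c s - y))"
  define B' where "B' = (\<lambda>s y. 1 / (c s - y)\<^sup>2)"
  have 0: "(0, 0) \<in> bid r" using r by simp
  have cW: "continuous_on (cbox (0, 0) (1, 1)) W" and ge: "\<And>x. x \<in> bid r \<Longrightarrow> g x = torus_integral W A A x"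
    using double_cauchy(1)[OF g r] double_cauchy(2)[OF g r 0] unfolding W_def A_def c_def by blast+
  note kf = kernel_facts[OF r(1), folded c_def] and kc = kernel_continuous[OF r(1), folded c_def]
  have "(torus_integral W B A has_derivative (\<lambda>h. torus_integral W B' A x * fst h + torus_integral W B A' x * snd h)) (at x)" if "x \<in> bid r" for x
    by (rule torus_integral_deriv[OF cW _ _ _ _ _ _ that]) (simp_all add: A_def A'_def B_def B'_def kf kc)
  then have "holomorphic2_on (torus_integral W B A) (bid r)" unfolding holomorphic2_on_def by blast
  moreover have "g (y, z) = g (0, z) + y * torus_integral W B A (y, z)" if yz: "(y, z) \<in> bid r" for y z
  proof -
    have ne: "c s \<noteq> w" if "norm w < r" for s w using norm_circlepath[of r s] r that by (auto simp: c_def)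
    have cc: "continuous_on S (\<lambda>t. c (f t))" if "continuous_on S f" for S :: "(real \<times> real) set" and f
      unfolding c_def by (rule continuous_on_compose2[OF continuous_on_circlepath[of UNIV] that]) auto
    have cB: "continuous_on S (\<lambda>t. B (fst t) w)" "continuous_on S (\<lambda>t. A (fst t) w)" "continuous_on S (\<lambda>t. A (snd t) w)"
      if "norm w < r" for S :: "(real \<times> real) set" and w
      unfolding A_def B_def using ne[OF that] by (auto intro!: continuous_intros cc)
    have n: "norm y < r" "norm z < r" using yz by auto
    have "torus_integral W A A (y, z) - torus_integral W A A (0, z) =
      integral (cbox (0, 0) (1, 1)) (\<lambda>t. W t * A (fst t) y * A (snd t) z - W t * A (fst t) 0 * A (snd t) z)"
      unfolding torus_integral_def fst_conv snd_conv using r n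
      by (intro integral_diff[symmetric] integrable_continuous continuous_on_mult cW cB) auto
    also have "\<dots> = integral (cbox (0, 0) (1, 1)) (\<lambda>t. y * (W t * B (fst t) y * A (snd t) z))"
    proof (rule integral_cong)
      fix t :: "real \<times> real"
      have "A (fst t) y - A (fst t) 0 = y * B (fst t) y" using ne[OF n(1), of "fst t"] ne[of 0 "fst t"] r
        by (simp add: A_def B_def field_simps)
      then show "W t * A (fst t) y * A (snd t) z - W t * A (fst t) 0 * A (snd t) z = y * (W t * B (fst t) y * A (snd t) z)"
        by (metis (no_types, opaque_lifting) left_diff_distrib mult.assoc mult.left_commute right_diff_distrib')
    qed
    finally show ?thesis using ge[of "(y, z)"] ge[of "(0, z)"] yz r
      by (simp add: torus_integral_def algebra_simps)
  qed
  ultimately show ?thesis by blast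
qed

section \<open>Taylor series of germs\<close>

lemma E_add: "f analytic_on {0} \<Longrightarrow> g analytic_on {0} \<Longrightarrow> fps_expansion (\<lambda>z. f z + g z) 0 = fps_expansion f 0 + fps_expansion g 0"
  by (rule fps_expansion_eqI) (intro has_fps_expansion_add analytic_at_imp_has_fps_expansion_0)

lemma E_mult: "f analytic_on {0} \<Longrightarrow> g analytic_on {0} \<Longrightarrow> fps_expansion (\<lambda>z. f z * g z) 0 = fps_expansion f 0 * fps_expansion g 0"
  by (rule fps_expansion_eqI) (intro has_fps_expansion_mult analytic_at_imp_has_fps_expansion_0)

lemma E_const: "fps_expansion (\<lambda>z. c) 0 = fps_const c" by (rule fps_expansion_eqI) simp
lemma E_id: "fps_expansion (\<lambda>z. z) 0 = fps_X" by (rule fps_expansion_eqI) (rule has_fps_expansion_fps_X)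

lemma E_nth: "fps_nth (fps_expansion f 0) 0 = f 0" "fps_nth (fps_expansion f 0) (Suc 0) = deriv f 0"
  by (simp_all add: fps_expansion_def)

lemma analytic_at_0I: "f holomorphic_on ball 0 R \<Longrightarrow> R > 0 \<Longrightarrow> f analytic_on {0}"
  using analytic_at[of f 0] open_ball centre_in_ball by blast

text \<open>Column \<open>k\<close> is the function of \<open>y\<close> that multiplies \<open>z\<^sup>k\<close> in the expansion of \<open>g (y, z)\<close>.\<close>

definition tcol :: "nat \<Rightarrow> (complex \<times> complex \<Rightarrow> complex) \<Rightarrow> complex \<Rightarrow> complex" where
  "tcol k g y = fps_nth (fps_expansion (\<lambda>z. g (y, z)) 0) k"

definition tay :: "(complex \<times> complex \<Rightarrow> complex) \<Rightarrow> ser2" where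
  "tay g = Abs_fps (\<lambda>i. Abs_fps (\<lambda>k. fps_nth (fps_expansion (tcol k g) 0) i))"

lemma cf_tay: "cf (tay g) i k = fps_nth (fps_expansion (tcol k g) 0) i" by (simp add: cf_def tay_def)

lemma ser2_eqI: "(\<And>i k. cf f i k = cf g i k) \<Longrightarrow> f = g" unfolding cf_def by (intro fps_ext)

lemma holomorphic2_on_higher_dz:
  assumes "holomorphic2_on g (bid R)" shows "holomorphic2_on (\<lambda>x. (deriv ^^ k) (\<lambda>z. g (fst x, z)) (snd x)) (bid R)"
proof (induction k)
  case (Suc k)
  from holomorphic2_on_dz[OF Suc] show ?case by (simp add: eta_contract_eq)
qed (use assms in simp)

lemma tcol_holomorphic: assumes "holomorphic2_on g (bid R)" "R > 0" shows "tcol k g holomorphic_on ball 0 R"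
proof -
  have "(\<lambda>y. (deriv ^^ k) (\<lambda>z. g (y, z)) 0) holomorphic_on ball 0 R"
    using holomorphic2_on_partial(2)[OF holomorphic2_on_higher_dz[OF assms(1)], of 0] assms(2) by simp
  then have "(\<lambda>y. (deriv ^^ k) (\<lambda>z. g (y, z)) 0 / fact k) holomorphic_on ball 0 R" by (intro holomorphic_intros) auto
  then show ?thesis by (simp add: tcol_def[abs_def] fps_expansion_def)
qed

lemma germs2_tcol: "g \<in> germs2 \<Longrightarrow> tcol k g analytic_on {0}"
  unfolding germs2_iff using tcol_holomorphic analytic_at_0I by blast

lemma germs2_common:
  assumes "g \<in> germs2" "h \<in> germs2" obtains R where "R > 0" "holomorphic2_on g (bid R)" "holomorphic2_on h (bid R)"
proof -
  obtain R S where "R > 0" "holomorphic2_on g (bid R)" "S > 0" "holomorphic2_on h (bid S)" using assms unfolding germs2_iff by blast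
  moreover have "bid (min R S) \<subseteq> bid R" "bid (min R S) \<subseteq> bid S" by auto
  ultimately show ?thesis using that[of "min R S"] by (auto intro: holomorphic2_on_subset)
qed

lemma germs2_add: "g \<in> germs2 \<Longrightarrow> h \<in> germs2 \<Longrightarrow> (\<lambda>x. g x + h x) \<in> germs2"
  by (erule germs2_common, assumption) (auto simp: germs2_iff intro: holomorphic2_on_add)
lemma germs2_mult: "g \<in> germs2 \<Longrightarrow> h \<in> germs2 \<Longrightarrow> (\<lambda>x. g x * h x) \<in> germs2"
  by (erule germs2_common, assumption) (auto simp: germs2_iff intro: holomorphic2_on_mult)
lemma germs2_gen: "(\<lambda>x. c) \<in> germs2" "fst \<in> germs2" "snd \<in> germs2"
  unfolding germs2_iff by (auto intro!: exI[of _ 1] hol2_intros)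

lemma nhds00: "(\<forall>\<^sub>F x in nhds (0, 0). P x) \<longleftrightarrow> (\<exists>R>0. \<forall>x\<in>bid R. P (x :: complex \<times> complex))"
proof
  assume "\<forall>\<^sub>F x in nhds (0, 0). P x"
  then obtain U where U: "open U" "(0, 0) \<in> U" "\<forall>x\<in>U. P x" by (auto simp: eventually_nhds)
  then obtain A B where AB: "open A" "open B" "(0 :: complex) \<in> A" "(0 :: complex) \<in> B" "A \<times> B \<subseteq> U"
    by (elim open_prod_elim) (auto simp: mem_Times_iff)
  then have "open (A \<inter> B)" "0 \<in> A \<inter> B" by auto
  then obtain R where "R > 0" "ball 0 R \<subseteq> A \<inter> B" by (meson openE)
  then show "\<exists>R>0. \<forall>x\<in>bid R. P x" using AB(5) U(3) by blast
next
  assume "\<exists>R>0. \<forall>x\<in>bid R. P x"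
  then show "\<forall>\<^sub>F x in nhds (0, 0). P x" unfolding eventually_nhds using open_bid by fastforce
qed

lemma nhds0: "(\<forall>\<^sub>F x in nhds 0. P x) \<longleftrightarrow> (\<exists>R>0. \<forall>x\<in>ball 0 R. P (x :: complex))"
  by (auto simp: eventually_nhds_metric dist_norm)

lemma tay_cong: assumes "\<forall>\<^sub>F x in nhds (0, 0). g x = h x" shows "tay g = tay h"
proof -
  obtain R where R: "R > 0" "\<forall>x\<in>bid R. g x = h x" using assms unfolding nhds00 by blast
  have "tcol k g y = tcol k h y" if "y \<in> ball 0 R" for y k
    unfolding tcol_def using R that by (intro arg_cong2[of _ _ _ _ fps_nth] fps_expansion_cong refl) (auto simp: nhds0)
  then have "fps_expansion (tcol k g) 0 = fps_expansion (tcol k h) 0" for k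
    using R(1) by (intro fps_expansion_cong) (auto simp: nhds0)
  then show ?thesis by (simp add: tay_def)
qed

lemma tay_add: assumes "g \<in> germs2" "h \<in> germs2" shows "tay (\<lambda>x. g x + h x) = tay g + tay h"
proof (rule ser2_eqI)
  fix i k
  obtain R where R: "R > 0" "holomorphic2_on g (bid R)" "holomorphic2_on h (bid R)" using germs2_common[OF assms] .
  have "tcol k (\<lambda>x. g x + h x) y = tcol k g y + tcol k h y" if "y \<in> ball 0 R" for y
    using R that by (simp add: tcol_def E_add analytic_at_0I[OF holomorphic2_on_partial(1)])
  then have "fps_expansion (tcol k (\<lambda>x. g x + h x)) 0 = fps_expansion (\<lambda>y. tcol k g y + tcol k h y) 0"
    using R(1) by (intro fps_expansion_cong) (auto simp: nhds0)
  then show "cf (tay (\<lambda>x. g x + h x)) i k = cf (tay g + tay h) i k"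
    by (simp add: cf_arith cf_tay E_add germs2_tcol assms)
qed

lemma tay_mult: assumes "g \<in> germs2" "h \<in> germs2" shows "tay (\<lambda>x. g x * h x) = tay g * tay h"
proof (rule ser2_eqI)
  fix i k
  obtain R where R: "R > 0" "holomorphic2_on g (bid R)" "holomorphic2_on h (bid R)" using germs2_common[OF assms] .
  have "tcol k (\<lambda>x. g x * h x) y = (\<Sum>j=0..k. tcol j g y * tcol (k - j) h y)" if "y \<in> ball 0 R" for y
    using R that by (simp add: tcol_def E_mult fps_mult_nth analytic_at_0I[OF holomorphic2_on_partial(1)])
  then have "fps_expansion (tcol k (\<lambda>x. g x * h x)) 0 = fps_expansion (\<lambda>y. \<Sum>j=0..k. tcol j g y * tcol (k - j) h y) 0"
    using R(1) by (intro fps_expansion_cong) (auto simp: nhds0)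
  also have "\<dots> = (\<Sum>j=0..k. fps_expansion (tcol j g) 0 * fps_expansion (tcol (k - j) h) 0)"
    by (rule fps_expansion_eqI) (intro has_fps_expansion_sum has_fps_expansion_mult analytic_at_imp_has_fps_expansion_0 germs2_tcol assms)
  finally have "cf (tay (\<lambda>x. g x * h x)) i k = (\<Sum>j=0..k. \<Sum>a=0..i. cf (tay g) a j * cf (tay h) (i - a) (k - j))"
    by (simp add: cf_tay fps_sum_nth fps_mult_nth)
  also have "\<dots> = cf (tay g * tay h) i k"
    by (subst sum.swap) (simp add: cf_def fps_mult_nth fps_sum_nth)
  finally show "cf (tay (\<lambda>x. g x * h x)) i k = cf (tay g * tay h) i k" .
qed

lemma tay_gen: "tay (\<lambda>x. c) = kap c" "tay fst = VY" "tay snd = VZ"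
proof -
  have "tcol k (\<lambda>x. c) = (\<lambda>y. if k = 0 then c else 0)" "tcol k fst = (\<lambda>y. if k = 0 then y else 0)"
    "tcol k snd = (\<lambda>y. if k = 1 then 1 else 0)" for k
    by (auto simp: tcol_def E_const E_id fun_eq_iff fps_X_nth)
  then have "cf (tay (\<lambda>x. c)) i k = cf (kap c) i k" "cf (tay fst) i k = cf VY i k" "cf (tay snd) i k = cf VZ i k" for i k
    unfolding cf_tay by (auto simp: E_const E_id cf_def kap_def VY_def VZ_def fps_X_nth)
  then show "tay (\<lambda>x. c) = kap c" "tay fst = VY" "tay snd = VZ" by (auto intro!: ser2_eqI)
qed

text \<open>Together with \<open>tay_cong\<close> this carries identities between polynomials in
  germs over to \<complex>[[Z]][[Y]].\<close>

lemma tay_ev3: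
  assumes P: "P \<in> germs2" "Q \<in> germs2" "R \<in> germs2"
  shows "(\<lambda>x. eval3 F (vector [P x, Q x, R x])) \<in> germs2 \<and>
    tay (\<lambda>x. eval3 F (vector [P x, Q x, R x])) = ev3 kap (tay P) (tay Q) (tay R) F"
proof (induction F rule: poly3_induct)
  case (5 F G)
  then show ?case using tay_add germs2_add by (auto simp: eval3_hom rhomD[OF rhom_ev3[OF rhom_kap]])
next
  case (6 F G)
  then show ?case using tay_mult germs2_mult by (auto simp: eval3_hom rhomD[OF rhom_ev3[OF rhom_kap]])
qed (use P in \<open>simp_all add: eval3_gen ev3_gen[OF rhom_kap] tay_gen germs2_gen\<close>)

lemma cf_tay_jet:
  assumes "g \<in> germs2" and d: "(g has_derivative (\<lambda>h. \<alpha> * fst h + \<beta> * snd h)) (at (0, 0))"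
  shows "cf (tay g) 0 0 = g (0, 0)" "cf (tay g) 1 0 = \<alpha>" "cf (tay g) 0 1 = \<beta>"
proof -
  have t: "tcol 0 g = (\<lambda>y. g (y, 0))" "tcol 1 g 0 = \<beta>"
    using DERIV_imp_deriv[OF has_derivative2_partial(2)[OF d]] by (simp_all add: tcol_def E_nth fun_eq_iff)
  then show "cf (tay g) 0 0 = g (0, 0)" "cf (tay g) 1 0 = \<alpha>" "cf (tay g) 0 1 = \<beta>"
    using DERIV_imp_deriv[OF has_derivative2_partial(1)[OF d]] by (simp_all add: cf_tay E_nth)
qed

section \<open>Change of chart and quasi-homogeneous singularities\<close>

lemma chart_dirs_cases:
  assumes "s \<noteq> 0"
  obtains i j k where "s $ k \<noteq> 0" "i \<noteq> j" "i \<noteq> k" "j \<noteq> k" "chart_dirs s = (axis i 1, axis j 1)" "UNIV = {i, j, k}"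
proof -
  have "(1::3) \<noteq> 2" "(1::3) \<noteq> 3" "(2::3) \<noteq> 3" by simp_all
  moreover have "UNIV = {2, 3, 1 :: 3}" "UNIV = {1, 3, 2 :: 3}" "UNIV = {1, 2, 3 :: 3}" using UNIV_3 by auto
  moreover have "s $ 1 \<noteq> 0 \<or> s $ 2 \<noteq> 0 \<or> s $ 3 \<noteq> 0" using assms by (auto simp: vec_eq_iff forall_3)
  ultimately show ?thesis using that unfolding chart_dirs_def by metis
qed

text \<open>
  Near \<open>[s]\<close> the affine coordinates \<open>(y, z) \<mapsto> [s + y u + z p]\<close> and those of \<open>chart s\<close> differ by the local
  biholomorphism \<open>(\<Theta>\<^sub>1, \<Theta>\<^sub>2)\<close>, with scaling factor \<open>\<nu>\<close>.
\<close>

definition chart_data where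
  "chart_data s u p r \<nu> \<Theta>\<^sub>1 \<Theta>\<^sub>2 \<alpha>\<^sub>1 \<beta>\<^sub>1 \<alpha>\<^sub>2 \<beta>\<^sub>2 \<longleftrightarrow>
    r > 0 \<and> holomorphic2_on \<nu> (bid r) \<and> (\<forall>x. x \<in> bid r \<longrightarrow> \<nu> x \<noteq> 0) \<and>
    holomorphic2_on \<Theta>\<^sub>1 (bid r) \<and> holomorphic2_on \<Theta>\<^sub>2 (bid r) \<and> \<Theta>\<^sub>1 (0, 0) = 0 \<and> \<Theta>\<^sub>2 (0, 0) = 0 \<and> \<nu> (0, 0) = 1 \<and>
    (\<Theta>\<^sub>1 has_derivative (\<lambda>h. \<alpha>\<^sub>1 * fst h + \<beta>\<^sub>1 * snd h)) (at (0, 0)) \<and> (\<Theta>\<^sub>2 has_derivative (\<lambda>h. \<alpha>\<^sub>2 * fst h + \<beta>\<^sub>2 * snd h)) (at (0, 0)) \<and>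
    \<alpha>\<^sub>1 * \<beta>\<^sub>2 \<noteq> \<beta>\<^sub>1 * \<alpha>\<^sub>2 \<and>
    (\<forall>x. x \<in> bid r \<longrightarrow> s + fst x *s u + snd x *s p = \<nu> x *s chart s (\<Theta>\<^sub>1 x, \<Theta>\<^sub>2 x)) \<and>
    (\<exists>c. p = \<beta>\<^sub>1 *s fst (chart_dirs s) + \<beta>\<^sub>2 *s snd (chart_dirs s) + c *s s) \<and>
    (\<forall>x. \<Theta>\<^sub>1 x = (\<alpha>\<^sub>1 * fst x + \<beta>\<^sub>1 * snd x) * inverse (\<nu> x)) \<and> (\<forall>x. \<Theta>\<^sub>2 x = (\<alpha>\<^sub>2 * fst x + \<beta>\<^sub>2 * snd x) * inverse (\<nu> x))"

lemma chart_dataD: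
  assumes "chart_data s u p r \<nu> \<Theta>\<^sub>1 \<Theta>\<^sub>2 \<alpha>\<^sub>1 \<beta>\<^sub>1 \<alpha>\<^sub>2 \<beta>\<^sub>2"
  shows "r > 0" "holomorphic2_on \<nu> (bid r)" "\<And>x. x \<in> bid r \<Longrightarrow> \<nu> x \<noteq> 0"
    "holomorphic2_on \<Theta>\<^sub>1 (bid r)" "holomorphic2_on \<Theta>\<^sub>2 (bid r)" "\<Theta>\<^sub>1 (0, 0) = 0" "\<Theta>\<^sub>2 (0, 0) = 0" "\<nu> (0, 0) = 1"
    "(\<Theta>\<^sub>1 has_derivative (\<lambda>h. \<alpha>\<^sub>1 * fst h + \<beta>\<^sub>1 * snd h)) (at (0, 0))" "(\<Theta>\<^sub>2 has_derivative (\<lambda>h. \<alpha>\<^sub>2 * fst h + \<beta>\<^sub>2 * snd h)) (at (0, 0))"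
    "\<alpha>\<^sub>1 * \<beta>\<^sub>2 \<noteq> \<beta>\<^sub>1 * \<alpha>\<^sub>2"
    "\<And>x. x \<in> bid r \<Longrightarrow> s + fst x *s u + snd x *s p = \<nu> x *s chart s (\<Theta>\<^sub>1 x, \<Theta>\<^sub>2 x)"
    "\<exists>c. p = \<beta>\<^sub>1 *s fst (chart_dirs s) + \<beta>\<^sub>2 *s snd (chart_dirs s) + c *s s"
    "\<And>x. \<Theta>\<^sub>1 x = (\<alpha>\<^sub>1 * fst x + \<beta>\<^sub>1 * snd x) * inverse (\<nu> x)" "\<And>x. \<Theta>\<^sub>2 x = (\<alpha>\<^sub>2 * fst x + \<beta>\<^sub>2 * snd x) * inverse (\<nu> x)"
  using assms unfolding chart_data_def by blast+

text \<open>The map \<open>chart\<close> keeps one coordinate k of \<open>s\<close> fixed. The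
  factor \<open>\<nu>\<close> is the ratio of the coordinates k, and \<open>\<alpha>\<close>,
  \<open>\<beta>\<close> are the vectors \<open>u\<close>, \<open>p\<close> reduced modulo
  \<open>s\<close> so that their coordinate k vanishes.\<close>

lemma chart_change:
  fixes s u p :: "complex ^ 3"
  assumes ind: "\<And>a b c. a *s s + b *s u + c *s p = 0 \<Longrightarrow> a = 0 \<and> b = 0 \<and> c = 0"
  shows "\<exists>r \<nu> \<Theta>\<^sub>1 \<Theta>\<^sub>2 \<alpha>\<^sub>1 \<beta>\<^sub>1 \<alpha>\<^sub>2 \<beta>\<^sub>2. chart_data s u p r \<nu> \<Theta>\<^sub>1 \<Theta>\<^sub>2 \<alpha>\<^sub>1 \<beta>\<^sub>1 \<alpha>\<^sub>2 \<beta>\<^sub>2"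
proof -
  have s0: "s \<noteq> 0" using ind[of 1 0 0] by auto
  obtain i j k where k: "s $ k \<noteq> 0" and ijk: "i \<noteq> j" "i \<noteq> k" "j \<noteq> k" and cd: "chart_dirs s = (axis i 1, axis j 1)" and U: "UNIV = {i, j, k}"
    using chart_dirs_cases[OF s0] .
  have ax: "axis i (1::complex) $ i = 1" "axis i (1::complex) $ j = 0" "axis i (1::complex) $ k = 0"
     "axis j (1::complex) $ j = 1" "axis j (1::complex) $ i = 0" "axis j (1::complex) $ k = 0"
    using ijk by (auto simp: axis_def)
  have all: "(\<forall>l. P l) \<longleftrightarrow> P i \<and> P j \<and> P k" for P :: "3 \<Rightarrow> bool" using U by (metis UNIV_I empty_iff insert_iff)
  define A B where "A = u $ k / s $ k" and "B = p $ k / s $ k"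
  define \<alpha> where "\<alpha> l = u $ l - s $ l * A" for l
  define \<beta> where "\<beta> l = p $ l - s $ l * B" for l
  have ab_k: "\<alpha> k = 0" "\<beta> k = 0" using k by (simp_all add: \<alpha>_def \<beta>_def A_def B_def)
  define \<nu> where "\<nu> x = 1 + fst x * A + snd x * B" for x :: "complex \<times> complex"
  \<comment> \<open>On this bidisc \<open>fst x * A + snd x * B\<close> has norm below 1, so
    \<open>\<nu>\<close> has no zero.\<close>
  define r where "r = 1 / (1 + norm A + norm B)"
  have r: "r > 0" by (simp add: r_def add_pos_nonneg)
  have l0: "\<nu> x \<noteq> 0" if "x \<in> bid r" for x
  proof
    assume "\<nu> x = 0"
    then have "norm (fst x * A + snd x * B) = 1" by (simp add: \<nu>_def add.assoc add_eq_0_iff norm_minus_commute)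
    moreover have "norm (fst x * A + snd x * B) \<le> norm (fst x) * norm A + norm (snd x) * norm B"
      by (metis norm_mult norm_triangle_ineq)
    moreover have "norm (fst x) * norm A + norm (snd x) * norm B \<le> r * norm A + r * norm B"
      using that by (intro add_mono mult_right_mono) auto
    moreover have "r * norm A + r * norm B < 1"
      unfolding r_def by (simp add: add_divide_distrib[symmetric] divide_less_eq add_pos_nonneg)
    ultimately show False by linarith
  qed
  have hl: "holomorphic2_on \<nu> V" for V unfolding \<nu>_def[abs_def] by (intro hol2_intros)
  define \<Theta> where "\<Theta> l x = (\<alpha> l * fst x + \<beta> l * snd x) * inverse (\<nu> x)" for l and x :: "complex \<times> complex"
  have hi: "holomorphic2_on (\<lambda>x. inverse (\<nu> x)) (bid r)" by (rule holomorphic2_on_inverse[OF hl l0])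
  have h: "holomorphic2_on (\<Theta> l) (bid r)" for l unfolding \<Theta>_def[abs_def] by (intro hol2_intros hi)
  have d: "(\<Theta> l has_derivative (\<lambda>h. \<alpha> l * fst h + \<beta> l * snd h)) (at (0, 0))" for l
  proof -
    obtain a b where di: "((\<lambda>x. inverse (\<nu> x)) has_derivative (\<lambda>h. a * fst h + b * snd h)) (at (0, 0))"
      using hi r unfolding holomorphic2_on_def by force
    have "((\<lambda>x. \<alpha> l * fst x + \<beta> l * snd x) has_derivative (\<lambda>h. \<alpha> l * fst h + \<beta> l * snd h)) (at (0, 0))"
      by (auto intro!: derivative_eq_intros)
    from has_derivative_mult[OF this di] show ?thesis unfolding \<Theta>_def[abs_def] by (simp add: \<nu>_def)
  qed
  \<comment> \<open>A linear relation between the two reduced vectors would be a relation between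
    \<open>s\<close>, \<open>u\<close> and \<open>p\<close>.\<close>
  have det: "\<alpha> i * \<beta> j \<noteq> \<beta> i * \<alpha> j"
  proof
    assume e: "\<alpha> i * \<beta> j = \<beta> i * \<alpha> j"
    have rel: "b = 0 \<and> c = 0" if "b * \<alpha> i + c * \<beta> i = 0" "b * \<alpha> j + c * \<beta> j = 0" for b c
    proof -
      have "((- (b * A + c * B)) *s s + b *s u + c *s p) $ l = b * \<alpha> l + c * \<beta> l" for l
        by (simp add: \<alpha>_def \<beta>_def algebra_simps)
      then have "(- (b * A + c * B)) *s s + b *s u + c *s p = 0"
        unfolding vec_eq_iff all using that ab_k by simp
      then show ?thesis using ind by blast
    qed
    have "\<beta> i = 0 \<and> \<alpha> i = 0" "\<beta> j = 0 \<and> \<alpha> j = 0"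
      using rel[of "\<beta> i" "- \<alpha> i"] rel[of "\<beta> j" "- \<alpha> j"] e by (auto simp: algebra_simps)
    then show False using rel[of 1 0] by simp
  qed
  have chart: "s + fst x *s u + snd x *s p = \<nu> x *s chart s (\<Theta> i x, \<Theta> j x)" if "x \<in> bid r" for x
  proof -
    have m: "\<nu> x * \<Theta> l x = \<alpha> l * fst x + \<beta> l * snd x" for l using l0[OF that] by (simp add: \<Theta>_def)
    have lk: "\<nu> x * s $ k = s $ k + fst x * u $ k + snd x * p $ k" using k by (simp add: \<nu>_def A_def B_def field_simps)
    have "\<nu> x * (s $ l + \<Theta> l x) = s $ l + fst x * u $ l + snd x * p $ l" for l
      unfolding distrib_left m by (simp add: \<nu>_def \<alpha>_def \<beta>_def algebra_simps)
    then have "\<nu> x * s $ l + \<nu> x * \<Theta> l x = s $ l + fst x * u $ l + snd x * p $ l" for l unfolding distrib_left .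
    then show ?thesis unfolding vec_eq_iff all chart_def cd by (simp add: ax lk distrib_left)
  qed
  have "p = \<beta> i *s fst (chart_dirs s) + \<beta> j *s snd (chart_dirs s) + B *s s"
    unfolding vec_eq_iff all cd using k by (simp add: ax \<beta>_def B_def)
  then have "chart_data s u p r \<nu> (\<Theta> i) (\<Theta> j) (\<alpha> i) (\<beta> i) (\<alpha> j) (\<beta> j)"
    unfolding chart_data_def using r hl l0 h d det chart by (auto simp: \<Theta>_def \<nu>_def)
  then show ?thesis by blast
qed

text \<open>The weighted Euler field multiplies each monomial by its weighted degree.\<close>

lemma weighted_euler:
  assumes "\<And>i j. coeff2 h i j \<noteq> 0 \<Longrightarrow> w\<^sub>1 * i + w\<^sub>2 * j = N"
  shows "of_nat w\<^sub>1 * PX * dx3 [:h:] + of_nat w\<^sub>2 * PY * dy3 [:h:] = of_nat N * [:h:]"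
proof -
  have emb_n: "of_nat n = emb (of_nat n)" for n by (simp add: rhomD(8)[OF rhom_emb])
  have h1: "coeff3 (emb c * p) i j k = c * coeff3 p i j k" for c p i j k by (simp add: coeff3_def emb_def)
  have X: "coeff3 (PX * p) i j k = (if i = 0 then 0 else coeff3 p (i - 1) j k)" for p i j k
    by (cases i) (simp_all add: coeff3_def PX_def)
  have Y: "coeff3 (PY * p) i j k = (if j = 0 then 0 else coeff3 p i (j - 1) k)" for p i j k
    by (cases j) (simp_all add: coeff3_def PY_def)
  have dx: "coeff3 (dx3 p) i j k = of_nat (Suc i) * coeff3 p (Suc i) j k" for p i j k
    by (simp add: coeff3_def dx3_def coeff_map_poly coeff_pderiv del: of_nat_Suc)
  have dy: "coeff3 (dy3 p) i j k = of_nat (Suc j) * coeff3 p i (Suc j) k" for p i j k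
  proof -
    have "coeff (of_nat n * q) i = of_nat n * coeff q i" for n and q :: "complex poly" by (simp add: of_nat_poly)
    then show ?thesis by (simp add: coeff3_def dy3_def coeff_map_poly coeff_pderiv del: of_nat_Suc)
  qed
  have c: "coeff3 [:h:] i j k \<noteq> 0 \<Longrightarrow> k = 0 \<and> w\<^sub>1 * i + w\<^sub>2 * j = N" for i j k
    using assms[of i j] by (cases k) (auto simp: coeff3_def coeff2_def)
  have "coeff3 (of_nat w\<^sub>1 * PX * dx3 [:h:] + of_nat w\<^sub>2 * PY * dy3 [:h:]) i j k = coeff3 (of_nat N * [:h:]) i j k" for i j k
  proof -
    have "coeff3 (of_nat w\<^sub>1 * PX * dx3 [:h:] + of_nat w\<^sub>2 * PY * dy3 [:h:]) i j k
      = coeff3 (emb (of_nat w\<^sub>1) * (PX * dx3 [:h:])) i j k + coeff3 (emb (of_nat w\<^sub>2) * (PY * dy3 [:h:])) i j k"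
      by (simp add: coeff3_def emb_n mult.assoc)
    also have "\<dots> = (of_nat w\<^sub>1 * of_nat i + of_nat w\<^sub>2 * of_nat j) * coeff3 [:h:] i j k"
      unfolding h1 X Y dx dy by (cases i; cases j) (simp_all add: algebra_simps)
    also have "\<dots> = of_nat (w\<^sub>1 * i + w\<^sub>2 * j) * coeff3 [:h:] i j k" by simp
    also have "\<dots> = of_nat N * coeff3 [:h:] i j k" using c[of i j k] by (cases "coeff3 [:h:] i j k = 0") auto
    finally show ?thesis unfolding emb_n[of N] h1 .
  qed
  then show ?thesis by (intro poly_eqI) (simp add: coeff3_def)
qed

lemma tay_loc:
  fixes T :: "complex ^ 3 ^ 3" and q\<^sub>1 q\<^sub>2 q\<^sub>3 e\<^sub>1 e\<^sub>2 :: complex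
  defines "s \<equiv> T *v vector [q\<^sub>1, q\<^sub>2, q\<^sub>3]" and "u \<equiv> T *v vector [e\<^sub>1, e\<^sub>2, 0]" and "p \<equiv> T *v vector [0, 0, 1]"
  shows "(\<lambda>x. eval3 G (s + fst x *s u + snd x *s p)) \<in> germs2"
    "tay (\<lambda>x. eval3 G (s + fst x *s u + snd x *s p)) = loc q\<^sub>1 q\<^sub>2 q\<^sub>3 e\<^sub>1 e\<^sub>2 (lsub T G)"
proof -
  have v: "s + fst x *s u + snd x *s p = T *v vector [q\<^sub>1 + fst x * e\<^sub>1, q\<^sub>2 + fst x * e\<^sub>2, q\<^sub>3 + snd x]" for x
    unfolding s_def u_def p_def vector_scalar_commute[symmetric] matrix_vector_right_distrib[symmetric]
    by (rule arg_cong[of _ _ "\<lambda>v. T *v v"]) (simp add: vec_eq_iff forall_3)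
  have g: "(\<lambda>x. q\<^sub>1 + fst x * e\<^sub>1) \<in> germs2" "(\<lambda>x. q\<^sub>2 + fst x * e\<^sub>2) \<in> germs2" "(\<lambda>x. q\<^sub>3 + snd x) \<in> germs2"
    by (intro germs2_add germs2_mult germs2_gen)+
  have t: "tay (\<lambda>x. q\<^sub>1 + fst x * e\<^sub>1) = kap q\<^sub>1 + VY * kap e\<^sub>1" "tay (\<lambda>x. q\<^sub>2 + fst x * e\<^sub>2) = kap q\<^sub>2 + VY * kap e\<^sub>2" "tay (\<lambda>x. q\<^sub>3 + snd x) = kap q\<^sub>3 + VZ"
    by (simp_all add: tay_add tay_mult germs2_add germs2_mult germs2_gen tay_gen)
  show "(\<lambda>x. eval3 G (s + fst x *s u + snd x *s p)) \<in> germs2"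
    "tay (\<lambda>x. eval3 G (s + fst x *s u + snd x *s p)) = loc q\<^sub>1 q\<^sub>2 q\<^sub>3 e\<^sub>1 e\<^sub>2 (lsub T G)"
    unfolding v using tay_ev3[OF g, of "lsub T G"] by (simp_all add: eval3_lsub loc_def t)
qed

text \<open>By the chain rule for a map and its inverse the two Jacobian determinants have product
  1.\<close>

lemma det_inverse_jacobian:
  assumes "(\<psi>\<^sub>1 has_derivative (\<lambda>h. a * fst h + b * snd h)) (at (0, 0))" "(\<psi>\<^sub>2 has_derivative (\<lambda>h. c * fst h + d * snd h)) (at (0, 0))"
    and "\<psi>\<^sub>1 (0, 0) = 0" "\<psi>\<^sub>2 (0, 0) = (0 :: complex)"
    and "(\<phi>\<^sub>1 has_derivative (\<lambda>h. \<alpha> * fst h + \<beta> * snd h)) (at (0, 0))" "(\<phi>\<^sub>2 has_derivative (\<lambda>h. \<gamma> * fst h + \<delta> * snd h)) (at (0, 0))"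
    and V: "open V" "(0, 0) \<in> V" "\<And>x. x \<in> V \<Longrightarrow> \<phi>\<^sub>1 (\<psi>\<^sub>1 x, \<psi>\<^sub>2 x) = fst x" "\<And>x. x \<in> V \<Longrightarrow> \<phi>\<^sub>2 (\<psi>\<^sub>1 x, \<psi>\<^sub>2 x) = snd x"
  shows "a * d \<noteq> b * (c :: complex)"
proof -
  have P: "((\<lambda>x. (\<psi>\<^sub>1 x, \<psi>\<^sub>2 x)) has_derivative (\<lambda>h. (a * fst h + b * snd h, c * fst h + d * snd h))) (at (0, 0))"
    by (rule has_derivative_Pair[OF assms(1,2)])
  have 1: "((\<lambda>x. \<phi>\<^sub>1 (\<psi>\<^sub>1 x, \<psi>\<^sub>2 x)) has_derivative (\<lambda>h. \<alpha> * (a * fst h + b * snd h) + \<beta> * (c * fst h + d * snd h))) (at (0, 0))"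
    using has_derivative_compose[OF P, of \<phi>\<^sub>1 "\<lambda>h. \<alpha> * fst h + \<beta> * snd h"] assms by simp
  have 2: "((\<lambda>x. \<phi>\<^sub>2 (\<psi>\<^sub>1 x, \<psi>\<^sub>2 x)) has_derivative (\<lambda>h. \<gamma> * (a * fst h + b * snd h) + \<delta> * (c * fst h + d * snd h))) (at (0, 0))"
    using has_derivative_compose[OF P, of \<phi>\<^sub>2 "\<lambda>h. \<gamma> * fst h + \<delta> * snd h"] assms by simp
  have "(fst has_derivative (\<lambda>h. \<alpha> * (a * fst h + b * snd h) + \<beta> * (c * fst h + d * snd h))) (at (0, 0 :: complex))"
    by (rule has_derivative_transform_within_open[OF 1 V(1,2)]) (simp add: V)
  then have e1: "fst = (\<lambda>h. \<alpha> * (a * fst h + b * snd h) + \<beta> * (c * fst h + d * snd h))"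
    by (rule has_derivative_unique[OF has_derivative_fst[OF has_derivative_ident], rotated])
  have "(snd has_derivative (\<lambda>h. \<gamma> * (a * fst h + b * snd h) + \<delta> * (c * fst h + d * snd h))) (at (0 :: complex, 0))"
    by (rule has_derivative_transform_within_open[OF 2 V(1,2)]) (simp add: V)
  then have e2: "snd = (\<lambda>h. \<gamma> * (a * fst h + b * snd h) + \<delta> * (c * fst h + d * snd h))"
    by (rule has_derivative_unique[OF has_derivative_snd[OF has_derivative_ident], rotated])
  have "(\<alpha> * \<delta> - \<beta> * \<gamma>) * (a * d - b * c) = (\<alpha> * a + \<beta> * c) * (\<gamma> * b + \<delta> * d) - (\<alpha> * b + \<beta> * d) * (\<gamma> * a + \<delta> * c)"
    by (simp add: algebra_simps)
  also have "\<dots> = 1" using fun_cong[OF e1, of "(1, 0)"] fun_cong[OF e1, of "(0, 1)"] fun_cong[OF e2, of "(1, 0)"] fun_cong[OF e2, of "(0, 1)"] by simp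
  finally show ?thesis by auto
qed

lemma frame_independent:
  fixes T S :: "complex ^ 3 ^ 3"
  assumes T: "S ** T = mat 1" and e: "q\<^sub>1 * e\<^sub>2 \<noteq> q\<^sub>2 * e\<^sub>1"
    and z0: "a *s (T *v vector [q\<^sub>1, q\<^sub>2, q\<^sub>3]) + b *s (T *v vector [e\<^sub>1, e\<^sub>2, 0]) + c *s (T *v vector [0, 0, 1]) = 0"
  shows "a = 0 \<and> b = 0 \<and> c = 0"
  proof -
    have "S *v (a *s (T *v vector [q\<^sub>1, q\<^sub>2, q\<^sub>3]) + b *s (T *v vector [e\<^sub>1, e\<^sub>2, 0]) + c *s (T *v vector [0, 0, 1])) = vector [a * q\<^sub>1 + b * e\<^sub>1, a * q\<^sub>2 + b * e\<^sub>2, a * q\<^sub>3 + c]"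
      unfolding vector_scalar_commute[symmetric] matrix_vector_right_distrib[symmetric] matrix_vector_mul_assoc T
      by (simp add: vec_eq_iff forall_3)
    then have "vector [a * q\<^sub>1 + b * e\<^sub>1, a * q\<^sub>2 + b * e\<^sub>2, a * q\<^sub>3 + c] = (0 :: complex ^ 3)" unfolding z0 by simp
    then have z: "a * q\<^sub>1 + b * e\<^sub>1 = 0" "a * q\<^sub>2 + b * e\<^sub>2 = 0" "a * q\<^sub>3 + c = 0" by (auto simp: vec_eq_iff forall_3)
    have 1: "a * (q\<^sub>1 * e\<^sub>2 - q\<^sub>2 * e\<^sub>1) = (a * q\<^sub>1 + b * e\<^sub>1) * e\<^sub>2 - (a * q\<^sub>2 + b * e\<^sub>2) * e\<^sub>1"
      "b * (q\<^sub>1 * e\<^sub>2 - q\<^sub>2 * e\<^sub>1) = (a * q\<^sub>2 + b * e\<^sub>2) * q\<^sub>1 - (a * q\<^sub>1 + b * e\<^sub>1) * q\<^sub>2" by (simp_all add: algebra_simps)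
    have "a * (q\<^sub>1 * e\<^sub>2 - q\<^sub>2 * e\<^sub>1) = 0" "b * (q\<^sub>1 * e\<^sub>2 - q\<^sub>2 * e\<^sub>1) = 0" unfolding 1 z by simp_all
    then show ?thesis using z(3) e by simp
  qed

text \<open>The coordinates around s are carried by (\<open>\<Theta>\<^sub>1\<close>,
  \<open>\<Theta>\<^sub>2\<close>) into the chart and by \<open>\<psi>\<close> into those in which
  the equation is weighted homogeneous. Taylor expansion of the resulting identity of germs supplies
  the hypotheses of \<open>quasi_homogeneous_local\<close>. The equation is that of the whole curve,
  lines included.\<close>

theorem local_condition_quasi_homogeneous:
  fixes T S :: "complex ^ 3 ^ 3"
  assumes T: "S ** T = mat 1" and e: "q\<^sub>1 * e\<^sub>2 \<noteq> q\<^sub>2 * e\<^sub>1" and G: "Hom n G" "lsub T G = Q * F"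
    and qh: "quasi_homogeneous_at G (T *v vector [q\<^sub>1, q\<^sub>2, q\<^sub>3])"
    and L: "L = loc q\<^sub>1 q\<^sub>2 q\<^sub>3 e\<^sub>1 e\<^sub>2" and u: "L Q = VY * v" "cf v 0 0 \<noteq> 0" and f0: "fps_nth (L F) 0 \<noteq> 0"
  shows "VY * fps_deriv (L F) \<in> ideal2 (L F) (dzs (L F))"
proof -
  define s u p where "s = T *v vector [q\<^sub>1, q\<^sub>2, q\<^sub>3]" and "u = T *v vector [e\<^sub>1, e\<^sub>2, 0]" and "p = T *v vector [0, 0, 1]"
  note ind = frame_independent[OF T e, of _ q\<^sub>3, folded s_def u_def p_def]
  obtain r \<nu> \<Theta>\<^sub>1 \<Theta>\<^sub>2 \<alpha>\<^sub>1 \<beta>\<^sub>1 \<alpha>\<^sub>2 \<beta>\<^sub>2 where cd: "chart_data s u p r \<nu> \<Theta>\<^sub>1 \<Theta>\<^sub>2 \<alpha>\<^sub>1 \<beta>\<^sub>1 \<alpha>\<^sub>2 \<beta>\<^sub>2"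
    using chart_change[OF ind] by blast
  note r = chart_dataD(1)[OF cd] and hl = chart_dataD(2)[OF cd] and l0 = chart_dataD(3)[OF cd] and hT = chart_dataD(4,5)[OF cd]
    and T0 = chart_dataD(6,7)[OF cd] and dT = chart_dataD(9,10)[OF cd] and det = chart_dataD(11)[OF cd] and ch = chart_dataD(12)[OF cd]
  obtain U V \<phi> \<psi> \<epsilon> h w\<^sub>1 w\<^sub>2 where U: "open U" "(0, 0) \<in> U" "open V" "\<phi> (0, 0) = (0, 0)" and hom: "homeomorphism U V \<phi> \<psi>"
    and hp: "holomorphic2_on (fst \<circ> \<phi>) U" "holomorphic2_on (snd \<circ> \<phi>) U" "holomorphic2_on (fst \<circ> \<psi>) V" "holomorphic2_on (snd \<circ> \<psi>) V"
    and he: "holomorphic2_on \<epsilon> U" "\<forall>z\<in>U. \<epsilon> z \<noteq> 0" and w: "w\<^sub>1 > 0" "w\<^sub>2 > 0" "weighted_homogeneous2 w\<^sub>1 w\<^sub>2 h"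
    and le: "\<forall>z\<in>U. eval2 (local_equation G s) (\<phi> z) = \<epsilon> z * eval2 h z"
    using qh unfolding quasi_homogeneous_at_def s_def[symmetric] by blast
  obtain N where N: "\<And>i j. coeff2 h i j \<noteq> 0 \<Longrightarrow> w\<^sub>1 * i + w\<^sub>2 * j = N" using w(3) unfolding weighted_homogeneous2_def by blast
  have V0: "(0, 0) \<in> V" using homeomorphism_image1[OF hom] U by force
  have psi0: "\<psi> (0, 0) = (0, 0)" using homeomorphism_apply1[OF hom U(2)] U(4) by simp
  have cT: "continuous_on (bid r) (\<lambda>x. (\<Theta>\<^sub>1 x, \<Theta>\<^sub>2 x))"
    by (intro continuous_on_Pair holomorphic2_on_imp_continuous_on hT)
  define D where "D = bid r \<inter> (\<lambda>x. (\<Theta>\<^sub>1 x, \<Theta>\<^sub>2 x)) -` V"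
  have D: "open D" "(0, 0) \<in> D" "D \<subseteq> bid r"
    unfolding D_def using continuous_open_preimage[OF cT open_bid U(3)] r T0 V0 by auto
  define P\<^sub>1 where "P\<^sub>1 x = fst (\<psi> (\<Theta>\<^sub>1 x, \<Theta>\<^sub>2 x))" for x
  define P\<^sub>2 where "P\<^sub>2 x = snd (\<psi> (\<Theta>\<^sub>1 x, \<Theta>\<^sub>2 x))" for x
  have hP: "holomorphic2_on P\<^sub>1 D" "holomorphic2_on P\<^sub>2 D"
    unfolding P\<^sub>1_def[abs_def] P\<^sub>2_def[abs_def]
    using holomorphic2_on_compose[OF hp(3) holomorphic2_on_subset[OF hT(1) D(3)] holomorphic2_on_subset[OF hT(2) D(3)]]
      holomorphic2_on_compose[OF hp(4) holomorphic2_on_subset[OF hT(1) D(3)] holomorphic2_on_subset[OF hT(2) D(3)]]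
    by (auto simp: D_def)
  have PU: "(P\<^sub>1 x, P\<^sub>2 x) \<in> U" if "x \<in> D" for x
    using that homeomorphism_image2[OF hom] by (force simp: P\<^sub>1_def P\<^sub>2_def D_def)
  \<comment> \<open>The unit collects \<open>\<nu> x ^ n\<close> from the homogeneity of
    \<open>G\<close> and the unit in the definition of quasi homogeneity.\<close>
  define E where "E x = \<nu> x ^ n * \<epsilon> (P\<^sub>1 x, P\<^sub>2 x)" for x
  have hpow: "holomorphic2_on (\<lambda>x. \<nu> x ^ m) D" for m
    by (induction m) (auto intro!: hol2_intros holomorphic2_on_subset[OF hl D(3)])
  have hE: "holomorphic2_on E D" unfolding E_def[abs_def]
    by (intro holomorphic2_on_mult hpow holomorphic2_on_compose[OF he(1)] hP PU)
  have gD: "g \<in> germs2" if "holomorphic2_on g D" for g using that D by (auto simp: germs2_def)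
  note gP = gD[OF hP(1)] gD[OF hP(2)] and gE = gD[OF hE]
  have GE: "eval3 G (s + fst x *s u + snd x *s p) = E x * eval3 [:h:] (vector [P\<^sub>1 x, P\<^sub>2 x, 0])" if "x \<in> D" for x
  proof -
    have "eval3 G (s + fst x *s u + snd x *s p) = \<nu> x ^ n * eval3 G (chart s (\<Theta>\<^sub>1 x, \<Theta>\<^sub>2 x))"
      using ch[of x] G(1) D(3) that unfolding Hom_iff_eval by auto
    also have "eval3 G (chart s (\<Theta>\<^sub>1 x, \<Theta>\<^sub>2 x)) = eval2 (local_equation G s) (\<phi> (P\<^sub>1 x, P\<^sub>2 x))"
      using homeomorphism_apply2[OF hom, of "(\<Theta>\<^sub>1 x, \<Theta>\<^sub>2 x)"] that
      by (simp add: eval2_local_equation P\<^sub>1_def P\<^sub>2_def D_def)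
    also have "\<dots> = \<epsilon> (P\<^sub>1 x, P\<^sub>2 x) * eval2 h (P\<^sub>1 x, P\<^sub>2 x)" using le PU[OF that] by blast
    finally show ?thesis by (simp add: E_def eval3_const)
  qed
  define W where "W = ev3 kap (tay P\<^sub>1) (tay P\<^sub>2) (tay (\<lambda>x. 0))"
  note hW = tay_ev3[OF gP germs2_gen(1)[of 0], folded W_def]
  note Wh = rhomD[OF rhom_ev3[OF rhom_kap], of "tay P\<^sub>1" "tay P\<^sub>2" "tay (\<lambda>x. 0)", folded W_def]
  have "\<forall>\<^sub>F x in nhds (0, 0). eval3 G (s + fst x *s u + snd x *s p) = E x * eval3 [:h:] (vector [P\<^sub>1 x, P\<^sub>2 x, 0])"
    unfolding eventually_nhds using D GE by blast
  from tay_cong[OF this] have "tay (\<lambda>x. eval3 G (s + fst x *s u + snd x *s p)) = tay E * W [:h:]"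
    by (simp add: tay_mult[OF gE] hW)
  then have "L (Q * F) = tay E * W [:h:]" using tay_loc(2)[of G T q\<^sub>1 q\<^sub>2 q\<^sub>3 e\<^sub>1 e\<^sub>2] G(2) by (simp add: s_def u_def p_def L)
  then have eq: "VY * v * L F = tay E * W [:h:]" using u(1) by (simp add: L loc_hom)
  obtain v' where v': "v * v' = 1" using unit_cf[OF u(2)] by blast
  have "\<exists>a b. (g has_derivative (\<lambda>h. a * fst h + b * snd h)) (at (0, 0))" if "holomorphic2_on g D" for g
    using that D(2) unfolding holomorphic2_on_def by blast
  then have "cf (tay E) 0 0 = E (0, 0)" using cf_tay_jet(1)[OF gE] hE by blast
  also have "\<dots> \<noteq> 0" using l0[of "(0, 0)"] he(2) PU[OF D(2)] r by (simp add: E_def)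
  finally obtain E' where E': "tay E * E' = 1" using unit_cf by blast
  have z0: "dz3 [:h:] = 0" by (simp add: dz3_def pderiv_pCons)
  have hy: "fps_deriv (W [:h:]) = W (dx3 [:h:]) * fps_deriv (tay P\<^sub>1) + W (dy3 [:h:]) * fps_deriv (tay P\<^sub>2)"
    unfolding W_def by (subst ev3_chain[OF rhom_kap der_fps_deriv]) (simp_all add: z0 rhomD[OF rhom_ev3[OF rhom_kap]])
  have hz: "dzs (W [:h:]) = W (dx3 [:h:]) * dzs (tay P\<^sub>1) + W (dy3 [:h:]) * dzs (tay P\<^sub>2)"
    unfolding W_def by (subst ev3_chain[OF rhom_kap der_dzs]) (simp_all add: z0 rhomD[OF rhom_ev3[OF rhom_kap]])
  have "W PX = tay P\<^sub>1" "W PY = tay P\<^sub>2" by (simp_all add: W_def ev3_gen[OF rhom_kap])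
  then have we: "of_nat w\<^sub>1 * tay P\<^sub>1 * W (dx3 [:h:]) + of_nat w\<^sub>2 * tay P\<^sub>2 * W (dy3 [:h:]) = of_nat N * W [:h:]"
    using arg_cong[OF weighted_euler[OF N], where f = W] unfolding Wh by simp
  obtain a b where ab: "(fst \<circ> \<psi> has_derivative (\<lambda>h. a * fst h + b * snd h)) (at (0, 0))" using hp(3) V0 unfolding holomorphic2_on_def by blast
  obtain c d where cd: "(snd \<circ> \<psi> has_derivative (\<lambda>h. c * fst h + d * snd h)) (at (0, 0))" using hp(4) V0 unfolding holomorphic2_on_def by blast
  obtain \<alpha> \<beta> where ab': "(fst \<circ> \<phi> has_derivative (\<lambda>h. \<alpha> * fst h + \<beta> * snd h)) (at (0, 0))" using hp(1) U(2) unfolding holomorphic2_on_def by blast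
  obtain \<gamma> \<delta> where cd': "(snd \<circ> \<phi> has_derivative (\<lambda>h. \<gamma> * fst h + \<delta> * snd h)) (at (0, 0))" using hp(2) U(2) unfolding holomorphic2_on_def by blast
  have det2: "a * d \<noteq> b * c"
    by (rule det_inverse_jacobian[OF ab cd _ _ ab' cd' U(3) V0]) (simp_all add: psi0 homeomorphism_apply2[OF hom])
  note PT = has_derivative_Pair[OF dT]
  have d1: "(P\<^sub>1 has_derivative (\<lambda>h. (a * \<alpha>\<^sub>1 + b * \<alpha>\<^sub>2) * fst h + (a * \<beta>\<^sub>1 + b * \<beta>\<^sub>2) * snd h)) (at (0, 0))"
    using has_derivative_compose[OF PT, of "fst \<circ> \<psi>" "\<lambda>h. a * fst h + b * snd h"] ab T0
    by (simp add: P\<^sub>1_def[abs_def] algebra_simps)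
  have d2: "(P\<^sub>2 has_derivative (\<lambda>h. (c * \<alpha>\<^sub>1 + d * \<alpha>\<^sub>2) * fst h + (c * \<beta>\<^sub>1 + d * \<beta>\<^sub>2) * snd h)) (at (0, 0))"
    using has_derivative_compose[OF PT, of "snd \<circ> \<psi>" "\<lambda>h. c * fst h + d * snd h"] cd T0
    by (simp add: P\<^sub>2_def[abs_def] algebra_simps)
  have "(a * \<alpha>\<^sub>1 + b * \<alpha>\<^sub>2) * (c * \<beta>\<^sub>1 + d * \<beta>\<^sub>2) - (a * \<beta>\<^sub>1 + b * \<beta>\<^sub>2) * (c * \<alpha>\<^sub>1 + d * \<alpha>\<^sub>2) = (a * d - b * c) * (\<alpha>\<^sub>1 * \<beta>\<^sub>2 - \<beta>\<^sub>1 * \<alpha>\<^sub>2)"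
    by (simp add: algebra_simps)
  then have "(a * \<alpha>\<^sub>1 + b * \<alpha>\<^sub>2) * (c * \<beta>\<^sub>1 + d * \<beta>\<^sub>2) \<noteq> (a * \<beta>\<^sub>1 + b * \<beta>\<^sub>2) * (c * \<alpha>\<^sub>1 + d * \<alpha>\<^sub>2)" using det det2 by auto
  then show ?thesis
    using cf_tay_jet[OF gP(1) d1] cf_tay_jet[OF gP(2) d2] T0 psi0
    by (intro quasi_homogeneous_local[OF eq v' E' f0 hy hz we w(1,2)]) (simp_all add: P\<^sub>1_def P\<^sub>2_def)
qed

section \<open>Codimensions of ideals of germs\<close>

lemma germs2_compose:
  assumes "g \<in> germs2" "\<phi> \<in> germs2" "\<psi> \<in> germs2" "\<phi> (0, 0) = 0" "\<psi> (0, 0) = 0"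
  shows "(\<lambda>x. g (\<phi> x, \<psi> x)) \<in> germs2"
proof -
  obtain R where R: "R > 0" "holomorphic2_on g (bid R)" using assms(1) germs2_iff by auto
  obtain r where r: "r > 0" "holomorphic2_on \<phi> (bid r)" "holomorphic2_on \<psi> (bid r)" using germs2_common[OF assms(2,3)] .
  have c: "continuous_on (bid r) (\<lambda>x. (\<phi> x, \<psi> x))" by (intro continuous_on_Pair holomorphic2_on_imp_continuous_on r)
  define D where "D = bid r \<inter> (\<lambda>x. (\<phi> x, \<psi> x)) -` bid R"
  have D: "open D" "(0, 0) \<in> D" "D \<subseteq> bid r"
    unfolding D_def using continuous_open_preimage[OF c open_bid open_bid] r(1) R(1) assms(4,5) by auto
  have "holomorphic2_on (\<lambda>x. g (\<phi> x, \<psi> x)) D"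
    by (rule holomorphic2_on_compose[OF R(2) holomorphic2_on_subset[OF r(2) D(3)] holomorphic2_on_subset[OF r(3) D(3)]]) (auto simp: D_def)
  then show ?thesis using D by (auto simp: germs2_def)
qed

lemma germs2_uminus: "g \<in> germs2 \<Longrightarrow> (\<lambda>x. - g x) \<in> germs2"
  using germs2_mult[OF germs2_gen(1)[of "-1"], of g] by simp

lemma germs2_diff: "g \<in> germs2 \<Longrightarrow> h \<in> germs2 \<Longrightarrow> (\<lambda>x. g x - h x) \<in> germs2"
  using germs2_add[OF _ germs2_uminus, of g h] by simp

lemma germs2_inverse: assumes "g \<in> germs2" "g (0, 0) \<noteq> 0" shows "(\<lambda>x. inverse (g x)) \<in> germs2"
    "\<forall>\<^sub>F x in nhds (0, 0). g x \<noteq> 0"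
proof -
  obtain R where R: "R > 0" "holomorphic2_on g (bid R)" using assms(1) germs2_iff by auto
  define D where "D = bid R \<inter> g -` (- {0})"
  have D: "open D" "(0, 0) \<in> D" "D \<subseteq> bid R" "\<And>x. x \<in> D \<Longrightarrow> g x \<noteq> 0"
    unfolding D_def using continuous_open_preimage[OF holomorphic2_on_imp_continuous_on[OF R(2)] open_bid, of "- {0}"] R(1) assms(2) by auto
  have "holomorphic2_on (\<lambda>x. inverse (g x)) D" by (rule holomorphic2_on_inverse[OF holomorphic2_on_subset[OF R(2) D(3)] D(4)])
  then show "(\<lambda>x. inverse (g x)) \<in> germs2" using D by (auto simp: germs2_def)
  show "\<forall>\<^sub>F x in nhds (0, 0). g x \<noteq> 0" unfolding eventually_nhds using D by blast
qed

lemma germs2_sum: "(\<And>b. b \<in> B \<Longrightarrow> f b \<in> germs2) \<Longrightarrow> (\<lambda>x. \<Sum>b\<in>B. f b x) \<in> germs2"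
  by (induction B rule: infinite_finite_induct) (auto intro: germs2_add germs2_gen)

lemma germs2_hadamard:
  assumes "H \<in> germs2"
  shows "\<exists>a\<in>germs2. \<exists>b\<in>germs2. \<forall>\<^sub>F x in nhds (0, 0). H x = H (0, 0) + fst x * a x + snd x * b x"
proof -
  have one: "\<exists>k\<in>germs2. \<forall>\<^sub>F x in nhds (0, 0). g x = g (0, snd x) + fst x * k x" if g: "g \<in> germs2" for g
  proof -
    obtain R where R: "R > 0" "holomorphic2_on g (bid R)" using g germs2_iff by auto
    obtain k where k: "holomorphic2_on k (bid (R / 2))" and kk: "\<forall>y z. (y, z) \<in> bid (R / 2) \<longrightarrow> g (y, z) = g (0, z) + y * k (y, z)"
      using holomorphic2_hadamard[OF R(2), of "R / 2"] R(1) by auto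
    have R2: "R / 2 > 0" using R(1) by simp
    have "k \<in> germs2" unfolding germs2_iff using k R2 by blast
    moreover have "g x = g (0, snd x) + fst x * k x" if "x \<in> bid (R / 2)" for x
      using kk[rule_format, of "fst x" "snd x"] that by simp
    ultimately show ?thesis using R2 unfolding nhds00 by blast
  qed
  obtain a where a: "a \<in> germs2" "\<forall>\<^sub>F x in nhds (0, 0). H x = H (0, snd x) + fst x * a x" using one[OF assms] by blast
  have "(\<lambda>x. H ((\<lambda>x. 0) x, fst x)) \<in> germs2" by (rule germs2_compose[OF assms germs2_gen(1,2)]) auto
  then obtain k where k: "k \<in> germs2" "\<forall>\<^sub>F x in nhds (0, 0). H (0, fst x) = H (0, 0) + fst x * k x" using one[of "\<lambda>x. H (0, fst x)"] by auto
  have k2: "(\<lambda>x. k (snd x, (\<lambda>x. 0) x)) \<in> germs2" by (rule germs2_compose[OF k(1) germs2_gen(3,1)]) auto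
  obtain r where r: "r > 0" "\<forall>x\<in>bid r. H (0, fst x) = H (0, 0) + fst x * k x" using k(2) unfolding nhds00 by blast
  have "H (0, snd x) = H (0, 0) + snd x * k (snd x, 0)" if "x \<in> bid r" for x
    using r(2)[rule_format, of "(snd x, 0)"] that r(1) by (simp add: mem_Times_iff)
  then have "\<forall>\<^sub>F x in nhds (0 :: complex, 0). H (0, snd x) = H (0, 0) + snd x * k (snd x, 0)" unfolding nhds00 using r(1) by blast
  with a(2) have "\<forall>\<^sub>F x in nhds (0, 0). H x = H (0, 0) + fst x * a x + snd x * k (snd x, 0)"
    by eventually_elim simp
  then show ?thesis by (intro bexI[OF bexI[OF _ k2] a(1)])
qed

text \<open>A function of one variable is regarded as a germ in two variables that ignores the
  second, so that composition of germs applies.\<close>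

lemma curve_germ_analytic:
  assumes g: "g \<in> germs2" and c: "c\<^sub>1 analytic_on {0}" "c\<^sub>2 analytic_on {0}" "c\<^sub>1 0 = 0" "c\<^sub>2 0 = 0"
  shows "(\<lambda>t. g (c\<^sub>1 t, c\<^sub>2 t)) analytic_on {0}"
proof -
  have "(\<lambda>x. c (fst x)) \<in> germs2" if ca: "c analytic_on {0}" for c
  proof -
    obtain r where r: "r > 0" "c holomorphic_on ball 0 r" using ca by (auto simp: analytic_on_def)
    have "holomorphic2_on (\<lambda>x. c (fst x)) (bid r)"
      by (rule holomorphic2_on_compose1[OF r(2) open_ball holomorphic2_on_fst]) auto
    then show ?thesis using r(1) germs2_iff by blast
  qed
  then have "(\<lambda>x. g ((\<lambda>x. c\<^sub>1 (fst x)) x, (\<lambda>x. c\<^sub>2 (fst x)) x)) \<in> germs2"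
    using c by (intro germs2_compose[OF g]) auto
  then obtain R where "R > 0" "holomorphic2_on (\<lambda>x. g (c\<^sub>1 (fst x), c\<^sub>2 (fst x))) (bid R)" using germs2_iff by auto
  then show ?thesis
    using holomorphic2_on_partial(2)[of "\<lambda>x. g (c\<^sub>1 (fst x), c\<^sub>2 (fst x))" R 0] by (intro analytic_at_0I[of _ R]) auto
qed

lemma curve_germ_deriv:
  assumes d: "(g has_derivative (\<lambda>h. \<alpha> * fst h + \<beta> * snd h)) (at (0, 0))" and c: "c\<^sub>1 analytic_on {0}" "c\<^sub>2 analytic_on {0}" "c\<^sub>1 0 = 0" "c\<^sub>2 0 = 0"
  shows "((\<lambda>t. g (c\<^sub>1 t, c\<^sub>2 t)) has_field_derivative \<alpha> * deriv c\<^sub>1 0 + \<beta> * deriv c\<^sub>2 0) (at 0)"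
proof -
  have cd: "(c has_field_derivative deriv c 0) (at 0)" if "c analytic_on {0}" for c
    using that analytic_on_imp_differentiable_at[of c "{0}" 0] by (simp add: DERIV_deriv_iff_field_differentiable)
  have "((\<lambda>t. (c\<^sub>1 t, c\<^sub>2 t)) has_derivative (\<lambda>h. (deriv c\<^sub>1 0 * h, deriv c\<^sub>2 0 * h))) (at 0)"
    using cd[OF c(1)] cd[OF c(2)] unfolding has_field_derivative_def by (rule has_derivative_Pair)
  from has_derivative_compose[OF this, of g "\<lambda>h. \<alpha> * fst h + \<beta> * snd h"] d c(3,4)
  have "((\<lambda>t. g (c\<^sub>1 t, c\<^sub>2 t)) has_derivative (\<lambda>h. \<alpha> * (deriv c\<^sub>1 0 * h) + \<beta> * (deriv c\<^sub>2 0 * h))) (at 0)" by simp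
  then show ?thesis unfolding has_field_derivative_def
    by (rule has_derivative_eq_rhs) (simp add: fun_eq_iff algebra_simps)
qed

definition jet where "jet c\<^sub>1 c\<^sub>2 g = fps_expansion (\<lambda>t. g (c\<^sub>1 t, c\<^sub>2 t)) 0"

lemma jet_cong:
  assumes c: "c\<^sub>1 analytic_on {0}" "c\<^sub>2 analytic_on {0}" "c\<^sub>1 0 = 0" "c\<^sub>2 0 = 0" and e: "\<forall>\<^sub>F x in nhds (0, 0). g x = h x"
  shows "jet c\<^sub>1 c\<^sub>2 g = jet c\<^sub>1 c\<^sub>2 h"
proof -
  have "isCont c\<^sub>1 0" "isCont c\<^sub>2 0" using c(1,2) by (auto intro: analytic_at_imp_isCont)
  then have "isCont (\<lambda>t. (c\<^sub>1 t, c\<^sub>2 t)) 0" by (intro continuous_intros)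
  then have "filterlim (\<lambda>t. (c\<^sub>1 t, c\<^sub>2 t)) (nhds (0, 0)) (nhds 0)"
    using c(3,4) by (simp add: isCont_def tendsto_nhds_iff)
  from eventually_compose_filterlim[OF e this] show ?thesis unfolding jet_def by (intro fps_expansion_cong)
qed

text \<open>
  The first \<open>n\<close> Taylor coefficients along the curve vanish on the ideal and are independent.  The finite type \<open>'n\<close> serves only
  to have the space \<open>\<complex>\<^sup>n\<close> of these coefficients.
\<close>

theorem codim_ge_curve:
  fixes idx :: "'n::finite \<Rightarrow> nat"
  assumes idx: "bij_betw idx UNIV {..<n}"
    and c: "c\<^sub>1 analytic_on {0}" "c\<^sub>2 analytic_on {0}" "c\<^sub>1 0 = 0" "c\<^sub>2 0 = 0" "(deriv c\<^sub>1 0, deriv c\<^sub>2 0) \<noteq> (0, 0)"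
    and fg: "f \<in> germs2" "g \<in> germs2" "\<And>k. k < n \<Longrightarrow> fps_nth (jet c\<^sub>1 c\<^sub>2 f) k = 0" "\<And>k. k < n \<Longrightarrow> fps_nth (jet c\<^sub>1 c\<^sub>2 g) k = 0"
  shows "germ_codim2 f g \<ge> enat n"
  unfolding germ_codim2_def
proof (rule Inf_greatest, clarify)
  fix B assume fB: "finite B" and BG: "B \<subseteq> germs2"
    and span: "\<forall>h\<in>germs2. \<exists>k. (\<lambda>z. h z - (\<Sum>b\<in>B. k b * b z)) \<in> germ_ideal2 f g"
  note an = curve_germ_analytic[OF _ c(1-4)]
  let ?J = "jet c\<^sub>1 c\<^sub>2"
  have Ja: "?J (\<lambda>x. a x + b x) = ?J a + ?J b" and Jm: "?J (\<lambda>x. a x * b x) = ?J a * ?J b"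
    if "a \<in> germs2" "b \<in> germs2" for a b
    using that an by (simp_all add: jet_def E_add E_mult)
  have Jc: "?J (\<lambda>x. k) = fps_const k" for k by (simp add: jet_def E_const)
  have Js: "?J (\<lambda>x. \<Sum>b\<in>A. k b * b x) = (\<Sum>b\<in>A. fps_const (k b) * ?J b)" if "A \<subseteq> germs2" "finite A" for A k
    using that(2,1)
  proof (induction A rule: finite_induct)
    case empty then show ?case using Jc[of 0] by simp
  next
    case (insert b A)
    have "(\<lambda>x. \<Sum>b\<in>A. k b * b x) \<in> germs2" using insert by (intro germs2_sum germs2_mult germs2_gen) auto
    moreover have "(\<lambda>x. k b * b x) \<in> germs2" using insert by (intro germs2_mult germs2_gen) auto
    ultimately show ?case using insert Ja[of "\<lambda>x. k b * b x"] Jm[OF germs2_gen(1), of b "k b"] by (simp add: Jc)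
  qed
  obtain u v where uv: "u * deriv c\<^sub>1 0 + v * deriv c\<^sub>2 0 = 1"
  proof (cases "deriv c\<^sub>1 0 = 0")
    case True then show ?thesis using c(5) that[of 0 "1 / deriv c\<^sub>2 0"] by simp
  qed (use that[of "1 / deriv c\<^sub>1 0" 0] in simp)
  \<comment> \<open>A linear function whose restriction to the curve has derivative 1; its powers
    prescribe the Taylor coefficients one at a time.\<close>
  define \<zeta> where "\<zeta> x = u * fst x + v * snd x" for x :: "complex \<times> complex"
  have zg: "\<zeta> \<in> germs2" unfolding \<zeta>_def[abs_def] by (intro germs2_add germs2_mult germs2_gen)
  have zd: "(\<zeta> has_derivative (\<lambda>h. u * fst h + v * snd h)) (at (0, 0))" unfolding \<zeta>_def[abs_def] by (auto intro!: derivative_eq_intros)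
  define W where "W = ?J \<zeta>"
  have W0: "fps_nth W 0 = 0" by (simp add: W_def jet_def E_nth \<zeta>_def c)
  have W1: "fps_nth W 1 = 1"
    using DERIV_imp_deriv[OF curve_germ_deriv[OF zd c(1-4)]] uv by (simp add: W_def jet_def E_nth)
  define V where "V = fps_shift 1 W"
  have WV: "W = fps_X * V" using W0 by (intro fps_ext) (simp add: V_def)
  have V0: "fps_nth V 0 = 1" using W1 by (simp add: V_def)
  have Wn: "fps_nth (W ^ m) k = (if k < m then 0 else fps_nth (V ^ m) (k - m))" for m k
    by (simp add: WV power_mult_distrib fps_X_power_mult_nth)
  have zp: "(\<lambda>x. \<zeta> x ^ m) \<in> germs2 \<and> ?J (\<lambda>x. \<zeta> x ^ m) = W ^ m" for m
  proof (induction m)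
    case 0 then show ?case using Jc[of 1] germs2_gen(1)[of 1] by simp
  next
    case (Suc m) then show ?case using germs2_mult[OF zg] Jm[OF zg] by (simp add: W_def)
  qed
  have hit: "\<exists>h\<in>germs2. \<forall>k<m. fps_nth (?J h) k = t k" for m t
  proof (induction m)
    case 0 then show ?case using germs2_gen(1) by auto
  next
    case (Suc m)
    then obtain h where h: "h \<in> germs2" "\<forall>k<m. fps_nth (?J h) k = t k" by blast
    define \<kappa> where "\<kappa> = t m - fps_nth (?J h) m"
    have kz: "(\<lambda>x. \<kappa> * \<zeta> x ^ m) \<in> germs2" using zp by (intro germs2_mult germs2_gen) auto
    have "?J (\<lambda>x. h x + \<kappa> * \<zeta> x ^ m) = ?J h + fps_const \<kappa> * W ^ m"
      using Ja[OF h(1) kz] Jm[OF germs2_gen(1)[of \<kappa>], of "\<lambda>x. \<zeta> x ^ m"] zp by (simp add: Jc)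
    then have "\<forall>k<Suc m. fps_nth (?J (\<lambda>x. h x + \<kappa> * \<zeta> x ^ m)) k = t k"
      using h(2) by (auto simp: less_Suc_eq Wn \<kappa>_def V0 fps_nth_power_0)
    then show ?case using germs2_add[OF h(1) kz] by blast
  qed
  define Jv :: "(complex \<times> complex \<Rightarrow> complex) \<Rightarrow> complex ^ 'n" where "Jv h = (\<chi> i. fps_nth (?J h) (idx i))" for h
  have idn: "idx i < n" for i using idx by (auto simp: bij_betw_def)
  have ideal0: "fps_nth (?J h) k = 0" if hk: "h \<in> germ_ideal2 f g" "k < n" for h k
  proof -
    obtain a b where ab: "a \<in> germs2" "b \<in> germs2" "\<forall>\<^sub>F z in nhds (0, 0). h z = a z * f z + b z * g z"
      using hk(1) unfolding germ_ideal2_def by blast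
    have "?J h = ?J a * ?J f + ?J b * ?J g"
      using jet_cong[OF c(1-4) ab(3)] Ja[OF germs2_mult[OF ab(1) fg(1)] germs2_mult[OF ab(2) fg(2)]] Jm ab fg by simp
    moreover have "fps_nth (p * r) k = 0" if "\<And>k. k < n \<Longrightarrow> fps_nth r k = 0" for p r :: "complex fps"
      using that \<open>k < n\<close> by (simp add: fps_mult_nth)
    ultimately show ?thesis using fg by simp
  qed
  \<comment> \<open>Every coefficient vector comes from some germ, and modulo the ideal that germ is
    a combination of \<open>B\<close>; hence the images of \<open>B\<close> span.\<close>
  have "UNIV \<subseteq> vec.span (Jv ` B)"
  proof
    fix x :: "complex ^ 'n"
    define t where "t k = x $ (inv idx k)" for k
    obtain h where h: "h \<in> germs2" "\<forall>k<n. fps_nth (?J h) k = t k" using hit by blast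
    obtain k where k: "(\<lambda>z. h z - (\<Sum>b\<in>B. k b * b z)) \<in> germ_ideal2 f g" using span h(1) by blast
    have sg: "(\<lambda>z. \<Sum>b\<in>B. k b * b z) \<in> germs2" using BG by (intro germs2_sum germs2_mult germs2_gen) auto
    have "?J (\<lambda>z. (h z - (\<Sum>b\<in>B. k b * b z)) + (\<Sum>b\<in>B. k b * b z)) = ?J (\<lambda>z. h z - (\<Sum>b\<in>B. k b * b z)) + ?J (\<lambda>z. \<Sum>b\<in>B. k b * b z)"
      by (rule Ja[OF germs2_diff[OF h(1) sg] sg])
    then have "fps_nth (?J h) m = (\<Sum>b\<in>B. k b * fps_nth (?J b) m)" if "m < n" for m
      using ideal0[OF k that] by (simp add: Js[OF BG fB] fps_sum_nth)
    moreover have "x $ i = fps_nth (?J h) (idx i)" for i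
      using h(2) idn[of i] idx by (simp add: t_def bij_betw_def)
    ultimately have "x = (\<Sum>b\<in>B. k b *s Jv b)" using idn by (simp add: vec_eq_iff Jv_def)
    moreover have "(\<Sum>b\<in>B. k b *s Jv b) \<in> vec.span (Jv ` B)"
      by (intro vec.span_sum vec.span_scale vec.span_base imageI)
    ultimately show "x \<in> vec.span (Jv ` B)" by simp
  qed
  then have "vec.dim (UNIV :: (complex ^ 'n) set) \<le> card (Jv ` B)" using fB by (intro vec.dim_le_card) auto
  also have "\<dots> \<le> card B" by (rule card_image_le[OF fB])
  finally have "CARD('n) \<le> card B" unfolding vec_dim_card .
  then show "enat n \<le> enat (card B)" using bij_betw_same_card[OF idx] by simp
qed

text \<open>The derivative of \<open>f\<close> along the line \<open>l = 0\<close> is nonzero, so in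
  coordinates (\<open>l\<close>, \<open>N\<^sub>2\<close>) f has the form l a +
  \<open>N\<^sub>2\<close> b with a unit b. Thus \<open>N\<^sub>2\<close> lies in the ideal, and
  every germ is constant modulo it.\<close>

theorem codim_le_one:
  assumes f: "f \<in> germs2" "f (0, 0) = 0" "(f has_derivative (\<lambda>h. A * fst h + B * snd h)) (at (0, 0))"
    and l: "\<And>x. l x = \<alpha> * fst x + \<beta> * snd x" "(\<alpha>, \<beta>) \<noteq> (0, 0)" "\<alpha> * m\<^sub>1 + \<beta> * m\<^sub>2 = 0" and m: "A * m\<^sub>1 + B * m\<^sub>2 \<noteq> 0"
  shows "germ_codim2 f l \<le> 1"
proof -
  obtain n\<^sub>1 n\<^sub>2 where n: "\<alpha> * n\<^sub>1 + \<beta> * n\<^sub>2 = 1"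
  proof (cases "\<alpha> = 0")
    case True then show ?thesis using l(2) that[of 0 "1 / \<beta>"] by simp
  qed (use that[of "1 / \<alpha>" 0] in simp)
  define \<delta> where "\<delta> = n\<^sub>1 * m\<^sub>2 - n\<^sub>2 * m\<^sub>1"
  have dl: "\<delta> * \<alpha> = m\<^sub>2" "\<delta> * \<beta> = - m\<^sub>1"
  proof -
    have "\<delta> * \<alpha> = (\<alpha> * n\<^sub>1 + \<beta> * n\<^sub>2) * m\<^sub>2 - n\<^sub>2 * (\<alpha> * m\<^sub>1 + \<beta> * m\<^sub>2)"
      "\<delta> * \<beta> = - ((\<alpha> * n\<^sub>1 + \<beta> * n\<^sub>2) * m\<^sub>1) + n\<^sub>1 * (\<alpha> * m\<^sub>1 + \<beta> * m\<^sub>2)" by (simp_all add: \<delta>_def algebra_simps)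
    then show "\<delta> * \<alpha> = m\<^sub>2" "\<delta> * \<beta> = - m\<^sub>1" using n l(3) by simp_all
  qed
  have d0: "\<delta> \<noteq> 0" using m dl by auto
  define M\<^sub>1 where "M\<^sub>1 x = n\<^sub>1 * fst x + m\<^sub>1 * snd x" for x :: "complex \<times> complex"
  define M\<^sub>2 where "M\<^sub>2 x = n\<^sub>2 * fst x + m\<^sub>2 * snd x" for x :: "complex \<times> complex"
  define N\<^sub>2 where "N\<^sub>2 x = (n\<^sub>1 / \<delta>) * snd x + (- n\<^sub>2 / \<delta>) * fst x" for x :: "complex \<times> complex"
  have lin: "M\<^sub>1 \<in> germs2" "M\<^sub>2 \<in> germs2" "N\<^sub>2 \<in> germs2" "l \<in> germs2"
    unfolding M\<^sub>1_def[abs_def] M\<^sub>2_def[abs_def] N\<^sub>2_def[abs_def] l(1)[abs_def] by (intro germs2_add germs2_mult germs2_gen)+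
  have inv: "M\<^sub>1 (l x, N\<^sub>2 x) = fst x" "M\<^sub>2 (l x, N\<^sub>2 x) = snd x" for x
  proof -
    have "\<delta> * M\<^sub>1 (l x, N\<^sub>2 x) = n\<^sub>1 * ((\<delta> * \<alpha>) * fst x + (\<delta> * \<beta>) * snd x) + m\<^sub>1 * (n\<^sub>1 * snd x - n\<^sub>2 * fst x)"
      "\<delta> * M\<^sub>2 (l x, N\<^sub>2 x) = n\<^sub>2 * ((\<delta> * \<alpha>) * fst x + (\<delta> * \<beta>) * snd x) + m\<^sub>2 * (n\<^sub>1 * snd x - n\<^sub>2 * fst x)"
      using d0 by (simp_all add: M\<^sub>1_def M\<^sub>2_def N\<^sub>2_def l(1) field_simps)
    then have "\<delta> * M\<^sub>1 (l x, N\<^sub>2 x) = \<delta> * fst x" "\<delta> * M\<^sub>2 (l x, N\<^sub>2 x) = \<delta> * snd x" unfolding dl by (simp_all add: \<delta>_def algebra_simps)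
    then show "M\<^sub>1 (l x, N\<^sub>2 x) = fst x" "M\<^sub>2 (l x, N\<^sub>2 x) = snd x" using d0 by simp_all
  qed
  have l0: "l (0, 0) = 0" "N\<^sub>2 (0, 0) = 0" "M\<^sub>1 (0, 0) = 0" "M\<^sub>2 (0, 0) = 0" by (simp_all add: l(1) N\<^sub>2_def M\<^sub>1_def M\<^sub>2_def)
  have dec: "\<exists>a\<in>germs2. \<exists>b\<in>germs2. \<forall>\<^sub>F x in nhds (0, 0). h x = h (0, 0) + l x * a x + N\<^sub>2 x * b x" if h: "h \<in> germs2" for h
  proof -
    have "(\<lambda>x. h (M\<^sub>1 x, M\<^sub>2 x)) \<in> germs2" by (rule germs2_compose[OF h lin(1,2) l0(3,4)])
    from germs2_hadamard[OF this] obtain a b where ab: "a \<in> germs2" "b \<in> germs2"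
      and e: "\<forall>\<^sub>F x in nhds (0, 0). h (M\<^sub>1 x, M\<^sub>2 x) = h (M\<^sub>1 (0, 0), M\<^sub>2 (0, 0)) + fst x * a x + snd x * b x" by blast
    have "continuous_on UNIV (\<lambda>x. (l x, N\<^sub>2 x))" unfolding l(1) N\<^sub>2_def by (intro continuous_intros)
    then have "isCont (\<lambda>x. (l x, N\<^sub>2 x)) (0, 0)" by (simp add: continuous_on_eq_continuous_at)
    then have "filterlim (\<lambda>x. (l x, N\<^sub>2 x)) (nhds (0, 0)) (nhds (0, 0))" using l0 by (simp add: isCont_def tendsto_nhds_iff)
    from eventually_compose_filterlim[OF e this]
    have "\<forall>\<^sub>F x in nhds (0, 0). h x = h (0, 0) + l x * a (l x, N\<^sub>2 x) + N\<^sub>2 x * b (l x, N\<^sub>2 x)" by (simp add: inv l0)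
    then show ?thesis
      by (intro bexI[OF bexI[OF _ germs2_compose[OF ab(2) lin(4,3) l0(1,2)]] germs2_compose[OF ab(1) lin(4,3) l0(1,2)]])
  qed
  obtain a b where ab: "a \<in> germs2" "b \<in> germs2" and fe: "\<forall>\<^sub>F x in nhds (0, 0). f x = f (0, 0) + l x * a x + N\<^sub>2 x * b x"
    using dec[OF f(1)] by blast
  \<comment> \<open>Both sides are restricted to the parametrized line with direction
    (\<open>m\<^sub>1\<close>, \<open>m\<^sub>2\<close>), on which \<open>l\<close> vanishes and
    \<open>N\<^sub>2\<close> is the parameter.\<close>
  have b0: "b (0, 0) \<noteq> 0"
  proof
    assume z: "b (0, 0) = 0"
    have ID: "(\<lambda>t. t * c) analytic_on {0}" "deriv (\<lambda>t. t * c) 0 = c" for c :: complex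
      by (auto intro!: analytic_intros DERIV_imp_deriv derivative_eq_intros)
    have lm: "l (t * m\<^sub>1, t * m\<^sub>2) = 0" "N\<^sub>2 (t * m\<^sub>1, t * m\<^sub>2) = t" for t
    proof -
      have "l (t * m\<^sub>1, t * m\<^sub>2) = t * (\<alpha> * m\<^sub>1 + \<beta> * m\<^sub>2)" by (simp add: l(1) algebra_simps)
      then show "l (t * m\<^sub>1, t * m\<^sub>2) = 0" using l(3) by simp
      have "\<delta> * N\<^sub>2 (t * m\<^sub>1, t * m\<^sub>2) = t * \<delta>" using d0 by (simp add: N\<^sub>2_def field_simps) (simp add: \<delta>_def algebra_simps)
      then show "N\<^sub>2 (t * m\<^sub>1, t * m\<^sub>2) = t" using d0 by simp
    qed
    let ?J = "jet (\<lambda>t. t * m\<^sub>1) (\<lambda>t. t * m\<^sub>2)"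
    have "?J f = ?J (\<lambda>x. f (0, 0) + l x * a x + N\<^sub>2 x * b x)" by (rule jet_cong[OF ID(1) ID(1) _ _ fe]) simp_all
    also have "\<dots> = fps_expansion (\<lambda>t. t * b (t * m\<^sub>1, t * m\<^sub>2)) 0" by (simp add: jet_def lm f(2))
    also have "\<dots> = fps_X * ?J b"
      using E_mult[of "\<lambda>t. t" "\<lambda>t. b (t * m\<^sub>1, t * m\<^sub>2)"] curve_germ_analytic[OF ab(2) ID(1) ID(1)] by (simp add: E_id jet_def analytic_on_id[unfolded id_def])
    finally have "fps_nth (?J f) (Suc 0) = b (0, 0)" by (simp add: jet_def E_nth)
    moreover have "fps_nth (?J f) (Suc 0) = A * m\<^sub>1 + B * m\<^sub>2"
      using DERIV_imp_deriv[OF curve_germ_deriv[OF f(3) ID(1) ID(1)]] by (simp add: jet_def E_nth ID(2))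
    ultimately show False using z m by simp
  qed
  have "(\<lambda>z. h z - (\<Sum>g\<in>{\<lambda>_. 1}. h (0, 0) * g z)) \<in> germ_ideal2 f l" if h: "h \<in> germs2" for h
  proof -
    obtain a' b' where ab': "a' \<in> germs2" "b' \<in> germs2" and he: "\<forall>\<^sub>F x in nhds (0, 0). h x = h (0, 0) + l x * a' x + N\<^sub>2 x * b' x"
      using dec[OF h] by blast
    note ib = germs2_inverse[OF ab(2) b0]
    have "\<forall>\<^sub>F x in nhds (0, 0). h x - h (0, 0) = (b' x * inverse (b x)) * f x + (a' x - b' x * inverse (b x) * a x) * l x"
      using he fe ib(2)
    proof eventually_elim
      case (elim x)
      have "(b' x * inverse (b x)) * f x + (a' x - b' x * inverse (b x) * a x) * l x = b' x * (inverse (b x) * b x) * N\<^sub>2 x + a' x * l x"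
        unfolding elim(2) f(2) by (simp add: algebra_simps)
      then show ?case using elim by (simp add: algebra_simps)
    qed
    moreover have "(\<lambda>x. b' x * inverse (b x)) \<in> germs2" "(\<lambda>x. a' x - b' x * inverse (b x) * a x) \<in> germs2"
      using ab ab' ib by (intro germs2_mult germs2_diff; blast)+
    moreover have "(\<lambda>x. h x - h (0, 0)) \<in> germs2" by (intro germs2_diff germs2_gen h)
    ultimately show ?thesis unfolding germ_ideal2_def by auto
  qed
  then have "enat (card {\<lambda>_ :: complex \<times> complex. 1 :: complex}) \<in> {enat (card B) | B. finite B \<and> B \<subseteq> germs2 \<and>
      (\<forall>h\<in>germs2. \<exists>c. (\<lambda>z. h z - (\<Sum>b\<in>B. c b * b z)) \<in> germ_ideal2 f l)}"
    using germs2_gen(1)[of 1] by (intro CollectI exI[of _ "{\<lambda>_. 1}"]) (auto intro!: exI[of _ "\<lambda>_. h (0, 0)" for h])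
  then have "germ_codim2 f l \<le> enat (card {\<lambda>_ :: complex \<times> complex. 1 :: complex})" unfolding germ_codim2_def by (rule Inf_lower)
  then show ?thesis by (simp add: one_enat_def)
qed

section \<open>Local study along a line through the projection centre\<close>

text \<open>The derivative in the constant direction \<open>a\<close>. It is again a polynomial on
  the whole space, so it can be expanded, restricted and pulled back like the equation of the
  curve.\<close>

definition dd :: "complex ^ 3 \<Rightarrow> poly3 \<Rightarrow> poly3" where
  "dd a G = (\<Sum>i\<in>UNIV. emb (a $ i) * grad G $ i)"

lemma dd_explicit: "dd a G = emb (a $ 1) * dx3 G + emb (a $ 2) * dy3 G + emb (a $ 3) * dz3 G"
  by (simp add: dd_def sum_3 grad_nth)

lemma dd_add: "dd (a + b) G = dd a G + dd b G"
  by (simp add: dd_explicit rhomD[OF rhom_emb] algebra_simps)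

lemma dd_scale: "dd (c *s a) G = emb c * dd a G"
  by (simp add: dd_explicit rhomD[OF rhom_emb] algebra_simps)

lemma Hom_dd: "Hom d G \<Longrightarrow> Hom (d - 1) (dd a G)"
  unfolding dd_explicit using Hom_mult[OF Hom_emb Hom_d3(1)] Hom_mult[OF Hom_emb Hom_d3(2)] Hom_mult[OF Hom_emb Hom_d3(3)]
  by (intro Hom_add) (metis add_0)+

lemma eval3_dd: "eval3 (dd a G) v = a $ 1 * eval3 (dx3 G) v + a $ 2 * eval3 (dy3 G) v + a $ 3 * eval3 (dz3 G) v"
  by (simp add: dd_explicit eval3_hom eval3_gen)

lemma euler_dd: assumes "Hom d G" shows "eval3 (dd v G) v = of_nat d * eval3 G v"
  using arg_cong[OF euler[OF assms], of "\<lambda>F. eval3 F v"] by (simp add: eval3_dd eval3_hom eval3_gen)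

lemma lsub_dd: "dd a (lsub T G) = lsub T (dd (T *v a) G)"
proof -
  have "dd a (lsub T G) = (\<Sum>j\<in>UNIV. \<Sum>i\<in>UNIV. emb (a $ j) * (emb (T $ i $ j) * lsub T (grad G $ i)))"
    by (simp add: dd_def grad_lsub sum_distrib_left)
  also have "\<dots> = (\<Sum>i\<in>UNIV. \<Sum>j\<in>UNIV. emb (T $ i $ j * a $ j) * lsub T (grad G $ i))"
    by (subst sum.swap) (simp add: rhomD[OF rhom_emb] mult_ac)
  also have "\<dots> = lsub T (dd (T *v a) G)"
    by (simp add: dd_def lsub_sum lsub_hom lsub_gen matrix_vector_mult_def emb_sum sum_distrib_right)
  finally show ?thesis .
qed

text \<open>Partial derivatives of the local equation are local equations of derivatives along the
  chart directions; this makes the Milnor number accessible from any other frame.\<close>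

lemma local_equation_partial:
  "dx2 (local_equation F s) = local_equation (dd (fst (chart_dirs s)) F) s"
  "dy2 (local_equation F s) = local_equation (dd (snd (chart_dirs s)) F) s"
proof -
  have k: "rhom (\<lambda>c. [:[:c:]:] :: poly2)" by (simp add: rhom_def one_pCons)
  have "dx2 = map_poly pderiv" "dy2 = pderiv" by (simp_all add: fun_eq_iff dx2_def dy2_def)
  then have dx: "der dx2" and dy: "der dy2" using der_map_poly[OF der_pderiv] der_pderiv by metis+
  have c: "dx2 [:[:c:]:] = 0" "dy2 [:[:c:]:] = 0" "dx2 [:[:a, b:], [:c:]:] = [:[:b:]:]" "dy2 [:[:a, b:], [:c:]:] = [:[:c:]:]" for a b c
    by (simp_all add: dx2_def dy2_def map_poly_pCons pderiv_pCons)
  have e: "local_equation (dd a F) s = local_equation (dx3 F) s * [:[:a $ 1:]:] + local_equation (dy3 F) s * [:[:a $ 2:]:] + local_equation (dz3 F) s * [:[:a $ 3:]:]" for a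
    unfolding local_equation_def Let_def subst3_ev3 dd_explicit
    by (simp add: rhomD[OF rhom_ev3[OF k]] ev3_gen[OF k] mult.commute)
  show "dx2 (local_equation F s) = local_equation (dd (fst (chart_dirs s)) F) s"
    unfolding e unfolding local_equation_def Let_def subst3_ev3 by (subst ev3_chain[OF k dx c(1)]) (simp only: c)
  show "dy2 (local_equation F s) = local_equation (dd (snd (chart_dirs s)) F) s"
    unfolding e unfolding local_equation_def Let_def subst3_ev3 by (subst ev3_chain[OF k dy c(2)]) (simp only: c)
qed

lemma germs2_eval2: "eval2 h \<in> germs2" and holomorphic2_on_eval2: "holomorphic2_on (eval2 h) U"
proof -
  have i: "holomorphic2_on (\<lambda>x. poly q (fst x)) V" for q V
    by (induction q) (auto intro!: hol2_intros)
  have p: "poly (poly (pCons q h) [:b:]) a = poly q a + b * poly (poly h [:b:]) a" for q h a b by simp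
  have "holomorphic2_on (\<lambda>x. poly (poly h [:snd x:]) (fst x)) V" for V
  proof (induction h)
    case (pCons q h) then show ?case unfolding p by (intro hol2_intros i)
  qed (auto intro: hol2_intros)
  then have *: "holomorphic2_on (eval2 h) V" for V by (simp add: eval2_def[abs_def] case_prod_unfold)
  show "holomorphic2_on (eval2 h) U" by (rule *)
  show "eval2 h \<in> germs2" unfolding germs2_iff using *[of "bid 1"] by (intro exI[of _ 1]) simp
qed

lemma linear_form_lform: "linear_form a = lform a"
  by (simp add: linear_form_def lform_def emb_def PX_def PY_def PZ_def)

text \<open>A point s off the centre p, with a direction u that completes s and p to a basis;
  \<open>T\<close> is the coordinate change that sends [0 : 0 : 1] to p. Germs are studied in the
  coordinates s + y u + z p, and the chart data translate the results into the chart of the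
  definitions.\<close>

locale frame =
  fixes T S :: "complex ^ 3 ^ 3" and q\<^sub>1 q\<^sub>2 q\<^sub>3 e\<^sub>1 e\<^sub>2 :: complex and s u p :: "complex ^ 3"
    and r :: real and \<nu> \<Theta>\<^sub>1 \<Theta>\<^sub>2 :: "complex \<times> complex \<Rightarrow> complex" and \<alpha>\<^sub>1 \<beta>\<^sub>1 \<alpha>\<^sub>2 \<beta>\<^sub>2 :: complex
  assumes TS: "T ** S = mat 1" "S ** T = mat 1" and e: "q\<^sub>1 * e\<^sub>2 \<noteq> q\<^sub>2 * e\<^sub>1"
    and s: "s = T *v vector [q\<^sub>1, q\<^sub>2, q\<^sub>3]" and u: "u = T *v vector [e\<^sub>1, e\<^sub>2, 0]" and p: "p = T *v vector [0, 0, 1]"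
    and cd: "chart_data s u p r \<nu> \<Theta>\<^sub>1 \<Theta>\<^sub>2 \<alpha>\<^sub>1 \<beta>\<^sub>1 \<alpha>\<^sub>2 \<beta>\<^sub>2"

lemma frame_exists:
  assumes "T ** S = mat 1" "S ** T = mat 1" "q\<^sub>1 * e\<^sub>2 \<noteq> q\<^sub>2 * e\<^sub>1"
  shows "\<exists>r \<nu> \<Theta>\<^sub>1 \<Theta>\<^sub>2 \<alpha>\<^sub>1 \<beta>\<^sub>1 \<alpha>\<^sub>2 \<beta>\<^sub>2. frame T S q\<^sub>1 q\<^sub>2 q\<^sub>3 e\<^sub>1 e\<^sub>2 (T *v vector [q\<^sub>1, q\<^sub>2, q\<^sub>3]) (T *v vector [e\<^sub>1, e\<^sub>2, 0]) (T *v vector [0, 0, 1]) r \<nu> \<Theta>\<^sub>1 \<Theta>\<^sub>2 \<alpha>\<^sub>1 \<beta>\<^sub>1 \<alpha>\<^sub>2 \<beta>\<^sub>2"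
  using chart_change[OF frame_independent[OF assms(2,3), of _ q\<^sub>3]] assms unfolding frame_def by blast

context frame
begin

lemmas ind = frame_independent[OF TS(2) e, of _ q\<^sub>3, folded s u p]
lemmas r0 = chart_dataD(1)[OF cd] and hol_nu = chart_dataD(2)[OF cd] and nu_nz = chart_dataD(3)[OF cd]
  and hol_theta = chart_dataD(4,5)[OF cd] and theta0 = chart_dataD(6,7)[OF cd] and nu0 = chart_dataD(8)[OF cd]
  and d_theta = chart_dataD(9,10)[OF cd] and det = chart_dataD(11)[OF cd] and chart_eq = chart_dataD(12)[OF cd]
  and p_dir = chart_dataD(13)[OF cd] and theta_eq = chart_dataD(14,15)[OF cd]

lemma spans: "\<exists>a b c. v = a *s s + b *s u + c *s p"
proof -
  define w where "w = S *v v"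
  define D where "D = q\<^sub>1 * e\<^sub>2 - q\<^sub>2 * e\<^sub>1"
  define a where "a = (w $ 1 * e\<^sub>2 - w $ 2 * e\<^sub>1) / D"
  define b where "b = (q\<^sub>1 * w $ 2 - q\<^sub>2 * w $ 1) / D"
  have D: "D \<noteq> 0" using e by (simp add: D_def)
  have 1: "a * q\<^sub>1 + b * e\<^sub>1 = w $ 1"
  proof -
    have "D * (a * q\<^sub>1 + b * e\<^sub>1) = (w $ 1 * e\<^sub>2 - w $ 2 * e\<^sub>1) * q\<^sub>1 + (q\<^sub>1 * w $ 2 - q\<^sub>2 * w $ 1) * e\<^sub>1" using D by (simp add: a_def b_def field_simps)
    also have "\<dots> = D * w $ 1" by (simp add: D_def algebra_simps)
    finally show ?thesis using D by simp
  qed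
  have 2: "a * q\<^sub>2 + b * e\<^sub>2 = w $ 2"
  proof -
    have "D * (a * q\<^sub>2 + b * e\<^sub>2) = (w $ 1 * e\<^sub>2 - w $ 2 * e\<^sub>1) * q\<^sub>2 + (q\<^sub>1 * w $ 2 - q\<^sub>2 * w $ 1) * e\<^sub>2" using D by (simp add: a_def b_def field_simps)
    also have "\<dots> = D * w $ 2" by (simp add: D_def algebra_simps)
    finally show ?thesis using D by simp
  qed
  have "w = a *s vector [q\<^sub>1, q\<^sub>2, q\<^sub>3] + b *s vector [e\<^sub>1, e\<^sub>2, 0] + (w $ 3 - a * q\<^sub>3) *s vector [0, 0, 1]"
    using 1 2 by (simp add: vec_eq_iff forall_3)
  then have "T *v w = a *s s + b *s u + (w $ 3 - a * q\<^sub>3) *s p"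
    unfolding s u p vector_scalar_commute[symmetric] matrix_vector_right_distrib[symmetric] by simp
  moreover have "T *v w = v" by (simp add: w_def matrix_vector_mul_assoc TS)
  ultimately show ?thesis by metis
qed

definition pull :: "poly3 \<Rightarrow> complex \<times> complex \<Rightarrow> complex" where
  "pull K x = eval3 K (s + fst x *s u + snd x *s p)"

definition ser :: "poly3 \<Rightarrow> ser2" where "ser K = loc q\<^sub>1 q\<^sub>2 q\<^sub>3 e\<^sub>1 e\<^sub>2 (lsub T K)"

lemma germ_pull: "pull K \<in> germs2" and tay_pull: "tay (pull K) = ser K"
proof -
  have "pull K = (\<lambda>x. eval3 K (s + fst x *s u + snd x *s p))" by (simp add: fun_eq_iff pull_def)
  then show "pull K \<in> germs2" "tay (pull K) = ser K"
    using tay_loc[of K T q\<^sub>1 q\<^sub>2 q\<^sub>3 e\<^sub>1 e\<^sub>2, folded s u p] by (simp_all add: ser_def)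
qed

lemma ser_deriv: "fps_deriv (ser K) = ser (dd u K)" "dzs (ser K) = ser (dd p K)"
proof -
  have "dd (vector [e\<^sub>1, e\<^sub>2, 0]) (lsub T K) = lsub T (dd u K)" "dd (vector [0, 0, 1]) (lsub T K) = lsub T (dd p K)"
    by (simp_all add: lsub_dd u p)
  then have 1: "emb e\<^sub>1 * dx3 (lsub T K) + emb e\<^sub>2 * dy3 (lsub T K) = lsub T (dd u K)" "dz3 (lsub T K) = lsub T (dd p K)"
    by (simp_all add: dd_explicit rhomD[OF rhom_emb])
  have "fps_deriv (ser K) = loc q\<^sub>1 q\<^sub>2 q\<^sub>3 e\<^sub>1 e\<^sub>2 (emb e\<^sub>1 * dx3 (lsub T K) + emb e\<^sub>2 * dy3 (lsub T K))"
    by (simp add: ser_def fps_deriv_loc loc_hom loc_gen)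
  then show "fps_deriv (ser K) = ser (dd u K)" unfolding 1 ser_def .
  show "dzs (ser K) = ser (dd p K)" unfolding ser_def dzs_loc 1 ..
qed

lemma cf_ser: "cf (ser K) 0 0 = eval3 K s"
  by (simp add: ser_def cf_def fps_nth_loc_00 eval3_lsub s)

lemma eval_q: "eval3 (lsub T K) (vector [q\<^sub>1, q\<^sub>2, q\<^sub>3]) = eval3 K s" "eval3 (dz3 (lsub T K)) (vector [q\<^sub>1, q\<^sub>2, q\<^sub>3]) = eval3 (dd p K) s"
proof -
  show "eval3 (lsub T K) (vector [q\<^sub>1, q\<^sub>2, q\<^sub>3]) = eval3 K s" by (simp add: eval3_lsub s)
  have "dd (vector [0, 0, 1]) (lsub T K) = lsub T (dd p K)" by (simp add: lsub_dd p)
  then have "dz3 (lsub T K) = lsub T (dd p K)" by (simp add: dd_explicit rhomD[OF rhom_emb])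
  then show "eval3 (dz3 (lsub T K)) (vector [q\<^sub>1, q\<^sub>2, q\<^sub>3]) = eval3 (dd p K) s" by (simp add: eval3_lsub s)
qed

lemma cf_ser_jet:
  "cf (ser K) 1 0 = eval3 (dd u K) s" "cf (ser K) 0 1 = eval3 (dd p K) s" "2 * cf (ser K) 2 0 = eval3 (dd u (dd u K)) s"
  "2 * cf (ser K) 0 2 = eval3 (dd p (dd p K)) s" "cf (ser K) 1 1 = eval3 (dd p (dd u K)) s" "cf (ser K) 1 1 = eval3 (dd u (dd p K)) s"
  unfolding cf_ser[symmetric] ser_deriv[symmetric] cf_der by (simp_all add: numeral_2_eq_2)

lemma has_derivative_pull:
  "(pull K has_derivative (\<lambda>h. eval3 (dd u K) s * fst h + eval3 (dd p K) s * snd h)) (at (0, 0))"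
proof -
  obtain R where "R > 0" "holomorphic2_on (pull K) (bid R)" using germ_pull[of K] germs2_iff by auto
  then obtain a b where d: "(pull K has_derivative (\<lambda>h. a * fst h + b * snd h)) (at (0, 0))" unfolding holomorphic2_on_def by force
  from cf_tay_jet[OF germ_pull this] have "a = eval3 (dd u K) s" "b = eval3 (dd p K) s"
    by (simp_all only: tay_pull cf_ser_jet)
  then show ?thesis using d by simp
qed

lemma pull_local_equation:
  assumes "Hom d K" "x \<in> bid r"
  shows "pull K x = \<nu> x ^ d * eval2 (local_equation K s) (\<Theta>\<^sub>1 x, \<Theta>\<^sub>2 x)"
  using assms(1) unfolding pull_def chart_eq[OF assms(2)] Hom_iff_eval eval2_local_equation by blast

lemma germ_theta: "\<Theta>\<^sub>1 \<in> germs2" "\<Theta>\<^sub>2 \<in> germs2" "\<nu> \<in> germs2"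
  using r0 hol_theta hol_nu germs2_iff by blast+

context
  fixes \<sigma> \<tau> :: "complex \<Rightarrow> complex"
  assumes an: "\<sigma> analytic_on {0}" "\<tau> analytic_on {0}" "\<sigma> 0 = 0" "\<tau> 0 = 0"
begin

lemma chart_curve:
  "(\<lambda>t. \<Theta>\<^sub>1 (\<sigma> t, \<tau> t)) analytic_on {0}" "(\<lambda>t. \<Theta>\<^sub>2 (\<sigma> t, \<tau> t)) analytic_on {0}"
  "\<Theta>\<^sub>1 (\<sigma> 0, \<tau> 0) = 0" "\<Theta>\<^sub>2 (\<sigma> 0, \<tau> 0) = 0"
  "deriv (\<lambda>t. \<Theta>\<^sub>1 (\<sigma> t, \<tau> t)) 0 = \<alpha>\<^sub>1 * deriv \<sigma> 0 + \<beta>\<^sub>1 * deriv \<tau> 0"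
  "deriv (\<lambda>t. \<Theta>\<^sub>2 (\<sigma> t, \<tau> t)) 0 = \<alpha>\<^sub>2 * deriv \<sigma> 0 + \<beta>\<^sub>2 * deriv \<tau> 0"
  using curve_germ_analytic[OF germ_theta(1) an] curve_germ_analytic[OF germ_theta(2) an] an theta0
    DERIV_imp_deriv[OF curve_germ_deriv[OF d_theta(1) an]] DERIV_imp_deriv[OF curve_germ_deriv[OF d_theta(2) an]] by auto

text \<open>After the change of chart the local equation differs from \<open>pull K\<close> by a
  unit, a power of \<open>\<nu>\<close>, which does not affect vanishing along a curve.\<close>

lemma jet_local_equation_zero:
  assumes K: "Hom d K" and z: "\<And>k. k < n \<Longrightarrow> fps_nth (jet \<sigma> \<tau> (pull K)) k = 0" and "k < n"
  shows "fps_nth (jet (\<lambda>t. \<Theta>\<^sub>1 (\<sigma> t, \<tau> t)) (\<lambda>t. \<Theta>\<^sub>2 (\<sigma> t, \<tau> t)) (eval2 (local_equation K s))) k = 0"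
proof -
  let ?J = "jet \<sigma> \<tau>"
  let ?g = "\<lambda>x. eval2 (local_equation K s) (\<Theta>\<^sub>1 x, \<Theta>\<^sub>2 x)"
  have g: "?g \<in> germs2" by (rule germs2_compose[OF germs2_eval2 germ_theta(1,2) theta0])
  have "\<nu> (0, 0) \<noteq> 0" by (simp add: nu0)
  note iv = germs2_inverse[OF germ_theta(3) this]
  define N where "N x = inverse (\<nu> x) ^ d" for x
  have N: "N \<in> germs2" unfolding N_def[abs_def]
  proof (induction d)
    case (Suc d) then show ?case using germs2_mult[OF iv(1)] by simp
  qed (simp add: germs2_gen)
  have "\<forall>\<^sub>F x in nhds (0, 0). ?g x = N x * pull K x"
    unfolding nhds00
  proof (intro exI[of _ r] conjI r0 ballI)
    fix x assume x: "x \<in> bid r"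
    show "?g x = N x * pull K x" unfolding pull_local_equation[OF K x] N_def using nu_nz[OF x] by (simp add: power_inverse)
  qed
  from jet_cong[OF an this] have "?J ?g = ?J (\<lambda>x. N x * pull K x)" .
  also have "\<dots> = ?J N * ?J (pull K)"
    unfolding jet_def by (rule E_mult[OF curve_germ_analytic[OF N an] curve_germ_analytic[OF germ_pull an]])
  finally have "fps_nth (?J ?g) k = 0" using z \<open>k < n\<close> by (simp add: fps_mult_nth)
  then show ?thesis by (simp add: jet_def)
qed

end

lemma jet_vertical: "jet (\<lambda>t. 0) (\<lambda>t. t) g = fps_nth (tay g) 0"
  by (rule fps_ext) (simp add: jet_def tay_def E_nth tcol_def)

text \<open>If the derivative along p vanishes, both equations vanish to order at least two along
  the line, and \<open>codim_ge_curve\<close> gives codimension at least two. Otherwise the curve is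
  transversal to the line and \<open>codim_le_one\<close> applies.\<close>

lemma intersection_multiplicity_line:
  assumes F: "Hom d F" "eval3 F s = 0" and L: "is_line L" "p \<in> L" "s \<in> L"
  shows "intersection_multiplicity F (line_equation L) s > 1 \<longleftrightarrow> eval3 (dd p F) s = 0"
proof -
  define a where "a = (SOME a. a \<noteq> 0 \<and> L = {v. eval3 (linear_form a) v = 0})"
  have "a \<noteq> 0 \<and> L = {v. eval3 (linear_form a) v = 0}"
    using L(1) unfolding is_line_def a_def by (rule someI_ex)
  then have a: "a \<noteq> 0" "L = {v. eval3 (linear_form a) v = 0}" by blast+
  define G where "G = linear_form a"
  have G: "line_equation L = G" by (simp add: line_equation_def a_def G_def)
  have Gl: "G = lform a" unfolding G_def by (rule linear_form_lform)
  have add: "eval3 G (v + w) = eval3 G v + eval3 G w" "eval3 G (c *s v) = c * eval3 G v" for v w c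
    by (simp_all add: Gl eval3_lform sum.distrib algebra_simps sum_distrib_left)
  have Gh: "Hom 1 G" unfolding Hom_iff_eval by (simp add: add)
  have Gs: "eval3 G s = 0" "eval3 G p = 0" using L(2,3) a(2) by (auto simp: G_def)
  have Gu: "eval3 G u \<noteq> 0"
  proof
    assume "eval3 G u = 0"
    then have "eval3 G v = 0" for v using spans[of v] Gs by (auto simp: add)
    moreover have "eval3 G (axis i 1) = a $ i" for i
      by (simp add: Gl eval3_lform axis_def if_distrib[of "(*) _"] cong: if_cong)
    ultimately have "a $ i = 0" for i by metis
    then show False using a(1) by (simp add: vec_eq_iff)
  qed
  let ?f = "eval2 (local_equation F s)" and ?l = "eval2 (local_equation G s)"
  define w\<^sub>1 w\<^sub>2 where "w\<^sub>1 = fst (chart_dirs s)" and "w\<^sub>2 = snd (chart_dirs s)"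
  have l: "?l x = eval3 G w\<^sub>1 * fst x + eval3 G w\<^sub>2 * snd x" for x
    by (cases x) (simp add: eval2_local_equation chart_def add Gs w\<^sub>1_def w\<^sub>2_def)
  have lm: "eval3 G w\<^sub>1 * \<beta>\<^sub>1 + eval3 G w\<^sub>2 * \<beta>\<^sub>2 = 0"
  proof -
    obtain c where "p = \<beta>\<^sub>1 *s w\<^sub>1 + \<beta>\<^sub>2 *s w\<^sub>2 + c *s s" using p_dir by (auto simp: w\<^sub>1_def w\<^sub>2_def)
    from arg_cong[OF this, of "eval3 G"] show ?thesis by (simp add: add Gs mult.commute)
  qed
  have ID: "(\<lambda>t::complex. 0::complex) analytic_on {0}" "(\<lambda>t::complex. t) analytic_on {0}" by (auto intro: analytic_intros)
  note cc = chart_curve[OF ID refl refl]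
  have der: "deriv (\<lambda>t. \<Theta>\<^sub>1 (0, t)) 0 = \<beta>\<^sub>1" "deriv (\<lambda>t. \<Theta>\<^sub>2 (0, t)) 0 = \<beta>\<^sub>2" using cc(5,6) by simp_all
  have E: "fps_nth (jet (\<lambda>t. 0) (\<lambda>t. t) (pull K)) 0 = eval3 K s" "fps_nth (jet (\<lambda>t. 0) (\<lambda>t. t) (pull K)) 1 = eval3 (dd p K) s" for K
    unfolding jet_vertical tay_pull using cf_ser[of K] cf_ser_jet(2)[of K] by (simp_all add: cf_def)
  show ?thesis
  proof (cases "eval3 (dd p F) s = 0")
    case True
    have ddG: "eval3 (dd p G) s = 0"
      using Gs(2) by (simp add: eval3_dd Gl lform_def dx3_der dy3_der dz3_der eval3_hom eval3_gen algebra_simps)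
    have two: "(k::nat) < 2 \<Longrightarrow> k = 0 \<or> k = 1" for k by auto
    have "enat 2 \<le> germ_codim2 ?f ?l"
    proof (rule codim_ge_curve)
      show "bij_betw (\<lambda>i::2. if i = 1 then 0 else 1) UNIV {..<2::nat}"
        by (rule bij_betwI[where g = "\<lambda>k. if k = 0 then 1 else 2"]) (auto simp: UNIV_2)
      show "?f \<in> germs2" "?l \<in> germs2" by (rule germs2_eval2)+
      show "(\<lambda>t. \<Theta>\<^sub>1 (0, t)) analytic_on {0}" "(\<lambda>t. \<Theta>\<^sub>2 (0, t)) analytic_on {0}" "\<Theta>\<^sub>1 (0, 0) = 0" "\<Theta>\<^sub>2 (0, 0) = 0" using cc by simp_all
      show "(deriv (\<lambda>t. \<Theta>\<^sub>1 (0, t)) 0, deriv (\<lambda>t. \<Theta>\<^sub>2 (0, t)) 0) \<noteq> (0, 0)" unfolding der using det by auto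
      show "fps_nth (jet (\<lambda>t. \<Theta>\<^sub>1 (0, t)) (\<lambda>t. \<Theta>\<^sub>2 (0, t)) ?f) k = 0" if "k < 2" for k
        using jet_local_equation_zero[OF ID refl refl F(1) _ that] E[of F] F(2) True two by metis
      show "fps_nth (jet (\<lambda>t. \<Theta>\<^sub>1 (0, t)) (\<lambda>t. \<Theta>\<^sub>2 (0, t)) ?l) k = 0" if "k < 2" for k
        using jet_local_equation_zero[OF ID refl refl Gh _ that] E[of G] Gs ddG two by metis
    qed
    moreover have "(1::enat) < enat 2" by (simp add: one_enat_def)
    ultimately have "1 < germ_codim2 ?f ?l" by (rule less_le_trans[rotated])
    then show ?thesis using True by (simp add: intersection_multiplicity_def G)
  next
    case False
    obtain A B where AB: "(?f has_derivative (\<lambda>h. A * fst h + B * snd h)) (at (0, 0))"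
      using holomorphic2_on_eval2[of "local_equation F s" UNIV] unfolding holomorphic2_on_def by blast
    have f0: "?f (0, 0) = 0" using F(2) by (simp add: eval2_local_equation chart_def)
    have "A * \<beta>\<^sub>1 + B * \<beta>\<^sub>2 \<noteq> 0"
    proof
      assume z: "A * \<beta>\<^sub>1 + B * \<beta>\<^sub>2 = 0"
      let ?J = "jet (\<lambda>t. 0) (\<lambda>t. t)"
      let ?g = "\<lambda>x. ?f (\<Theta>\<^sub>1 x, \<Theta>\<^sub>2 x)"
      have g: "?g \<in> germs2" by (rule germs2_compose[OF germs2_eval2 germ_theta(1,2) theta0])
      have Nd: "(\<lambda>x. \<nu> x ^ d) \<in> germs2"
      proof (induction d)
        case (Suc d) then show ?case using germs2_mult[OF germ_theta(3)] by simp
      qed (simp add: germs2_gen)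
      have "\<forall>\<^sub>F x in nhds (0, 0). pull F x = \<nu> x ^ d * ?g x"
        unfolding nhds00 using r0 pull_local_equation[OF F(1)] by blast
      from jet_cong[OF ID refl refl this] have "?J (pull F) = ?J (\<lambda>x. \<nu> x ^ d * ?g x)" .
      also have "\<dots> = ?J (\<lambda>x. \<nu> x ^ d) * ?J ?g"
        unfolding jet_def by (rule E_mult[OF curve_germ_analytic[OF Nd ID refl refl] curve_germ_analytic[OF g ID refl refl]])
      finally have e: "?J (pull F) = ?J (\<lambda>x. \<nu> x ^ d) * ?J ?g" .
      have "deriv (\<lambda>t. ?f (\<Theta>\<^sub>1 (0, t), \<Theta>\<^sub>2 (0, t))) 0 = 0"
        using DERIV_imp_deriv[OF curve_germ_deriv[OF AB, of "\<lambda>t. \<Theta>\<^sub>1 (0, t)" "\<lambda>t. \<Theta>\<^sub>2 (0, t)"]] cc z der by simp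
      then have "fps_nth (?J ?g) 1 = 0" "fps_nth (?J ?g) 0 = 0" using f0 theta0 by (simp_all add: jet_def E_nth)
      then have "fps_nth (?J (pull F)) 1 = 0" unfolding e by (simp add: fps_mult_nth)
      then show False using False E(2)[of F] by simp
    qed
    \<comment> \<open>Otherwise the equation of the line would vanish on the whole chart, and hence
      on \<open>u\<close>.\<close>
    moreover have "(eval3 G w\<^sub>1, eval3 G w\<^sub>2) \<noteq> (0, 0)"
    proof
      assume z: "(eval3 G w\<^sub>1, eval3 G w\<^sub>2) = (0, 0)"
      have "(of_real (r / 2), 0) \<in> bid r" using r0 by simp
      from arg_cong[OF chart_eq[OF this], of "eval3 G"] have "of_real (r / 2) * eval3 G u = 0"
        using z by (simp add: add Gs chart_def w\<^sub>1_def w\<^sub>2_def)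
      then show False using Gu r0 by simp
    qed
    ultimately have "germ_codim2 ?f ?l \<le> 1" by (intro codim_le_one[OF germs2_eval2 f0 AB l _ lm])
    then show ?thesis using False by (simp add: intersection_multiplicity_def G not_less)
  qed
qed

end

section \<open>Branches at the singularities of order at least three\<close>

lemma holomorphic2_on_dy:
  assumes "holomorphic2_on g (bid R)"
  shows "holomorphic2_on (\<lambda>x. deriv (\<lambda>y. g (y, snd x)) (fst x)) (bid R)"
proof -
  have "holomorphic2_on (\<lambda>x. g (snd x, fst x)) (bid R)"
    by (rule holomorphic2_on_compose[OF assms holomorphic2_on_snd holomorphic2_on_fst]) auto
  from holomorphic2_on_dz[OF this]
  have *: "holomorphic2_on (\<lambda>x. deriv (\<lambda>z. g (z, fst x)) (snd x)) (bid R)" by simp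
  have "holomorphic2_on (\<lambda>x. (\<lambda>x. deriv (\<lambda>z. g (z, fst x)) (snd x)) (snd x, fst x)) (bid R)"
    by (rule holomorphic2_on_compose[OF * holomorphic2_on_snd holomorphic2_on_fst]) auto
  then show ?thesis by simp
qed

text \<open>The inverse function theorem is applied to the map from (t, z) to (t, G(t, z)). That
  theorem is real; the solution is holomorphic because its derivative, found by differentiating G(t,
  v(t)) = 0, is multiplication by a complex number.\<close>

theorem implicit_function_germ:
  assumes G: "G \<in> germs2" "G (0, 0) = 0" and d: "(G has_derivative (\<lambda>h. \<alpha> * fst h + \<beta> * snd h)) (at (0, 0))" and b: "\<beta> \<noteq> 0"
  shows "\<exists>v. v analytic_on {0} \<and> v 0 = 0 \<and> (\<forall>\<^sub>F t in nhds 0. G (t, v t) = 0)"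
proof -
  obtain R where R: "R > 0" "holomorphic2_on G (bid R)" using G(1) germs2_iff by auto
  define A where "A x = deriv (\<lambda>y. G (y, snd x)) (fst x)" for x
  define B where "B x = deriv (\<lambda>z. G (fst x, z)) (snd x)" for x
  have cA: "continuous_on (bid R) A" and cB: "continuous_on (bid R) B"
    unfolding A_def[abs_def] B_def[abs_def]
    by (rule holomorphic2_on_imp_continuous_on[OF holomorphic2_on_dy[OF R(2)]] holomorphic2_on_imp_continuous_on[OF holomorphic2_on_dz[OF R(2)]])+
  have dG: "(G has_derivative (\<lambda>h. A x * fst h + B x * snd h)) (at x)" if "x \<in> bid R" for x
  proof -
    obtain a c where ac: "(G has_derivative (\<lambda>h. a * fst h + c * snd h)) (at x)" using R(2) \<open>x \<in> bid R\<close> unfolding holomorphic2_on_def by blast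
    then have "(G has_derivative (\<lambda>h. a * fst h + c * snd h)) (at (fst x, snd x))" by simp
    note p = has_derivative2_partial[OF this]
    have "A x = a" "B x = c" unfolding A_def B_def using DERIV_imp_deriv[OF p(1)] DERIV_imp_deriv[OF p(2)] by auto
    then show ?thesis using ac by simp
  qed
  have 0: "(0, 0) \<in> bid R" using R(1) by simp
  have AB0: "A (0, 0) = \<alpha>" "B (0, 0) = \<beta>"
    using DERIV_imp_deriv[OF has_derivative2_partial(1)[OF d]] DERIV_imp_deriv[OF has_derivative2_partial(2)[OF d]] by (simp_all add: A_def B_def)
  define inl inr where "inl = Blinfun (\<lambda>z::complex. (z, 0::complex))" and "inr = Blinfun (\<lambda>z::complex. (0::complex, z))"
  have "bounded_linear (\<lambda>z::complex. (z, 0::complex))" "bounded_linear (\<lambda>z::complex. (0::complex, z))"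
    by (intro bounded_linear_Pair bounded_linear_ident bounded_linear_zero)+
  then have inl: "blinfun_apply inl z = (z, 0)" and inr: "blinfun_apply inr z = (0, z)" for z
    by (simp_all add: inl_def inr_def bounded_linear_Blinfun_apply)
  define f where "f x = (fst x, G x)" for x
  define f' where "f' x = (inl o\<^sub>L fst_blinfun) + (inr o\<^sub>L ((blinfun_mult_right (A x) o\<^sub>L fst_blinfun) + (blinfun_mult_right (B x) o\<^sub>L snd_blinfun)))" for x
  have f': "blinfun_apply (f' x) h = (fst h, A x * fst h + B x * snd h)" for x h
    by (simp add: f'_def blinfun.add_left inl inr)
  \<comment> \<open>The inverse of the derivative of \<open>f\<close> at the origin.\<close>
  define g0 where "g0 = (inl o\<^sub>L fst_blinfun) + (inr o\<^sub>L ((blinfun_mult_right (- \<alpha> / \<beta>) o\<^sub>L fst_blinfun) + (blinfun_mult_right (1 / \<beta>) o\<^sub>L snd_blinfun)))"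
  have g0: "blinfun_apply g0 h = (fst h, (- \<alpha> / \<beta>) * fst h + (1 / \<beta>) * snd h)" for h
    by (simp add: g0_def blinfun.add_left inl inr)
  have df: "(f has_derivative blinfun_apply (f' x)) (at x)" if "x \<in> bid R" for x
    unfolding f_def[abs_def] f'[abs_def] by (rule has_derivative_Pair[OF has_derivative_fst[OF has_derivative_ident] dG[OF that]])
  have cf: "continuous_on (bid R) f'" unfolding f'_def
    by (intro continuous_intros bounded_linear.continuous_on[OF bounded_linear_blinfun_mult_right] cA cB)
  have iv: "g0 o\<^sub>L f' (0, 0) = id_blinfun"
    by (rule blinfun_eqI) (use b in \<open>auto simp: g0 f' AB0 field_simps\<close>)
  obtain U V g g' where U: "open U" "U \<subseteq> bid R" "(0, 0) \<in> U" "open V" "f (0, 0) \<in> V" and h: "homeomorphism U V f g"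
    and dg: "\<And>y. y \<in> V \<Longrightarrow> (g has_derivative (g' y)) (at y)" and "\<And>y. y \<in> V \<Longrightarrow> g' y = inv (blinfun_apply (f'(g y)))"
    and bij: "\<And>y. y \<in> V \<Longrightarrow> bij (blinfun_apply (f'(g y)))"
    using inverse_function_theorem[OF open_bid df cf 0 iv] by metis
  have f0: "f (0, 0) = (0, 0)" by (simp add: f_def G(2))
  have gf: "g (0, 0) = (0, 0)" using homeomorphism_apply1[OF h U(3)] f0 by simp
  define v where "v t = snd (g (t, 0))" for t
  define N where "N = (\<lambda>t::complex. (t, 0::complex)) -` V"
  have N: "open N" "0 \<in> N" unfolding N_def using U(4,5) f0 by (auto intro!: open_vimage continuous_intros)
  have gt: "g (t, 0) = (t, v t)" "G (t, v t) = 0" "(t, v t) \<in> bid R" if "t \<in> N" for t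
  proof -
    have V: "(t, 0) \<in> V" using that by (simp add: N_def)
    have "f (g (t, 0)) = (t, 0)" by (rule homeomorphism_apply2[OF h V])
    then have 1: "fst (g (t, 0)) = t" "G (g (t, 0)) = 0" by (simp_all add: f_def)
    then show e: "g (t, 0) = (t, v t)" by (simp add: v_def prod_eq_iff)
    show "G (t, v t) = 0" using 1(2) e by simp
    have "g (t, 0) \<in> U" using homeomorphism_image2[OF h] V by blast
    then show "(t, v t) \<in> bid R" using e U(2) by auto
  qed
  have "(v has_field_derivative - A (t, v t) / B (t, v t)) (at t)" if t: "t \<in> N" for t
  proof -
    have V: "(t, 0) \<in> V" using t by (simp add: N_def)
    define D where "D k = snd (g' (t, 0) (k, 0))" for k
    have "((\<lambda>t. (t, 0::complex)) has_derivative (\<lambda>k. (k, 0))) (at t)" by (auto intro!: derivative_eq_intros)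
    from has_derivative_snd[OF has_derivative_compose[OF this dg[OF V]]]
    have vD: "(v has_derivative D) (at t)" by (simp add: v_def[abs_def] D_def[abs_def])
    have "((\<lambda>t. (t, v t)) has_derivative (\<lambda>k. (k, D k))) (at t)" by (rule has_derivative_Pair[OF has_derivative_ident vD])
    from has_derivative_compose[OF this dG[OF gt(3)[OF t]]]
    have 1: "((\<lambda>t. G (t, v t)) has_derivative (\<lambda>k. A (t, v t) * k + B (t, v t) * D k)) (at t)" by simp
    have "((\<lambda>t. 0) has_derivative (\<lambda>k. A (t, v t) * k + B (t, v t) * D k)) (at t)"
      by (rule has_derivative_transform_within_open[OF 1 N(1) t]) (simp add: gt)
    then have e: "(\<lambda>k. A (t, v t) * k + B (t, v t) * D k) = (\<lambda>k. 0)" by (rule has_derivative_unique) (rule has_derivative_const)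
    have "B (t, v t) \<noteq> 0"
    proof
      assume "B (t, v t) = 0"
      then have "blinfun_apply (f' (g (t, 0))) (0, 1) = blinfun_apply (f' (g (t, 0))) (0, 0)" by (simp add: f' gt(1)[OF t])
      then show False using bij[OF V] by (metis bij_is_inj injD prod.inject zero_neq_one)
    qed
    then have "D k = - A (t, v t) / B (t, v t) * k" for k using fun_cong[OF e, of k] by (simp add: field_simps add_eq_0_iff)
    then have "D = (*) (- A (t, v t) / B (t, v t))" by (simp add: fun_eq_iff)
    then show ?thesis using vD unfolding has_field_derivative_def by simp
  qed
  then have "v holomorphic_on N" unfolding holomorphic_on_open[OF N(1)] by blast
  then have "v analytic_on {0}" using N analytic_at by blast
  moreover have "v 0 = 0" by (simp add: v_def gf)
  moreover have "\<forall>\<^sub>F t in nhds 0. G (t, v t) = 0" unfolding eventually_nhds using N gt(2) by blast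
  ultimately show ?thesis by blast
qed

lemma analytic_factor:
  assumes "f analytic_on {0}" "\<And>k. k < n \<Longrightarrow> fps_nth (fps_expansion f 0) k = 0"
  shows "\<exists>g. g analytic_on {0} \<and> g 0 = fps_nth (fps_expansion f 0) n \<and> (\<forall>\<^sub>F z in nhds 0. f z = z ^ n * g z)"
proof -
  let ?F = "fps_expansion f 0"
  have F: "f has_fps_expansion ?F" by (rule analytic_at_imp_has_fps_expansion_0[OF assms(1)])
  then have r: "fps_conv_radius ?F > 0" by (simp add: has_fps_expansion_def)
  define g where "g = eval_fps (fps_shift n ?F)"
  have g: "g has_fps_expansion fps_shift n ?F" unfolding g_def by (rule eval_fps_has_fps_expansion) (simp add: r)
  have X: "fps_X ^ n * fps_shift n ?F = ?F" using assms(2) by (intro fps_ext) (simp add: fps_X_power_mult_nth)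
  have "(\<lambda>z. z ^ n * g z) has_fps_expansion fps_X ^ n * fps_shift n ?F"
    by (intro has_fps_expansion_mult g has_fps_expansion_fps_X_power)
  then have h: "(\<lambda>z. z ^ n * g z) has_fps_expansion ?F" unfolding X .
  have "\<forall>\<^sub>F z in nhds 0. f z = z ^ n * g z"
    using F h unfolding has_fps_expansion_def by (auto elim: eventually_elim2)
  moreover have "g analytic_on {0}" using g has_fps_expansion_imp_analytic_0 by blast
  moreover have "g 0 = fps_nth ?F n" using has_fps_expansion_imp_0_eq_fps_nth_0[OF g] by simp
  ultimately show ?thesis by blast
qed

lemma germs2_of_analytic: assumes "c analytic_on {0}" shows "(\<lambda>x. c (fst x)) \<in> germs2" "(\<lambda>x. c (snd x)) \<in> germs2"
proof -
  obtain r where r: "r > 0" "c holomorphic_on ball 0 r" using assms by (auto simp: analytic_on_def)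
  have "holomorphic2_on (\<lambda>x. c (fst x)) (bid r)" "holomorphic2_on (\<lambda>x. c (snd x)) (bid r)"
    by (rule holomorphic2_on_compose1[OF r(2) open_ball holomorphic2_on_fst], auto)
      (rule holomorphic2_on_compose1[OF r(2) open_ball holomorphic2_on_snd], auto)
  then show "(\<lambda>x. c (fst x)) \<in> germs2" "(\<lambda>x. c (snd x)) \<in> germs2" using r(1) germs2_iff by blast+
qed

lemma germs2_hadamard1:
  assumes "g \<in> germs2" shows "\<exists>k\<in>germs2. \<forall>\<^sub>F x in nhds (0, 0). g x = g (0, snd x) + fst x * k x"
proof -
  obtain R where R: "R > 0" "holomorphic2_on g (bid R)" using assms germs2_iff by auto
  obtain k where k: "holomorphic2_on k (bid (R / 2))" and kk: "\<forall>y z. (y, z) \<in> bid (R / 2) \<longrightarrow> g (y, z) = g (0, z) + y * k (y, z)"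
    using holomorphic2_hadamard[OF R(2), of "R / 2"] R(1) by auto
  have R2: "R / 2 > 0" using R(1) by simp
  have "k \<in> germs2" unfolding germs2_iff using k R2 by blast
  moreover have "g x = g (0, snd x) + fst x * k x" if "x \<in> bid (R / 2)" for x
    using kk[rule_format, of "fst x" "snd x"] that by simp
  ultimately show ?thesis using R2 unfolding nhds00 by blast
qed

lemma germs2_has_derivative: assumes "g \<in> germs2" obtains \<alpha> \<beta> where "(g has_derivative (\<lambda>h. \<alpha> * fst h + \<beta> * snd h)) (at (0, 0))"
proof -
  obtain R where "R > 0" "holomorphic2_on g (bid R)" using assms germs2_iff by auto
  then show ?thesis using that unfolding holomorphic2_on_def by force
qed

lemma eval3_line_deriv: "((\<lambda>h. eval3 K (v + h *s u)) has_field_derivative eval3 (dd u K) (v + h *s u)) (at h)"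
proof (induction K rule: poly3_induct)
  case (5 F G) then show ?case unfolding eval3_hom dd_explicit dx3_der dy3_der dz3_der
    by (rule DERIV_cong[OF DERIV_add]) (simp add: eval3_hom eval3_dd algebra_simps)
next
  case (6 F G) then show ?case unfolding eval3_hom
    by (rule DERIV_cong[OF DERIV_mult]) (simp add: dd_explicit dx3_der dy3_der dz3_der eval3_hom eval3_gen algebra_simps)
qed (auto simp: eval3_gen dd_explicit eval3_hom intro!: derivative_eq_intros)

lemma jet_horizontal: "fps_nth (jet (\<lambda>t. t) (\<lambda>t. 0) g) k = cf (tay g) k 0"
proof -
  have "tcol 0 g = (\<lambda>y. g (y, 0))" by (simp add: fun_eq_iff tcol_def E_nth)
  then show ?thesis by (simp add: jet_def cf_tay)
qed

text \<open>Conditions on a disc are stated for all sufficiently small radii, so that finitely many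
  of them can be combined.\<close>

lemma ev_ball: "\<forall>\<^sub>F t in nhds (0::complex). P t \<Longrightarrow> \<forall>\<^sub>F r in at_right (0::real). \<forall>t\<in>ball 0 r. P t"
proof -
  assume "\<forall>\<^sub>F t in nhds 0. P t"
  then obtain R where "R > 0" "\<forall>t\<in>ball 0 R. P t" unfolding nhds0 by blast
  then show ?thesis unfolding eventually_at_right_field by (intro exI[of _ R]) auto
qed

lemma ev_holomorphic: "f analytic_on {0} \<Longrightarrow> \<forall>\<^sub>F r in at_right (0::real). f holomorphic_on ball 0 r"
proof -
  assume "f analytic_on {0}"
  then obtain R where "R > 0" "f holomorphic_on ball 0 R" by (auto simp: analytic_on_def)
  then show ?thesis unfolding eventually_at_right_field by (intro exI[of _ R]) (auto intro: holomorphic_on_subset)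
qed

lemma fps_expansion_eq_0: "\<forall>\<^sub>F t in nhds 0. f t = 0 \<Longrightarrow> fps_expansion f 0 = 0"
  using fps_expansion_cong[of f "\<lambda>t. 0" 0] E_const[of 0] by simp

context frame
begin

text \<open>Points with the same image give proportional vectors s + y u + z p, whose s-components
  are both 1.\<close>

lemma theta_inj:
  assumes "x \<in> bid r" "x' \<in> bid r" "\<Theta>\<^sub>1 x = \<Theta>\<^sub>1 x'" "\<Theta>\<^sub>2 x = \<Theta>\<^sub>2 x'" shows "x = x'"
proof -
  define C where "C = chart s (\<Theta>\<^sub>1 x, \<Theta>\<^sub>2 x)"
  have 1: "s + fst x *s u + snd x *s p = \<nu> x *s C" "s + fst x' *s u + snd x' *s p = \<nu> x' *s C"
    using chart_eq assms by (auto simp: C_def)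
  have "(\<nu> x' - \<nu> x) *s s + (\<nu> x' * fst x - \<nu> x * fst x') *s u + (\<nu> x' * snd x - \<nu> x * snd x') *s p =
    \<nu> x' *s (s + fst x *s u + snd x *s p) - \<nu> x *s (s + fst x' *s u + snd x' *s p)"
    by (simp add: vec_eq_iff algebra_simps)
  also have "\<dots> = 0" unfolding 1 by (simp add: vec_eq_iff)
  finally have "\<nu> x' - \<nu> x = 0" "\<nu> x' * fst x - \<nu> x * fst x' = 0" "\<nu> x' * snd x - \<nu> x * snd x' = 0" using ind by blast+
  then show ?thesis using nu_nz[OF assms(1)] by (auto simp: prod_eq_iff)
qed

definition jetp :: "(complex \<Rightarrow> complex) \<Rightarrow> poly3 \<Rightarrow> complex fps" where
  "jetp \<sigma> K = jet \<sigma> (\<lambda>t. t) (pull K)"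

context
  fixes \<sigma> :: "complex \<Rightarrow> complex" and \<Sigma> :: "complex fps"
  assumes an: "\<sigma> analytic_on {0}" "\<sigma> 0 = 0" and \<Sigma>: "\<Sigma> = fps_expansion \<sigma> 0"
begin

lemma ID: "(\<lambda>t::complex. t) analytic_on {0}" by (auto intro: analytic_intros)

lemma rhom_jetp: "rhom (jetp \<sigma>)"
proof -
  note ag = curve_germ_analytic[OF germ_pull an(1) ID an(2) refl]
  have "pull 1 = (\<lambda>x. 1)" "pull (a + b) = (\<lambda>x. pull a x + pull b x)" "pull (a * b) = (\<lambda>x. pull a x * pull b x)" for a b
    by (simp_all add: fun_eq_iff pull_def eval3_hom)
  then show ?thesis unfolding rhom_def jetp_def jet_def using E_const[of 1] E_add[OF ag ag] E_mult[OF ag ag] by simp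
qed

lemma jetp_deriv: "fps_deriv (jetp \<sigma> K) = fps_deriv \<Sigma> * jetp \<sigma> (dd u K) + jetp \<sigma> (dd p K)"
proof -
  define X where "X i = fps_const (s $ i) + \<Sigma> * fps_const (u $ i) + fps_X * fps_const (p $ i)" for i
  have k: "rhom (fps_const :: complex \<Rightarrow> _)" by (simp add: rhom_def fps_const_add[symmetric] fps_const_mult[symmetric] del: fps_const_add fps_const_mult)
  have g: "jetp \<sigma> (emb c) = fps_const c" "jetp \<sigma> PX = X 1" "jetp \<sigma> PY = X 2" "jetp \<sigma> PZ = X 3" for c
  proof -
    have lin: "fps_expansion (\<lambda>t. a + \<sigma> t * b + t * c) 0 = fps_const a + \<Sigma> * fps_const b + fps_X * fps_const c" for a b c
      unfolding \<Sigma> by (rule fps_expansion_eqI)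
        (intro has_fps_expansion_add has_fps_expansion_mult has_fps_expansion_const has_fps_expansion_fps_X analytic_at_imp_has_fps_expansion_0 an)
    show "jetp \<sigma> (emb c) = fps_const c" "jetp \<sigma> PX = X 1" "jetp \<sigma> PY = X 2" "jetp \<sigma> PZ = X 3"
      using lin by (simp_all add: jetp_def jet_def pull_def eval3_gen E_const X_def)
  qed
  have J: "jetp \<sigma> K = ev3 fps_const (X 1) (X 2) (X 3) K" for K
    by (rule rhom_poly3_unique[OF rhom_jetp rhom_ev3[OF k]]) (simp_all add: g ev3_gen[OF k])
  have dX: "fps_deriv (X i) = fps_deriv \<Sigma> * fps_const (u $ i) + fps_const (p $ i)" for i by (simp add: X_def)
  have dj: "jetp \<sigma> (dd a K) = fps_const (a $ 1) * jetp \<sigma> (dx3 K) + fps_const (a $ 2) * jetp \<sigma> (dy3 K) + fps_const (a $ 3) * jetp \<sigma> (dz3 K)" for a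
    by (simp add: dd_explicit rhomD[OF rhom_jetp] g)
  have "fps_deriv (jetp \<sigma> K) = jetp \<sigma> (dx3 K) * fps_deriv (X 1) + jetp \<sigma> (dy3 K) * fps_deriv (X 2) + jetp \<sigma> (dz3 K) * fps_deriv (X 3)"
    unfolding J by (rule ev3_chain[OF k der_fps_deriv]) simp
  then show ?thesis unfolding dX dj by (simp add: algebra_simps)
qed

lemma jetp_0: "fps_nth (jetp \<sigma> K) 0 = eval3 K s"
  by (simp add: jetp_def jet_def E_nth an pull_def)

text \<open>If a form in x and y vanishes along the curve, so does one of its linear factors. As
  that factor cannot vanish at both q and e, the curve is the line through s and p.\<close>

lemma jetp_form_nonzero:
  assumes "Hom n [:\<Delta>:]" "\<Delta> \<noteq> 0" "jetp \<sigma> (lsub S [:\<Delta>:]) = 0" shows "\<Sigma> = 0"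
  using assms
proof (induction n arbitrary: \<Delta>)
  case 0
  obtain c where "\<Delta> = [:[:c:]:]" using Hom0_const[OF 0(1)] by blast
  then have c: "[:\<Delta>:] = emb c" "c \<noteq> 0" using 0(2) by (auto simp: emb_def)
  have "jetp \<sigma> (emb c) = fps_const c" by (simp add: jetp_def jet_def pull_def eval3_gen E_const)
  then show ?case using 0(3) c by (simp add: lsub_gen)
next
  case (Suc n)
  obtain a b \<gamma> where f: "(a, b) \<noteq> (0, 0)" "\<Delta> = lin a b * \<gamma>" "Hom n [:\<gamma>:]" "\<gamma> \<noteq> 0"
    using binary_form_factor[OF Suc.prems(1,2)] by blast
  have "[:\<Delta>:] = [:lin a b:] * [:\<gamma>:]" using f(2) by (simp add: mult.commute)
  then have "jetp \<sigma> (lsub S [:lin a b:]) * jetp \<sigma> (lsub S [:\<gamma>:]) = 0"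
    using Suc.prems(3) by (simp only: lsub_hom rhomD(3)[OF rhom_jetp])
  then consider "jetp \<sigma> (lsub S [:lin a b:]) = 0" | "jetp \<sigma> (lsub S [:\<gamma>:]) = 0" by auto
  then show ?case
  proof cases
    case 2 then show ?thesis using Suc.IH[OF f(3,4)] by blast
  next
    case 1
    have pl: "pull (lsub S [:lin a b:]) x = (b * q\<^sub>1 - a * q\<^sub>2) + fst x * (b * e\<^sub>1 - a * e\<^sub>2)" for x
    proof -
      have "S *v (s + fst x *s u + snd x *s p) = vector [q\<^sub>1 + fst x * e\<^sub>1, q\<^sub>2 + fst x * e\<^sub>2, q\<^sub>3 + snd x]"
        unfolding s u p vector_scalar_commute[symmetric] matrix_vector_right_distrib[symmetric] matrix_vector_mul_assoc TS
        by (simp add: vec_eq_iff forall_3)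
      then show ?thesis by (simp add: pull_def eval3_lsub eval3_const eval2_lin algebra_simps)
    qed
    have "jetp \<sigma> (lsub S [:lin a b:]) = fps_const (b * q\<^sub>1 - a * q\<^sub>2) + \<Sigma> * fps_const (b * e\<^sub>1 - a * e\<^sub>2)"
      unfolding jetp_def jet_def pl fst_conv \<Sigma>
      by (rule fps_expansion_eqI) (intro has_fps_expansion_add has_fps_expansion_mult has_fps_expansion_const analytic_at_imp_has_fps_expansion_0 an)
    then have z: "fps_const (b * q\<^sub>1 - a * q\<^sub>2) + \<Sigma> * fps_const (b * e\<^sub>1 - a * e\<^sub>2) = 0" using 1 by simp
    have "fps_nth \<Sigma> 0 = 0" by (simp add: \<Sigma> E_nth an)
    then have z0: "b * q\<^sub>1 - a * q\<^sub>2 = 0" using arg_cong[OF z, of "\<lambda>f. fps_nth f 0"] by simp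
    have "b * e\<^sub>1 - a * e\<^sub>2 \<noteq> 0"
    proof
      assume z1: "b * e\<^sub>1 - a * e\<^sub>2 = 0"
      have "b * (q\<^sub>1 * e\<^sub>2 - q\<^sub>2 * e\<^sub>1) = (b * q\<^sub>1 - a * q\<^sub>2) * e\<^sub>2 - q\<^sub>2 * (b * e\<^sub>1 - a * e\<^sub>2)" by (simp add: algebra_simps)
      moreover have "a * (q\<^sub>1 * e\<^sub>2 - q\<^sub>2 * e\<^sub>1) = (b * q\<^sub>1 - a * q\<^sub>2) * e\<^sub>1 - q\<^sub>1 * (b * e\<^sub>1 - a * e\<^sub>2)" by (simp add: algebra_simps)
      ultimately show False using z0 z1 e f(1) by auto
    qed
    then show ?thesis using z z0 by simp
  qed
qed

end

text \<open>The 2-jet is a nonzero multiple of y^2, and f has order at least four on the line. On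
  the curve y = \<open>\<sigma>\<close>(z), where f_y vanishes, f has order at least four and both
  partial derivatives have order at least three; this bounds the Milnor number. The branch comes
  from completing the square around this curve.\<close>

theorem vertical_tangent_branch:
  assumes F: "Hom d F" and c: "cf (ser F) 0 0 = 0" "cf (ser F) 0 1 = 0" "cf (ser F) 0 2 = 0" "cf (ser F) 0 3 = 0"
    "cf (ser F) 1 0 = 0" "cf (ser F) 1 1 = 0" "cf (ser F) 2 0 \<noteq> 0" and F0: "fps_nth (ser F) 0 \<noteq> 0"
    and D: "Hom n [:\<Delta>:]" "\<Delta> \<noteq> 0" "[:\<Delta>:] \<in> ideal2 (lsub T F) (dz3 (lsub T F))"
  shows "milnor_number F s \<ge> 3" "p \<in> tangent_cone F s"
proof -
  define H where "H = pull (dd u F)"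
  have H00: "H (0, 0) = 0" using cf_ser_jet(1)[of F] c by (simp add: H_def pull_def)
  have dH: "(H has_derivative (\<lambda>h. 2 * cf (ser F) 2 0 * fst h + 0 * snd h)) (at (0, 0))"
    using has_derivative_pull[of "dd u F"] unfolding cf_ser_jet(3,5)[symmetric] c(6) H_def by simp
  have gH: "(\<lambda>x. H (snd x, fst x)) \<in> germs2" unfolding H_def by (rule germs2_compose[OF germ_pull germs2_gen(3,2)]) auto
  have dHs: "((\<lambda>x. H (snd x, fst x)) has_derivative (\<lambda>h. 0 * fst h + 2 * cf (ser F) 2 0 * snd h)) (at (0, 0))"
  proof -
    have "((\<lambda>x. (snd x, fst x)) has_derivative (\<lambda>h. (snd h, fst h))) (at (0 :: complex, 0 :: complex))"
      by (intro has_derivative_Pair has_derivative_snd has_derivative_fst has_derivative_ident)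
    from has_derivative_compose[OF this, of H "\<lambda>h. 2 * cf (ser F) 2 0 * fst h + 0 * snd h"] dH show ?thesis by simp
  qed
  \<comment> \<open>The variables are exchanged because y is to be expressed through z.\<close>
  have "\<exists>v. v analytic_on {0} \<and> v 0 = 0 \<and> (\<forall>\<^sub>F t in nhds 0. H (snd (t, v t), fst (t, v t)) = 0)"
    by (rule implicit_function_germ[OF gH _ dHs]) (use H00 c(7) in simp_all)
  then obtain \<sigma> where sg: "\<sigma> analytic_on {0}" "\<sigma> 0 = 0" "\<forall>\<^sub>F t in nhds 0. H (\<sigma> t, t) = 0" by auto
  define \<Sigma> where "\<Sigma> = fps_expansion \<sigma> 0"
  note C = sg(1,2) \<Sigma>_def
  note J_rhom = rhomD[OF rhom_jetp[OF C]] and J_deriv = jetp_deriv[OF C] and J_0 = jetp_0[OF C]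
  let ?J = "jetp \<sigma>"
  have IDa: "(\<lambda>t::complex. t) analytic_on {0}" by (auto intro: analytic_intros)
  have JH: "?J (dd u F) = 0" unfolding jetp_def jet_def using sg(3) by (intro fps_expansion_eq_0) (simp add: H_def)
  have "2 * cf (ser F) 2 0 * deriv \<sigma> 0 = 0"
  proof -
    have "deriv (\<lambda>t. H (\<sigma> t, t)) 0 = 2 * cf (ser F) 2 0 * deriv \<sigma> 0"
      using DERIV_imp_deriv[OF curve_germ_deriv[OF dH sg(1) IDa sg(2) refl]] by simp
    moreover have "deriv (\<lambda>t. H (\<sigma> t, t)) 0 = 0" using JH unfolding jetp_def jet_def H_def[symmetric] by (metis E_nth(2) fps_zero_nth)
    ultimately show ?thesis by simp
  qed
  \<comment> \<open>The coefficient of yz in f is zero, so \<open>H\<close> has no linear term in z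
    and the curve is tangent to the line.\<close>
  then have s1: "deriv \<sigma> 0 = 0" using c(7) by simp
  define D where "D = ?J F"
  have D': "fps_deriv D = ?J (dd p F)" unfolding D_def J_deriv JH by simp
  have S1: "fps_nth (fps_deriv \<Sigma>) 0 = 0" by (simp add: \<Sigma>_def E_nth s1)
  \<comment> \<open>Three differentiations along the curve: each term with \<open>\<sigma>\<close>
    carries its vanishing first derivative or the vanishing mixed derivative of f, so only pure
    z-derivatives of f remain, and these are zero up to order three.\<close>
  have Dk: "fps_nth D k = 0" if "k < 4" for k
  proof -
    have v: "eval3 F s = 0" "eval3 (dd p F) s = 0" "eval3 (dd p (dd p F)) s = 0" "eval3 (dd u (dd p F)) s = 0"
      using c cf_ser[of F] cf_ser_jet[of F] by auto
    have v3: "eval3 (dd p (dd p (dd p F))) s = 0"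
      unfolding cf_ser[symmetric] ser_deriv[symmetric] cf_der using c(4) by (simp add: numeral_3_eq_3)
    have d0: "fps_nth D 0 = 0" by (simp add: D_def J_0 v)
    have "fps_nth (fps_deriv D) 0 = 0" unfolding D' J_0 v ..
    then have d1: "fps_nth D 1 = 0" by simp
    have DD: "fps_deriv (fps_deriv D) = fps_deriv \<Sigma> * ?J (dd u (dd p F)) + ?J (dd p (dd p F))" unfolding D' J_deriv ..
    have "fps_nth (fps_deriv (fps_deriv D)) 0 = 0" unfolding DD by (simp add: J_0 v)
    then have d2: "fps_nth D 2 = 0" by (simp add: numeral_2_eq_2)
    have "fps_nth (fps_deriv (fps_deriv (fps_deriv D))) 0 = 0"
      unfolding DD fps_deriv_add fps_deriv_mult J_deriv[of "dd p (dd p F)"] fps_add_nth fps_mult_nth_0 J_0 v v3 S1 by simp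
    then have "of_nat 1 * (of_nat 2 * (of_nat 3 * fps_nth D 3)) = 0" by (simp add: numeral_3_eq_3 numeral_2_eq_2)
    then have d3: "fps_nth D 3 = 0" by simp
    have "k = 0 \<or> k = 1 \<or> k = 2 \<or> k = 3" using that by auto
    then show ?thesis using d0 d1 d2 d3 by auto
  qed
  \<comment> \<open>If f vanished identically on the curve, so would f_z and hence the discriminant.
    The curve would then be the line through s and p, on which f is not zero.\<close>
  have Dnz: "D \<noteq> 0"
  proof
    assume z: "D = 0"
    obtain a b where ab: "[:\<Delta>:] = a * lsub T F + b * dz3 (lsub T F)" using D(3) by (auto simp: ideal2_def)
    have "dd (vector [0, 0, 1]) (lsub T F) = lsub T (dd p F)" by (simp add: lsub_dd p)
    then have dz: "dz3 (lsub T F) = lsub T (dd p F)" by (simp add: dd_explicit rhomD[OF rhom_emb])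
    have "lsub S [:\<Delta>:] = lsub S a * F + lsub S b * dd p F"
      unfolding ab dz by (simp add: lsub_hom lsub_lsub TS lsub_mat1)
    then have "?J (lsub S [:\<Delta>:]) = ?J (lsub S a) * D + ?J (lsub S b) * fps_deriv D"
      unfolding D' by (simp add: J_rhom D_def)
    then have "\<Sigma> = 0" using jetp_form_nonzero[OF C D(1,2)] z by simp
    then have "\<forall>\<^sub>F t in nhds 0. \<sigma> t = 0"
      using analytic_at_imp_has_fps_expansion_0[OF sg(1)] unfolding \<Sigma>_def[symmetric] by (simp add: has_fps_expansion_0_iff)
    then have "D = jet (\<lambda>t. 0) (\<lambda>t. t) (pull F)"
      unfolding D_def jetp_def jet_def by (intro fps_expansion_cong) (auto elim: eventually_mono)
    then show False using z F0 by (simp add: jet_vertical tay_pull)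
  qed
  define k where "k = subdegree D"
  have k4: "k \<ge> 4" unfolding k_def using Dnz Dk by (intro subdegree_geI) auto
  define w\<^sub>1 w\<^sub>2 where "w\<^sub>1 = fst (chart_dirs s)" and "w\<^sub>2 = snd (chart_dirs s)"
  \<comment> \<open>An arbitrary direction is decomposed along s, u and p. On the curve the
    derivative along u vanishes, the one along p is the derivative of \<open>D\<close>, and Euler's
    identity expresses the one along s through these and \<open>D\<close>.\<close>
  have J3: "fps_nth (jet \<sigma> (\<lambda>t. t) (pull (dd w F))) k = 0" if k: "k < 3" for w k
  proof -
    obtain a b c where w: "w = a *s s + b *s u + c *s p" using spans by blast
    have es: "pull (dd s F) x = of_nat d * pull F x - fst x * pull (dd u F) x - snd x * pull (dd p F) x" for x
    proof -
      define v where "v = s + fst x *s u + snd x *s p"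
      have "eval3 (dd v F) v = of_nat d * eval3 F v" by (rule euler_dd[OF F])
      moreover have "eval3 (dd v F) v = eval3 (dd s F) v + fst x * eval3 (dd u F) v + snd x * eval3 (dd p F) v"
        unfolding v_def by (simp add: dd_add dd_scale eval3_hom eval3_gen)
      ultimately show ?thesis by (simp add: pull_def v_def)
    qed
    note ag = curve_germ_analytic[OF germ_pull sg(1) IDa sg(2) refl, THEN analytic_at_imp_has_fps_expansion_0, folded jet_def]
    have "?J (dd s F) = of_nat d * D - \<Sigma> * ?J (dd u F) - fps_X * ?J (dd p F)"
      unfolding D_def jetp_def jet_def es fst_conv snd_conv
      by (rule fps_expansion_eqI, unfold jet_def[symmetric] \<Sigma>_def fps_of_nat[symmetric])
        (intro has_fps_expansion_diff has_fps_expansion_mult has_fps_expansion_const has_fps_expansion_fps_X ag[unfolded jet_def] ag analytic_at_imp_has_fps_expansion_0[OF sg(1)])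
    then have Js: "?J (dd s F) = of_nat d * D - fps_X * fps_deriv D" unfolding JH D' by simp
    have "?J (dd w F) = fps_const a * ?J (dd s F) + fps_const c * ?J (dd p F)"
    proof -
      have em: "?J (emb x) = fps_const x" for x by (simp add: jetp_def jet_def pull_def eval3_gen E_const)
      show ?thesis unfolding w by (simp add: dd_add dd_scale J_rhom em JH)
    qed
    then have "?J (dd w F) = fps_const a * (of_nat d * D - fps_X * fps_deriv D) + fps_const c * fps_deriv D" unfolding Js D' .
    moreover have "fps_nth (of_nat d * D - fps_X * fps_deriv D) k = 0" "fps_nth (fps_deriv D) k = 0"
      using k Dk by (auto simp: fps_of_nat[symmetric])
    ultimately have "fps_nth (?J (dd w F)) k = 0" by (simp only: fps_add_nth fps_mult_left_const_nth) simp
    then show ?thesis by (simp add: jetp_def)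
  qed
  note cc = chart_curve[OF sg(1) IDa sg(2) refl]
  have b0: "(\<beta>\<^sub>1, \<beta>\<^sub>2) \<noteq> (0, 0)" using det by auto
  obtain idx :: "3 \<Rightarrow> nat" where idx: "bij_betw idx UNIV {..<3}"
    using ex_bij_betw_finite_nat[of "UNIV :: 3 set"] by (auto simp: atLeast0LessThan)
  have "enat 3 \<le> germ_codim2 (eval2 (local_equation (dd w\<^sub>1 F) s)) (eval2 (local_equation (dd w\<^sub>2 F) s))"
  proof (rule codim_ge_curve[OF idx])
    show "eval2 (local_equation (dd w\<^sub>1 F) s) \<in> germs2" "eval2 (local_equation (dd w\<^sub>2 F) s) \<in> germs2" by (rule germs2_eval2)+
    show "(\<lambda>t. \<Theta>\<^sub>1 (\<sigma> t, t)) analytic_on {0}" "(\<lambda>t. \<Theta>\<^sub>2 (\<sigma> t, t)) analytic_on {0}" "\<Theta>\<^sub>1 (\<sigma> 0, 0) = 0" "\<Theta>\<^sub>2 (\<sigma> 0, 0) = 0" using cc by simp_all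
    show "(deriv (\<lambda>t. \<Theta>\<^sub>1 (\<sigma> t, t)) 0, deriv (\<lambda>t. \<Theta>\<^sub>2 (\<sigma> t, t)) 0) \<noteq> (0, 0)"
      using b0 cc(5,6) by (simp add: s1)
    show "fps_nth (jet (\<lambda>t. \<Theta>\<^sub>1 (\<sigma> t, t)) (\<lambda>t. \<Theta>\<^sub>2 (\<sigma> t, t)) (eval2 (local_equation (dd w\<^sub>1 F) s))) k = 0" if "k < 3" for k
      by (rule jet_local_equation_zero[OF sg(1) IDa sg(2) refl Hom_dd[OF F] J3 that])
    show "fps_nth (jet (\<lambda>t. \<Theta>\<^sub>1 (\<sigma> t, t)) (\<lambda>t. \<Theta>\<^sub>2 (\<sigma> t, t)) (eval2 (local_equation (dd w\<^sub>2 F) s))) k = 0" if "k < 3" for k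
      by (rule jet_local_equation_zero[OF sg(1) IDa sg(2) refl Hom_dd[OF F] J3 that])
  qed
  then show "milnor_number F s \<ge> 3"
    by (simp add: milnor_number_def local_equation_partial w\<^sub>1_def w\<^sub>2_def numeral_eq_enat)
  txt \<open>With \<open>\<Phi> (h, z) = pull F (\<sigma> z + h, z) = D (z) + h\<^sup>2 \<Phi>\<^sub>2\<close>, the branch is \<open>z = t\<^sup>\<kappa>\<close>, \<open>h = t\<^sup>M w\<close> where \<open>2 M = \<kappa> ord D\<close>.\<close>
  define \<Phi> where "\<Phi> x = pull F (\<sigma> (snd x) + fst x, snd x)" for x
  have "(\<lambda>x. pull F ((\<lambda>x. \<sigma> (snd x) + fst x) x, snd x)) \<in> germs2"
    by (rule germs2_compose[OF germ_pull germs2_add[OF germs2_of_analytic(2)[OF sg(1)] germs2_gen(2)] germs2_gen(3)]) (simp_all add: sg)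
  then have gPhi: "\<Phi> \<in> germs2" unfolding \<Phi>_def[abs_def] .
  obtain \<Phi>\<^sub>1 where P1: "\<Phi>\<^sub>1 \<in> germs2" "\<forall>\<^sub>F x in nhds (0, 0). \<Phi> x = \<Phi> (0, snd x) + fst x * \<Phi>\<^sub>1 x" using germs2_hadamard1[OF gPhi] by blast
  obtain \<Phi>\<^sub>2 where P2: "\<Phi>\<^sub>2 \<in> germs2" "\<forall>\<^sub>F x in nhds (0, 0). \<Phi>\<^sub>1 x = \<Phi>\<^sub>1 (0, snd x) + fst x * \<Phi>\<^sub>2 x" using germs2_hadamard1[OF P1(1)] by blast
  obtain R\<^sub>1 where R1: "R\<^sub>1 > 0" "\<forall>x\<in>bid R\<^sub>1. \<Phi> x = \<Phi> (0, snd x) + fst x * \<Phi>\<^sub>1 x" using P1(2) unfolding nhds00 by blast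
  obtain R\<^sub>2 where R2: "R\<^sub>2 > 0" "\<forall>t\<in>ball 0 R\<^sub>2. H (\<sigma> t, t) = 0" using sg(3) unfolding nhds0 by blast
  obtain R\<^sub>3 where R3: "R\<^sub>3 > 0" "holomorphic2_on \<Phi>\<^sub>1 (bid R\<^sub>3)" using P1(1) germs2_iff by auto
  define R where "R = min R\<^sub>1 (min R\<^sub>2 R\<^sub>3)"
  have R: "R > 0" "R \<le> R\<^sub>1" "R \<le> R\<^sub>2" "R \<le> R\<^sub>3" using R1(1) R2(1) R3(1) by (auto simp: R_def)
  \<comment> \<open>This value is the y-derivative of f on the curve, which vanishes by the choice
    of \<open>\<sigma>\<close>.\<close>
  have P10: "\<Phi>\<^sub>1 (0, z) = 0" if z: "z \<in> ball 0 R" for z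
  proof -
    have "(\<lambda>h. \<Phi>\<^sub>1 (h, z)) holomorphic_on ball 0 R\<^sub>3" using holomorphic2_on_partial(2)[OF R3(2)] z R by auto
    then have "((\<lambda>h. \<Phi>\<^sub>1 (h, z)) has_field_derivative deriv (\<lambda>h. \<Phi>\<^sub>1 (h, z)) 0) (at 0)" using R3(1) by (intro holomorphic_derivI) auto
    from DERIV_add[OF DERIV_const[of "\<Phi> (0, z)"] DERIV_mult[OF DERIV_ident this]]
    have 1: "((\<lambda>h. \<Phi> (0, z) + h * \<Phi>\<^sub>1 (h, z)) has_field_derivative \<Phi>\<^sub>1 (0, z)) (at 0)" by simp
    have 2: "((\<lambda>h. \<Phi> (h, z)) has_field_derivative \<Phi>\<^sub>1 (0, z)) (at 0)"
    proof (rule has_field_derivative_transform_within_open[OF 1 open_ball[of 0 R]])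
      show "0 \<in> ball (0::complex) R" using R(1) by simp
      fix h :: complex assume "h \<in> ball 0 R"
      then have "(h, z) \<in> bid R\<^sub>1" using z R by auto
      from R1(2)[rule_format, OF this] show "\<Phi> (0, z) + h * \<Phi>\<^sub>1 (h, z) = \<Phi> (h, z)" by simp
    qed
    have "((\<lambda>h. \<Phi> (h, z)) has_field_derivative H (\<sigma> z, z)) (at 0)"
    proof -
      have "(\<lambda>h. \<Phi> (h, z)) = (\<lambda>h. eval3 F ((s + \<sigma> z *s u + z *s p) + h *s u))"
        by (simp add: \<Phi>_def pull_def fun_eq_iff vector_sadd_rdistrib add_ac)
      then show ?thesis using eval3_line_deriv[of F "s + \<sigma> z *s u + z *s p" u 0] by (simp add: H_def pull_def)
    qed
    then have "\<Phi>\<^sub>1 (0, z) = H (\<sigma> z, z)" using 2 DERIV_unique by blast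
    then show ?thesis using R2(2) z R by auto
  qed
  have ePhi: "\<forall>\<^sub>F x in nhds (0, 0). \<Phi> x = \<Phi> (0, snd x) + fst x ^ 2 * \<Phi>\<^sub>2 x"
  proof -
    have "\<forall>\<^sub>F x :: complex \<times> complex in nhds (0, 0). \<Phi>\<^sub>1 (0, snd x) = 0" unfolding nhds00 using R(1) P10 by (intro exI[of _ R]) auto
    with P1(2) P2(2) show ?thesis by eventually_elim (simp add: power2_eq_square)
  qed
  have P200: "\<Phi>\<^sub>2 (0, 0) = cf (ser F) 2 0"
  proof -
    have ID0: "(\<lambda>t::complex. 0::complex) analytic_on {0}" by (auto intro: analytic_intros)
    let ?K = "jet (\<lambda>t. t) (\<lambda>t. 0)"
    have "?K \<Phi> = ?K (\<lambda>x. \<Phi> (0, snd x) + fst x ^ 2 * \<Phi>\<^sub>2 x)" by (rule jet_cong[OF IDa ID0 refl refl ePhi])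
    also have "\<dots> = fps_expansion (\<lambda>t. \<Phi> (0, 0) + t ^ 2 * \<Phi>\<^sub>2 (t, 0)) 0" by (simp add: jet_def)
    also have "\<dots> = fps_const (\<Phi> (0, 0)) + fps_X ^ 2 * ?K \<Phi>\<^sub>2" unfolding jet_def
      by (rule fps_expansion_eqI)
        (intro has_fps_expansion_add has_fps_expansion_mult has_fps_expansion_const has_fps_expansion_fps_X_power
          analytic_at_imp_has_fps_expansion_0 curve_germ_analytic[OF P2(1) IDa ID0 refl refl])
    finally have "fps_nth (?K \<Phi>) 2 = \<Phi>\<^sub>2 (0, 0)" by (simp add: fps_X_power_mult_nth jet_def E_nth)
    moreover have "?K \<Phi> = ?K (pull F)" by (simp add: jet_def \<Phi>_def sg(2))
    ultimately show ?thesis by (simp add: jet_horizontal tay_pull)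
  qed
  have aD: "(\<lambda>t. pull F (\<sigma> t, t)) analytic_on {0}" by (rule curve_germ_analytic[OF germ_pull sg(1) IDa sg(2) refl])
  have eD: "fps_expansion (\<lambda>t. pull F (\<sigma> t, t)) 0 = D" by (simp add: D_def jetp_def jet_def)
  obtain \<delta> where del: "\<delta> analytic_on {0}" "\<delta> 0 = fps_nth D k" "\<forall>\<^sub>F z in nhds 0. pull F (\<sigma> z, z) = z ^ k * \<delta> z"
  proof -
    have "fps_nth D j = 0" if "j < k" for j using that unfolding k_def by (rule nth_less_subdegree_zero)
    then have "\<exists>g. g analytic_on {0} \<and> g 0 = fps_nth D k \<and> (\<forall>\<^sub>F z in nhds 0. pull F (\<sigma> z, z) = z ^ k * g z)"
      by (rule analytic_factor[OF aD, of k, unfolded eD])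
    then show ?thesis using that by blast
  qed
  have del0: "\<delta> 0 \<noteq> 0" using Dnz by (simp add: del k_def)
  obtain \<sigma>\<^sub>1 where sg1: "\<sigma>\<^sub>1 analytic_on {0}" "\<sigma>\<^sub>1 0 = 0" "\<forall>\<^sub>F z in nhds 0. \<sigma> z = z * \<sigma>\<^sub>1 z"
  proof -
    have "\<exists>g. g analytic_on {0} \<and> g 0 = fps_nth (fps_expansion \<sigma> 0) 1 \<and> (\<forall>\<^sub>F z in nhds 0. \<sigma> z = z ^ 1 * g z)"
      by (rule analytic_factor[OF sg(1)]) (simp add: E_nth sg(2))
    then show ?thesis using that s1 by (auto simp: E_nth)
  qed
  \<comment> \<open>For even k the square root of \<open>D\<close> is a power series in z; for odd k
    it requires z = t^2. The inequality \<open>\<kappa> < M\<close> uses k \<ge> 4 and makes the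
    branch tangent to the line, while odd \<open>M\<close> will give injectivity.\<close>
  obtain \<kappa> M :: nat where kM: "\<kappa> * k = 2 * M" "\<kappa> < M" "\<kappa> = 1 \<or> \<kappa> = 2 \<and> odd M"
  proof (cases "even k")
    case True then show ?thesis using k4 by (intro that[of 1 "k div 2"]) auto
  next
    case False then show ?thesis using k4 by (intro that[of 2 k]) auto
  qed
  \<comment> \<open>The value for which the leading terms of \<open>D\<close> and of the square
    cancel.\<close>
  define w\<^sub>0 where "w\<^sub>0 = csqrt (- \<delta> 0 / \<Phi>\<^sub>2 (0, 0))"
  have w0: "w\<^sub>0\<^sup>2 * \<Phi>\<^sub>2 (0, 0) = - \<delta> 0" "w\<^sub>0 \<noteq> 0" using c(7) del0 by (auto simp: w\<^sub>0_def P200)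
  \<comment> \<open>The equation of the curve after division by t^(2M), to be solved for the
    correction to \<open>w\<^sub>0\<close>.\<close>
  define G where "G x = \<delta> (fst x ^ \<kappa>) + (w\<^sub>0 + snd x) ^ 2 * \<Phi>\<^sub>2 (fst x ^ M * (w\<^sub>0 + snd x), fst x ^ \<kappa>)" for x
  have kp: "\<kappa> > 0" "M > 0" using kM by auto
  have pw: "(\<lambda>x. fst x ^ m) \<in> germs2" for m
  proof (induction m)
    case (Suc m) then show ?case using germs2_mult[OF germs2_gen(2)] by simp
  qed (simp add: germs2_gen)
  have wg: "(\<lambda>x. w\<^sub>0 + snd x) \<in> germs2" by (intro germs2_add germs2_gen)
  have tk: "(\<lambda>t::complex. t ^ \<kappa>) analytic_on {0}" by (auto intro: analytic_intros)
  have dk: "(\<lambda>t. \<delta> (t ^ \<kappa>)) analytic_on {0}"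
    using analytic_on_compose[OF tk, of \<delta>] del(1) kp by (simp add: o_def zero_power)
  have P2g: "(\<lambda>x. \<Phi>\<^sub>2 ((\<lambda>x. fst x ^ M * (w\<^sub>0 + snd x)) x, (\<lambda>x. fst x ^ \<kappa>) x)) \<in> germs2"
    by (rule germs2_compose[OF P2(1) germs2_mult[OF pw wg] pw]) (use kp in \<open>auto simp: zero_power\<close>)
  have Gg: "G \<in> germs2" unfolding G_def[abs_def] power2_eq_square
    by (rule germs2_add[OF germs2_of_analytic(1)[OF dk] germs2_mult[OF germs2_mult[OF wg wg] P2g]])
  have G0: "G (0, 0) = 0" using w0(1) kp by (simp add: G_def zero_power)
  obtain a b where dG: "(G has_derivative (\<lambda>h. a * fst h + b * snd h)) (at (0, 0))" using germs2_has_derivative[OF Gg] .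
  have "b \<noteq> 0"
  proof -
    have "((\<lambda>z. \<delta> 0 + (w\<^sub>0 + z) ^ 2 * \<Phi>\<^sub>2 (0, 0)) has_field_derivative 2 * w\<^sub>0 * \<Phi>\<^sub>2 (0, 0)) (at 0)" by (auto intro!: derivative_eq_intros)
    moreover have "(\<lambda>z. G (0, z)) = (\<lambda>z. \<delta> 0 + (w\<^sub>0 + z) ^ 2 * \<Phi>\<^sub>2 (0, 0))" using kp by (simp add: G_def fun_eq_iff zero_power)
    ultimately have "b = 2 * w\<^sub>0 * \<Phi>\<^sub>2 (0, 0)" using has_derivative2_partial(2)[OF dG] DERIV_unique by simp
    then show ?thesis using w0 c(7) P200 by simp
  qed
  then obtain v where v: "v analytic_on {0}" "v 0 = 0" "\<forall>\<^sub>F t in nhds 0. G (t, v t) = 0" using implicit_function_germ[OF Gg G0 dG] by blast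
  define w where "w t = w\<^sub>0 + v t" for t
  have wa: "w analytic_on {0}" unfolding w_def[abs_def] by (intro analytic_intros v)
  have ww0: "w 0 = w\<^sub>0" by (simp add: w_def v)
  have cw: "isCont w 0" using wa by (rule analytic_at_imp_isCont)
  \<comment> \<open>Both summands vanish at t = 0, because \<open>\<sigma>\<close> has order at
    least two and \<open>M\<close> exceeds \<open>\<kappa>\<close>. This makes the direction of p
    the tangent direction.\<close>
  define y\<^sub>1 where "y\<^sub>1 t = \<sigma>\<^sub>1 (t ^ \<kappa>) + t ^ (M - \<kappa>) * w t" for t
  have y1a: "y\<^sub>1 analytic_on {0}" unfolding y\<^sub>1_def[abs_def]
    using analytic_on_compose[OF tk, of \<sigma>\<^sub>1] sg1(1) kp by (intro analytic_intros wa) (simp add: o_def zero_power)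
  have y10: "y\<^sub>1 0 = 0" using kM kp by (simp add: y\<^sub>1_def sg1 zero_power)
  define Y where "Y t = t ^ \<kappa> * y\<^sub>1 t" for t
  have Ya: "Y analytic_on {0}" unfolding Y_def[abs_def] by (intro analytic_intros y1a)
  have Y0: "Y 0 = 0" using kp by (simp add: Y_def zero_power)
  have tk0: "(0::complex) ^ \<kappa> = 0" using kp by (simp add: zero_power)
  have ctk: "isCont (\<lambda>t::complex. t ^ \<kappa>) 0" by (intro continuous_intros)
  have ftk: "filterlim (\<lambda>t::complex. t ^ \<kappa>) (nhds 0) (nhds 0)" using ctk tk0 by (simp add: isCont_def tendsto_nhds_iff)
  have Ye: "\<forall>\<^sub>F t in nhds 0. Y t = \<sigma> (t ^ \<kappa>) + t ^ M * w t"
    using eventually_compose_filterlim[OF sg1(3) ftk]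
  proof eventually_elim
    case (elim t)
    have "t ^ M = t ^ \<kappa> * t ^ (M - \<kappa>)" using kM(2) by (simp flip: power_add)
    then show ?case unfolding Y_def y\<^sub>1_def elim by (simp add: algebra_simps)
  qed
  have zero: "\<forall>\<^sub>F t in nhds 0. pull F (Y t, t ^ \<kappa>) = 0"
  proof -
    have "isCont (\<lambda>t. (t ^ M * w t, t ^ \<kappa>)) 0" by (intro continuous_intros cw)
    then have fl: "filterlim (\<lambda>t. (t ^ M * w t, t ^ \<kappa>)) (nhds (0, 0)) (nhds 0)" using kp tk0 by (simp add: isCont_def tendsto_nhds_iff zero_power)
    show ?thesis using eventually_compose_filterlim[OF ePhi fl] Ye v(3) eventually_compose_filterlim[OF del(3) ftk]
    proof eventually_elim
      case (elim t)
      have "pull F (Y t, t ^ \<kappa>) = \<Phi> (t ^ M * w t, t ^ \<kappa>)" by (simp add: \<Phi>_def elim)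
      also have "\<dots> = pull F (\<sigma> (t ^ \<kappa>), t ^ \<kappa>) + (t ^ M * w t)\<^sup>2 * \<Phi>\<^sub>2 (t ^ M * w t, t ^ \<kappa>)" using elim(1) by (simp add: \<Phi>_def)
      also have "\<dots> = (t ^ \<kappa>) ^ k * \<delta> (t ^ \<kappa>) + (t ^ M) ^ 2 * ((w t)\<^sup>2 * \<Phi>\<^sub>2 (t ^ M * w t, t ^ \<kappa>))" unfolding elim(4) by (simp add: power_mult_distrib)
      also have "(t ^ \<kappa>) ^ k = (t ^ M) ^ 2" using kM(1) by (simp add: power_mult[symmetric] mult.commute)
      also have "(t ^ M)\<^sup>2 * \<delta> (t ^ \<kappa>) + (t ^ M) ^ 2 * ((w t)\<^sup>2 * \<Phi>\<^sub>2 (t ^ M * w t, t ^ \<kappa>)) = (t ^ M) ^ 2 * G (t, v t)"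
        by (simp add: G_def w_def distrib_left)
      finally show ?case using elim(3) by simp
    qed
  qed
  have cY: "isCont (\<lambda>t. (Y t, t ^ \<kappa>)) 0" by (intro continuous_intros analytic_at_imp_isCont[OF Ya])
  then have fY: "filterlim (\<lambda>t. (Y t, t ^ \<kappa>)) (nhds (0, 0)) (nhds 0)" using Y0 tk0 by (simp add: isCont_def tendsto_nhds_iff)
  have inr: "\<forall>\<^sub>F t in nhds 0. (Y t, t ^ \<kappa>) \<in> bid r"
    using eventually_compose_filterlim[OF eventually_nhds_in_open[OF open_bid] fY] r0 by simp
  have wne: "\<forall>\<^sub>F t in nhds 0. norm (w t - w\<^sub>0) < norm w\<^sub>0"
  proof -
    have "isCont (\<lambda>t. norm (w t - w\<^sub>0)) 0" by (intro continuous_intros cw)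
    then have "((\<lambda>t. norm (w t - w\<^sub>0)) \<longlongrightarrow> 0) (nhds 0)" using ww0 by (simp add: isCont_def tendsto_nhds_iff)
    from order_tendstoD(2)[OF this, of "norm w\<^sub>0"] w0(2) show ?thesis by simp
  qed
  define \<gamma>\<^sub>1 \<gamma>\<^sub>2 where "\<gamma>\<^sub>1 t = \<Theta>\<^sub>1 (Y t, t ^ \<kappa>)" and "\<gamma>\<^sub>2 t = \<Theta>\<^sub>2 (Y t, t ^ \<kappa>)" for t
  define \<delta>\<^sub>1 \<delta>\<^sub>2 where "\<delta>\<^sub>1 t = (\<alpha>\<^sub>1 * y\<^sub>1 t + \<beta>\<^sub>1) * inverse (\<nu> (Y t, t ^ \<kappa>))" and "\<delta>\<^sub>2 t = (\<alpha>\<^sub>2 * y\<^sub>1 t + \<beta>\<^sub>2) * inverse (\<nu> (Y t, t ^ \<kappa>))" for t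
  have ga: "\<gamma>\<^sub>1 analytic_on {0}" "\<gamma>\<^sub>2 analytic_on {0}" unfolding \<gamma>\<^sub>1_def[abs_def] \<gamma>\<^sub>2_def[abs_def]
    by (rule curve_germ_analytic[OF germ_theta(1) Ya tk Y0 tk0] curve_germ_analytic[OF germ_theta(2) Ya tk Y0 tk0])+
  have na: "(\<lambda>t. \<nu> (Y t, t ^ \<kappa>)) analytic_on {0}" by (rule curve_germ_analytic[OF germ_theta(3) Ya tk Y0 tk0])
  have da: "\<delta>\<^sub>1 analytic_on {0}" "\<delta>\<^sub>2 analytic_on {0}" unfolding \<delta>\<^sub>1_def[abs_def] \<delta>\<^sub>2_def[abs_def]
    by (intro analytic_intros y1a na; simp add: Y0 tk0 nu0)+
  have gd: "\<gamma>\<^sub>1 t = t ^ \<kappa> * \<delta>\<^sub>1 t" "\<gamma>\<^sub>2 t = t ^ \<kappa> * \<delta>\<^sub>2 t" for t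
    by (simp_all add: \<gamma>\<^sub>1_def \<gamma>\<^sub>2_def \<delta>\<^sub>1_def \<delta>\<^sub>2_def theta_eq Y_def algebra_simps)
  define Q where "Q \<rho> \<longleftrightarrow> \<rho> > 0 \<and> \<gamma>\<^sub>1 holomorphic_on ball 0 \<rho> \<and> \<gamma>\<^sub>2 holomorphic_on ball 0 \<rho> \<and> \<delta>\<^sub>1 holomorphic_on ball 0 \<rho> \<and> \<delta>\<^sub>2 holomorphic_on ball 0 \<rho> \<and>
     (\<forall>t\<in>ball 0 \<rho>. pull F (Y t, t ^ \<kappa>) = 0 \<and> (Y t, t ^ \<kappa>) \<in> bid r \<and> norm (w t - w\<^sub>0) < norm w\<^sub>0 \<and> Y t = \<sigma> (t ^ \<kappa>) + t ^ M * w t)" for \<rho> :: real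
  have "\<forall>\<^sub>F \<rho> in at_right 0. Q \<rho>" unfolding Q_def
    by (intro eventually_conj ev_holomorphic ga da ev_ball zero inr wne Ye eventually_at_right_less)
  from eventually_happens'[OF trivial_limit_at_right_real this] obtain \<rho> where Q: "Q \<rho>" by blast
  then have rho: "\<rho> > 0" "\<gamma>\<^sub>1 holomorphic_on ball 0 \<rho>" "\<gamma>\<^sub>2 holomorphic_on ball 0 \<rho>" "\<delta>\<^sub>1 holomorphic_on ball 0 \<rho>" "\<delta>\<^sub>2 holomorphic_on ball 0 \<rho>"
    unfolding Q_def by blast+
  have all: "pull F (Y t, t ^ \<kappa>) = 0 \<and> (Y t, t ^ \<kappa>) \<in> bid r \<and> norm (w t - w\<^sub>0) < norm w\<^sub>0 \<and> Y t = \<sigma> (t ^ \<kappa>) + t ^ M * w t"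
    if "t \<in> ball 0 \<rho>" for t
    using Q that unfolding Q_def by blast
  have inj: "inj_on (\<lambda>t. (\<gamma>\<^sub>1 t, \<gamma>\<^sub>2 t)) (ball 0 \<rho>)"
  proof (rule inj_onI)
    fix t t' assume t: "t \<in> ball 0 \<rho>" "t' \<in> ball 0 \<rho>" and eq: "(\<gamma>\<^sub>1 t, \<gamma>\<^sub>2 t) = (\<gamma>\<^sub>1 t', \<gamma>\<^sub>2 t')"
    have "(Y t, t ^ \<kappa>) = (Y t', t' ^ \<kappa>)"
      using eq all[OF t(1)] all[OF t(2)] by (intro theta_inj) (auto simp: \<gamma>\<^sub>1_def \<gamma>\<^sub>2_def)
    then have Yt: "Y t = Y t'" and tt: "t ^ \<kappa> = t' ^ \<kappa>" by auto
    show "t = t'"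
    proof (rule ccontr)
      assume ne: "t \<noteq> t'"
      then have "\<kappa> \<noteq> 1" using tt by auto
      \<comment> \<open>Two parameters t and -t with the same image would satisfy w(t) = -w(-t), as
        \<open>M\<close> is odd, while both values are closer to \<open>w\<^sub>0\<close> than 0
        is.\<close>
      then have k2: "\<kappa> = 2" and Mo: "odd M" using kM(3) by auto
      then have t': "t' = - t" using tt ne by (auto simp: power2_eq_iff)
      have t0: "t \<noteq> 0" using ne t' by auto
      have "t ^ M * w t = t' ^ M * w t'" using Yt all[OF t(1)] all[OF t(2)] tt by simp
      then have "t ^ M * (w t + w t') = 0" using Mo t' by (simp add: power_minus_odd algebra_simps)
      then have ws: "w t = - w t'" using t0 by (simp add: add_eq_0_iff2)
      have "(w t - w\<^sub>0) + (w t' - w\<^sub>0) = - (2 * w\<^sub>0)" unfolding ws by simp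
      then have "2 * norm w\<^sub>0 = norm ((w t - w\<^sub>0) + (w t' - w\<^sub>0))" by (simp add: norm_mult)
      also have "\<dots> < 2 * norm w\<^sub>0" using norm_triangle_ineq[of "w t - w\<^sub>0" "w t' - w\<^sub>0"] all[OF t(1)] all[OF t(2)] by linarith
      finally show False by simp
    qed
  qed
  have "eval2 (local_equation F s) (\<gamma>\<^sub>1 t, \<gamma>\<^sub>2 t) = 0" if "t \<in> ball 0 \<rho>" for t
    using pull_local_equation[OF F, of "(Y t, t ^ \<kappa>)"] all[OF that] nu_nz[of "(Y t, t ^ \<kappa>)"] by (auto simp: \<gamma>\<^sub>1_def \<gamma>\<^sub>2_def)
  moreover have "(\<beta>\<^sub>1, \<beta>\<^sub>2) = (\<delta>\<^sub>1 0, \<delta>\<^sub>2 0)" by (simp add: \<delta>\<^sub>1_def \<delta>\<^sub>2_def y10 Y0 tk0 nu0)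
  moreover have "\<kappa> \<ge> 1" using kp by simp
  ultimately have "branch_tangent_direction (local_equation F s) (\<beta>\<^sub>1, \<beta>\<^sub>2)"
    unfolding branch_tangent_direction_def using rho inj gd b0 by blast
  moreover obtain c where "p = \<beta>\<^sub>1 *s fst (chart_dirs s) + \<beta>\<^sub>2 *s snd (chart_dirs s) + c *s s" using p_dir by blast
  then have "p = c *s s + 1 *s (\<beta>\<^sub>1 *s fst (chart_dirs s) + \<beta>\<^sub>2 *s snd (chart_dirs s))" by (simp add: algebra_simps)
  ultimately show "p \<in> tangent_cone F s" unfolding tangent_cone_def by blast
qed

end

section \<open>Isotopies following simple roots\<close>

lemma card_simple_roots:
  fixes p :: "complex poly"
  assumes "p \<noteq> 0" "\<And>a. poly p a = 0 \<Longrightarrow> poly (pderiv p) a \<noteq> 0"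
  shows "card {z. poly p z = 0} = degree p"
  using assms
proof (induction "degree p" arbitrary: p)
  case 0
  then obtain c where "p = [:c:]" by (metis degree_eq_zeroE)
  then show ?case using 0 by simp
next
  case (Suc n)
  then obtain r where r: "poly p r = 0"
    using Fundamental_Theorem_Algebra.fundamental_theorem_of_algebra[of p] constant_degree[of p] by auto
  then obtain q where q: "p = [:- r, 1:] * q" unfolding poly_eq_0_iff_dvd by (elim dvdE)
  have q0: "q \<noteq> 0" using Suc.prems(1) q by auto
  have dq: "degree p = Suc (degree q)" unfolding q by (subst degree_mult_eq) (use q0 in auto)
  have d: "poly (pderiv p) a = (a - r) * poly (pderiv q) a + poly q a" for a
    unfolding q pderiv_mult by (simp add: pderiv_pCons algebra_simps)
  have "card {z. poly q z = 0} = degree q"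
  proof (rule Suc.hyps(1)[OF _ q0])
    show "n = degree q" using dq Suc.hyps(2) by simp
    fix a assume "poly q a = 0"
    then show "poly (pderiv q) a \<noteq> 0" using Suc.prems(2)[of a] d[of a] by (auto simp: q)
  qed
  moreover have "{z. poly p z = 0} = insert r {z. poly q z = 0}" by (auto simp: q)
  moreover have "r \<notin> {z. poly q z = 0}" using Suc.prems(2)[OF r] d[of r] by auto
  ultimately show ?case using dq poly_roots_finite[OF q0] by simp
qed

text \<open>The norm of the value at \<open>r\<close> is that of the leading coefficient times the
  product of the distances from \<open>r\<close> to the roots. The lemma serves as a quantitative
  continuity of roots.\<close>

lemma root_near:
  fixes p :: "complex poly"
  assumes "p \<noteq> 0" "degree p > 0" "\<delta> > 0" "norm (poly p r) < norm (lead_coeff p) * \<delta> ^ degree p"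
  shows "\<exists>\<zeta>. poly p \<zeta> = 0 \<and> norm (\<zeta> - r) < \<delta>"
proof (rule ccontr)
  assume n: "\<not> ?thesis"
  have "norm (lead_coeff p) * \<delta> ^ degree p \<le> norm (poly p r)"
    if "p \<noteq> 0" "\<And>\<zeta>. poly p \<zeta> = 0 \<Longrightarrow> \<delta> \<le> norm (\<zeta> - r)" for p
    using that
  proof (induction "degree p" arbitrary: p)
    case 0
    then obtain c where "p = [:c:]" by (metis degree_eq_zeroE)
    then show ?case by simp
  next
    case (Suc n)
    then obtain s where s: "poly p s = 0"
      using Fundamental_Theorem_Algebra.fundamental_theorem_of_algebra[of p] constant_degree[of p] by auto
    then obtain q where q: "p = [:- s, 1:] * q" unfolding poly_eq_0_iff_dvd by (elim dvdE)
    have q0: "q \<noteq> 0" using Suc.prems(1) q by auto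
    have dq: "degree p = Suc (degree q)" unfolding q by (subst degree_mult_eq) (use q0 in auto)
    have lc: "lead_coeff p = lead_coeff q" unfolding q by (simp add: lead_coeff_mult del: mult_pCons_left)
    have "norm (lead_coeff q) * \<delta> ^ degree q \<le> norm (poly q r)"
      using Suc.hyps(2) dq Suc.prems(2) by (intro Suc.hyps(1) q0) (auto simp: q)
    moreover have "\<delta> \<le> norm (r - s)" using Suc.prems(2)[OF s] by (simp add: norm_minus_commute)
    ultimately have "\<delta> * (norm (lead_coeff q) * \<delta> ^ degree q) \<le> norm (r - s) * norm (poly q r)"
      using assms(3) by (intro mult_mono) auto
    moreover have "poly p r = (r - s) * poly q r" by (simp add: q algebra_simps)
    ultimately have "norm (lead_coeff q) * \<delta> ^ Suc (degree q) \<le> norm (poly p r)" by (simp add: norm_mult mult_ac)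
    then show ?case unfolding lc unfolding dq .
  qed
  then have "norm (lead_coeff p) * \<delta> ^ degree p \<le> norm (poly p r)" using assms(1) n by (meson not_less)
  then show False using assms(4) by simp
qed

text \<open>
  The homeomorphism \<open>\<Theta> (w, \<cdot>)\<close> of the plane is the identity plus a sum of bump functions, one for each root \<open>r\<close>
  of \<open>f w\<^sub>0\<close>, that push \<open>r\<close> to the root of \<open>f w\<close> next to it; for \<open>w\<close> near \<open>w\<^sub>0\<close> this perturbation is a contraction.
\<close>

theorem root_isotopy:
  fixes f :: "'w::metric_space \<Rightarrow> complex poly"
  assumes W: "open W" "w\<^sub>0 \<in> W" and c: "c \<noteq> 0" and f: "\<And>w. w \<in> W \<Longrightarrow> degree (f w) = d \<and> lead_coeff (f w) = c"
    and cont: "\<And>z. continuous_on W (\<lambda>w. poly (f w) z)" and simple: "\<And>a. poly (f w\<^sub>0) a = 0 \<Longrightarrow> poly (pderiv (f w\<^sub>0)) a \<noteq> 0"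
  shows "\<exists>N \<Theta> \<Xi>. open N \<and> w\<^sub>0 \<in> N \<and> N \<subseteq> W \<and> continuous_on (N \<times> UNIV) \<Theta> \<and> continuous_on (N \<times> UNIV) \<Xi> \<and>
    (\<forall>w\<in>N. \<forall>z. \<Xi> (w, \<Theta> (w, z)) = z \<and> \<Theta> (w, \<Xi> (w, z)) = z \<and> (poly (f w) (\<Theta> (w, z)) = 0 \<longleftrightarrow> poly (f w\<^sub>0) z = 0))"
proof -
  define Z where "Z w = {z. poly (f w) z = 0}" for w
  have f0: "f w \<noteq> 0" if "w \<in> W" for w using f[OF that] c by auto
  have fin: "finite (Z w)" if "w \<in> W" for w unfolding Z_def by (rule poly_roots_finite[OF f0[OF that]])
  have cle: "card (Z w) \<le> d" if "w \<in> W" for w unfolding Z_def using card_poly_roots_bound[OF f0[OF that]] f[OF that] by simp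
  have c0: "card (Z w\<^sub>0) = d" unfolding Z_def using card_simple_roots[OF f0[OF W(2)] simple] f[OF W(2)] by simp
  have fin0: "finite (Z w\<^sub>0)" by (rule fin[OF W(2)])
  \<comment> \<open>The element 1 keeps the set nonempty when there is at most one root.\<close>
  define Ds where "Ds = insert 1 ((\<lambda>(a, b). dist a b) ` {(a, b) \<in> Z w\<^sub>0 \<times> Z w\<^sub>0. a \<noteq> b})"
  have "finite {(a, b) \<in> Z w\<^sub>0 \<times> Z w\<^sub>0. a \<noteq> b}" by (rule finite_subset[of _ "Z w\<^sub>0 \<times> Z w\<^sub>0"]) (use fin0 in auto)
  then have fD: "finite Ds" unfolding Ds_def by simp
  define \<epsilon> where "\<epsilon> = Min Ds / 2"
  have eps: "\<epsilon> > 0" unfolding \<epsilon>_def using fD by (auto simp: Ds_def Min_gr_iff)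
  have sep: "2 * \<epsilon> \<le> norm (a - b)" if "a \<in> Z w\<^sub>0" "b \<in> Z w\<^sub>0" "a \<noteq> b" for a b
  proof -
    have "dist a b \<in> Ds" unfolding Ds_def using that by force
    then show ?thesis unfolding \<epsilon>_def using fD by (simp add: dist_norm)
  qed
  \<comment> \<open>Each of the d roots moves by less than \<open>\<eta>\<close>, and each bump has
    Lipschitz constant 1/(2 \<open>\<epsilon>\<close>), so the perturbation has Lipschitz constant
    at most d/(2 (d + 1)), which is below 1/2.\<close>
  define \<eta> where "\<eta> = \<epsilon> / (d + 1)"
  have eta: "\<eta> > 0" "\<eta> \<le> \<epsilon>" using eps by (auto simp: \<eta>_def divide_le_eq)
  define N where "N = {w \<in> W. \<forall>r\<in>Z w\<^sub>0. norm (poly (f w) r) < norm c * \<eta> ^ d}"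
  have "open {w \<in> W. norm (poly (f w) r) < norm c * \<eta> ^ d}" for r
    using continuous_on_open_vimage[OF W(1)] continuous_open_preimage[OF continuous_on_norm[OF cont[of r]] W(1), of "{..<norm c * \<eta> ^ d}"]
    by (simp add: vimage_def Int_def)
  then have "open (W \<inter> (\<Inter>r\<in>Z w\<^sub>0. {w \<in> W. norm (poly (f w) r) < norm c * \<eta> ^ d}))" using fin0 W(1) by (intro open_Int open_INT) auto
  moreover have "N = W \<inter> (\<Inter>r\<in>Z w\<^sub>0. {w \<in> W. norm (poly (f w) r) < norm c * \<eta> ^ d})" by (auto simp: N_def)
  ultimately have N: "open N" by simp
  have N0: "w\<^sub>0 \<in> N" using W(2) c eta by (auto simp: N_def Z_def)
  have NW: "N \<subseteq> W" by (auto simp: N_def)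
  have dpos: "d > 0" if "r \<in> Z w\<^sub>0" for r using that c0 fin0 by (metis card_gt_0_iff empty_iff)
  have ex: "\<exists>\<zeta>. \<zeta> \<in> Z w \<and> norm (\<zeta> - r) < \<eta>" if "w \<in> N" "r \<in> Z w\<^sub>0" for w r
    using root_near[OF f0 _ eta(1), of w r] f[of w] dpos[OF that(2)] that NW unfolding N_def Z_def by auto
  define \<rho> where "\<rho> r w = (SOME \<zeta>. \<zeta> \<in> Z w \<and> norm (\<zeta> - r) < \<eta>)" for r w
  have rho: "\<rho> r w \<in> Z w" "norm (\<rho> r w - r) < \<eta>" if "w \<in> N" "r \<in> Z w\<^sub>0" for w r
    using someI_ex[OF ex[OF that]] unfolding \<rho>_def by auto
  have near: "r = r'" if "norm (a - r) < \<eta>" "norm (a - r') < \<eta>" "r \<in> Z w\<^sub>0" "r' \<in> Z w\<^sub>0" for a r r'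
  proof (rule ccontr)
    assume "r \<noteq> r'"
    then have "2 * \<epsilon> \<le> norm (r - r')" using sep that by blast
    also have "\<dots> \<le> norm (a - r') + norm (a - r)" using norm_triangle_ineq4[of "a - r'" "a - r"] by simp
    finally show False using that eta(2) by linarith
  qed
  \<comment> \<open>Distinct roots of \<open>f w\<^sub>0\<close> have distinct neighbours among the
    roots of \<open>f w\<close>. This gives d roots, the most that the degree allows.\<close>
  have Zw: "Z w = (\<lambda>r. \<rho> r w) ` Z w\<^sub>0" if "w \<in> N" for w
  proof -
    have "inj_on (\<lambda>r. \<rho> r w) (Z w\<^sub>0)" using near rho(2)[OF that] by (intro inj_onI) metis
    then have "card ((\<lambda>r. \<rho> r w) ` Z w\<^sub>0) = d" by (simp add: card_image c0)
    moreover have "(\<lambda>r. \<rho> r w) ` Z w\<^sub>0 \<subseteq> Z w" using rho(1)[OF that] by auto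
    ultimately show ?thesis using card_seteq[OF fin] cle that NW by (metis subsetD)
  qed
  have rho_unique: "\<zeta> = \<rho> r w" if a: "w \<in> N" "r \<in> Z w\<^sub>0" "\<zeta> \<in> Z w" "norm (\<zeta> - r) < \<eta>" for w r \<zeta>
  proof -
    obtain r' where r': "r' \<in> Z w\<^sub>0" "\<zeta> = \<rho> r' w" using Zw[OF a(1)] a(3) by blast
    have "norm (\<zeta> - r') < \<eta>" using rho(2)[OF a(1) r'(1)] r'(2) by simp
    then have "r' = r" using near[OF _ a(4) r'(1) a(2)] by blast
    then show ?thesis using r'(2) by simp
  qed
  \<comment> \<open>\<open>root_near\<close>, applied at the chosen root of \<open>f w\<close>,
    finds a close root of \<open>f w'\<close>; it is the chosen one because it is also within
    \<open>\<eta>\<close> of \<open>r\<close>.\<close>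
  have crho: "continuous_on N (\<rho> r)" if r: "r \<in> Z w\<^sub>0" for r
    unfolding continuous_on_iff dist_norm
  proof (intro ballI allI impI)
    fix w and e :: real assume w: "w \<in> N" and e: "e > 0"
    define e' where "e' = min e (\<eta> - norm (\<rho> r w - r))"
    have e': "e' > 0" using e rho(2)[OF w r] by (simp add: e'_def)
    have pos: "0 < norm c * e' ^ d" using c e' by simp
    have "continuous_on N (\<lambda>w'. poly (f w') (\<rho> r w))" by (rule continuous_on_subset[OF cont NW])
    then obtain \<delta> where de: "\<delta> > 0" "\<forall>w'\<in>N. dist w' w < \<delta> \<longrightarrow> dist (poly (f w') (\<rho> r w)) (poly (f w) (\<rho> r w)) < norm c * e' ^ d"
      using w pos unfolding continuous_on_iff by blast
    show "\<exists>\<delta>>0. \<forall>w'\<in>N. dist w' w < \<delta> \<longrightarrow> norm (\<rho> r w' - \<rho> r w) < e"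
    proof (intro exI[of _ \<delta>] conjI ballI impI de(1))
      fix w' assume w': "w' \<in> N" "dist w' w < \<delta>"
      have "poly (f w) (\<rho> r w) = 0" using rho(1)[OF w r] by (simp add: Z_def)
      then have "norm (poly (f w') (\<rho> r w)) < norm c * e' ^ d" using de(2) w' by (auto simp: dist_norm)
      then obtain \<zeta> where z: "poly (f w') \<zeta> = 0" "norm (\<zeta> - \<rho> r w) < e'"
        using root_near[OF f0 _ e', of w' "\<rho> r w"] f[of w'] dpos[OF r] w' NW by auto
      have "norm (\<zeta> - r) \<le> norm (\<zeta> - \<rho> r w) + norm (\<rho> r w - r)" using norm_triangle_ineq[of "\<zeta> - \<rho> r w" "\<rho> r w - r"] by simp
      then have "norm (\<zeta> - r) < \<eta>" using z(2) unfolding e'_def by linarith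
      then have "\<zeta> = \<rho> r w'" using rho_unique[OF w'(1) r] z(1) by (simp add: Z_def)
      then show "norm (\<rho> r w' - \<rho> r w) < e" using z(2) unfolding e'_def by simp
    qed
  qed
  \<comment> \<open>A cone of height 1 and radius 2 \<open>\<epsilon>\<close>. It is 1 at
    \<open>r\<close> and 0 at all other roots, so \<open>\<Theta>\<close> moves each root exactly to
    its neighbour.\<close>
  define bump where "bump r z = max 0 (1 - norm (z - r) / (2 * \<epsilon>))" for r z :: complex
  have clamp: "\<bar>max 0 (1 - a) - max 0 (1 - b)\<bar> \<le> \<bar>a - b\<bar>" for a b :: real by (simp add: max_def abs_if)
  have bump_lip: "\<bar>bump r z - bump r z'\<bar> \<le> norm (z - z') / (2 * \<epsilon>)" for r z z'
  proof -
    have "\<bar>bump r z - bump r z'\<bar> \<le> \<bar>norm (z - r) / (2 * \<epsilon>) - norm (z' - r) / (2 * \<epsilon>)\<bar>" unfolding bump_def by (rule clamp)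
    also have "\<dots> = \<bar>norm (z - r) - norm (z' - r)\<bar> / (2 * \<epsilon>)" using eps by (simp add: diff_divide_distrib[symmetric])
    also have "\<dots> \<le> norm (z - z') / (2 * \<epsilon>)" using norm_triangle_ineq3[of "z - r" "z' - r"] eps by (intro divide_right_mono) auto
    finally show ?thesis .
  qed
  define g where "g x = (\<Sum>r\<in>Z w\<^sub>0. of_real (bump r (snd x)) * (\<rho> r (fst x) - r))" for x :: "'w \<times> complex"
  define \<Theta> where "\<Theta> x = snd x + g x" for x
  have cb: "continuous_on A (\<lambda>x. of_real (bump r (snd x)) :: complex)" for A :: "('w \<times> complex) set" and r
    unfolding bump_def using eps by (intro continuous_intros) auto
  have cg: "continuous_on (N \<times> UNIV) g" unfolding g_def[abs_def]
    by (intro continuous_on_sum continuous_on_mult cb continuous_on_diff continuous_on_const continuous_on_compose2[OF crho] continuous_on_fst continuous_on_id) auto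
  then have cT: "continuous_on (N \<times> UNIV) \<Theta>" unfolding \<Theta>_def[abs_def] by (intro continuous_intros)
  have cancel: "e \<noteq> 0 \<Longrightarrow> K \<noteq> 0 \<Longrightarrow> D * (x / (2 * e) * (e / K)) = D / K * (x / 2)" for e K D x :: real by (simp add: field_simps)
  have g_lip: "norm (g (w, z) - g (w, z')) \<le> norm (z - z') / 2" if w: "w \<in> N" for w z z'
  proof -
    have "g (w, z) - g (w, z') = (\<Sum>r\<in>Z w\<^sub>0. of_real (bump r z - bump r z') * (\<rho> r w - r))"
      by (simp add: g_def sum_subtractf left_diff_distrib)
    also have "norm \<dots> \<le> (\<Sum>r\<in>Z w\<^sub>0. norm (z - z') / (2 * \<epsilon>) * \<eta>)"
    proof (rule sum_norm_le)
      fix r assume r: "r \<in> Z w\<^sub>0"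
      have "norm (of_real (bump r z - bump r z') * (\<rho> r w - r)) = \<bar>bump r z - bump r z'\<bar> * norm (\<rho> r w - r)"
        by (simp only: norm_mult norm_of_real)
      then show "norm (of_real (bump r z - bump r z') * (\<rho> r w - r)) \<le> norm (z - z') / (2 * \<epsilon>) * \<eta>"
        using mult_mono[OF bump_lip[of r z z'] less_imp_le[OF rho(2)[OF w r]]] eps by (simp only: norm_ge_zero) simp
    qed
    also have "\<dots> = (d / (d + 1)) * (norm (z - z') / 2)" using cancel[of \<epsilon> "d + 1" d] eps by (simp add: c0 \<eta>_def)
    also have "\<dots> \<le> 1 * (norm (z - z') / 2)" by (intro mult_right_mono) auto
    finally show ?thesis by simp
  qed
  have T_lip: "norm (z - z') \<le> 2 * norm (\<Theta> (w, z) - \<Theta> (w, z'))" if "w \<in> N" for w z z'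
  proof -
    have "norm (z - z') \<le> norm (\<Theta> (w, z) - \<Theta> (w, z')) + norm (g (w, z) - g (w, z'))"
      using norm_triangle_ineq4[of "\<Theta> (w, z) - \<Theta> (w, z')" "g (w, z) - g (w, z')"] by (simp add: \<Theta>_def)
    then show ?thesis using g_lip[OF that, of z z'] by linarith
  qed
  \<comment> \<open>A solution of z + g(w, z) = y is a fixed point of the contraction that sends z
    to y - g(w, z).\<close>
  have surj: "\<exists>z. \<Theta> (w, z) = y" if w: "w \<in> N" for w y
  proof -
    have "dist (y - g (w, a)) (y - g (w, b)) \<le> (1 / 2) * dist a b" for a b
      using g_lip[OF w, of a b] by (simp add: dist_norm norm_minus_commute)
    then have "\<exists>!z\<in>UNIV. y - g (w, z) = z"
      by (intro Banach_fix[of UNIV "1/2"]) (auto simp: complete_UNIV)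
    then obtain z where "y - g (w, z) = z" by blast
    then have "\<Theta> (w, z) = y" unfolding \<Theta>_def by (simp add: algebra_simps)
    then show ?thesis by blast
  qed
  define \<Xi> where "\<Xi> x = (SOME z. \<Theta> (fst x, z) = snd x)" for x
  have TX: "\<Theta> (w, \<Xi> (w, y)) = y" if "w \<in> N" for w y
    using someI_ex[OF surj[OF that]] by (simp add: \<Xi>_def)
  have XT: "\<Xi> (w, \<Theta> (w, z)) = z" if "w \<in> N" for w z
    using T_lip[OF that, of "\<Xi> (w, \<Theta> (w, z))" z] TX[OF that] by simp
  have Tr: "\<Theta> (w, r) = \<rho> r w" if "w \<in> N" "r \<in> Z w\<^sub>0" for w r
  proof -
    have "bump r' r = (if r' = r then 1 else 0)" if "r' \<in> Z w\<^sub>0" for r'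
    proof (cases "r' = r")
      case False
      then have "1 \<le> norm (r - r') / (2 * \<epsilon>)" using sep[of r r'] that \<open>r \<in> Z w\<^sub>0\<close> eps by (simp add: le_divide_eq)
      then show ?thesis using False by (simp add: bump_def)
    qed (simp add: bump_def)
    then have "g (w, r) = (\<Sum>r'\<in>Z w\<^sub>0. if r' = r then \<rho> r w - r else 0)" unfolding g_def by (intro sum.cong) auto
    then show ?thesis using that fin0 by (simp add: \<Theta>_def)
  qed
  have roots: "poly (f w) (\<Theta> (w, z)) = 0 \<longleftrightarrow> poly (f w\<^sub>0) z = 0" if w: "w \<in> N" for w z
  proof
    assume "poly (f w\<^sub>0) z = 0"
    then have "z \<in> Z w\<^sub>0" by (simp add: Z_def)
    then show "poly (f w) (\<Theta> (w, z)) = 0" using Tr[OF w] rho(1)[OF w] by (simp add: Z_def)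
  next
    assume "poly (f w) (\<Theta> (w, z)) = 0"
    then obtain r where r: "r \<in> Z w\<^sub>0" "\<Theta> (w, z) = \<rho> r w" using Zw[OF w] by (auto simp: Z_def)
    then have "\<Theta> (w, z) = \<Theta> (w, r)" using Tr[OF w] by simp
    then have "z = r" using XT[OF w] by metis
    then show "poly (f w\<^sub>0) z = 0" using r by (simp add: Z_def)
  qed
  \<comment> \<open>The bound \<open>T_lip\<close> is uniform in w, so continuity of
    \<open>\<Theta>\<close> in w yields joint continuity of the inverse.\<close>
  have cX: "continuous_on (N \<times> UNIV) \<Xi>"
    unfolding continuous_on_iff
  proof (intro ballI allI impI)
    fix x :: "'w \<times> complex" and e :: real assume x: "x \<in> N \<times> UNIV" and e: "e > 0"
    obtain w y where wy: "x = (w, y)" "w \<in> N" using x by auto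
    have e4: "0 < e / 4" using e by simp
    define \<zeta> where "\<zeta> = \<Xi> (w, y)"
    have "continuous_on N (\<lambda>w'. \<Theta> (w', \<zeta>))" by (rule continuous_on_compose2[OF cT]) (auto intro!: continuous_intros)
    then obtain \<delta> where de: "\<delta> > 0" "\<forall>w'\<in>N. dist w' w < \<delta> \<longrightarrow> dist (\<Theta> (w', \<zeta>)) (\<Theta> (w, \<zeta>)) < e / 4"
      using wy(2) e4 unfolding continuous_on_iff by blast
    show "\<exists>\<delta>>0. \<forall>x'\<in>N \<times> UNIV. dist x' x < \<delta> \<longrightarrow> dist (\<Xi> x') (\<Xi> x) < e"
    proof (intro exI[of _ "min \<delta> (e / 4)"] conjI ballI impI)
      show "0 < min \<delta> (e / 4)" using de e by simp
      fix x' :: "'w \<times> complex" assume x': "x' \<in> N \<times> UNIV" and dx: "dist x' x < min \<delta> (e / 4)"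
      obtain w' y' where wy': "x' = (w', y')" "w' \<in> N" using x' by auto
      have "dist w' w \<le> dist x' x" "dist y' y \<le> dist x' x" using dist_fst_le[of x' x] dist_snd_le[of x' x] by (simp_all add: wy wy')
      then have d1: "dist w' w < \<delta>" "dist y' y < e / 4" using dx by auto
      have "norm (\<Xi> x' - \<zeta>) \<le> 2 * norm (\<Theta> (w', \<Xi> x') - \<Theta> (w', \<zeta>))" by (rule T_lip[OF wy'(2)])
      also have "\<Theta> (w', \<Xi> x') = y'" unfolding wy'(1) by (rule TX[OF wy'(2)])
      also have "y' - \<Theta> (w', \<zeta>) = (y' - y) - (\<Theta> (w', \<zeta>) - \<Theta> (w, \<zeta>))" using TX[OF wy(2), of y] by (simp add: \<zeta>_def)
      also have "2 * norm \<dots> \<le> 2 * (norm (y' - y) + norm (\<Theta> (w', \<zeta>) - \<Theta> (w, \<zeta>)))" by (intro mult_left_mono norm_triangle_ineq4) auto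
      also have "\<dots> < 2 * (e / 4 + e / 4)" using d1 de(2) wy'(2) by (intro mult_strict_left_mono add_strict_mono) (auto simp: dist_norm)
      finally show "dist (\<Xi> x') (\<Xi> x) < e" by (simp add: dist_norm \<zeta>_def wy(1))
    qed
  qed
  show ?thesis using N N0 NW cT cX XT TX roots by (intro exI[of _ N] exI[of _ \<Theta>] exI[of _ \<Xi>]) blast
qed

section \<open>Continuity on projective spaces\<close>

lemma mem_proj: "v \<in> proj v" unfolding proj_def by (rule range_eqI[of _ _ 1]) simp

lemma proj_scale: "c \<noteq> 0 \<Longrightarrow> proj (c *s v) = proj v"
proof (intro equalityI subsetI)
  assume c: "c \<noteq> 0"
  fix x assume "x \<in> proj v"
  then obtain d where d: "x = d *s v" unfolding proj_def by (elim rangeE)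
  have "d *s v = (d / c) *s (c *s v)" using c by (simp add: vector_smult_assoc)
  then show "x \<in> proj (c *s v)" unfolding proj_def d by (rule range_eqI)
next
  fix x assume "x \<in> proj (c *s v)"
  then obtain d where "x = d *s (c *s v)" unfolding proj_def by (elim rangeE)
  then have "x = (d * c) *s v" by (simp add: vector_smult_assoc)
  then show "x \<in> proj v" unfolding proj_def by (rule range_eqI)
qed

lemma proj_eqD: "proj v = proj w \<Longrightarrow> w \<noteq> 0 \<Longrightarrow> \<exists>c. c \<noteq> 0 \<and> w = c *s v"
proof -
  assume a: "proj v = proj w" "w \<noteq> 0"
  have "w \<in> proj v" using mem_proj[of w] a(1) by simp
  then obtain c where "w = c *s v" unfolding proj_def by (elim rangeE)
  then show ?thesis using a(2) by auto
qed

lemma continuous_map_proj: "continuous_map (top_of_set (- {0})) proj_space proj"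
  unfolding continuous_map
proof (intro conjI allI impI)
  show "proj ` topspace (top_of_set (- {0})) \<subseteq> topspace proj_space" by (auto simp: topspace_proj_space)
  fix U :: "(complex ^ 'n) set set" assume U: "openin proj_space U"
  have "{x \<in> topspace (top_of_set (- {0})). proj x \<in> U} = {v. v \<noteq> 0 \<and> proj v \<in> U}" by auto
  then show "openin (top_of_set (- {0})) {x \<in> topspace (top_of_set (- {0})). proj x \<in> U}"
    using U unfolding openin_proj_space by (auto intro: open_subset)
qed

lemma continuous_map_into_proj:
  assumes "continuous_map Z euclidean g" "\<And>z. z \<in> topspace Z \<Longrightarrow> g z \<noteq> 0 \<and> proj (g z) \<in> W"
  shows "continuous_map Z (subtopology proj_space W) (\<lambda>z. proj (g z))"
proof -
  have "continuous_map Z (top_of_set (- {0})) g" using assms by (auto intro!: continuous_map_into_subtopology)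
  from continuous_map_compose[OF this continuous_map_proj] show ?thesis
    using assms(2) by (auto intro!: continuous_map_into_subtopology simp: o_def)
qed

text \<open>The projection onto the projective space is open, so that it restricts to quotient maps of saturated sets.\<close>

lemma continuous_map_from_proj:
  fixes W :: "(complex ^ 'n) set set"
  assumes W: "W \<subseteq> proj ` (- {0})" and g: "continuous_map (top_of_set {v. v \<noteq> 0 \<and> proj v \<in> W}) Y g"
    and f: "\<And>v. v \<noteq> 0 \<Longrightarrow> proj v \<in> W \<Longrightarrow> f (proj v) = g v"
  shows "continuous_map (subtopology proj_space W) Y f"
  unfolding continuous_map
proof (intro conjI allI impI)
  let ?C = "{v. v \<noteq> 0 \<and> proj v \<in> W}"
  have ts: "topspace (subtopology proj_space W) = W" using W by (auto simp: topspace_proj_space)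
  show "f ` topspace (subtopology proj_space W) \<subseteq> topspace Y"
    unfolding ts using W f g by (force simp: continuous_map)
  fix V assume V: "openin Y V"
  have "openin (top_of_set ?C) {v \<in> ?C. g v \<in> V}" using openin_continuous_map_preimage[OF g V] by simp
  then obtain O' where O': "open O'" "{v \<in> ?C. g v \<in> V} = ?C \<inter> O'" unfolding openin_open by blast
  \<comment> \<open>The cone over this image is the union of all nonzero multiples of an open set,
    hence open.\<close>
  define W' where "W' = proj ` (O' - {0})"
  have "{v. v \<noteq> 0 \<and> proj v \<in> W'} = (\<Union>c\<in>- {0}. (\<lambda>v. c *s v) -` (O' - {0}))"
  proof (intro equalityI subsetI)
    fix v assume "v \<in> {v. v \<noteq> 0 \<and> proj v \<in> W'}"
    then obtain o' where o: "o' \<in> O'" "o' \<noteq> 0" "proj v = proj o'" by (auto simp: W'_def)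
    then obtain c where "c \<noteq> 0" "o' = c *s v" using proj_eqD by blast
    then show "v \<in> (\<Union>c\<in>- {0}. (\<lambda>v. c *s v) -` (O' - {0}))" using o by auto
  next
    fix v assume "v \<in> (\<Union>c\<in>- {0}. (\<lambda>v. c *s v) -` (O' - {0}))"
    then obtain c where c: "c \<noteq> 0" "c *s v \<in> O' - {0}" by auto
    then have "proj v \<in> W'" using proj_scale[OF c(1), of v] by (auto simp: W'_def)
    then show "v \<in> {v. v \<noteq> 0 \<and> proj v \<in> W'}" using c by auto
  qed
  moreover have "open ((\<lambda>v. c *s v) -` (O' - {0}))" for c :: complex
  proof (rule open_vimage)
    show "open (O' - {0})" using O'(1) by (simp add: open_delete)
    show "continuous_on UNIV (\<lambda>v :: complex ^ 'n. c *s v)" unfolding vector_scalar_mult_def by (intro continuous_intros)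
  qed
  ultimately have "openin proj_space W'" unfolding openin_proj_space by (auto simp: W'_def)
  moreover have "{x \<in> W. f x \<in> V} = W' \<inter> W"
  proof (intro equalityI subsetI)
    fix x assume x: "x \<in> {x \<in> W. f x \<in> V}"
    then obtain v where v: "v \<noteq> 0" "x = proj v" using W by auto
    then have "v \<in> {v \<in> ?C. g v \<in> V}" using x f by auto
    then have "v \<in> O'" using O'(2) by blast
    then show "x \<in> W' \<inter> W" using v x by (auto simp: W'_def)
  next
    fix x assume x: "x \<in> W' \<inter> W"
    then obtain v where v: "v \<noteq> 0" "x = proj v" "v \<in> O'" by (auto simp: W'_def)
    then have "v \<in> {v \<in> ?C. g v \<in> V}" using O'(2) x by auto
    then show "x \<in> {x \<in> W. f x \<in> V}" using f v x by auto
  qed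
  ultimately show "openin (subtopology proj_space W) {x \<in> topspace (subtopology proj_space W). f x \<in> V}"
    unfolding ts openin_subtopology by blast
qed

section \<open>The central projection of a curve with simple fibres\<close>

lemma continuous_on_eval3:
  assumes "continuous_on A g"
  shows "continuous_on A (\<lambda>w. eval3 F (g w))"
proof (induction F rule: poly3_induct)
  case (5 F G) then show ?case unfolding eval3_hom by (rule continuous_on_add)
next
  case (6 F G) then show ?case unfolding eval3_hom by (rule continuous_on_mult)
qed (simp_all add: eval3_gen assms continuous_on_component)

lemma proj_image: "(\<lambda>v. A *v v) ` proj v = proj (A *v v)"
  by (auto simp: proj_def image_image vector_scalar_commute)

lemma continuous_on_matrix_vector:
  fixes A :: "complex ^ 'n ^ 'm"
  shows "continuous_on U g \<Longrightarrow> continuous_on U (\<lambda>v. A *v g v)"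
  unfolding matrix_vector_mult_def by (intro continuous_intros)

text \<open>With w = \<open>A *v v\<close> and z = \<open>zz v\<close> the equation is a constant
  times \<open>lam w * P w z\<close>. Where \<open>lam\<close> does not vanish, the fibre is an
  affine line minus the roots of \<open>P w\<close>, which are simple and constant in number;
  \<open>root_isotopy\<close> identifies neighbouring fibres.\<close>

theorem modular_point_of_simple_fibres:
  fixes T S :: "complex ^ 3 ^ 3" and l :: poly2
  assumes TS: "T ** S = mat 1" "S ** T = mat 1" and G: "lsub T G = emb c * [:l:] * F" "c \<noteq> 0"
    and l: "Hom m [:l:]" "m > 0" and F: "Hom d F" "monz F"
    and simple: "\<And>a b z. eval2 l (a, b) \<noteq> 0 \<Longrightarrow> poly (lz a b F) z = 0 \<Longrightarrow> poly (pderiv (lz a b F)) z \<noteq> 0"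
  shows "modular_point G (T *v vector [0, 0, 1])"
proof -
  define A :: "complex ^ 3 ^ 2" where "A = (\<chi> i. S $ (if i = 1 then 1 else 2))"
  define zz where "zz v = (S *v v) $ 3" for v
  define lam where "lam w = eval2 l (w $ 1, w $ 2)" for w :: "complex ^ 2"
  define P where "P w z = eval3 F (vector [w $ 1, w $ 2, z])" for w :: "complex ^ 2" and z
  define Mk where "Mk w z = T *v vector [w $ 1, w $ 2, z]" for w :: "complex ^ 2" and z
  have A12: "(A *v v) $ 1 = (S *v v) $ 1" "(A *v v) $ 2 = (S *v v) $ 2" for v
    by (simp_all add: A_def matrix_vector_mult_def)
  have ST: "S *v (T *v v) = v" "T *v (S *v v) = v" for v by (simp_all add: matrix_vector_mul_assoc TS)
  have v3: "vector [x $ 1, x $ 2, x $ 3] = x" for x :: "complex ^ 3" by (simp add: vec_eq_iff forall_3 eval_nth)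
  have A_Mk: "A *v Mk w z = w" for w z unfolding Mk_def by (simp add: vec_eq_iff forall_2 A12 ST eval_nth)
  have z_Mk: "zz (Mk w z) = z" for w z unfolding Mk_def zz_def by (simp add: ST eval_nth)
  have Mk_A: "Mk (A *v v) (zz v) = v" for v unfolding Mk_def zz_def A12 v3 ST ..
  have Mk_scale: "Mk (k *s w) (k * z) = k *s Mk w z" for k w z
  proof -
    have "vector [(k *s w) $ 1, (k *s w) $ 2, k * z] = k *s (vector [w $ 1, w $ 2, z] :: complex ^ 3)"
      by (simp add: vec_eq_iff forall_3 eval_nth)
    then show ?thesis unfolding Mk_def by (simp add: vector_scalar_commute)
  qed
  have zz_scale: "zz (k *s v) = k * zz v" for k v by (simp add: zz_def vector_scalar_commute)
  have A_scale: "A *v (k *s v) = k *s (A *v v)" for k v by (simp add: vector_scalar_commute)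
  have lam_scale: "lam (t *s w) = t ^ m * lam w" for t w using l(1) unfolding Hom_const_iff lam_def by simp
  have lam0: "lam 0 = 0" using lam_scale[of 0 0] l(2) by (simp add: zero_power)
  have P_scale: "P (t *s w) (t * z) = t ^ d * P w z" for t w z
  proof -
    have "vector [(t *s w) $ 1, (t *s w) $ 2, t * z] = t *s (vector [w $ 1, w $ 2, z] :: complex ^ 3)"
      by (simp add: vec_eq_iff forall_3 eval_nth)
    then show ?thesis using F(1) unfolding Hom_iff_eval P_def by simp
  qed
  have EG: "eval3 G v = c * lam (A *v v) * P (A *v v) (zz v)" for v
  proof -
    have "eval3 G v = eval3 (lsub T G) (S *v v)" by (simp add: eval3_lsub ST)
    then show ?thesis unfolding G(1) eval3_hom eval3_gen eval3_const lam_def P_def A12 zz_def v3 .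
  qed
  have EG_Mk: "eval3 G (Mk w z) = c * lam w * P w z" for w z unfolding EG A_Mk z_Mk ..
  have EGs: "eval3 G (k *s v) \<noteq> 0 \<longleftrightarrow> eval3 G v \<noteq> 0" if "k \<noteq> 0" for k v
    using that unfolding EG A_scale zz_scale lam_scale P_scale by simp
  have G0: "v \<noteq> 0" if "eval3 G v \<noteq> 0" for v using that lam0 unfolding EG by auto
  have wne: "w \<noteq> 0" if "lam w \<noteq> 0" for w using that lam0 by auto
  have Mk0: "Mk w z \<noteq> 0" if "w \<noteq> 0" for w z using A_Mk[of w z] that by auto
  have Ane: "A *v v \<noteq> 0" if "eval3 G v \<noteq> 0" for v using that lam0 unfolding EG by auto
  have cA: "continuous_on V (\<lambda>v. A *v v)" for V by (intro continuous_on_matrix_vector continuous_on_id)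
  have czz: "continuous_on V zz" for V
    unfolding zz_def[abs_def] by (intro continuous_on_component continuous_on_matrix_vector continuous_on_id)
  have cMk: "continuous_on V (\<lambda>x. Mk (f x) (g x))" if "continuous_on V f" "continuous_on V g"
    for V f g and dummy :: "'x::topological_space"
  proof -
    have "Mk w z = (\<chi> i. T $ i $ 1 * w $ 1 + T $ i $ 2 * w $ 2 + T $ i $ 3 * z)" for w z
      by (simp add: Mk_def matrix_vector_mult_def sum_3 eval_nth)
    then show ?thesis by (simp only:) (intro continuous_intros that)
  qed
  have clam: "continuous_on UNIV lam"
  proof -
    have e: "lam = (\<lambda>w. eval3 [:l:] (\<chi> i. if i = 1 then w $ 1 else w $ 2))" by (simp add: fun_eq_iff lam_def eval3_const)
    have "continuous_on UNIV (\<lambda>w :: complex ^ 2. (\<chi> i. if i = 1 then w $ 1 else w $ 2) :: complex ^ 3)"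
    proof (rule continuous_on_vec_lambda)
      show "continuous_on UNIV (\<lambda>w :: complex ^ 2. if i = 1 then w $ 1 else w $ 2)" for i :: 3
        by (cases "i = 1") (auto intro!: continuous_intros)
    qed
    then show ?thesis unfolding e by (rule continuous_on_eval3)
  qed
  define X\<^sub>0 where "X\<^sub>0 = {proj v | v. v \<noteq> 0 \<and> eval3 G v \<noteq> 0}"
  define B\<^sub>0 where "B\<^sub>0 = {proj w | w. lam w \<noteq> 0}"
  let ?\<pi> = "image (\<lambda>v. A *v v)"
  have X0: "proj v \<in> X\<^sub>0 \<longleftrightarrow> eval3 G v \<noteq> 0" if "v \<noteq> 0" for v
  proof
    assume "proj v \<in> X\<^sub>0"
    then obtain v' where "proj v = proj v'" "v' \<noteq> 0" "eval3 G v' \<noteq> 0" by (auto simp: X\<^sub>0_def)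
    then obtain k where "k \<noteq> 0" "v' = k *s v" using proj_eqD by blast
    then show "eval3 G v \<noteq> 0" using EGs \<open>eval3 G v' \<noteq> 0\<close> by blast
  qed (use that in \<open>auto simp: X\<^sub>0_def\<close>)
  have B0: "proj w \<in> B\<^sub>0 \<longleftrightarrow> lam w \<noteq> 0" if "w \<noteq> 0" for w
  proof
    assume "proj w \<in> B\<^sub>0"
    then obtain w' where w': "proj w = proj w'" "lam w' \<noteq> 0" by (auto simp: B\<^sub>0_def)
    then obtain k where "k \<noteq> 0" "w' = k *s w" using proj_eqD wne by blast
    then show "lam w \<noteq> 0" using w'(2) lam_scale by auto
  qed (auto simp: B\<^sub>0_def)
  have X0s: "X\<^sub>0 \<subseteq> proj ` (- {0})" by (auto simp: X\<^sub>0_def)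
  have B0s: "B\<^sub>0 \<subseteq> proj ` (- {0})" using wne by (auto simp: B\<^sub>0_def)
  have CX: "curve_complement G = subtopology proj_space X\<^sub>0" by (simp add: curve_complement_def X\<^sub>0_def)
  have tX: "topspace (curve_complement G) = X\<^sub>0" unfolding CX using X0s by (auto simp: topspace_proj_space)
  have piX: "?\<pi> ` X\<^sub>0 = B\<^sub>0"
  proof (intro equalityI subsetI)
    fix b assume "b \<in> ?\<pi> ` X\<^sub>0"
    then obtain v where "eval3 G v \<noteq> 0" "b = proj (A *v v)" by (auto simp: X\<^sub>0_def proj_image)
    then show "b \<in> B\<^sub>0" unfolding EG B\<^sub>0_def by auto
  next
    fix b assume "b \<in> B\<^sub>0"
    then obtain w where w: "b = proj w" "lam w \<noteq> 0" by (auto simp: B\<^sub>0_def)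
    obtain z where "poly (lz (w $ 1) (w $ 2) F) z \<noteq> 0"
      using degree_lz(2)[OF F(2)] poly_all_0_iff_0 by blast
    then have "P w z \<noteq> 0" by (simp add: P_def poly_lz)
    then have e: "eval3 G (Mk w z) \<noteq> 0" using w(2) G(2) unfolding EG_Mk by simp
    have "?\<pi> (proj (Mk w z)) = b" unfolding proj_image A_Mk w(1) ..
    moreover have "proj (Mk w z) \<in> X\<^sub>0" using X0 G0[OF e] e by blast
    ultimately show "b \<in> ?\<pi> ` X\<^sub>0" by blast
  qed
  define Bt where "Bt = subtopology proj_space B\<^sub>0"
  have cpi: "continuous_map (curve_complement G) Bt ?\<pi>"
    unfolding CX Bt_def
  proof (rule continuous_map_from_proj[OF X0s, where g = "\<lambda>v. proj (A *v v)"])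
    show "continuous_map (top_of_set {v. v \<noteq> 0 \<and> proj v \<in> X\<^sub>0}) (subtopology proj_space B\<^sub>0) (\<lambda>v. proj (A *v v))"
    proof (rule continuous_map_into_proj)
      fix v assume "v \<in> topspace (top_of_set {v. v \<noteq> 0 \<and> proj v \<in> X\<^sub>0})"
      then have "eval3 G v \<noteq> 0" using X0 by auto
      then show "A *v v \<noteq> 0 \<and> proj (A *v v) \<in> B\<^sub>0" using Ane B0 EG by auto
    qed (simp add: cA)
  qed (rule proj_image)
  have triv: "\<exists>U h. openin Bt U \<and> b \<in> U \<and>
      homeomorphic_map (subtopology (curve_complement G) {x. ?\<pi> x \<in> U})
        (prod_topology (subtopology Bt U) (subtopology (curve_complement G) {x. ?\<pi> x = b})) h \<and>
      (\<forall>x\<in>topspace (curve_complement G). ?\<pi> x \<in> U \<longrightarrow> fst (h x) = ?\<pi> x)" if b: "b \<in> topspace Bt" for b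
  proof -
    have "b \<in> B\<^sub>0" using b by (simp add: Bt_def)
    then obtain w\<^sub>0 where w0: "b = proj w\<^sub>0" "lam w\<^sub>0 \<noteq> 0" by (auto simp: B\<^sub>0_def)
    obtain i\<^sub>0 where i0: "w\<^sub>0 $ i\<^sub>0 \<noteq> 0" using wne[OF w0(2)] by (auto simp: vec_eq_iff)
    \<comment> \<open>Scaling the coordinate \<open>i\<^sub>0\<close> to that of
      \<open>w\<^sub>0\<close> gives each nearby point of the base one representative and each point
      over it one value of z. This is needed because the isotopy is not homogeneous.\<close>
    define el where "el w = w $ i\<^sub>0 / w\<^sub>0 $ i\<^sub>0" for w :: "complex ^ 2"
    define nn where "nn w = (1 / el w) *s w" for w
    have el: "el (k *s w) = k * el w" "el w\<^sub>0 = 1" for k w using i0 by (simp_all add: el_def)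
    have cel: "continuous_on V el" for V unfolding el_def[abs_def] using i0 by (intro continuous_intros) auto
    have nn_scale: "nn (k *s w) = nn w" if "k \<noteq> 0" for k w using that by (simp add: nn_def el vector_smult_assoc)
    have el_nn: "el (nn w) = 1" if "el w \<noteq> 0" for w using that by (simp add: nn_def el)
    have nn_1: "nn w = w" if "el w = 1" for w using that by (simp add: nn_def)
    have pnn: "proj (nn w) = proj w" if "el w \<noteq> 0" for w using that unfolding nn_def by (intro proj_scale) simp
    have cnn: "continuous_on {w. el w \<noteq> 0} nn"
      unfolding nn_def[abs_def] vector_scalar_mult_def by (intro continuous_intros cel) auto
    define W where "W = {w. lam w \<noteq> 0}"
    have W: "open W" using continuous_open_preimage[OF clam open_UNIV, of "- {0}"] by (simp add: W_def vimage_def open_delete Compl_eq_Diff_UNIV)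
    obtain lc where lc: "lc \<noteq> 0" "lead_coeff F = [:[:lc:]:]" using F(2) by (auto simp: monz_def)
    define f where "f w = lz (w $ 1) (w $ 2) F" for w :: "complex ^ 2"
    have f: "degree (f w) = degree F \<and> lead_coeff (f w) = lc" for w
      unfolding f_def degree_lz(1)[OF F(2)] coeff_lz lc(2) eval2_const by simp
    have Pf: "poly (f w) z = P w z" for w z by (simp add: f_def P_def poly_lz)
    have PMk: "P w z = eval3 (lsub S F) (Mk w z)" for w z by (simp add: Mk_def P_def eval3_lsub ST)
    have cf: "continuous_on W (\<lambda>w. poly (f w) z)" for z
      unfolding Pf PMk by (intro continuous_on_eval3 cMk continuous_intros)
    have sf: "poly (pderiv (f w\<^sub>0)) a \<noteq> 0" if "poly (f w\<^sub>0) a = 0" for a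
      using simple w0(2) that unfolding lam_def f_def by blast
    obtain N \<Theta> \<Xi> where N: "open N" "w\<^sub>0 \<in> N" "N \<subseteq> W" and cT: "continuous_on (N \<times> UNIV) \<Theta>" and cX: "continuous_on (N \<times> UNIV) \<Xi>"
      and XT: "\<forall>w\<in>N. \<forall>z. \<Xi> (w, \<Theta> (w, z)) = z \<and> \<Theta> (w, \<Xi> (w, z)) = z \<and> (poly (f w) (\<Theta> (w, z)) = 0 \<longleftrightarrow> poly (f w\<^sub>0) z = 0)"
      using root_isotopy[OF W _ lc(1) f cf sf] w0(2) unfolding W_def by blast
    have XT1: "\<Xi> (w, \<Theta> (w, z)) = z" "\<Theta> (w, \<Xi> (w, z)) = z" "P w (\<Theta> (w, z)) = 0 \<longleftrightarrow> P w\<^sub>0 z = 0" if "w \<in> N" for w z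
      using XT that unfolding Pf by blast+
    define U where "U = {proj w | w. el w \<noteq> 0 \<and> nn w \<in> N}"
    have e0: "w \<noteq> 0" if "el w \<noteq> 0" for w using that by (auto simp: el_def)
    have U: "proj w \<in> U \<longleftrightarrow> el w \<noteq> 0 \<and> nn w \<in> N" if "w \<noteq> 0" for w
    proof
      assume "proj w \<in> U"
      then obtain w' where w': "proj w = proj w'" "el w' \<noteq> 0" "nn w' \<in> N" by (auto simp: U_def)
      then obtain k where k: "k \<noteq> 0" "w' = k *s w" using proj_eqD e0 by blast
      then show "el w \<noteq> 0 \<and> nn w \<in> N" using w'(2,3) el nn_scale by auto
    qed (auto simp: U_def)
    have lamN: "lam w \<noteq> 0" if "el w \<noteq> 0" "nn w \<in> N" for w
    proof -
      have "lam (nn w) \<noteq> 0" using N(3) that(2) by (auto simp: W_def)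
      then show ?thesis unfolding nn_def lam_scale by auto
    qed
    have UB: "U \<subseteq> B\<^sub>0" using lamN by (auto simp: U_def B\<^sub>0_def)
    have bU: "b \<in> U" unfolding w0(1) using U[OF wne[OF w0(2)]] nn_1[OF el(2)] N(2) el(2) by simp
    have oU: "openin Bt U"
    proof -
      have "open {w. el w \<noteq> 0}" using continuous_open_preimage[OF cel open_UNIV, of "- {0}"] by (simp add: vimage_def open_delete Compl_eq_Diff_UNIV)
      then have "open ({w. el w \<noteq> 0} \<inter> nn -` N)" by (intro continuous_open_preimage cnn N(1))
      moreover have "{w. w \<noteq> 0 \<and> proj w \<in> U} = {w. el w \<noteq> 0} \<inter> nn -` N" using U e0 by auto
      ultimately have "openin proj_space U" unfolding openin_proj_space using UB B0s by auto
      then show ?thesis unfolding Bt_def openin_subtopology using UB by blast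
    qed
    define nU where "nU x = (THE n. el n = 1 \<and> proj n = x)" for x
    have unique: "n = n'" if a: "el n = 1" "el n' = 1" "proj n = proj n'" for n n'
    proof -
      have "n' \<noteq> 0" using e0 a(2) by simp
      then obtain k where "n' = k *s n" using proj_eqD[OF a(3)] by blast
      then show ?thesis using el(1)[of k n] a(1,2) by simp
    qed
    have nU: "nU (proj w) = nn w" if "el w \<noteq> 0" for w
      unfolding nU_def using el_nn[OF that] pnn[OF that] unique by (intro the_equality) auto
    have nU_N: "nU x \<in> N" "el (nU x) = 1" "proj (nU x) = x" if x: "x \<in> U" for x
    proof -
      obtain w where w: "x = proj w" "el w \<noteq> 0" "nn w \<in> N" using x by (auto simp: U_def)
      then show "nU x \<in> N" "el (nU x) = 1" "proj (nU x) = x" using nU el_nn pnn by auto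
    qed
    have SU: "subtopology Bt U = subtopology proj_space U" unfolding Bt_def subtopology_subtopology using UB by (simp add: Int_absorb1)
    have cnU: "continuous_map (subtopology Bt U) (top_of_set N) nU"
      unfolding SU
    proof (rule continuous_map_from_proj[where g = nn])
      show "U \<subseteq> proj ` (- {0})" using UB B0s by blast
      have "continuous_on {w. w \<noteq> 0 \<and> proj w \<in> U} nn" by (rule continuous_on_subset[OF cnn]) (use U in auto)
      then show "continuous_map (top_of_set {v. v \<noteq> 0 \<and> proj v \<in> U}) (top_of_set N) nn"
        using U by (auto intro!: continuous_map_into_subtopology)
    qed (use U nU in auto)
    define XU where "XU = {x \<in> X\<^sub>0. ?\<pi> x \<in> U}"
    define Xb where "Xb = {x \<in> X\<^sub>0. ?\<pi> x = b}"
    define tt where "tt v = zz v / el (A *v v)" for v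
    define tU where "tU y = (THE t. proj (Mk (nU (?\<pi> y)) t) = y)" for y
    have Mk_inj: "t = t'" if a: "el n \<noteq> 0" "proj (Mk n t) = proj (Mk n t')" for n t t'
    proof -
      have "Mk n t' \<noteq> 0" by (rule Mk0[OF e0[OF a(1)]])
      then obtain k where k: "Mk n t' = k *s Mk n t" using proj_eqD[OF a(2)] by blast
      have "A *v Mk n t' = k *s (A *v Mk n t)" "zz (Mk n t') = k * zz (Mk n t)" unfolding k A_scale zz_scale by simp_all
      then have "n = k *s n" "t' = k * t" unfolding A_Mk z_Mk by auto
      moreover from this have "k = 1" using el(1)[of k n] a(1) by auto
      ultimately show ?thesis by simp
    qed
    have Mk_tt: "Mk (nn (A *v v)) (tt v) = (1 / el (A *v v)) *s v" for v
      using Mk_scale[of "1 / el (A *v v)" "A *v v" "zz v"] by (simp add: nn_def tt_def Mk_A)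
    have tU: "tU (proj v) = tt v" if "el (A *v v) \<noteq> 0" for v
      unfolding tU_def proj_image nU[OF that]
    proof (rule the_equality)
      show e: "proj (Mk (nn (A *v v)) (tt v)) = proj v" unfolding Mk_tt using that by (intro proj_scale) simp
      fix t assume "proj (Mk (nn (A *v v)) t) = proj v"
      then show "t = tt v" using Mk_inj[of "nn (A *v v)" t "tt v"] el_nn[OF that] e by simp
    qed
    have XUv: "eval3 G v \<noteq> 0 \<and> el (A *v v) \<noteq> 0 \<and> nn (A *v v) \<in> N" if "v \<noteq> 0" "proj v \<in> XU" for v
    proof -
      have "eval3 G v \<noteq> 0" "proj (A *v v) \<in> U" using that X0 by (auto simp: XU_def proj_image)
      then show ?thesis using U Ane by blast
    qed
    have XUs: "XU \<subseteq> proj ` (- {0})" using X0s by (auto simp: XU_def)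
    have tU_XU: "proj (Mk (nU (?\<pi> y)) (tU y)) = y" "P (nU (?\<pi> y)) (tU y) \<noteq> 0" if y: "y \<in> XU" for y
    proof -
      obtain v where v: "y = proj v" "v \<noteq> 0" using XUs y by auto
      have vv: "eval3 G v \<noteq> 0" "el (A *v v) \<noteq> 0" "nn (A *v v) \<in> N" using XUv[OF v(2)] y v(1) by auto
      have e: "Mk (nU (?\<pi> y)) (tU y) = (1 / el (A *v v)) *s v" unfolding v(1) proj_image nU[OF vv(2)] tU[OF vv(2)] by (rule Mk_tt)
      then show "proj (Mk (nU (?\<pi> y)) (tU y)) = y" unfolding v(1) using vv(2) by (simp add: proj_scale)
      have "eval3 G (Mk (nU (?\<pi> y)) (tU y)) \<noteq> 0" unfolding e using EGs vv by simp
      then show "P (nU (?\<pi> y)) (tU y) \<noteq> 0" unfolding EG_Mk by simp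
    qed
    have ctU: "continuous_map (subtopology proj_space XU) euclidean tU"
    proof (rule continuous_map_from_proj[where g = tt])
      show "continuous_map (top_of_set {v. v \<noteq> 0 \<and> proj v \<in> XU}) euclidean tt"
        unfolding tt_def[abs_def] continuous_map_iff_continuous
        by (intro continuous_intros czz continuous_on_compose2[OF cel cA]) (use XUv in auto)
    qed (use XUs XUv tU in auto)
    have mkX: "proj (Mk n t) \<in> XU \<and> ?\<pi> (proj (Mk n t)) = proj n \<and> nU (proj n) = n \<and> tU (proj (Mk n t)) = t"
      if "n \<in> N" "el n = 1" "P n t \<noteq> 0" for n t
    proof -
      have n: "el n \<noteq> 0" "nn n = n" using that(2) nn_1 by auto
      have "lam n \<noteq> 0" using lamN n that(1) by simp
      then have "eval3 G (Mk n t) \<noteq> 0" unfolding EG_Mk using G(2) that(3) by simp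
      then have "proj (Mk n t) \<in> X\<^sub>0" using X0 G0 by blast
      moreover have "proj n \<in> U" using U[OF e0[OF n(1)]] n that(1) by simp
      moreover have "tU (proj (Mk n t)) = t" using tU[of "Mk n t"] n(1) that(2) unfolding A_Mk by (simp add: tt_def A_Mk z_Mk)
      ultimately show ?thesis using nU[OF n(1)] n(2) by (simp add: XU_def proj_image A_Mk)
    qed
    have XbU: "Xb \<subseteq> XU" using bU by (auto simp: Xb_def XU_def)
    have nUb: "nU b = w\<^sub>0" unfolding w0(1) using nU[of w\<^sub>0] el(2) nn_1 by simp
    \<comment> \<open>The second component carries the z-coordinate back along the isotopy to the
      fibre over \<open>b\<close>; the map \<open>h'\<close> carries it forward.\<close>
    define h where "h y = (?\<pi> y, proj (Mk w\<^sub>0 (\<Xi> (nU (?\<pi> y), tU y))))" for y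
    define h' where "h' z = proj (Mk (nU (fst z)) (\<Theta> (nU (fst z), tU (snd z))))" for z
    have hX: "proj (Mk w\<^sub>0 (\<Xi> (nU (?\<pi> y), tU y))) \<in> Xb" if y: "y \<in> XU" for y
    proof -
      have yU: "?\<pi> y \<in> U" using y by (simp add: XU_def)
      have "P w\<^sub>0 (\<Xi> (nU (?\<pi> y), tU y)) \<noteq> 0" using XT1[OF nU_N(1)[OF yU]] tU_XU(2)[OF y] by metis
      then show ?thesis using mkX[OF N(2) el(2)] w0(1) by (simp add: Xb_def XU_def)
    qed
    have hX': "h' (x, y) \<in> XU \<and> ?\<pi> (h' (x, y)) = x \<and> tU (h' (x, y)) = \<Theta> (nU x, tU y)" if x: "x \<in> U" and y: "y \<in> Xb" for x y
    proof -
      have y': "y \<in> XU" "?\<pi> y = b" using y XbU by (auto simp: Xb_def)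
      have "P w\<^sub>0 (tU y) \<noteq> 0" using tU_XU(2)[OF y'(1)] unfolding y'(2) nUb .
      then have "P (nU x) (\<Theta> (nU x, tU y)) \<noteq> 0" using XT1(3)[OF nU_N(1)[OF x]] by simp
      then show ?thesis using mkX[OF nU_N(1,2)[OF x]] nU_N(3)[OF x] by (simp add: h'_def)
    qed
    have top_XU: "topspace (subtopology proj_space XU) = XU" using XUs by (auto simp: topspace_proj_space)
    have top_Xb: "topspace (subtopology proj_space Xb) = Xb" using XUs XbU by (auto simp: topspace_proj_space)
    have top_U: "topspace (subtopology Bt U) = U" using UB B0s by (auto simp: SU topspace_proj_space)
    have XUX0: "XU \<subseteq> X\<^sub>0" unfolding XU_def by blast
    have cpU: "continuous_map (subtopology proj_space XU) (subtopology Bt U) ?\<pi>"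
    proof -
      have "subtopology proj_space XU = subtopology (curve_complement G) XU"
        unfolding CX subtopology_subtopology Int_absorb1[OF XUX0] ..
      then have c: "continuous_map (subtopology proj_space XU) Bt ?\<pi>" using continuous_map_from_subtopology[OF cpi, of XU] by simp
      show ?thesis
      proof (rule continuous_map_into_subtopology[OF c])
        show "?\<pi> \<in> topspace (subtopology proj_space XU) \<rightarrow> U" unfolding top_XU by (rule funcsetI) (simp add: XU_def)
      qed
    qed
    have cNT: "continuous_map (prod_topology (top_of_set N) (euclidean :: complex topology)) euclidean H"
      if "continuous_on (N \<times> UNIV) H" for H :: "(complex ^ 2) \<times> complex \<Rightarrow> 'b::topological_space"
      using that by (simp add: prod_topology_subtopology(1) flip: euclidean_product_topology)
    have chom: "homeomorphic_maps (subtopology proj_space XU) (prod_topology (subtopology Bt U) (subtopology proj_space Xb)) h h'"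
      unfolding homeomorphic_maps_def
    proof (intro conjI ballI)
      have "continuous_map (subtopology proj_space XU) (prod_topology (top_of_set N) euclidean) (\<lambda>y. (nU (?\<pi> y), tU y))"
        using continuous_map_compose[OF cpU cnU] ctU by (simp add: continuous_map_paired o_def)
      from continuous_map_compose[OF this cNT[of "\<lambda>x. Mk w\<^sub>0 (\<Xi> x)"]]
      have "continuous_map (subtopology proj_space XU) euclidean (\<lambda>y. Mk w\<^sub>0 (\<Xi> (nU (?\<pi> y), tU y)))"
        using cMk[OF continuous_on_const cX] by (simp add: o_def)
      then have "continuous_map (subtopology proj_space XU) (subtopology proj_space Xb) (\<lambda>y. proj (Mk w\<^sub>0 (\<Xi> (nU (?\<pi> y), tU y))))"
        by (rule continuous_map_into_proj) (use hX Mk0 wne w0(2) top_XU in auto)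
      then show "continuous_map (subtopology proj_space XU) (prod_topology (subtopology Bt U) (subtopology proj_space Xb)) h"
        unfolding h_def[abs_def] using cpU by (simp add: continuous_map_paired)
    next
      let ?Z = "prod_topology (subtopology Bt U) (subtopology proj_space Xb)"
      have cb: "continuous_map (subtopology proj_space Xb) euclidean tU"
        using continuous_map_from_subtopology_mono[OF ctU XbU] .
      have "continuous_map ?Z (top_of_set N) (\<lambda>z. nU (fst z))"
        using continuous_map_compose[OF continuous_map_fst cnU] by (simp only: o_def)
      moreover have "continuous_map ?Z euclidean (\<lambda>z. tU (snd z))"
        using continuous_map_compose[OF continuous_map_snd cb] by (simp only: o_def)
      ultimately have "continuous_map ?Z (prod_topology (top_of_set N) euclidean) (\<lambda>z. (nU (fst z), tU (snd z)))"
        unfolding continuous_map_paired ..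
      from continuous_map_compose[OF this cNT[of "\<lambda>x. Mk (fst x) (\<Theta> x)"]]
      have "continuous_map ?Z euclidean (\<lambda>z. Mk (nU (fst z)) (\<Theta> (nU (fst z), tU (snd z))))"
        using cMk[OF continuous_on_fst[OF continuous_on_id] cT] by (simp add: o_def)
      then show "continuous_map ?Z (subtopology proj_space XU) h'"
        unfolding h'_def[abs_def]
      proof (rule continuous_map_into_proj)
        fix z assume "z \<in> topspace ?Z"
        then have z: "fst z \<in> U" "snd z \<in> Xb" by (auto simp: top_U top_Xb)
        have "el (nU (fst z)) \<noteq> 0" using nU_N(2)[OF z(1)] by simp
        then show "Mk (nU (fst z)) (\<Theta> (nU (fst z), tU (snd z))) \<noteq> 0 \<and> proj (Mk (nU (fst z)) (\<Theta> (nU (fst z), tU (snd z)))) \<in> XU"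
          using hX'[OF z] Mk0 e0 by (simp add: h'_def)
      qed
    next
      fix y assume "y \<in> topspace (subtopology proj_space XU)"
      then have y: "y \<in> XU" by (simp add: top_XU)
      then have yU: "?\<pi> y \<in> U" by (simp add: XU_def)
      have "P w\<^sub>0 (\<Xi> (nU (?\<pi> y), tU y)) \<noteq> 0" using XT1[OF nU_N(1)[OF yU]] tU_XU(2)[OF y] by metis
      then have "tU (proj (Mk w\<^sub>0 (\<Xi> (nU (?\<pi> y), tU y)))) = \<Xi> (nU (?\<pi> y), tU y)" using mkX[OF N(2) el(2)] by simp
      then show "h' (h y) = y" unfolding h_def h'_def by (simp add: XT1(2)[OF nU_N(1)[OF yU]] tU_XU(1)[OF y])
    next
      fix z assume "z \<in> topspace (prod_topology (subtopology Bt U) (subtopology proj_space Xb))"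
      then obtain x y where z: "z = (x, y)" "x \<in> U" "y \<in> Xb" by (auto simp: top_U top_Xb)
      note hh = hX'[OF z(2,3)]
      have y': "y \<in> XU" "?\<pi> y = b" using z(3) XbU by (auto simp: Xb_def)
      have "proj (Mk w\<^sub>0 (tU y)) = y" using tU_XU(1)[OF y'(1)] unfolding y'(2) nUb .
      then show "h (h' z) = z" unfolding h_def z(1) using hh XT1(1)[OF nU_N(1)[OF z(2)]] by simp
    qed
    have "X\<^sub>0 \<inter> {x. ?\<pi> x \<in> U} = XU" "X\<^sub>0 \<inter> {x. ?\<pi> x = b} = Xb" by (auto simp: XU_def Xb_def)
    then have "homeomorphic_map (subtopology (curve_complement G) {x. ?\<pi> x \<in> U})
        (prod_topology (subtopology Bt U) (subtopology (curve_complement G) {x. ?\<pi> x = b})) h"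
      unfolding CX subtopology_subtopology using homeomorphic_maps_imp_map[OF chom] by simp
    then show ?thesis using oU bU by (intro exI[of _ U] exI[of _ h]) (simp add: h_def)
  qed
  have ker: "{v. A *v v = 0} = proj (T *v vector [0, 0, 1])"
  proof -
    have e: "Mk 0 z = z *s (T *v vector [0, 0, 1])" for z
      using Mk_scale[of z 0 1] by (simp add: Mk_def)
    show ?thesis unfolding proj_def
    proof (intro equalityI subsetI)
      fix v assume "v \<in> {v. A *v v = 0}"
      then show "v \<in> range (\<lambda>z. z *s (T *v vector [0, 0, 1]))" using Mk_A[of v] e[of "zz v"] by (intro range_eqI[of _ _ "zz v"]) simp
    next
      fix v assume "v \<in> range (\<lambda>z. z *s (T *v vector [0, 0, 1]))"
      then obtain z where "v = Mk 0 z" unfolding e by blast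
      then show "v \<in> {v. A *v v = 0}" using A_Mk by simp
    qed
  qed
  have T1: "T *v vector [0, 0, 1] = Mk 0 1" by (simp add: Mk_def)
  have p0: "T *v vector [0, 0, 1] \<noteq> 0" using z_Mk[of 0 1] zz_scale[of 0 0] unfolding T1 by auto
  have "eval3 G (T *v vector [0, 0, 1]) = 0" unfolding T1 EG_Mk lam0 by simp
  moreover have "locally_trivial_fibration (curve_complement G) (subtopology proj_space (?\<pi> ` topspace (curve_complement G))) ?\<pi>"
    unfolding tX piX locally_trivial_fibration_def Bt_def[symmetric] by (intro conjI ballI cpi triv[unfolded tX])
  ultimately show ?thesis unfolding modular_point_def Let_def by (intro conjI exI[of _ A] p0 ker)
qed

section \<open>Singularities of multiplicity two\<close>

lemma der_dd: "der (dd a)"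
  unfolding der_def dd_explicit by (simp add: dx3_der dy3_der dz3_der algebra_simps)

lemmas dd_der = derD[OF der_dd]

lemma dd_gen [simp]: "dd a (emb c) = 0" "dd a PX = emb (a $ 1)" "dd a PY = emb (a $ 2)" "dd a PZ = emb (a $ 3)"
  by (simp_all add: dd_explicit)

lemma dd_commute: "dd a (dd b F) = dd b (dd a F)"
proof (induction F rule: poly3_induct)
  case (5 F G) then show ?case by (simp add: dd_der)
next
  case (6 F G)
  have "dd a (dd b (F * G)) = F * dd a (dd b G) + dd a F * dd b G + (dd b F * dd a G + dd a (dd b F) * G)"
    by (simp only: dd_der)
  moreover have "dd b (dd a (F * G)) = F * dd b (dd a G) + dd b F * dd a G + (dd a F * dd b G + dd b (dd a F) * G)"
    by (simp only: dd_der)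
  ultimately show ?case using 6 by (simp only: ac_simps)
qed (simp_all add: dd_der)

lemma coeff2_at_origin:
  "coeff2 h 0 0 = eval2 h (0, 0)" "coeff2 h 1 0 = eval2 (dx2 h) (0, 0)" "coeff2 h 0 1 = eval2 (dy2 h) (0, 0)"
  "2 * coeff2 h 2 0 = eval2 (dx2 (dx2 h)) (0, 0)" "coeff2 h 1 1 = eval2 (dx2 (dy2 h)) (0, 0)" "2 * coeff2 h 0 2 = eval2 (dy2 (dy2 h)) (0, 0)"
proof -
  have e: "eval2 h (0, 0) = coeff2 h 0 0" for h by (simp add: eval2_def coeff2_def poly_0_coeff_0)
  have x: "coeff2 (dx2 h) i j = of_nat (Suc i) * coeff2 h (Suc i) j" for h i j
    by (simp add: coeff2_def dx2_def coeff_map_poly coeff_pderiv)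
  have y: "coeff2 (dy2 h) i j = of_nat (Suc j) * coeff2 h i (Suc j)" for h i j
  proof -
    have "coeff (of_nat n * q) i = of_nat n * coeff q i" for n and q :: "complex poly" by (induction n) (simp_all add: algebra_simps)
    then show ?thesis by (simp only: coeff2_def dy2_def coeff_pderiv)
  qed
  show "coeff2 h 0 0 = eval2 h (0, 0)" "coeff2 h 1 0 = eval2 (dx2 h) (0, 0)" "coeff2 h 0 1 = eval2 (dy2 h) (0, 0)"
    "2 * coeff2 h 2 0 = eval2 (dx2 (dx2 h)) (0, 0)" "coeff2 h 1 1 = eval2 (dx2 (dy2 h)) (0, 0)" "2 * coeff2 h 0 2 = eval2 (dy2 (dy2 h)) (0, 0)"
    unfolding e x y by (simp_all add: numeral_2_eq_2)
qed

context frame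
begin

lemma eval3_dd_spans: "\<exists>a b c. \<forall>K. eval3 (dd v K) s = a * eval3 (dd s K) s + b * eval3 (dd u K) s + c * eval3 (dd p K) s"
proof -
  obtain a b c where v: "v = a *s s + b *s u + c *s p" using spans by blast
  show ?thesis unfolding v by (intro exI[of _ a] exI[of _ b] exI[of _ c]) (simp add: dd_add dd_scale eval3_hom eval3_gen)
qed

text \<open>Ensures that the least degree in \<open>multiplicity_at\<close> is attained.\<close>

lemma local_equation_nonzero:
  assumes "Hom d F" "fps_nth (ser F) 0 \<noteq> 0"
  shows "local_equation F s \<noteq> 0"
proof
  assume "local_equation F s = 0"
  then have "pull F x = 0" if "x \<in> bid r" for x using pull_local_equation[OF assms(1) that] by (simp add: eval2_arith)
  moreover have "\<forall>\<^sub>F x in nhds (0, 0). x \<in> bid r" using r0 by (intro eventually_nhds_in_open open_bid) simp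
  ultimately have "\<forall>\<^sub>F x in nhds (0, 0). pull F x = 0" by (auto elim: eventually_mono)
  then have "tay (pull F) = tay (\<lambda>x. 0)" by (rule tay_cong)
  then show False using assms(2) by (simp add: tay_pull tay_gen kap_def)
qed

text \<open>Second derivatives along u and p vanish by the hypothesis on the 2-jet, those involving
  s by Euler's identity. Since s, u, p span, all second derivatives vanish, and the local equation
  in the chart of the definition has no term of degree two.\<close>

lemma multiplicity_not_two:
  assumes F: "Hom d F" "fps_nth (ser F) 0 \<noteq> 0" and z: "\<And>v. eval3 (dd v F) s = 0"
    and c: "cf (ser F) 2 0 = 0" "cf (ser F) 1 1 = 0" "cf (ser F) 0 2 = 0" and F0: "eval3 F s = 0"
  shows "multiplicity_at F s \<noteq> 2"
proof
  assume m: "multiplicity_at F s = 2"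
  have sv: "eval3 (dd s (dd v F)) s = 0" for v using euler_dd[OF Hom_dd[OF F(1)], of s v] z by simp
  have uu: "eval3 (dd u (dd u F)) s = 0" "eval3 (dd p (dd p F)) s = 0" "eval3 (dd p (dd u F)) s = 0" "eval3 (dd u (dd p F)) s = 0"
    using cf_ser_jet(3-6)[of F] c by simp_all
  have uv: "eval3 (dd u (dd v F)) s = 0" for v
  proof -
    obtain a b c where "\<forall>K. eval3 (dd v K) s = a * eval3 (dd s K) s + b * eval3 (dd u K) s + c * eval3 (dd p K) s" using eval3_dd_spans by blast
    then show ?thesis by (subst dd_commute) (simp add: sv uu)
  qed
  have pv: "eval3 (dd p (dd v F)) s = 0" for v
  proof -
    obtain a b c where "\<forall>K. eval3 (dd v K) s = a * eval3 (dd s K) s + b * eval3 (dd u K) s + c * eval3 (dd p K) s" using eval3_dd_spans by blast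
    then show ?thesis by (subst dd_commute) (simp add: sv uu)
  qed
  have vw: "eval3 (dd v (dd w F)) s = 0" for v w
  proof -
    obtain a b c where "\<forall>K. eval3 (dd v K) s = a * eval3 (dd s K) s + b * eval3 (dd u K) s + c * eval3 (dd p K) s" using eval3_dd_spans by blast
    then show ?thesis by (simp add: sv uv pv)
  qed
  define h where "h = local_equation F s"
  have ev: "eval2 (local_equation K s) (0, 0) = eval3 K s" for K by (simp add: eval2_local_equation chart_def)
  have "coeff2 h 0 0 = 0" "coeff2 h 1 0 = 0" "coeff2 h 0 1 = 0" "coeff2 h 2 0 = 0" "coeff2 h 1 1 = 0" "coeff2 h 0 2 = 0"
    using coeff2_at_origin[of h] unfolding h_def local_equation_partial ev z vw F0 by simp_all
  then have low: "coeff2 h i j = 0" if "i + j = 2" for i j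
  proof -
    have "i = 0 \<and> j = 2 \<or> i = 1 \<and> j = 1 \<or> i = 2 \<and> j = 0" using that by auto
    then show ?thesis using \<open>coeff2 h 2 0 = 0\<close> \<open>coeff2 h 1 1 = 0\<close> \<open>coeff2 h 0 2 = 0\<close> by blast
  qed
  have "h \<noteq> 0" unfolding h_def by (rule local_equation_nonzero[OF F])
  then obtain j where "coeff h j \<noteq> 0" by (auto simp: poly_eq_iff)
  then obtain i where "coeff (coeff h j) i \<noteq> 0" by (auto simp: poly_eq_iff)
  then have "\<exists>m i j. i + j = m \<and> coeff2 h i j \<noteq> 0" by (auto simp: coeff2_def)
  then have "\<exists>i j. i + j = multiplicity_at F s \<and> coeff2 h i j \<noteq> 0"
    unfolding multiplicity_at_def h_def by (rule LeastI_ex)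
  then show False using low unfolding m by blast
qed

text \<open>At a smooth point the derivative along u is nonzero, since those along s and p vanish.
  At a singular point the multiplicity gives a nonzero 2-jet, and the only kind of jet left over by
  \<open>local_condition_formal\<close> is ruled out by
  \<open>vertical_tangent_branch\<close>.\<close>

theorem local_condition_multiplicity_two:
  assumes F: "Hom d F" "eval3 F s = 0" "eval3 (dd p F) s = 0" "fps_nth (ser F) 0 \<noteq> 0"
    and D: "Hom n [:\<Delta>:]" "\<Delta> \<noteq> 0" "[:\<Delta>:] \<in> ideal2 (lsub T F) (dz3 (lsub T F))"
    and m: "singular_point F s \<Longrightarrow> multiplicity_at F s = 2"
    and t: "singular_point F s \<Longrightarrow> milnor_number F s \<ge> 3 \<Longrightarrow> p \<notin> tangent_cone F s"
  shows "VY * fps_deriv (ser F) \<in> ideal2 (ser F) (dzs (ser F))"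
proof -
  have c: "cf (ser F) 0 0 = 0" "cf (ser F) 0 1 = 0" using F(2,3) cf_ser cf_ser_jet(2) by simp_all
  note formal = local_condition_formal[OF c F(4)]
  show ?thesis
  proof (cases "cf (ser F) 1 0 = 0")
    case False then show ?thesis using formal by blast
  next
    case True
    have du: "eval3 (dd u F) s = 0" using True cf_ser_jet(1) by simp
    have ds: "eval3 (dd s F) s = 0" using euler_dd[OF F(1), of s] F(2) by simp
    have z: "eval3 (dd v F) s = 0" for v
    proof -
      obtain a b c where "\<forall>K. eval3 (dd v K) s = a * eval3 (dd s K) s + b * eval3 (dd u K) s + c * eval3 (dd p K) s" using eval3_dd_spans by blast
      then show ?thesis by (simp add: du ds F(3))
    qed
    have s0: "s \<noteq> 0"
    proof
      assume "s = 0"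
      then have "S *v s = 0" by simp
      then have "vector [q\<^sub>1, q\<^sub>2, q\<^sub>3] = (0 :: complex ^ 3)" unfolding s by (simp add: matrix_vector_mul_assoc TS)
      then have "q\<^sub>1 = 0" "q\<^sub>2 = 0" by (simp_all add: vec_eq_iff forall_3 eval_nth)
      then show False using e by simp
    qed
    have sing: "singular_point F s"
      unfolding singular_point_def using s0 F(2) z[of "vector [1, 0, 0]"] z[of "vector [0, 1, 0]"] z[of "vector [0, 0, 1]"]
      by (simp add: eval3_dd eval_nth)
    show ?thesis
    proof (cases "cf (ser F) 0 2 \<noteq> 0 \<or> cf (ser F) 1 1 \<noteq> 0 \<or> (cf (ser F) 2 0 \<noteq> 0 \<and> cf (ser F) 0 3 \<noteq> 0)")
      case True then show ?thesis using formal by blast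
    next
      case False
      have "cf (ser F) 2 0 \<noteq> 0"
        using multiplicity_not_two[OF F(1,4) z _ _ _ F(2)] m[OF sing] False by blast
      then have "milnor_number F s \<ge> 3" "p \<in> tangent_cone F s"
        using vertical_tangent_branch[OF F(1) c _ _ \<open>cf (ser F) 1 0 = 0\<close> _ _ F(4) D] False by blast+
      then show ?thesis using t[OF sing] by blast
    qed
  qed
qed

end

section \<open>Lines through the projection centre\<close>

text \<open>The last column of \<open>T\<close> is p, the others are the two unit vectors away from
  a nonzero coordinate of p.\<close>

lemma frame_matrix:
  fixes p :: "complex ^ 3"
  assumes "p \<noteq> 0"
  shows "\<exists>T S :: complex ^ 3 ^ 3. T ** S = mat 1 \<and> S ** T = mat 1 \<and> T *v vector [0, 0, 1] = p"
proof -
  have *: "\<exists>T S :: complex ^ 3 ^ 3. T ** S = mat 1 \<and> S ** T = mat 1 \<and> T *v vector [0, 0, 1] = p"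
    if "T ** S = mat 1" "S ** T = mat 1" "T *v vector [0, 0, 1] = p" for T S :: "complex ^ 3 ^ 3" using that by blast
  note rules = vec_eq_iff forall_3 matrix_matrix_mult_def matrix_vector_mult_def sum_3 mat_def eval_nth
  consider "p $ 3 \<noteq> 0" | "p $ 2 \<noteq> 0" | "p $ 1 \<noteq> 0" using assms by (auto simp: vec_eq_iff forall_3)
  then show ?thesis
  proof cases
    case 1
    then show ?thesis
      by (intro *[of "vector [vector [1, 0, p $ 1], vector [0, 1, p $ 2], vector [0, 0, p $ 3]]"
            "vector [vector [1, 0, - p $ 1 / p $ 3], vector [0, 1, - p $ 2 / p $ 3], vector [0, 0, 1 / p $ 3]]"])
        (simp_all add: rules)
  next
    case 2
    then show ?thesis
      by (intro *[of "vector [vector [1, 0, p $ 1], vector [0, 0, p $ 2], vector [0, 1, p $ 3]]"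
            "vector [vector [1, - p $ 1 / p $ 2, 0], vector [0, - p $ 3 / p $ 2, 1], vector [0, 1 / p $ 2, 0]]"])
        (simp_all add: rules)
  next
    case 3
    then show ?thesis
      by (intro *[of "vector [vector [0, 0, p $ 1], vector [1, 0, p $ 2], vector [0, 1, p $ 3]]"
            "vector [vector [- p $ 2 / p $ 1, 1, 0], vector [- p $ 3 / p $ 1, 0, 1], vector [1 / p $ 1, 0, 0]]"])
        (simp_all add: rules)
  qed
qed

text \<open>The coefficient of z^d is a form of degree zero whose value is that of \<open>F\<close>
  at the projection centre.\<close>

lemma monz_lsub:
  assumes F: "Hom d F" and p: "eval3 F (T *v vector [0, 0, 1]) \<noteq> 0"
  shows "monz (lsub T F)" "degree (lsub T F) = d"
proof -
  define G where "G = lsub T F"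
  have G: "Hom d G" unfolding G_def by (rule Hom_lsub[OF F])
  define a where "a = eval3 G (vector [0, 0, 1])"
  have a: "a \<noteq> 0" using p by (simp add: a_def G_def eval3_lsub)
  have "poly (lz 0 0 G) z = poly (monom a d) z" for z
  proof -
    have "z *s (vector [0, 0, 1] :: complex ^ 3) = vector [0, 0, z]" by (simp add: vec_eq_iff forall_3 eval_nth)
    then have "eval3 G (vector [0, 0, z]) = z ^ d * a" using G unfolding Hom_iff_eval a_def by metis
    then show ?thesis by (simp add: poly_lz poly_monom)
  qed
  then have "lz 0 0 G = monom a d" by (simp add: poly_eq_poly_eq_iff[symmetric] fun_eq_iff)
  then have e: "eval2 (coeff G d) (0, 0) = a" using coeff_lz[of 0 0 G d] by simp
  then have n: "coeff G d \<noteq> 0" using a by (auto simp: eval2_arith)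
  have "degree G \<le> d" using Hom_coeff[OF G] by (intro degree_le) (metis not_le)
  then have dG: "degree G = d" using le_degree[OF n] by simp
  have "Hom 0 [:coeff G d:]" using Hom_coeff[OF G n] by simp
  then have "coeff G d = [:[:a:]:]" using Hom0_const e by metis
  then show "monz (lsub T F)" "degree (lsub T F) = d" using a dG unfolding monz_def G_def by auto
qed

lemma squarefree_lsub:
  assumes TS: "T ** S = mat 1" "S ** T = mat 1" and F: "squarefree F"
  shows "squarefree (lsub T F)"
proof (rule squarefreeI)
  fix x assume "x\<^sup>2 dvd lsub T F"
  then obtain y where "lsub T F = x\<^sup>2 * y" by (elim dvdE)
  then have "lsub S (lsub T F) = (lsub S x)\<^sup>2 * lsub S y" by (simp add: lsub_hom power2_eq_square)
  then have "F = (lsub S x)\<^sup>2 * lsub S y" by (simp add: lsub_lsub TS lsub_mat1)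
  then have "(lsub S x)\<^sup>2 dvd F" by (metis dvd_triv_left)
  then have "lsub S x dvd 1" using F by (rule squarefreeD[rotated])
  then obtain z where "1 = lsub S x * z" by (elim dvdE)
  then have "lsub T 1 = lsub T (lsub S x * z)" by (rule arg_cong)
  then have "lsub T 1 = lsub T (lsub S x) * lsub T z" unfolding lsub_hom .
  then have "1 = x * lsub T z" by (simp add: lsub_lsub TS lsub_mat1 lsub_hom)
  then show "x dvd 1" by (metis dvd_triv_left)
qed

lemma proportional_lines:
  fixes a b a' b' x y :: complex
  assumes "(a, b) \<noteq> (0, 0)" "a * b' = b * a'" "b * x = a * y"
  shows "b' * x = a' * y"
proof (cases "a = 0")
  case True
  then have b: "b \<noteq> 0" "a' = 0" using assms(1,2) by auto
  then show ?thesis using assms(3) True by simp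
next
  case False
  have "a * (b' * x) = (a * b') * x" by (simp only: mult.assoc)
  also have "\<dots> = a' * (b * x)" unfolding assms(2) by (simp only: ac_simps)
  also have "\<dots> = a * (a' * y)" unfolding assms(3) by (simp only: ac_simps)
  finally show ?thesis using False by simp
qed

lemma same_line:
  fixes a b a' b' x y :: complex
  assumes "(x, y) \<noteq> (0, 0)" "b * x = a * y" "b' * x = a' * y"
  shows "a * b' = b * a'"
proof (cases "x = 0")
  case True then show ?thesis using assms by auto
next
  case False
  have "x * (a * b') = a * (b' * x)" by (simp only: ac_simps)
  also have "\<dots> = a' * (a * y)" unfolding assms(3) by (simp only: ac_simps)
  also have "\<dots> = x * (b * a')" unfolding assms(2)[symmetric] by (simp only: ac_simps)
  finally show ?thesis using False by simp
qed

lemma linear_form_scalar: "eval3 (lform a) (v + w) = eval3 (lform a) v + eval3 (lform a) w" "eval3 (lform a) (c *s v) = c * eval3 (lform a) v"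
  by (simp_all add: eval3_lform sum.distrib algebra_simps sum_distrib_left)

lemma lsub_lform_centre:
  fixes T S :: "complex ^ 3 ^ 3"
  assumes TS: "T ** S = mat 1" and k: "k \<noteq> 0" "eval3 (lform k) (T *v vector [0, 0, 1]) = 0"
  shows "\<exists>a b. (a, b) \<noteq> (0, 0) \<and> lsub T (lform k) = [:lin a b:]"
proof -
  have TSv: "T *v (S *v v) = v" for v by (simp add: matrix_vector_mul_assoc TS)
  define b where "b = eval3 (lform k) (T *v vector [1, 0, 0])"
  define a where "a = - eval3 (lform k) (T *v vector [0, 1, 0])"
  have ev: "eval3 (lform k) (T *v w) = b * w $ 1 - a * w $ 2" for w
  proof -
    have "w = w $ 1 *s vector [1, 0, 0] + w $ 2 *s vector [0, 1, 0] + w $ 3 *s vector [0, 0, 1]"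
      by (simp add: vec_eq_iff forall_3 eval_nth)
    then have "T *v w = w $ 1 *s (T *v vector [1, 0, 0]) + w $ 2 *s (T *v vector [0, 1, 0]) + w $ 3 *s (T *v vector [0, 0, 1])"
      by (metis (no_types, lifting) matrix_vector_right_distrib vector_scalar_commute)
    then show ?thesis using k(2) by (simp add: linear_form_scalar a_def b_def)
  qed
  have "(a, b) \<noteq> (0, 0)"
  proof
    assume "(a, b) = (0, 0)"
    then have z: "eval3 (lform k) v = 0" for v using ev[of "S *v v"] by (simp add: TSv)
    have "k $ i = 0" for i
    proof -
      have "eval3 (lform k) (axis i 1) = k $ i" by (simp add: eval3_lform axis_def if_distrib cong: if_cong)
      then show ?thesis using z by simp
    qed
    then show False using k(1) by (simp add: vec_eq_iff)
  qed
  moreover have "lsub T (lform k) = [:lin a b:]"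
    by (rule eval3_ext) (simp add: eval3_lsub ev eval3_const eval2_lin)
  ultimately show ?thesis by blast
qed

lemma line_through_centre:
  fixes T S :: "complex ^ 3 ^ 3"
  assumes TS: "T ** S = mat 1" "S ** T = mat 1" and L: "is_line L" "T *v vector [0, 0, 1] \<in> L"
  shows "\<exists>a b. (a, b) \<noteq> (0, 0) \<and> lsub T (line_equation L) = [:lin a b:] \<and> (\<forall>v. v \<in> L \<longleftrightarrow> b * (S *v v) $ 1 = a * (S *v v) $ 2)"
proof -
  define k where "k = (SOME a. a \<noteq> 0 \<and> L = {v. eval3 (linear_form a) v = 0})"
  have "k \<noteq> 0 \<and> L = {v. eval3 (linear_form k) v = 0}" using L(1) unfolding is_line_def k_def by (rule someI_ex)
  then have k: "k \<noteq> 0" "L = {v. eval3 (lform k) v = 0}" unfolding linear_form_lform by blast+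
  have eq: "line_equation L = lform k" by (simp add: line_equation_def k_def linear_form_lform)
  have "eval3 (lform k) (T *v vector [0, 0, 1]) = 0" using L(2) k(2) by simp
  then obtain a b where ab: "(a, b) \<noteq> (0, 0)" "lsub T (lform k) = [:lin a b:]" using lsub_lform_centre[OF TS(1) k(1)] by blast
  have "eval3 (lform k) v = eval3 (lsub T (lform k)) (S *v v)" for v by (simp add: eval3_lsub matrix_vector_mul_assoc TS)
  then have "eval3 (lform k) v = b * (S *v v) $ 1 - a * (S *v v) $ 2" for v unfolding ab(2) by (simp add: eval3_const eval2_lin)
  then show ?thesis using ab k(2) unfolding eq by (intro exI[of _ a] exI[of _ b]) auto
qed

lemma is_line_through_centre:
  fixes T S :: "complex ^ 3 ^ 3"
  assumes TS: "S ** T = mat 1" and ab: "(a, b) \<noteq> (0, 0)"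
  shows "is_line {v. b * (S *v v) $ 1 = a * (S *v v) $ 2}" "T *v vector [0, 0, 1] \<in> {v. b * (S *v v) $ 1 = a * (S *v v) $ 2}"
proof -
  have TSv: "S *v (T *v v) = v" for v by (simp add: matrix_vector_mul_assoc TS)
  show "T *v vector [0, 0, 1] \<in> {v. b * (S *v v) $ 1 = a * (S *v v) $ 2}" by (simp add: TSv eval_nth)
  define k where "k = b *s (S $ 1) - a *s (S $ 2)"
  have k: "eval3 (linear_form k) v = b * (S *v v) $ 1 - a * (S *v v) $ 2" for v
    by (simp add: linear_form_lform eval3_lform k_def matrix_vector_mult_def sum_3 algebra_simps)
  have "k \<noteq> 0"
  proof
    assume "k = 0"
    then have z: "b * (S *v v) $ 1 - a * (S *v v) $ 2 = 0" for v unfolding k[symmetric] by (simp add: linear_form_lform eval3_lform)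
    show False using z[of "T *v vector [1, 0, 0]"] z[of "T *v vector [0, 1, 0]"] ab unfolding TSv by (simp add: eval_nth)
  qed
  then show "is_line {v. b * (S *v v) $ 1 = a * (S *v v) $ 2}" unfolding is_line_def by (intro exI[of _ k]) (simp add: k)
qed

lemma complement_direction: "(x, y) \<noteq> (0 :: complex, 0) \<Longrightarrow> \<exists>x' y'. x * y' \<noteq> y * x'"
proof (cases "x = 0")
  case True
  moreover assume "(x, y) \<noteq> (0, 0)"
  ultimately show ?thesis by (intro exI[of _ 1]) simp
next
  case False
  then show ?thesis by (intro exI[of _ 0] exI[of _ 1]) simp
qed

text \<open>By \<open>intersection_multiplicity_line\<close> the added lines are those through the
  points where \<open>F\<close> and its derivative along p vanish; the discriminant shows that there
  are finitely many. In degree one this derivative is a nonzero constant, so no line is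
  added.\<close>

lemma add_lines_normal_form:
  assumes TS: "T ** S = mat 1" "S ** T = mat 1" and p: "p = T *v vector [0, 0, 1]"
    and F: "Hom d F" "squarefree F" "eval3 F p \<noteq> 0" and d: "d \<ge> 1"
  shows "\<exists>R. distinct_lines R \<and> lsub T (add_lines F p) = [:line_prod R:] * lsub T F \<and>
    (\<forall>q\<^sub>1 q\<^sub>2 q\<^sub>3. (q\<^sub>1, q\<^sub>2) \<noteq> (0, 0) \<longrightarrow> eval3 (lsub T F) (vector [q\<^sub>1, q\<^sub>2, q\<^sub>3]) = 0 \<longrightarrow> eval3 (dz3 (lsub T F)) (vector [q\<^sub>1, q\<^sub>2, q\<^sub>3]) = 0 \<longrightarrow>
      (\<exists>(a, b)\<in>R. b * q\<^sub>1 = a * q\<^sub>2)) \<and> (d = 1 \<longrightarrow> R = {})"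
proof -
  let ?F = "lsub T F" and ?NL = "nontransversal_lines F p"
  note hF = Hom_lsub[OF F(1), of T] and mz = monz_lsub[OF F(1) F(3)[unfolded p]] and sf = squarefree_lsub[OF TS F(2)]
  have TSv: "T *v (S *v v) = v" "S *v (T *v v) = v" for v by (simp_all add: matrix_vector_mul_assoc TS)
  have v3: "vector [x $ 1, x $ 2, x $ 3] = x" for x :: "complex ^ 3" by (simp add: vec_eq_iff forall_3 eval_nth)
  have im: "intersection_multiplicity F (line_equation L) (T *v vector [q\<^sub>1, q\<^sub>2, q\<^sub>3]) > 1 \<longleftrightarrow> eval3 (dz3 ?F) (vector [q\<^sub>1, q\<^sub>2, q\<^sub>3]) = 0"
    if L: "is_line L" "p \<in> L" "T *v vector [q\<^sub>1, q\<^sub>2, q\<^sub>3] \<in> L" and q: "(q\<^sub>1, q\<^sub>2) \<noteq> (0, 0)" "eval3 ?F (vector [q\<^sub>1, q\<^sub>2, q\<^sub>3]) = 0" for L q\<^sub>1 q\<^sub>2 q\<^sub>3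
  proof -
    obtain e\<^sub>1 e\<^sub>2 where e: "q\<^sub>1 * e\<^sub>2 \<noteq> q\<^sub>2 * e\<^sub>1" using complement_direction[OF q(1)] by blast
    have L2: "T *v vector [0, 0, 1] \<in> L" using L(2) unfolding p .
    obtain r \<nu> \<Theta>\<^sub>1 \<Theta>\<^sub>2 \<alpha>\<^sub>1 \<beta>\<^sub>1 \<alpha>\<^sub>2 \<beta>\<^sub>2 where
      "frame T S q\<^sub>1 q\<^sub>2 q\<^sub>3 e\<^sub>1 e\<^sub>2 (T *v vector [q\<^sub>1, q\<^sub>2, q\<^sub>3]) (T *v vector [e\<^sub>1, e\<^sub>2, 0]) (T *v vector [0, 0, 1]) r \<nu> \<Theta>\<^sub>1 \<Theta>\<^sub>2 \<alpha>\<^sub>1 \<beta>\<^sub>1 \<alpha>\<^sub>2 \<beta>\<^sub>2"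
      using frame_exists[OF TS e] by blast
    then interpret frame T S q\<^sub>1 q\<^sub>2 q\<^sub>3 e\<^sub>1 e\<^sub>2 "T *v vector [q\<^sub>1, q\<^sub>2, q\<^sub>3]" "T *v vector [e\<^sub>1, e\<^sub>2, 0]" "T *v vector [0, 0, 1]" r \<nu> \<Theta>\<^sub>1 \<Theta>\<^sub>2 \<alpha>\<^sub>1 \<beta>\<^sub>1 \<alpha>\<^sub>2 \<beta>\<^sub>2 .
    show ?thesis unfolding eval_q(2) using q(2) unfolding eval_q(1)
      by (rule intersection_multiplicity_line[OF F(1) _ L(1) L2 L(3)])
  qed
  \<comment> \<open>A choice of coefficients for each line. It is injective on the added lines, so
    the product over lines becomes a \<open>line_prod\<close>.\<close>
  define slope where "slope L = (SOME ab. ab \<noteq> (0, 0) \<and> lsub T (line_equation L) = [:lin (fst ab) (snd ab):] \<and>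
    (\<forall>v. v \<in> L \<longleftrightarrow> snd ab * (S *v v) $ 1 = fst ab * (S *v v) $ 2))" for L
  have la0: "slope L \<noteq> (0, 0) \<and> lsub T (line_equation L) = [:lin (fst (slope L)) (snd (slope L)):] \<and>
    (\<forall>v. v \<in> L \<longleftrightarrow> snd (slope L) * (S *v v) $ 1 = fst (slope L) * (S *v v) $ 2)" if "is_line L" "p \<in> L" for L
  proof -
    obtain a b where "(a, b) \<noteq> (0, 0) \<and> lsub T (line_equation L) = [:lin a b:] \<and> (\<forall>v. v \<in> L \<longleftrightarrow> b * (S *v v) $ 1 = a * (S *v v) $ 2)"
      using line_through_centre[OF TS \<open>is_line L\<close>] \<open>p \<in> L\<close> unfolding p by blast
    then have "\<exists>ab. ab \<noteq> (0, 0) \<and> lsub T (line_equation L) = [:lin (fst ab) (snd ab):] \<and>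
        (\<forall>v. v \<in> L \<longleftrightarrow> snd ab * (S *v v) $ 1 = fst ab * (S *v v) $ 2)"
      by (intro exI[of _ "(a, b)"]) (simp only: fst_conv snd_conv simp_thms)
    from someI_ex[OF this] show ?thesis unfolding slope_def[symmetric] .
  qed
  note la = conjunct1[OF la0] conjunct1[OF conjunct2[OF la0]] conjunct2[OF conjunct2[OF la0], THEN spec]
  have NLD: "is_line L" "p \<in> L" if "L \<in> ?NL" for L using that by (auto simp: nontransversal_lines_def)
  have NLq: "\<exists>q\<^sub>1 q\<^sub>2 q\<^sub>3. (q\<^sub>1, q\<^sub>2) \<noteq> (0, 0) \<and> eval3 ?F (vector [q\<^sub>1, q\<^sub>2, q\<^sub>3]) = 0 \<and> eval3 (dz3 ?F) (vector [q\<^sub>1, q\<^sub>2, q\<^sub>3]) = 0 \<and>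
      snd (slope L) * q\<^sub>1 = fst (slope L) * q\<^sub>2" if L: "L \<in> ?NL" for L
  proof -
    obtain q where q: "q \<in> L" "q \<noteq> 0" "eval3 F q = 0" "intersection_multiplicity F (line_equation L) q > 1"
      using L by (auto simp: nontransversal_lines_def)
    define w where "w = S *v q"
    have qw: "q = T *v vector [w $ 1, w $ 2, w $ 3]" unfolding v3 w_def TSv ..
    have F0: "eval3 ?F (vector [w $ 1, w $ 2, w $ 3]) = 0" using q(3) unfolding eval3_lsub qw .
    \<comment> \<open>The point is not the centre, because \<open>F\<close> does not vanish at
      p.\<close>
    have w0: "(w $ 1, w $ 2) \<noteq> (0, 0)"
    proof
      assume a: "(w $ 1, w $ 2) = (0, 0)"
      then have "w = w $ 3 *s vector [0, 0, 1]" by (simp add: vec_eq_iff forall_3 eval_nth)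
      then have qp: "q = w $ 3 *s p" unfolding p w_def by (metis TSv(1) vector_scalar_commute)
      then have "w $ 3 \<noteq> 0" using q(2) by auto
      then have "eval3 F q \<noteq> 0" using F(1,3) unfolding qp Hom_iff_eval by simp
      then show False using q(3) by simp
    qed
    have "eval3 (dz3 ?F) (vector [w $ 1, w $ 2, w $ 3]) = 0"
      using im[OF NLD[OF L] _ w0 F0] q(1,4) unfolding qw[symmetric] by blast
    moreover have "snd (slope L) * w $ 1 = fst (slope L) * w $ 2" using la(3)[OF NLD[OF L], of q] q(1) unfolding w_def by blast
    ultimately show ?thesis using w0 F0 by blast
  qed
  have L_eq: "L = L'" if L: "is_line L" "p \<in> L" "is_line L'" "p \<in> L'" and pr: "fst (slope L) * snd (slope L') = snd (slope L) * fst (slope L')" for L L'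
  proof (intro equalityI subsetI)
    fix v
    have z: "(fst (slope L), snd (slope L)) \<noteq> (0, 0)" "(fst (slope L'), snd (slope L')) \<noteq> (0, 0)" using la(1)[OF L(1,2)] la(1)[OF L(3,4)] by simp_all
    have pr': "fst (slope L') * snd (slope L) = snd (slope L') * fst (slope L)" using pr by (simp only: mult.commute)
    show "v \<in> L \<Longrightarrow> v \<in> L'" unfolding la(3)[OF L(1,2)] la(3)[OF L(3,4)] by (rule proportional_lines[OF z(1) pr])
    show "v \<in> L' \<Longrightarrow> v \<in> L" unfolding la(3)[OF L(1,2)] la(3)[OF L(3,4)] by (rule proportional_lines[OF z(2) pr'])
  qed
  have inj: "inj_on slope ?NL"
  proof (rule inj_onI)
    fix L L' assume "L \<in> ?NL" "L' \<in> ?NL" "slope L = slope L'"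
    then show "L = L'" by (intro L_eq NLD) (simp_all add: mult.commute)
  qed
  obtain R\<^sub>0 where R0: "finite R\<^sub>0" "\<forall>(a, b)\<in>R\<^sub>0. (a, b) \<noteq> (0, 0)"
    "\<forall>q\<^sub>1 q\<^sub>2 q\<^sub>3. eval3 ?F (vector [q\<^sub>1, q\<^sub>2, q\<^sub>3]) = 0 \<longrightarrow> eval3 (dz3 ?F) (vector [q\<^sub>1, q\<^sub>2, q\<^sub>3]) = 0 \<longrightarrow> (\<exists>(a, b)\<in>R\<^sub>0. b * q\<^sub>1 = a * q\<^sub>2)"
    using finite_multiple_lines[OF hF mz(1) sf] by blast
  have "?NL \<subseteq> (\<lambda>(a, b). {v. b * (S *v v) $ 1 = a * (S *v v) $ 2}) ` R\<^sub>0"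
  proof
    fix L assume L: "L \<in> ?NL"
    obtain q\<^sub>1 q\<^sub>2 q\<^sub>3 where q: "(q\<^sub>1, q\<^sub>2) \<noteq> (0, 0)" "eval3 ?F (vector [q\<^sub>1, q\<^sub>2, q\<^sub>3]) = 0" "eval3 (dz3 ?F) (vector [q\<^sub>1, q\<^sub>2, q\<^sub>3]) = 0"
      "snd (slope L) * q\<^sub>1 = fst (slope L) * q\<^sub>2" using NLq[OF L] by blast
    then obtain ab where ab: "ab \<in> R\<^sub>0" "snd ab * q\<^sub>1 = fst ab * q\<^sub>2" using R0(3) by fastforce
    have ab0: "(fst ab, snd ab) \<noteq> (0, 0)" using R0(2) ab(1) by auto
    have l0: "(fst (slope L), snd (slope L)) \<noteq> (0, 0)" using la(1)[OF NLD[OF L]] by simp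
    have "v \<in> L \<longleftrightarrow> snd ab * (S *v v) $ 1 = fst ab * (S *v v) $ 2" for v
      unfolding la(3)[OF NLD[OF L]]
      using proportional_lines[OF l0 same_line[OF q(1,4) ab(2)]] proportional_lines[OF ab0 same_line[OF q(1) ab(2) q(4)]] by blast
    then have "L = (\<lambda>(a, b). {v. b * (S *v v) $ 1 = a * (S *v v) $ 2}) ab" by (auto simp: split_beta)
    then show "L \<in> (\<lambda>(a, b). {v. b * (S *v v) $ 1 = a * (S *v v) $ 2}) ` R\<^sub>0" using ab(1) by blast
  qed
  then have fin: "finite ?NL" using R0(1) finite_surj by blast
  define R where "R = slope ` ?NL"
  have "distinct_lines R"
    unfolding distinct_lines_def
  proof (intro conjI ballI impI)
    show "finite R" using fin by (simp add: R_def)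
    fix s assume "s \<in> R"
    then obtain L where L: "L \<in> ?NL" "s = slope L" by (auto simp: R_def)
    show "s \<noteq> (0, 0)" unfolding L(2) by (rule la(1)[OF NLD[OF L(1)]])
    fix s' assume "s' \<in> R" and ne: "s' \<noteq> s"
    then obtain L' where L': "L' \<in> ?NL" "s' = slope L'" by (auto simp: R_def)
    show "fst s * snd s' \<noteq> snd s * fst s'" using L_eq[OF NLD[OF L(1)] NLD[OF L'(1)]] ne unfolding L(2) L'(2) by blast
  qed
  moreover have "lsub T (add_lines F p) = [:line_prod R:] * lsub T F"
  proof -
    have "lsub T (\<Prod>L\<in>A. line_equation L) = [:line_prod (slope ` A):]" if "A \<subseteq> ?NL" for A
      using finite_subset[OF that fin] that
    proof (induction A rule: finite_induct)
      case empty then show ?case by (simp add: lsub_hom line_prod_def flip: one_pCons)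
    next
      case (insert L A)
      have "slope L \<notin> slope ` A" using insert.hyps(2) insert.prems inj unfolding inj_on_def by blast
      then have "line_prod (slope ` insert L A) = lin (fst (slope L)) (snd (slope L)) * line_prod (slope ` A)"
        using insert.hyps(1) by (simp add: line_prod_def split_beta)
      then show ?case using insert la(2)[OF NLD[of L]] by (simp add: lsub_hom mult.commute)
    qed
    then show ?thesis by (simp add: add_lines_def lsub_hom R_def mult.commute)
  qed
  moreover have "\<exists>(a, b)\<in>R. b * q\<^sub>1 = a * q\<^sub>2" if q: "(q\<^sub>1, q\<^sub>2) \<noteq> (0, 0)" "eval3 ?F (vector [q\<^sub>1, q\<^sub>2, q\<^sub>3]) = 0" "eval3 (dz3 ?F) (vector [q\<^sub>1, q\<^sub>2, q\<^sub>3]) = 0" for q\<^sub>1 q\<^sub>2 q\<^sub>3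
  proof -
    define L where "L = {v. q\<^sub>2 * (S *v v) $ 1 = q\<^sub>1 * (S *v v) $ 2}"
    note l = is_line_through_centre[OF TS(2) q(1), folded L_def p]
    have s: "T *v vector [q\<^sub>1, q\<^sub>2, q\<^sub>3] \<in> L" unfolding L_def by (simp add: TSv eval_nth)
    have s0: "T *v vector [q\<^sub>1, q\<^sub>2, q\<^sub>3] \<noteq> 0"
    proof
      assume "T *v vector [q\<^sub>1, q\<^sub>2, q\<^sub>3] = 0"
      then have "S *v (T *v vector [q\<^sub>1, q\<^sub>2, q\<^sub>3]) = 0" by simp
      then show False using q(1) unfolding TSv by (simp add: vec_eq_iff forall_3 eval_nth)
    qed
    have "L \<in> ?NL" unfolding nontransversal_lines_def
      using l s s0 im[OF l s q(1,2)] q(2,3) by (auto simp: eval3_lsub)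
    then have "slope L \<in> R" by (simp add: R_def)
    moreover have "snd (slope L) * q\<^sub>1 = fst (slope L) * q\<^sub>2" using la(3)[OF l] s by (simp add: TSv eval_nth)
    ultimately show ?thesis by (force simp: split_beta)
  qed
  moreover have "R = {}" if "d = 1"
  proof (rule ccontr)
    assume "R \<noteq> {}"
    then obtain L where "L \<in> ?NL" by (auto simp: R_def)
    then obtain q\<^sub>1 q\<^sub>2 q\<^sub>3 where q: "eval3 (dz3 ?F) (vector [q\<^sub>1, q\<^sub>2, q\<^sub>3]) = 0" using NLq by blast
    have dg: "degree ?F = 1" using mz(2) that by simp
    obtain c where c: "c \<noteq> 0" "lead_coeff ?F = [:[:c:]:]" using mz(1) unfolding monz_def by blast
    have "dz3 ?F = [:coeff ?F 1:]"
      unfolding dz3_def by (rule poly_eqI) (use dg in \<open>auto simp: coeff_pderiv coeff_pCons coeff_eq_0 split: nat.split\<close>)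
    then have "dz3 ?F = emb c" using c(2) dg by (simp add: emb_def)
    then show False using q c(1) by (simp add: eval3_gen)
  qed
  ultimately show ?thesis by blast
qed

section \<open>Supersolvability and freeness\<close>

lemma lz_dz3: "lz a b (dz3 F) = pderiv (lz a b F)"
proof (rule poly_eqI)
  fix n
  have "eval2 (of_nat k * c) z = of_nat k * eval2 c z" for k c z
    by (induction k) (simp_all add: eval2_arith distrib_right)
  then show "coeff (lz a b (dz3 F)) n = coeff (pderiv (lz a b F)) n"
    by (simp only: coeff_lz dz3_def coeff_pderiv)
qed

lemma line_prod_remove:
  assumes "distinct_lines R" "(a, b) \<in> R"
  shows "line_prod R = lin a b * line_prod (R - {(a, b)})"
proof -
  have "finite R" using assms(1) by (simp add: distinct_lines_def)
  then show ?thesis unfolding line_prod_def using prod.remove[OF _ assms(2), of "\<lambda>(a, b). lin a b"] by simp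
qed

lemma line_prod_eval_nonzero:
  assumes R: "distinct_lines R" "(a, b) \<in> R" and q: "(x, y) \<noteq> (0, 0)" "b * x = a * y"
  shows "eval2 (line_prod (R - {(a, b)})) (x, y) \<noteq> 0"
proof -
  have *: "b' * x \<noteq> a' * y" if "(a', b') \<in> R - {(a, b)}" for a' b'
    using distinct_linesD(2)[OF R, of a' b'] same_line[OF q, of b' a'] that by (auto simp: mult.commute)
  have "eval2 (line_prod A) (x, y) \<noteq> 0" if "finite A" "A \<subseteq> R - {(a, b)}" for A
    using that
  proof (induction A rule: finite_induct)
    case (insert r A)
    have "eval2 (line_prod (insert r A)) (x, y) = (snd r * x - fst r * y) * eval2 (line_prod A) (x, y)"
      using insert.hyps by (simp add: line_prod_def eval2_arith eval2_lin split_beta)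
    then show ?case using insert *[of "fst r" "snd r"] by simp
  qed (simp add: line_prod_def)
  moreover have "finite (R - {(a, b)})" using R(1) by (simp add: distinct_lines_def)
  ultimately show ?thesis by blast
qed

lemma loc_not_divisible_VY: "monz F \<Longrightarrow> fps_nth (loc q\<^sub>1 q\<^sub>2 q\<^sub>3 e\<^sub>1 e\<^sub>2 F) 0 \<noteq> 0"
proof
  assume "monz F" and z: "fps_nth (loc q\<^sub>1 q\<^sub>2 q\<^sub>3 e\<^sub>1 e\<^sub>2 F) 0 = 0"
  have "fps_of_poly (pcompose (lz q\<^sub>1 q\<^sub>2 F) [:q\<^sub>3, 1:]) = fps_of_poly 0" using z unfolding loc_nth0 by simp
  then have "pcompose (lz q\<^sub>1 q\<^sub>2 F) [:q\<^sub>3, 1:] = 0" unfolding fps_of_poly_eq_iff .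
  then have "lz q\<^sub>1 q\<^sub>2 F = 0" by (rule pcompose_eq_0) simp
  then show False using degree_lz(2)[OF \<open>monz F\<close>] by blast
qed

text \<open>By \<open>cover\<close> the fibres of \<open>F\<close> on lines through the centre
  outside \<open>R\<close> have simple roots, as \<open>modular_point_of_simple_fibres\<close>
  requires. That \<open>R\<close> is nonempty puts the centre on the curve.\<close>

lemma supersolvable_and_free_of_local:
  assumes TS: "T ** S = mat 1" "S ** T = mat 1" and F: "Hom d F" "monz F" "squarefree F"
    and R: "distinct_lines R" "R \<noteq> {}" and G: "lsub T G = [:line_prod R:] * F"
    and cover: "\<And>q\<^sub>1 q\<^sub>2 q\<^sub>3. (q\<^sub>1, q\<^sub>2) \<noteq> (0, 0) \<Longrightarrow> eval3 F (vector [q\<^sub>1, q\<^sub>2, q\<^sub>3]) = 0 \<Longrightarrow> eval3 (dz3 F) (vector [q\<^sub>1, q\<^sub>2, q\<^sub>3]) = 0 \<Longrightarrow>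
      \<exists>(a, b)\<in>R. b * q\<^sub>1 = a * q\<^sub>2"
    and local: "\<And>q\<^sub>1 q\<^sub>2 q\<^sub>3 e\<^sub>1 e\<^sub>2. q\<^sub>1 * e\<^sub>2 \<noteq> q\<^sub>2 * e\<^sub>1 \<Longrightarrow> eval3 F (vector [q\<^sub>1, q\<^sub>2, q\<^sub>3]) = 0 \<Longrightarrow> eval3 (dz3 F) (vector [q\<^sub>1, q\<^sub>2, q\<^sub>3]) = 0 \<Longrightarrow>
      VY * fps_deriv (loc q\<^sub>1 q\<^sub>2 q\<^sub>3 e\<^sub>1 e\<^sub>2 F) \<in> ideal2 (loc q\<^sub>1 q\<^sub>2 q\<^sub>3 e\<^sub>1 e\<^sub>2 F) (loc q\<^sub>1 q\<^sub>2 q\<^sub>3 e\<^sub>1 e\<^sub>2 (dz3 F))"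
  shows "supersolvable G \<and> free_curve G"
proof
  have "free2 (lsub T G)" unfolding G
  proof (rule free2_of_local[OF F R])
    fix q\<^sub>1 q\<^sub>2 q\<^sub>3 e\<^sub>1 e\<^sub>2 assume a: "q\<^sub>1 * e\<^sub>2 \<noteq> q\<^sub>2 * e\<^sub>1" "eval3 F (vector [q\<^sub>1, q\<^sub>2, q\<^sub>3]) = 0" "eval3 (dz3 F) (vector [q\<^sub>1, q\<^sub>2, q\<^sub>3]) = 0"
    then have "(q\<^sub>1, q\<^sub>2) \<noteq> (0, 0)" by auto
    then show "(\<exists>(a, b)\<in>R. b * q\<^sub>1 = a * q\<^sub>2) \<and>
      VY * fps_deriv (loc q\<^sub>1 q\<^sub>2 q\<^sub>3 e\<^sub>1 e\<^sub>2 F) \<in> ideal2 (loc q\<^sub>1 q\<^sub>2 q\<^sub>3 e\<^sub>1 e\<^sub>2 F) (loc q\<^sub>1 q\<^sub>2 q\<^sub>3 e\<^sub>1 e\<^sub>2 (dz3 F))"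
      by (intro conjI cover[OF _ a(2,3)] local[OF a])
  qed
  then show "free_curve G" using free2_lsub[OF TS] free2_free_curve by blast
  have h: "Hom (card R) [:line_prod R:]" by (rule line_prod_Hom(1)[OF R(1)])
  have c: "card R > 0" using R by (simp add: distinct_lines_def card_gt_0_iff)
  have "modular_point G (T *v vector [0, 0, 1])"
  proof (rule modular_point_of_simple_fibres[OF TS _ _ h c F(1,2), of G 1])
    have "emb 1 = 1" by (simp add: emb_def one_pCons)
    then show "lsub T G = emb 1 * [:line_prod R:] * F" unfolding G by simp
    fix a b z assume l: "eval2 (line_prod R) (a, b) \<noteq> 0" and z: "poly (lz a b F) z = 0"
    have ab: "(a, b) \<noteq> (0, 0)"
    proof
      assume "(a, b) = (0, 0)"
      moreover have "eval2 (line_prod R) (0 * 0, 0 * 0) = 0 ^ card R * eval2 (line_prod R) (0, 0)"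
        using h unfolding Hom_const_iff by blast
      ultimately show False using l c by (simp add: zero_power)
    qed
    show "poly (pderiv (lz a b F)) z \<noteq> 0"
    proof
      assume "poly (pderiv (lz a b F)) z = 0"
      then have "eval3 (dz3 F) (vector [a, b, z]) = 0" by (simp add: poly_lz[symmetric] lz_dz3)
      then obtain a' b' where r: "(a', b') \<in> R" "b' * a = a' * b" using cover[OF ab] z unfolding poly_lz by blast
      show False using l r(2) unfolding line_prod_remove[OF R(1) r(1)] by (simp add: eval2_arith eval2_lin)
    qed
  qed simp
  then show "supersolvable G" unfolding supersolvable_def by blast
qed

text \<open>By the product rule all derivatives vanish where both factors do. The hypothesis on the
  singularities of the enlarged curve can therefore be applied where an added line meets the
  original curve.\<close>

lemma singular_point_of_product:
  fixes T S :: "complex ^ 3 ^ 3"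
  assumes TS: "T ** S = mat 1" "S ** T = mat 1" and G: "lsub T G = Q * F"
    and q: "eval3 Q w = 0" "eval3 F w = 0" "w \<noteq> 0"
  shows "singular_point G (T *v w)"
proof -
  have TSv: "T *v (S *v v) = v" "S *v (T *v v) = v" for v by (simp_all add: matrix_vector_mul_assoc TS)
  have z: "eval3 (dd v G) (T *v w) = 0" for v
  proof -
    have "eval3 (dd v G) (T *v w) = eval3 (lsub T (dd (T *v (S *v v)) G)) w" by (simp add: eval3_lsub TSv)
    also have "\<dots> = eval3 (dd (S *v v) (Q * F)) w" unfolding lsub_dd[symmetric] G ..
    also have "\<dots> = 0" by (simp add: dd_der eval3_hom q)
    finally show ?thesis .
  qed
  have "eval3 G (T *v w) = eval3 (lsub T G) w" by (simp add: eval3_lsub)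
  then have "eval3 G (T *v w) = 0" unfolding G by (simp add: eval3_hom q)
  moreover have "T *v w \<noteq> 0" using TSv(2)[of w] q(3) by auto
  ultimately show ?thesis
    unfolding singular_point_def using z[of "vector [1, 0, 0]"] z[of "vector [0, 1, 0]"] z[of "vector [0, 0, 1]"]
    by (simp add: eval3_dd eval_nth)
qed

text \<open>Exactly one of the lines passes through q. It contributes Y up to a nonzero constant,
  the others contribute units.\<close>

lemma loc_line_prod:
  assumes R: "distinct_lines R" "(a, b) \<in> R" and e: "q\<^sub>1 * e\<^sub>2 \<noteq> q\<^sub>2 * e\<^sub>1" and q: "b * q\<^sub>1 = a * q\<^sub>2"
  shows "\<exists>v. loc q\<^sub>1 q\<^sub>2 q\<^sub>3 e\<^sub>1 e\<^sub>2 [:line_prod R:] = VY * v \<and> cf v 0 0 \<noteq> 0"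
proof -
  define v where "v = kap (b * e\<^sub>1 - a * e\<^sub>2) * loc q\<^sub>1 q\<^sub>2 q\<^sub>3 e\<^sub>1 e\<^sub>2 [:line_prod (R - {(a, b)}):]"
  have q0: "(q\<^sub>1, q\<^sub>2) \<noteq> (0, 0)" using e by auto
  have be: "b * e\<^sub>1 - a * e\<^sub>2 \<noteq> 0"
    using proportional_lines[OF distinct_linesD(1)[OF R] _ q, of e\<^sub>2 e\<^sub>1] e by (auto simp: mult.commute)
  have "[:line_prod R:] = [:lin a b:] * [:line_prod (R - {(a, b)}):]" using line_prod_remove[OF R] by simp
  then have "loc q\<^sub>1 q\<^sub>2 q\<^sub>3 e\<^sub>1 e\<^sub>2 [:line_prod R:] = VY * v"
    by (simp only: loc_hom loc_lin v_def) (simp add: q kap_hom mult.assoc)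
  moreover have "cf v 0 0 = (b * e\<^sub>1 - a * e\<^sub>2) * eval2 (line_prod (R - {(a, b)})) (q\<^sub>1, q\<^sub>2)"
    by (simp add: v_def cf_def rhomD[OF rhom_nth0] fps_nth_loc_00 eval3_const eval_nth kap_def)
  ultimately show ?thesis using be line_prod_eval_nonzero[OF R q0 q] by (intro exI[of _ v]) simp
qed

lemma Hom_0_emb: assumes "Hom 0 F" shows "\<exists>c. F = emb c"
proof -
  have "coeff F k = 0" if "k > 0" for k using Hom_coeff[OF assms, of k] that by auto
  then have F: "F = [:coeff F 0:]" by (intro poly_eqI) (simp add: coeff_pCons split: nat.split)
  then have "Hom 0 [:coeff F 0:]" using assms by simp
  from Hom0_const[OF this] F show ?thesis unfolding emb_def by metis
qed

lemma Hom_1_lform: assumes "Hom 1 F" shows "\<exists>a. F = lform a"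
proof -
  have "Hom 0 (dx3 F)" "Hom 0 (dy3 F)" "Hom 0 (dz3 F)" using Hom_d3[OF assms] by simp_all
  then obtain a b c where "dx3 F = emb a" "dy3 F = emb b" "dz3 F = emb c"
    using Hom_0_emb by meson
  then have "F = lform (vector [a, b, c])" using euler[OF assms] by (simp add: lform_def eval_nth mult.commute)
  then show ?thesis by blast
qed

text \<open>With the centre moved to a point of the line, it becomes a single line through the
  centre added to the empty curve with equation 1, for which the local conditions are void.\<close>

lemma supersolvable_and_free_line:
  assumes "a \<noteq> 0"
  shows "supersolvable (lform a) \<and> free_curve (lform a)"
proof -
  have "\<exists>p. p \<noteq> 0 \<and> eval3 (lform a) p = 0"
  proof (cases "a $ 1 = 0 \<and> a $ 2 = 0")
    case True
    then show ?thesis by (intro exI[of _ "vector [1, 0, 0]"]) (simp add: eval3_lform sum_3 eval_nth vec_eq_iff forall_3)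
  next
    case False
    then show ?thesis by (intro exI[of _ "vector [a $ 2, - a $ 1, 0]"]) (auto simp: eval3_lform sum_3 eval_nth vec_eq_iff forall_3)
  qed
  then obtain p where p: "p \<noteq> 0" "eval3 (lform a) p = 0" by blast
  obtain T S :: "complex ^ 3 ^ 3" where TS: "T ** S = mat 1" "S ** T = mat 1" "T *v vector [0, 0, 1] = p" using frame_matrix[OF p(1)] by blast
  have "eval3 (lform a) (T *v vector [0, 0, 1]) = 0" unfolding TS(3) by (rule p(2))
  from lsub_lform_centre[OF TS(1) assms this]
  obtain b c where bc: "(b, c) \<noteq> (0, 0)" "lsub T (lform a) = [:lin b c:]" by blast
  show ?thesis
  proof (rule supersolvable_and_free_of_local[OF TS(1,2) Hom_1, of "{(b, c)}"])
    show "monz 1" unfolding monz_def by (intro exI[of _ 1]) (simp add: one_pCons)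
    show "squarefree (1 :: poly3)" by (simp add: squarefree_def is_unit_power_iff)
    show "distinct_lines {(b, c)}" using bc(1) by (simp add: distinct_lines_def)
    show "lsub T (lform a) = [:line_prod {(b, c)}:] * 1" unfolding bc(2) by (simp add: line_prod_def)
  qed (simp_all add: eval3_hom)
qed

theorem theorem1p11:
  fixes F :: poly3 and p :: "complex ^ 3"
  assumes "reduced_plane_curve F"
    and "p \<noteq> 0" and "eval3 F p \<noteq> 0"
  shows "((\<forall>s. singular_point (add_lines F p) s \<longrightarrow> quasi_homogeneous_at (add_lines F p) s) \<longrightarrow>
           supersolvable (add_lines F p) \<and> free_curve (add_lines F p)) \<and>
         ((\<forall>s. singular_point F s \<longrightarrow> multiplicity_at F s = 2) \<and>
          (\<forall>s. singular_point F s \<and> milnor_number F s \<ge> 3 \<longrightarrow> p \<notin> tangent_cone F s) \<longrightarrow>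
           supersolvable (add_lines F p) \<and> free_curve (add_lines F p))"
proof -
  let ?G = "add_lines F p"
  obtain d where F: "squarefree F" "d \<ge> 1" "Hom d F"
    using assms(1) unfolding reduced_plane_curve_def Hom_iff_homogeneous3 by blast
  obtain T S :: "complex ^ 3 ^ 3" where TS: "T ** S = mat 1" "S ** T = mat 1" and pT: "T *v vector [0, 0, 1] = p"
    using frame_matrix[OF assms(2)] by blast
  have Fp: "eval3 F (T *v vector [0, 0, 1]) \<noteq> 0" unfolding pT by (rule assms(3))
  note hF = Hom_lsub[OF F(3), of T] and mz = monz_lsub[OF F(3) Fp] and sf = squarefree_lsub[OF TS F(1)]
  obtain R where R: "distinct_lines R" "lsub T ?G = [:line_prod R:] * lsub T F"
    and cover: "\<forall>q\<^sub>1 q\<^sub>2 q\<^sub>3. (q\<^sub>1, q\<^sub>2) \<noteq> (0, 0) \<longrightarrow> eval3 (lsub T F) (vector [q\<^sub>1, q\<^sub>2, q\<^sub>3]) = 0 \<longrightarrow>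
      eval3 (dz3 (lsub T F)) (vector [q\<^sub>1, q\<^sub>2, q\<^sub>3]) = 0 \<longrightarrow> (\<exists>(a, b)\<in>R. b * q\<^sub>1 = a * q\<^sub>2)" and R1: "d = 1 \<longrightarrow> R = {}"
    using add_lines_normal_form[OF TS pT[symmetric] F(3,1) assms(3) F(2)] by blast
  show ?thesis
  proof (cases "d = 1")
    \<comment> \<open>For d = 1 the set \<open>R\<close> is empty, so the curve is a line and its
      modular point has to be taken on it instead of at p.\<close>
    case True
    then obtain a where a: "F = lform a" using Hom_1_lform F(3) by blast
    have "lsub S (lsub T ?G) = lsub S (lsub T F)" using R(2) R1 True by (simp add: line_prod_def flip: one_pCons)
    then have "?G = lform a" by (simp add: lsub_lsub TS lsub_mat1 a)
    moreover have "a \<noteq> 0" using assms(3) unfolding a by (auto simp: eval3_lform)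
    ultimately show ?thesis using supersolvable_and_free_line by simp
  next
    case False
    \<comment> \<open>From degree two on there is a multiple point, so at least one line is
      added.\<close>
    then have "d \<ge> 2" using F(2) by simp
    then obtain q\<^sub>1 q\<^sub>2 q\<^sub>3 where "(q\<^sub>1, q\<^sub>2) \<noteq> (0, 0)" "eval3 (lsub T F) (vector [q\<^sub>1, q\<^sub>2, q\<^sub>3]) = 0" "eval3 (dz3 (lsub T F)) (vector [q\<^sub>1, q\<^sub>2, q\<^sub>3]) = 0"
      using exists_multiple_point[OF hF mz(1) sf] by blast
    then have "R \<noteq> {}" using cover by fastforce
    note reduction = supersolvable_and_free_of_local[OF TS hF mz(1) sf R(1) this R(2) cover[rule_format]]
    show ?thesis
    proof (rule conjI; rule impI; rule reduction)
      fix q\<^sub>1 q\<^sub>2 q\<^sub>3 e\<^sub>1 e\<^sub>2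
      assume qh: "\<forall>s. singular_point ?G s \<longrightarrow> quasi_homogeneous_at ?G s" and e: "q\<^sub>1 * e\<^sub>2 \<noteq> q\<^sub>2 * e\<^sub>1"
        and q: "eval3 (lsub T F) (vector [q\<^sub>1, q\<^sub>2, q\<^sub>3]) = 0" "eval3 (dz3 (lsub T F)) (vector [q\<^sub>1, q\<^sub>2, q\<^sub>3]) = 0"
      have q0: "(q\<^sub>1, q\<^sub>2) \<noteq> (0, 0)" using e by auto
      then obtain a b where ab: "(a, b) \<in> R" "b * q\<^sub>1 = a * q\<^sub>2" using cover q by blast
      obtain v where v: "loc q\<^sub>1 q\<^sub>2 q\<^sub>3 e\<^sub>1 e\<^sub>2 [:line_prod R:] = VY * v" "cf v 0 0 \<noteq> 0"
        using loc_line_prod[OF R(1) ab(1) e ab(2)] by blast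
      have "vector [q\<^sub>1, q\<^sub>2, q\<^sub>3] \<noteq> (0 :: complex ^ 3)" using q0 by (auto simp: vec_eq_iff forall_3 eval_nth)
      moreover have "eval3 [:line_prod R:] (vector [q\<^sub>1, q\<^sub>2, q\<^sub>3]) = 0"
        unfolding line_prod_remove[OF R(1) ab(1)] eval3_const by (simp add: eval2_arith eval2_lin eval_nth ab(2))
      ultimately have "quasi_homogeneous_at ?G (T *v vector [q\<^sub>1, q\<^sub>2, q\<^sub>3])"
        using singular_point_of_product[OF TS R(2) _ q(1)] qh by blast
      \<comment> \<open>Homogeneity of \<open>add_lines F p\<close> is read off its normal form and
        carried back by \<open>S\<close>.\<close>
      moreover have "Hom (card R + d) (lsub T ?G)" unfolding R(2) by (intro Hom_mult line_prod_Hom(1) R(1) hF)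
      from Hom_lsub[OF this, of S] have "Hom (card R + d) ?G" by (simp add: lsub_lsub TS lsub_mat1)
      ultimately show "VY * fps_deriv (loc q\<^sub>1 q\<^sub>2 q\<^sub>3 e\<^sub>1 e\<^sub>2 (lsub T F)) \<in>
          ideal2 (loc q\<^sub>1 q\<^sub>2 q\<^sub>3 e\<^sub>1 e\<^sub>2 (lsub T F)) (loc q\<^sub>1 q\<^sub>2 q\<^sub>3 e\<^sub>1 e\<^sub>2 (dz3 (lsub T F)))"
        using local_condition_quasi_homogeneous[OF TS(2) e _ R(2) _ refl v loc_not_divisible_VY[OF mz(1)]] unfolding dzs_loc by blast
    next
      fix q\<^sub>1 q\<^sub>2 q\<^sub>3 e\<^sub>1 e\<^sub>2
      assume h: "(\<forall>s. singular_point F s \<longrightarrow> multiplicity_at F s = 2) \<and>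
          (\<forall>s. singular_point F s \<and> milnor_number F s \<ge> 3 \<longrightarrow> p \<notin> tangent_cone F s)"
        and e: "q\<^sub>1 * e\<^sub>2 \<noteq> q\<^sub>2 * e\<^sub>1"
        and q: "eval3 (lsub T F) (vector [q\<^sub>1, q\<^sub>2, q\<^sub>3]) = 0" "eval3 (dz3 (lsub T F)) (vector [q\<^sub>1, q\<^sub>2, q\<^sub>3]) = 0"
      obtain \<Delta> n where D: "\<Delta> \<noteq> 0" "Hom n [:\<Delta>:]" "[:\<Delta>:] \<in> ideal2 (lsub T F) (dz3 (lsub T F))"
        using discriminant_or_not_squarefree[OF hF mz(1)] sf by blast
      define s where "s = T *v vector [q\<^sub>1, q\<^sub>2, q\<^sub>3]"
      obtain r \<nu> \<Theta>\<^sub>1 \<Theta>\<^sub>2 \<alpha>\<^sub>1 \<beta>\<^sub>1 \<alpha>\<^sub>2 \<beta>\<^sub>2 where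
        fr: "frame T S q\<^sub>1 q\<^sub>2 q\<^sub>3 e\<^sub>1 e\<^sub>2 s (T *v vector [e\<^sub>1, e\<^sub>2, 0]) p r \<nu> \<Theta>\<^sub>1 \<Theta>\<^sub>2 \<alpha>\<^sub>1 \<beta>\<^sub>1 \<alpha>\<^sub>2 \<beta>\<^sub>2"
        using frame_exists[OF TS e, of q\<^sub>3, folded s_def, unfolded pT] by blast
      note ev = frame.eval_q[OF fr, of F] and ser = frame.ser_def[OF fr, of F]
      have "VY * fps_deriv (loc q\<^sub>1 q\<^sub>2 q\<^sub>3 e\<^sub>1 e\<^sub>2 (lsub T F)) \<in>
          ideal2 (loc q\<^sub>1 q\<^sub>2 q\<^sub>3 e\<^sub>1 e\<^sub>2 (lsub T F)) (dzs (loc q\<^sub>1 q\<^sub>2 q\<^sub>3 e\<^sub>1 e\<^sub>2 (lsub T F)))"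
      proof (rule frame.local_condition_multiplicity_two[OF fr F(3), unfolded ser])
        show "eval3 F s = 0" "eval3 (dd p F) s = 0" using q unfolding ev by simp_all
        show "fps_nth (loc q\<^sub>1 q\<^sub>2 q\<^sub>3 e\<^sub>1 e\<^sub>2 (lsub T F)) 0 \<noteq> 0" by (rule loc_not_divisible_VY[OF mz(1)])
        show "Hom n [:\<Delta>:]" "\<Delta> \<noteq> 0" "[:\<Delta>:] \<in> ideal2 (lsub T F) (dz3 (lsub T F))" by (fact D)+
        show "singular_point F s \<Longrightarrow> multiplicity_at F s = 2" using h by blast
        show "singular_point F s \<Longrightarrow> milnor_number F s \<ge> 3 \<Longrightarrow> p \<notin> tangent_cone F s" using h by blast
      qed
      then show "VY * fps_deriv (loc q\<^sub>1 q\<^sub>2 q\<^sub>3 e\<^sub>1 e\<^sub>2 (lsub T F)) \<in>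
          ideal2 (loc q\<^sub>1 q\<^sub>2 q\<^sub>3 e\<^sub>1 e\<^sub>2 (lsub T F)) (loc q\<^sub>1 q\<^sub>2 q\<^sub>3 e\<^sub>1 e\<^sub>2 (dz3 (lsub T F)))"
        unfolding dzs_loc .
    qed
  qed
qed

end
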